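(* Fix $\rho>0$ and $\alpha>-1$. With the notation given in the context, the following hold. (i) Suppose that for every $\gamma\in\mathbb{R}$ there exists $n_0\in\mathbb{N}$ such that $$\sup_{n\ge n_0}\ \sup_{z\in P_\rho}\ n^{-\alpha/2+1/4}\,e^{2\rho\sqrt{n}}\,|\Phi^{(\alpha)}_n(z)|\,|z|^{\gamma}<\infty .$$ Then for every $f$ satisfying the growth condition $(\mathrm{G}_\rho)$, as $n\to\infty$, $$|a^{(\alpha)}_n|\lessapprox \frac{1}{2\sqrt{\pi}}\,n^{-\alpha/2-1/4}e^{-2\rho\sqrt{n}}\int_{P_\rho}|e^{-z/2}|\,|z|^{\alpha/2-1/4}|f(z)|\,ds,$$ $$\|f-\Pi^P_nf\|_{\omega_\alpha}\lessapprox \frac{1}{2\sqrt{2\pi\rho}}\,e^{-2\rho\sqrt{n}}\int_{P_\rho}|e^{-z/2}|\,|z|^{\alpha/2-1/4}|f(z)|\,ds .$$ (ii) Suppose that for every $\gamma\in\mathbb{R}$ there exists $n_0\in\mathbb{N}$ such that $$\sup_{n\ge n_0}\ \sup_{z\in P_\rho}\ \frac{n^{\alpha/2-1/4}\,e^{2\rho\sqrt{n}}\,|z|^{\gamma}}{|L^{(\alpha)}_n(z)|}<\infty .$$ Then: (ii-a) for every $f$ satisfying $(\mathrm{G}_\rho)$, as $n\to\infty$, $$\|f-p_n\|_{\omega_\alpha}\lessapprox \frac{1}{\sqrt{\pi}\,\rho^2}\,n^{1/4}e^{-2\rho\sqrt{n}}\int_{P_\rho}|e^{-z/2}|\,|z|^{\alpha/2+1/4}|f(z)|\,ds,$$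 $$\|f-p^R_n\|_{\omega_\alpha}\lessapprox \frac{\sqrt{2}}{\sqrt{\pi}\,\rho^2}\,n^{3/4}e^{-2\rho\sqrt{n}}\int_{P_\rho}|e^{-z/2}|\,|z|^{\alpha/2-1/4}|f(z)|\,ds ;$$ (ii-b) for every $f$ such that the function $z\mapsto e^{z/2}f(z)$ satisfies $(\mathrm{G}_\rho)$, as $n\to\infty$, $$\|f-q_n\|_{\infty}\lessapprox \frac{\kappa_\alpha}{\sqrt{\pi}\,\rho^2}\,n^{|\alpha|/2+1/4}e^{-2\rho\sqrt{n}}\int_{P_\rho}|z|^{\alpha/2+1/4}|f(z)|\,ds,$$ $$\|f-q^R_n\|_{\infty}\lessapprox \frac{2\kappa_\alpha}{\sqrt{\pi}\,\rho^2}\,n^{|\alpha|/2+3/4}e^{-2\rho\sqrt{n}}\int_{P_\rho}|z|^{\alpha/2-1/4}|f(z)|\,ds,$$ where $\kappa_\alpha:=1/\Gamma(\alpha+1)$ if $\alpha\ge 0$ and $\kappa_\alpha:=2$ if $\alpha\in(-1,0)$. (iii) Suppose that for every $\gamma\in\mathbb{R}$ there exists $n_0\in\mathbb{N}$ such that $$\sup_{n\ge n_0}\ \sup_{z\in P_\rho}\ \frac{e^{4\rho\sqrt{n}}\,|\Phi^{(\alpha)}_n(z)|\,|z|^{\gamma}}{|L^{(\alpha)}_n(z)|}<\infty .$$ Then for every $f$ satisfying $(\mathrm{G}_\rho)$, with $I:=\int_{\mathbb{R}_+}\omega_\alpha(x)f(x)\,dx$ and $Q_n$ denoting either the $(n+1)$-point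 Gauss-Laguerre or the $(n+1)$-point Gauss-Laguerre-Radau quadrature approximation of $I$, as $n\to\infty$, $$|I-Q_n|\lessapprox e^{-4\rho\sqrt{n}}\int_{P_\rho}|e^{-z}|\,|z|^{\alpha}|f(z)|\,ds .$$
   Context: Notation. $\mathbb{R}_+=[0,\infty)$; fractional powers of complex variables are principal branches. For $\rho>0$, $P_\rho=\{z\in\mathbb{C}:\operatorname{Re}[\sqrt{-z}]=\rho\}$ is a parabola, parametrised by $z(t)=t^2-\rho^2-2t\rho\,\mathrm{i}$, $t\in\mathbb{R}$, and $D_\rho=\{z\in\mathbb{C}:\operatorname{Re}[\sqrt{-z}]<\rho\}$ is the open set containing $\mathbb{R}_+$ whose boundary is $P_\rho$. Integrals $\int_{P_\rho}\cdots\,ds$ are with respect to arc length. The weight is $\omega_\alpha(x)=x^\alpha e^{-x}$, $x\in\mathbb{R}_+$, and $\|g\|_{\omega_\alpha}=\left(\int_{\mathbb{R}_+}\omega_\alpha(x)|g(x)|^2\,dx\right)^{1/2}$ is the norm of $L^2_{\omega_\alpha}(\mathbb{R}_+)$; $\|g\|_\infty=\sup_{x\in\mathbb{R}_+}|g(x)|$. $\mathbb{P}_n$ is the space of polynomials of degree at most $n$, and $\mathbb{Q}_n=\{e^{-x/2}u(x):u\in\mathbb{P}_n\}$. $L^{(\alpha)}_n\in\mathbb{P}_n$ is the generalised Laguerre polynomial, $L^{(\alpha)}_n(z)=\frac{(\alpha+1)_n}{n!}M(-n,\alpha+1;z)$, with $(\cdot)_n$ the Pochhammer symbol and $M$ the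 confluent hypergeometric function of the first kind; equivalently $L_n^{(\alpha)}(x)=\frac{1}{n!\,\omega_\alpha(x)}\frac{d^n}{dx^n}(\omega_\alpha(x)x^n)$. The weighted Cauchy transform is $$\Phi^{(\alpha)}_n(z)=\frac{1}{2\pi \mathrm{i}}\int_{\mathbb{R}_+}\frac{\omega_\alpha(x)L^{(\alpha)}_n(x)}{z-x}\,dx,\qquad z\in\mathbb{C}\setminus\mathbb{R}_+ .$$ Growth condition $(\mathrm{G}_\rho)$ (for the fixed $\rho$): a function $f$ satisfies $(\mathrm{G}_\rho)$ if $f$ is analytic on $\overline{D_\rho}$ and there exists $\beta\in\mathbb{R}$ such that $f(z)=O(|z|^\beta)$ as $z\to\infty$ in $\overline{D_\rho}$. Projection: $\Pi^P_nf=\sum_{k=0}^n a^{(\alpha)}_kL^{(\alpha)}_k$ is the orthogonal projection of $f$ onto $\mathbb{P}_n$ in $L^2_{\omega_\alpha}(\mathbb{R}_+)$, with $a^{(\alpha)}_k=\frac{k!}{\Gamma(k+\alpha+1)}\int_{\mathbb{R}_+}\omega_\alpha(x)f(x)L^{(\alpha)}_k(x)\,dx$. Interpolation: the Laguerre points are the $n+1$ zeros of $L^{(\alpha)}_{n+1}(z)$, and the Laguerre-Radau points are the $n+1$ zeros of $zL^{(\alpha+1)}_n(z)$. $p_n\in\mathbb{P}_n$ and $p^R_n\in\mathbb{P}_n$ are the interpolants of $f$ in $\mathbb{P}_n$ at the Laguerre points and the Laguerre-Radau points respectively; $q_n\in\mathbb{Q}_n$ and $q^R_n\in\mathbb{Q}_n$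 are the interpolants of $f$ in $\mathbb{Q}_n$ at the Laguerre points and the Laguerre-Radau points respectively. Quadrature: the $(n+1)$-point Gauss-Laguerre (respectively Gauss-Laguerre-Radau) approximation of $I$ is the interpolatory rule $Q_n=\int_{\mathbb{R}_+}\omega_\alpha(x)p_n(x)\,dx$ (respectively $Q_n=\int_{\mathbb{R}_+}\omega_\alpha(x)p^R_n(x)\,dx$). The notation "$A_n\lessapprox C B_n$ as $n\to\infty$", with $C>0$ a constant, means: for all $C_0>C$ there exists $n_0\in\mathbb{N}$ such that $A_n\le C_0B_n$ for all $n\ge n_0$. In each bound $C$ is the displayed constant prefactor independent of $n$ and $f$ (equal to $1$ in (iii)). *)

theory Defs
  imports "HOL-Analysis.Analysis" "HOL-Library.Landau_Symbols"
begin

definition parabola :: "real \<Rightarrow> complex set" where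
  "parabola \<rho> = {z. Re (csqrt (- z)) = \<rho>}"

definition parabola_interior :: "real \<Rightarrow> complex set" where
  "parabola_interior \<rho> = {z. Re (csqrt (- z)) < \<rho>}"

definition parabola_param :: "real \<Rightarrow> real \<Rightarrow> complex" where
  "parabola_param \<rho> t = Complex (t\<^sup>2 - \<rho>\<^sup>2) (- (2 * t * \<rho>))"

lemma bij_betw_parabola_param:
  assumes "\<rho> > 0"
  shows "bij_betw (parabola_param \<rho>) UNIV (parabola \<rho>)"
proof -
  have sq: "- parabola_param \<rho> t = (Complex \<rho> t)\<^sup>2" for t
    by (simp add: parabola_param_def complex_eq_iff power2_eq_square)
  have root: "csqrt (- parabola_param \<rho> t) = Complex \<rho> t" for t
    unfolding sq using assms by (intro csqrt_square) auto
  have "t = s" if "parabola_param \<rho> t = parabola_param \<rho> s" for s t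
    using root[of t] root[of s] unfolding that by simp
  then have "inj (parabola_param \<rho>)"
    by (rule injI)
  moreover have "z = parabola_param \<rho> (Im (csqrt (- z)))" if "z \<in> parabola \<rho>" for z
  proof -
    have "csqrt (- z) = Complex \<rho> (Im (csqrt (- z)))"
      using that by (simp only: parabola_def mem_Collect_eq complex_eq_iff complex.sel)
    then have "- z = - parabola_param \<rho> (Im (csqrt (- z)))"
      unfolding sq using power2_csqrt[of "- z"] by simp
    then show ?thesis by simp
  qed
  moreover have "parabola_param \<rho> t \<in> parabola \<rho>" for t
    by (simp only: parabola_def mem_Collect_eq root complex.sel)
  ultimately show ?thesis
    unfolding bij_betw_def by blast
qed

text \<open>
  As the parametrisation is a bijection onto the parabola, this is the integral with
  respect to arc length.
\<close>

definition parabola_integral :: "real \<Rightarrow> (complex \<Rightarrow> real) \<Rightarrow> real" where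
  "parabola_integral \<rho> g =
     (\<integral>t. g (parabola_param \<rho> t) * norm (vector_derivative (parabola_param \<rho>) (at t)) \<partial>lborel)"

definition growth_cond :: "real \<Rightarrow> (complex \<Rightarrow> complex) \<Rightarrow> bool" where
  "growth_cond \<rho> f \<longleftrightarrow>
     f analytic_on closure (parabola_interior \<rho>) \<and>
     (\<exists>\<beta>::real. (\<lambda>z. norm (f z))
        \<in> O[inf at_infinity (principal (closure (parabola_interior \<rho>)))](\<lambda>z. norm z powr \<beta>))"

definition weight :: "real \<Rightarrow> real \<Rightarrow> real" where
  "weight \<alpha> x = x powr \<alpha> * exp (- x)"

text \<open>
  Functions on the half-line are represented by functions on the complex plane, of which
  only the values at nonnegative reals matter. Both norms are real-valued and meaningful
  only for weighted square-integrable, respectively bounded, functions; a function of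
  polynomial growth (respectively \<^term>\<open>exp (- x / 2)\<close> times such a function)
  that is continuous on the half-line satisfies this.
\<close>

definition weight_norm :: "real \<Rightarrow> (complex \<Rightarrow> complex) \<Rightarrow> real" where
  "weight_norm \<alpha> g =
     sqrt (LINT x:{0..}|lborel. weight \<alpha> x * (norm (g (complex_of_real x)))\<^sup>2)"

definition sup_norm :: "(complex \<Rightarrow> complex) \<Rightarrow> real" where
  "sup_norm g = (SUP x\<in>{0..}. norm (g (complex_of_real x)))"

definition kummer_M :: "complex \<Rightarrow> complex \<Rightarrow> complex \<Rightarrow> complex" where
  "kummer_M a b z = eval_fps (fps_hypergeo [a] [b] 1) z"

definition laguerre :: "real \<Rightarrow> nat \<Rightarrow> complex \<Rightarrow> complex" where
  "laguerre \<alpha> n z =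
     pochhammer (complex_of_real (\<alpha> + 1)) n / fact n
       * kummer_M (- of_nat n) (complex_of_real (\<alpha> + 1)) z"

definition cauchy_transform :: "real \<Rightarrow> nat \<Rightarrow> complex \<Rightarrow> complex" where
  "cauchy_transform \<alpha> n z =
     1 / (2 * complex_of_real pi * \<i>)
       * (LINT x:{0..}|lborel.
            complex_of_real (weight \<alpha> x) * laguerre \<alpha> n (complex_of_real x)
              / (z - complex_of_real x))"

definition laguerre_coeff :: "real \<Rightarrow> (complex \<Rightarrow> complex) \<Rightarrow> nat \<Rightarrow> complex" where
  "laguerre_coeff \<alpha> f k =
     complex_of_real (fact k / Gamma (real k + \<alpha> + 1))
       * (LINT x:{0..}|lborel.
            complex_of_real (weight \<alpha> x) * f (complex_of_real x)
              * laguerre \<alpha> k (complex_of_real x))"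

definition laguerre_proj :: "real \<Rightarrow> nat \<Rightarrow> (complex \<Rightarrow> complex) \<Rightarrow> complex \<Rightarrow> complex" where
  "laguerre_proj \<alpha> n f z = (\<Sum>k\<le>n. laguerre_coeff \<alpha> f k * laguerre \<alpha> k z)"

definition poly_space :: "nat \<Rightarrow> (complex \<Rightarrow> complex) set" where
  "poly_space n = {poly u | u. degree u \<le> n}"

definition exp_poly_space :: "nat \<Rightarrow> (complex \<Rightarrow> complex) set" where
  "exp_poly_space n = {(\<lambda>z. exp (- z / 2) * poly u z) | u. degree u \<le> n}"

definition interpolant ::
    "(complex \<Rightarrow> complex) set \<Rightarrow> complex set \<Rightarrow> (complex \<Rightarrow> complex) \<Rightarrow> complex \<Rightarrow> complex" where
  "interpolant V S f = (THE g. g \<in> V \<and> (\<forall>x\<in>S. g x = f x))"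

text \<open>
  The index \<^term>\<open>n\<close> refers to the degree of the interpolant: both sets have
  \<^term>\<open>n + 1\<close> elements. For \<^term>\<open>\<alpha> > - 1\<close> all complex zeros of
  \<^term>\<open>laguerre \<alpha> n\<close> are real and positive; in particular there are none on a parabola.
\<close>

definition laguerre_points :: "real \<Rightarrow> nat \<Rightarrow> complex set" where
  "laguerre_points \<alpha> n = {z. laguerre \<alpha> (n + 1) z = 0}"

definition radau_points :: "real \<Rightarrow> nat \<Rightarrow> complex set" where
  "radau_points \<alpha> n = {z. z * laguerre (\<alpha> + 1) n z = 0}"

definition weighted_integral :: "real \<Rightarrow> (complex \<Rightarrow> complex) \<Rightarrow> complex" where
  "weighted_integral \<alpha> g =
     (LINT x:{0..}|lborel. complex_of_real (weight \<alpha> x) * g (complex_of_real x))"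

definition gauss_laguerre :: "real \<Rightarrow> nat \<Rightarrow> (complex \<Rightarrow> complex) \<Rightarrow> complex" where
  "gauss_laguerre \<alpha> n f =
     weighted_integral \<alpha> (interpolant (poly_space n) (laguerre_points \<alpha> n) f)"

definition gauss_laguerre_radau :: "real \<Rightarrow> nat \<Rightarrow> (complex \<Rightarrow> complex) \<Rightarrow> complex" where
  "gauss_laguerre_radau \<alpha> n f =
     weighted_integral \<alpha> (interpolant (poly_space n) (radau_points \<alpha> n) f)"

definition asymp_bound :: "(nat \<Rightarrow> real) \<Rightarrow> real \<Rightarrow> (nat \<Rightarrow> real) \<Rightarrow> bool" where
  "asymp_bound A C B \<longleftrightarrow> (\<forall>C\<^sub>0 > C. \<exists>n\<^sub>0. \<forall>n\<ge>n\<^sub>0. A n \<le> C\<^sub>0 * B n)"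

definition kappa :: "real \<Rightarrow> real" where
  "kappa \<alpha> = (if \<alpha> \<ge> 0 then 1 / Gamma (\<alpha> + 1) else 2)"

end

theory Submission
 imports Defs "HOL-Complex_Analysis.Complex_Analysis" "HOL-Probability.Probability" "HOL-Real_Asymp.Real_Asymp"
  "HOL-Computational_Algebra.Fundamental_Theorem_Algebra"
begin

text \<open>
 The parameter \<open>\<alpha>\<close> is called \<open>a\<close> in the lemmas.  Write \<open>\<psi>\<^sub>n\<close> for the Cauchy transform of \<open>\<omega> L\<^sub>n\<close> without its factor \<open>- 1 / (2 \<pi> i)\<close>.  Cauchy's formula on the
 parabola turns every error into a contour integral of \<open>f\<close> against a kernel made of \<open>L\<^sub>n\<close> and \<open>\<psi>\<^sub>n\<close>: a
 Laguerre coefficient has kernel \<open>\<psi>\<^sub>n(z)\<close>, an interpolation error has kernel \<open>W(x) / (W(z) (z - x))\<close> for the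
 node polynomial \<open>W\<close>, and integrating the latter over \<open>x\<close> gives the kernel \<open>\<psi>\<^sub>n / L\<^sub>n\<close> of a quadrature error
 (\<open>laguerre_coeff_contour\<close>, \<open>interpolation_error_contour\<close>, \<open>quadrature_error\<close>).  A growing \<open>f\<close> is first divided
 by a fixed polynomial, which has no effect on these formulas once its degree is at most \<open>n\<close>.

 The constants come from the pointwise limits of the scaled kernels.  For \<open>z = - w\<^sup>2\<close> and \<open>Re w > 0\<close>, Perron's
 formula (\<open>lagpoly_asymp\<close>) needs no saddle points in the complex plane.  The logarithmic derivative of \<open>L\<^sub>n\<close> is a sum over the
 zeros which satisfies a Riccati equation; two steps of approximation determine \<open>L\<^sub>n(z)\<close> up to a factor depending on
 \<open>n\<close> alone.  That factor is found at \<open>z = -1\<close>: for the parameter \<open>-1/2\<close> by Laplace's method on a Gaussian integral,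
 for other parameters by a fractional integral and the relation between \<open>L\<^sub>n\<close> and its derivative (\<open>lag_c_tendsto\<close>).
 The asymptotics of \<open>\<psi>\<^sub>n\<close> follow because \<open>\<psi>\<^sub>n\<close> and \<open>L\<^sub>n\<close> solve the same recurrence, so that \<open>\<psi>\<^sub>n / L\<^sub>n\<close> is a
 telescoping tail whose terms involve \<open>L\<^sub>n\<close> only (\<open>lag_psi_asymp\<close>).

 The decay hypotheses supply the dominating functions with which these limits pass under the integral sign.
 Each part assumes decay of one kernel only, but some bounds need another one: since \<open>L\<^sub>n \<psi>\<^sub>n\<close> is the Stieltjes
 transform of a positive measure, its size is known up to powers of \<open>|z|\<close>, and decay passes from \<open>\<psi>\<^sub>n\<close> and from
 \<open>\<psi>\<^sub>n / L\<^sub>n\<close> to \<open>1 / L\<^sub>n\<close>, from \<open>1 / L\<^sub>n\<close> to \<open>\<psi>\<^sub>n / L\<^sub>n\<close>, and from the parameter \<open>a\<close> to \<open>a + 1\<close>, which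
 governs the Radau nodes.  In the maximum norm, \<open>W\<close> is controlled on the half-line by \<open>lagpoly_bound\<close>.  The
 projection error is summed from the coefficients; that it tends to zero follows from comparison with the interpolant.
\<close>

abbreviation cx :: "real \<Rightarrow> complex" where
 "cx \<equiv> of_real"

abbreviation zpar :: "real \<Rightarrow> real \<Rightarrow> complex" where
 "zpar \<equiv> parabola_param"

lemmas lint_cong = Bochner_Integration.integral_cong[OF refl]

section \<open>Laguerre polynomials: algebraic identities\<close>

definition lagcoef :: "real \<Rightarrow> nat \<Rightarrow> nat \<Rightarrow> real" where
 "lagcoef a n k =
   (if k \<le> n then (-1) ^ k * pochhammer (a + real k + 1) (n - k) / (fact (n - k) * fact k) else 0)"

text \<open>The ground ring is left open, so that the zeros can be discussed over the reals and the contour integrals over the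
 complex numbers.\<close>

definition lagpoly :: "real \<Rightarrow> nat \<Rightarrow> 'a::real_field poly" where
 "lagpoly a n = Abs_poly (\<lambda>k. of_real (lagcoef a n k))"

lemma coeff_lagpoly [simp]: "coeff (lagpoly a n) k = of_real (lagcoef a n k)"
 unfolding lagpoly_def by (subst coeff_Abs_poly[where n = n]) (auto simp: lagcoef_def)

lemma degree_lagpoly [simp]: "degree (lagpoly a n) = n"
proof (rule antisym)
 show "degree (lagpoly a n) \<le> n" by (rule degree_le) (simp add: lagcoef_def)
 show "n \<le> degree (lagpoly a n)" by (rule le_degree) (simp add: lagcoef_def)
qed

lemma lagpoly_nonzero [simp]: "lagpoly a n \<noteq> 0"
proof
 assume "lagpoly a n = (0 :: 'a poly)"
 then have "coeff (lagpoly a n :: 'a poly) n = 0" by simp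
 then show False by (simp add: lagcoef_def)
qed

lemma lagpoly_0 [simp]: "lagpoly a 0 = 1"
 by (rule poly_eqI) (simp add: lagcoef_def coeff_1 pochhammer_0)

lemma lagpoly_Suc_0: "lagpoly a (Suc 0) = [:of_real (a + 1), -1:]"
 by (rule poly_eqI) (auto simp: lagcoef_def coeff_pCons split: nat.splits)

lemma poly_lagpoly_0: "poly (lagpoly a n) 0 = of_real (pochhammer (a + 1) n / fact n)"
 by (simp add: poly_0_coeff_0 lagcoef_def)

lemma pderiv_lagpoly: "pderiv (lagpoly a (Suc n)) = - lagpoly (a + 1) n"
proof (rule poly_eqI)
 fix k
 have "(real k + 1) * lagcoef a (Suc n) (Suc k) = - lagcoef (a + 1) n k"
  by (auto simp: lagcoef_def divide_simps add_ac)
 then have "of_real ((real k + 1) * lagcoef a (Suc n) (Suc k)) = (of_real (- lagcoef (a + 1) n k) :: 'a)"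
  by (rule arg_cong)
 then show "coeff (pderiv (lagpoly a (Suc n))) k = coeff (- lagpoly (a + 1) n :: 'a poly) k"
  by (simp add: coeff_pderiv add_ac)
qed

lemma lagcoef_raise:
 "(if k = 0 then 0 else lagcoef (a + 1) n (k - 1)) =
   (real n + a + 1) * lagcoef a n k - (real n + 1) * lagcoef a (Suc n) k"
proof (cases "k \<le> n")
 case True
 define m where "m = n - k"
 define Q where "Q = pochhammer (a + real k + 1) m"
 have n: "n = m + k" using True by (simp add: m_def)
 have 1: "pochhammer (a + real k + 1) (Suc m) = (a + real k + 1 + real m) * Q"
  unfolding Q_def pochhammer_rec' by (simp add: add_ac)
 have 2: "pochhammer (a + real k + 1) m = Q"
  unfolding Q_def by simp
 have mm: "Suc n - k = Suc m" "n - k = m" "k \<le> Suc n" "k \<le> n" using n by auto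
 show ?thesis
 proof (cases k)
  case 0
  then show ?thesis
   using n unfolding lagcoef_def mm 1 2 fact_Suc
   by (simp add: divide_simps) (simp add: algebra_simps)
 next
  case (Suc j)
  have 3: "pochhammer (a + 1 + real j + 1) (Suc m) = (a + real k + 1 + real m) * Q"
   using 1 Suc by (simp add: add_ac)
  have "n - j = Suc m" "j \<le> n" using n Suc by auto
  then have e0: "lagcoef (a + 1) n (k - 1) =
    (-1) ^ j * ((a + real k + 1 + real m) * Q) / (((real m + 1) * fact m) * fact j)"
   using Suc 3 by (simp add: lagcoef_def add_ac)
  have e1: "lagcoef a n k = (-1) ^ k * Q / (fact m * fact k)"
   unfolding lagcoef_def mm 2 using True by simp
  have e2: "lagcoef a (Suc n) k =
    (-1) ^ k * ((a + real k + 1 + real m) * Q) / (((real m + 1) * fact m) * fact k)"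
   unfolding lagcoef_def mm 1 using True by (simp add: add_ac)
  have s: "(-1 :: real) ^ k = - ((-1) ^ j)" "(fact k :: real) = (real j + 1) * fact j"
   using Suc by (auto simp: add_ac)
  have kk: "k \<noteq> 0" "real n = real m + real j + 1" "real k = real j + 1" using n Suc by auto
  show ?thesis
   unfolding e0 e1 e2 s kk using kk(1)
   by (simp add: divide_simps add_eq_0_iff) (simp add: algebra_simps)
 qed
next
 case False
 show ?thesis
 proof (cases "k = Suc n")
  case True
  then show ?thesis by (simp add: lagcoef_def divide_simps)
 next
  case False
  with \<open>\<not> k \<le> n\<close> show ?thesis by (auto simp: lagcoef_def)
 qed
qed

text \<open>This expands the node polynomial of the Radau points in the orthogonal basis for the parameter \<open>a\<close>.\<close>

lemma lagpoly_raise: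
 "pCons 0 (lagpoly (a + 1) n) =
   smult (of_real (real n + a + 1)) (lagpoly a n) - smult (of_real (real n + 1)) (lagpoly a (Suc n))"
 (is "?l = ?r")
proof (rule poly_eqI)
 fix k
 have "coeff ?l k = of_real (if k = 0 then 0 else lagcoef (a + 1) n (k - 1))"
  by (simp add: coeff_pCons split: nat.splits)
 also have "\<dots> = coeff ?r k"
  unfolding lagcoef_raise by simp
 finally show "coeff ?l k = coeff ?r k" .
qed

lemma lagcoef_lower: "lagcoef a (Suc n) k = lagcoef (a + 1) (Suc n) k - lagcoef (a + 1) n k"
proof (cases "k \<le> n")
 case True
 define m where "m = n - k"
 define Q where "Q = pochhammer (a + real k + 2) m"
 have n: "n = m + k" using True by (simp add: m_def)
 have 1: "pochhammer (a + real k + 1) (Suc m) = (a + real k + 1) * Q"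
  unfolding Q_def pochhammer_rec by (simp add: add_ac)
 have 2: "pochhammer (a + 1 + real k + 1) (Suc m) = (a + real k + 2 + real m) * Q"
  unfolding Q_def pochhammer_rec' by (simp add: add_ac)
 have 3: "pochhammer (a + 1 + real k + 1) m = Q"
  unfolding Q_def by (simp add: add_ac)
 have mm: "Suc n - k = Suc m" "n - k = m" "k \<le> Suc n" "k \<le> n" using n by auto
 show ?thesis
  unfolding lagcoef_def mm 1 2 3 fact_Suc
  using True by (simp add: divide_simps) (simp add: algebra_simps)
next
 case False
 then show ?thesis by (auto simp: lagcoef_def)
qed

lemma lagpoly_lower: "lagpoly a (Suc n) = lagpoly (a + 1) (Suc n) - lagpoly (a + 1) n"
proof (rule poly_eqI)
 fix k
 show "coeff (lagpoly a (Suc n)) k = coeff (lagpoly (a + 1) (Suc n) - lagpoly (a + 1) n) k"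
  unfolding coeff_diff coeff_lagpoly lagcoef_lower[of a] by simp
qed

lemma lagpoly_three_term:
 "pCons 0 (lagpoly a (Suc n)) =
   smult (of_real (2 * real n + 3 + a)) (lagpoly a (Suc n))
   - smult (of_real (real n + 2)) (lagpoly a (Suc (Suc n)))
   - smult (of_real (real n + 1 + a)) (lagpoly a n)"
proof -
 have "pCons 0 (lagpoly a (Suc n)) =
   pCons 0 (lagpoly (a + 1) (Suc n)) - (pCons 0 (lagpoly (a + 1) n) :: 'a poly)"
  unfolding lagpoly_lower[of a n] by simp
 also have "\<dots> = smult (of_real (2 * real n + 3 + a)) (lagpoly a (Suc n))
   - smult (of_real (real n + 2)) (lagpoly a (Suc (Suc n)))
   - smult (of_real (real n + 1 + a)) (lagpoly a n)"
  unfolding lagpoly_raise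
  by (rule poly_eqI) (simp add: algebra_simps)
 finally show ?thesis .
qed

lemma lagcoef_shift:
 "(real k + a + 1) * lagcoef (a + 1) n k = (real n + a + 1) * lagcoef a n k"
proof (cases "k \<le> n")
 case True
 define m where "m = n - k"
 have n: "real n = real m + real k" "n - k = m" using True by (auto simp: m_def)
 have "(a + real k + 1) * pochhammer (a + 1 + real k + 1) m =
    (a + real k + 1 + real m) * pochhammer (a + real k + 1) m"
  using pochhammer_rec[of "a + real k + 1" m] pochhammer_rec'[of "a + real k + 1" m]
  by (simp add: add_ac)
 then have "(real k + a + 1) * pochhammer (a + 1 + real k + 1) m * c =
    (real n + a + 1) * pochhammer (a + real k + 1) m * c" for c
  unfolding n by (simp add: add_ac)
 from this[of "(-1) ^ k / (fact m * fact k)"] show ?thesis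
  using True by (simp add: lagcoef_def n(2))
qed (simp add: lagcoef_def)

text \<open>Rodrigues' formula, one derivative at a time: the left side is \<open>(x \<omega> L)' / \<omega>\<close> for the weight \<open>\<omega>\<close> of
 parameter \<open>a\<close> and \<open>L\<close> of parameter \<open>a + 1\<close>.\<close>

lemma lagpoly_rodrigues:
 "pCons 0 (pderiv (lagpoly (a + 1) n)) + smult (of_real (a + 1)) (lagpoly (a + 1) n)
   - pCons 0 (lagpoly (a + 1) n) = smult (of_real (real n + 1)) (lagpoly a (Suc n))"
 (is "?l = _")
proof -
 have "pCons 0 (pderiv (lagpoly (a + 1) n)) + smult (of_real (a + 1)) (lagpoly (a + 1) n)
  = (smult (of_real (real n + a + 1)) (lagpoly a n) :: 'a poly)"
 proof (rule poly_eqI)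
  fix k
  have "coeff (pCons 0 (pderiv (lagpoly (a + 1) n)) + smult (of_real (a + 1)) (lagpoly (a + 1) n)) k
    = (of_real ((real k + a + 1) * lagcoef (a + 1) n k) :: 'a)"
   by (cases k) (simp_all add: coeff_pderiv algebra_simps)
  also have "\<dots> = coeff (smult (of_real (real n + a + 1)) (lagpoly a n)) k"
   unfolding lagcoef_shift by simp
  finally show "coeff (pCons 0 (pderiv (lagpoly (a + 1) n)) + smult (of_real (a + 1)) (lagpoly (a + 1) n)) k
    = coeff (smult (of_real (real n + a + 1)) (lagpoly a n) :: 'a poly) k" .
 qed
 then show ?thesis unfolding lagpoly_raise by simp
qed

lemma lagpoly_ode:
 "pCons 0 (pderiv (pderiv (lagpoly a (Suc n)))) + smult (of_real (a + 1)) (pderiv (lagpoly a (Suc n)))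
   - pCons 0 (pderiv (lagpoly a (Suc n))) + smult (of_real (real n + 1)) (lagpoly a (Suc n)) = 0"
 unfolding pderiv_lagpoly pderiv_minus lagpoly_rodrigues[symmetric]
 by (rule poly_eqI) (simp add: coeff_pCons split: nat.splits)

lemma lagpoly_connection:
 "lagpoly a n = (\<Sum>j\<le>n. smult (of_real (pochhammer (a - \<beta>) j / fact j)) (lagpoly \<beta> (n - j)))"
proof (rule poly_eqI)
 fix k
 have "lagcoef a n k = (\<Sum>j\<le>n. pochhammer (a - \<beta>) j / fact j * lagcoef \<beta> (n - j) k)"
 proof (cases "k \<le> n")
  case True
  define m where "m = n - k"
  have m: "n - k = m" "m \<le> n" "n = m + k" using True by (auto simp: m_def)
  have "pochhammer (a - \<beta> + (\<beta> + real k + 1)) m =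
    (\<Sum>j\<le>m. of_nat (m choose j) * pochhammer (a - \<beta>) j * pochhammer (\<beta> + real k + 1) (m - j))"
   by (rule pochhammer_binomial_sum)
  then have "pochhammer (a + real k + 1) m =
    (\<Sum>j\<le>m. of_nat (m choose j) * pochhammer (a - \<beta>) j * pochhammer (\<beta> + real k + 1) (m - j))"
   by (simp add: algebra_simps)
  then have "lagcoef a n k = (-1) ^ k * (\<Sum>j\<le>m. of_nat (m choose j) * pochhammer (a - \<beta>) j * pochhammer (\<beta> + real k + 1) (m - j)) / (fact m * fact k)"
   using True by (simp add: lagcoef_def m(1))
  also have "\<dots> = (\<Sum>j\<le>m. pochhammer (a - \<beta>) j / fact j * lagcoef \<beta> (n - j) k)"
   unfolding sum_distrib_left sum_divide_distrib
  proof (rule sum.cong[OF refl])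
   fix j assume "j \<in> {..m}"
   then have j: "j \<le> m" by simp
   have "n - j - k = m - j" "k \<le> n - j" using j m by auto
   moreover have "real (m choose j) = fact m / (fact j * fact (m - j))"
    by (rule binomial_fact[OF j])
   ultimately show "(-1) ^ k * (real (m choose j) * pochhammer (a - \<beta>) j * pochhammer (\<beta> + real k + 1) (m - j)) / (fact m * fact k)
     = pochhammer (a - \<beta>) j / fact j * lagcoef \<beta> (n - j) k"
    by (simp add: lagcoef_def)
  qed
  also have "\<dots> = (\<Sum>j\<le>n. pochhammer (a - \<beta>) j / fact j * lagcoef \<beta> (n - j) k)"
   by (rule sum.mono_neutral_left) (use m in \<open>auto simp: lagcoef_def\<close>)
  finally show ?thesis .
 next
  case False
  then have "lagcoef \<beta> (n - j) k = 0" for j by (simp add: lagcoef_def)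
  with False show ?thesis by (simp add: lagcoef_def)
 qed
 then have "of_real (lagcoef a n k) = (of_real (\<Sum>j\<le>n. pochhammer (a - \<beta>) j / fact j * lagcoef \<beta> (n - j) k) :: 'a)"
  by simp
 then show "coeff (lagpoly a n) k =
   coeff (\<Sum>j\<le>n. smult (of_real (pochhammer (a - \<beta>) j / fact j)) (lagpoly \<beta> (n - j)) :: 'a poly) k"
  by (simp add: coeff_sum)
qed

lemma poly_lagpoly_of_real:
 "poly (lagpoly a n) (of_real x) = (of_real (poly (lagpoly a n) x) :: 'a::real_field)"
 by (simp add: poly_altdef)

lemma laguerre_eq_poly:
 assumes "a > -1"
 shows "laguerre a n z = poly (lagpoly a n) z"
proof -
 let ?d = "cx (a + 1)"
 let ?F = "fps_hypergeo [- of_nat n] [?d] (1 :: complex)"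
 have poch: "pochhammer ?d k \<noteq> 0" for k
  using assms pochhammer_pos[of "a + 1" k] unfolding pochhammer_of_real by simp
 have nth: "?F $ k = pochhammer (- of_nat n) k / (pochhammer ?d k * fact k)" for k
  by simp
 have "kummer_M (- of_nat n) ?d z = (\<Sum>k. ?F $ k * z ^ k)"
  by (simp add: kummer_M_def eval_fps_def)
 also have "\<dots> = (\<Sum>k\<le>n. ?F $ k * z ^ k)"
 proof (rule suminf_finite)
  fix k assume "k \<notin> {..n}"
  then have "pochhammer (- of_nat n :: complex) k = 0" by (simp add: pochhammer_of_nat_eq_0_iff)
  then have "?F $ k = 0" unfolding nth by (simp only: div_0)
  then show "?F $ k * z ^ k = 0" by (simp only: mult_zero_left)
 qed simp
 finally have "laguerre a n z = (\<Sum>k\<le>n. pochhammer ?d n / fact n * (?F $ k * z ^ k))"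
  by (simp only: laguerre_def sum_distrib_left)
 also have "\<dots> = (\<Sum>k\<le>n. of_real (lagcoef a n k) * z ^ k)"
 proof (rule sum.cong[OF refl])
  fix k assume "k \<in> {..n}"
  then have k: "k \<le> n" by simp
  have split: "pochhammer ?d n = pochhammer ?d k * pochhammer (?d + of_nat k) (n - k)"
   using k by (rule pochhammer_product)
  have "of_nat (n choose k) = (-1) ^ k * pochhammer (- of_nat n :: complex) k / fact k"
   by (simp add: binomial_gbinomial gbinomial_pochhammer)
  then have "fact n / (fact k * fact (n - k)) = (-1) ^ k * pochhammer (- of_nat n :: complex) k / fact k"
   by (simp add: binomial_fact[OF k])
  then have "(-1) ^ k * ((-1) ^ k * pochhammer (- of_nat n :: complex) k) = (-1) ^ k * (fact n / fact (n - k))"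
   by (simp add: field_simps)
  then have neg: "pochhammer (- of_nat n :: complex) k = (-1) ^ k * (fact n / fact (n - k))"
   by (simp flip: mult.assoc power_mult_distrib)
  have "pochhammer (cx (a + real k + 1)) (n - k) = pochhammer (?d + of_nat k) (n - k)"
   by (simp add: add_ac)
  then have lc: "cx (lagcoef a n k) =
    (-1) ^ k * pochhammer (?d + of_nat k) (n - k) / (fact (n - k) * fact k)"
   using k unfolding lagcoef_def pochhammer_of_real[symmetric] by (simp add: pochhammer_of_real[symmetric])
  show "pochhammer ?d n / fact n * (?F $ k * z ^ k) = of_real (lagcoef a n k) * z ^ k"
   unfolding nth split neg lc using poch[of k] by (simp add: field_simps)
 qed
 also have "\<dots> = poly (lagpoly a n) z"
  by (simp add: poly_altdef)
 finally show ?thesis .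
qed

section \<open>The Laguerre weight and orthogonality\<close>

definition lagM :: "real \<Rightarrow> real measure" where
 "lagM a = density (restrict_space lborel {0..}) (\<lambda>x. ennreal (weight a x))"

lemma weight_nonneg: "weight a x \<ge> 0"
 by (simp add: weight_def)

lemma weight_pos: "x > 0 \<Longrightarrow> weight a x > 0"
 by (simp add: weight_def)

lemma borel_measurable_weight [measurable]: "weight a \<in> borel_measurable borel"
 unfolding weight_def[abs_def] by measurable

lemma space_lagM [simp]: "space (lagM a) = {0..}"
 by (simp add: lagM_def space_restrict_space)

lemma sets_lagM: "sets (lagM a) = sets (restrict_space borel {0..})"
 unfolding lagM_def sets_density by (rule sets_restrict_space_cong) simp

lemma measurable_lagM_cong: "borel_measurable (lagM a) = borel_measurable (restrict_space borel {0..})"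
 by (rule measurable_cong_sets[OF sets_lagM refl])

lemma measurable_lagM_continuous:
 "continuous_on {0..} g \<Longrightarrow> g \<in> borel_measurable (lagM a)"
 for g :: "real \<Rightarrow> 'b::topological_space"
 unfolding measurable_lagM_cong by (rule borel_measurable_continuous_on_restrict)

lemma weight_measurable_restrict: "weight a \<in> borel_measurable (restrict_space lborel {0..})"
 by (intro measurable_restrict_space1) simp

lemma measurable_lagM_lborel:
 "g \<in> borel_measurable (lagM a) \<longleftrightarrow> g \<in> borel_measurable (restrict_space lborel {0..})"
 by (simp add: lagM_def)

lemma integral_lagM:
 fixes g :: "real \<Rightarrow> 'b::{banach, second_countable_topology}"
 assumes "g \<in> borel_measurable (lagM a)"
 shows "(LINT x|lagM a. g x) = (LINT x:{0..}|lborel. weight a x *\<^sub>R g x)"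
proof -
 have "(LINT x|lagM a. g x) = (LINT x|restrict_space lborel {0..}. weight a x *\<^sub>R g x)"
  unfolding lagM_def
  by (rule integral_density) (use assms measurable_lagM_lborel weight_nonneg weight_measurable_restrict in auto)
 also have "\<dots> = (LINT x:{0..}|lborel. weight a x *\<^sub>R g x)"
  unfolding set_lebesgue_integral_def by (rule integral_restrict_space) simp
 finally show ?thesis .
qed

lemma integrable_lagM_iff:
 fixes g :: "real \<Rightarrow> 'b::{banach, second_countable_topology}"
 assumes "g \<in> borel_measurable (lagM a)"
 shows "integrable (lagM a) g \<longleftrightarrow> set_integrable lborel {0..} (\<lambda>x. weight a x *\<^sub>R g x)"
proof -
 have "integrable (lagM a) g \<longleftrightarrow> integrable (restrict_space lborel {0..}) (\<lambda>x. weight a x *\<^sub>R g x)"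
  unfolding lagM_def
  by (rule integrable_density) (use assms measurable_lagM_lborel weight_nonneg weight_measurable_restrict in auto)
 also have "\<dots> \<longleftrightarrow> set_integrable lborel {0..} (\<lambda>x. weight a x *\<^sub>R g x)"
  unfolding set_integrable_def by (rule integrable_restrict_space) simp
 finally show ?thesis .
qed

lemma integral_lagM_complex:
 assumes "g \<in> borel_measurable (lagM a)"
 shows "(LINT x:{0..}|lborel. cx (weight a x) * g x) = (LINT x|lagM a. g x)"
 using integral_lagM[OF assms] by (simp add: scaleR_conv_of_real)

lemma has_bochner_integral_moment:
 assumes "a > -1"
 shows "has_bochner_integral (lagM a) (\<lambda>x. x ^ k) (Gamma (real k + a + 1))"
proof -
 have pos: "real k + a + 1 > 0" using assms by simp
 have meas: "(\<lambda>x::real. x ^ k) \<in> borel_measurable (lagM a)"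
  by (intro measurable_lagM_continuous continuous_intros)
 have eq: "indicator {0..} x *\<^sub>R (weight a x *\<^sub>R x ^ k)
    = (indicator {0..} x * x powr (real k + a + 1 - 1) / exp x)" if "x \<noteq> 0" for x :: real
  using that by (auto simp: indicator_def weight_def powr_add powr_realpow exp_minus field_simps)
 have nn: "nn_integral lborel (\<lambda>x. ennreal (indicator {0..} x *\<^sub>R (weight a x *\<^sub>R x ^ k)))
   = ennreal (Gamma (real k + a + 1))"
 proof -
  have "nn_integral lborel (\<lambda>x. ennreal (indicator {0..} x *\<^sub>R (weight a x *\<^sub>R x ^ k)))
   = nn_integral lborel (\<lambda>x. ennreal (indicator {0..} x * x powr (real k + a + 1 - 1) / exp x))"
   by (rule nn_integral_cong_AE) (use eq AE_lborel_singleton[of 0] in \<open>auto elim: eventually_mono\<close>)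
  also have "\<dots> = ennreal (Gamma (real k + a + 1))"
   by (rule Gamma_conv_nn_integral_real[OF pos, symmetric])
  finally show ?thesis .
 qed
 have hb: "has_bochner_integral lborel (\<lambda>x. indicator {0..} x *\<^sub>R (weight a x *\<^sub>R x ^ k)) (Gamma (real k + a + 1))"
  by (rule has_bochner_integral_nn_integral)
    (use nn pos in \<open>auto intro!: AE_I2 simp: indicator_def weight_nonneg Gamma_real_nonneg\<close>)
 have "integrable (lagM a) (\<lambda>x. x ^ k)"
  unfolding integrable_lagM_iff[OF meas] set_integrable_def using hb by (rule integrable.intros)
 moreover have "(LINT x|lagM a. x ^ k) = Gamma (real k + a + 1)"
  unfolding integral_lagM[OF meas] set_lebesgue_integral_def
  using hb by (rule has_bochner_integral_integral_eq)
 ultimately show ?thesis by (simp add: has_bochner_integral_iff)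
qed

lemma integrable_lagM_power: "a > -1 \<Longrightarrow> integrable (lagM a) (\<lambda>x. x ^ k)"
 using has_bochner_integral_moment by (simp add: has_bochner_integral_iff)

lemma integrable_lagM_poly:
 fixes p :: "complex poly"
 assumes "a > -1"
 shows "integrable (lagM a) (\<lambda>x. poly p (cx x))"
proof -
 have "integrable (lagM a) (\<lambda>x. \<Sum>i\<le>degree p. coeff p i * cx (x ^ i))"
  by (intro Bochner_Integration.integrable_sum integrable_mult_right integrable_of_real
    integrable_lagM_power assms)
 then show ?thesis by (simp add: poly_altdef)
qed

lemma integrable_lagM_poly_growth:
 fixes g :: "real \<Rightarrow> 'b::{banach, second_countable_topology}"
 assumes "a > -1" "continuous_on {0..} g" "\<And>x. x \<ge> 0 \<Longrightarrow> norm (g x) \<le> C * (1 + x) ^ m"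
 shows "integrable (lagM a) g"
proof (rule Bochner_Integration.integrable_bound)
 have "integrable (lagM a) (\<lambda>x. C * (\<Sum>k\<le>m. of_nat (m choose k) * x ^ k))"
  by (intro integrable_mult_right Bochner_Integration.integrable_sum integrable_lagM_power assms)
 moreover have "(\<Sum>k\<le>m. of_nat (m choose k) * x ^ k) = (1 + x) ^ m" for x :: real
  using binomial_ring[of x 1 m] by (simp add: add.commute)
 ultimately show "integrable (lagM a) (\<lambda>x. C * (1 + x) ^ m)" by simp
 show "g \<in> borel_measurable (lagM a)" by (rule measurable_lagM_continuous[OF assms(2)])
 show "AE x in lagM a. norm (g x) \<le> norm (C * (1 + x) ^ m)"
 proof (rule AE_I2)
  fix x assume "x \<in> space (lagM a)"
  then have "x \<ge> 0" by simp
  from assms(3)[OF this] show "norm (g x) \<le> norm (C * (1 + x) ^ m)"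
   by (simp only: real_norm_def)
 qed
qed

subsection \<open>The moment functional on polynomials\<close>

definition lagint :: "real \<Rightarrow> complex poly \<Rightarrow> complex" where
 "lagint a p = (LINT x|lagM a. poly p (cx x))"

context
 fixes a :: real
 assumes a: "a > -1"
begin

lemma lagint_add: "lagint a (p + q) = lagint a p + lagint a q"
 unfolding lagint_def poly_add by (intro Bochner_Integration.integral_add integrable_lagM_poly a)

lemma lagint_diff: "lagint a (p - q) = lagint a p - lagint a q"
 unfolding lagint_def poly_diff by (intro Bochner_Integration.integral_diff integrable_lagM_poly a)

lemma lagint_smult: "lagint a (smult c p) = c * lagint a p"
 unfolding lagint_def poly_smult by (rule integral_mult_right_zero)

lemma lagint_sum: "lagint a (\<Sum>i\<in>A. p i) = (\<Sum>i\<in>A. lagint a (p i))"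
 unfolding lagint_def poly_sum by (intro Bochner_Integration.integral_sum integrable_lagM_poly a)

lemma lagint_monom: "lagint a (monom c k) = c * of_real (Gamma (real k + a + 1))"
proof -
 have "lagint a (monom c k) = (LINT x|lagM a. c * cx (x ^ k))"
  by (simp add: lagint_def poly_monom)
 also have "\<dots> = c * of_real (LINT x|lagM a. x ^ k)"
  by (subst integral_mult_right_zero) (simp only: integral_complex_of_real)
 finally show ?thesis
  using has_bochner_integral_moment[OF a, of k] by (simp add: has_bochner_integral_iff)
qed

end

lemma lagint_0 [simp]: "lagint a 0 = 0"
 by (simp add: lagint_def)

lemma lagint_as_sum:
 assumes "a > -1"
 shows "lagint a p = (\<Sum>i\<le>degree p. coeff p i * of_real (Gamma (real i + a + 1)))"
 by (subst poly_as_sum_of_monoms[symmetric, of p])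
   (simp only: lagint_sum[OF assms] lagint_monom[OF assms])

text \<open>Multiplication by the variable raises the parameter of the weight.\<close>

lemma lagint_pCons_0:
 assumes "a > -1"
 shows "lagint a (pCons 0 p) = lagint (a + 1) p"
proof -
 have a1: "a + 1 > -1" using assms by simp
 have "lagint a (pCons 0 p) = lagint a (\<Sum>i\<le>degree p. monom (coeff p i) (Suc i))"
 proof (rule arg_cong[where f = "lagint a"])
  have "pCons 0 p = [:0, 1:] * (\<Sum>i\<le>degree p. monom (coeff p i) i)"
   by (simp add: poly_as_sum_of_monoms)
  also have "\<dots> = (\<Sum>i\<le>degree p. monom (coeff p i) (Suc i))"
   unfolding sum_distrib_left by (simp add: monom_Suc)
  finally show "pCons 0 p = (\<Sum>i\<le>degree p. monom (coeff p i) (Suc i))" .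
 qed
 also have "\<dots> = lagint (a + 1) p"
  unfolding lagint_sum[OF assms] lagint_monom[OF assms] lagint_as_sum[OF a1]
  by (simp add: add_ac)
 finally show ?thesis .
qed

text \<open>The weight satisfies \<open>(x \<omega>)' = (a + 1 - x) \<omega>\<close>, so integrating the derivative of
 \<open>x q(x) \<omega>(x)\<close> gives zero.\<close>

lemma lagint_total_derivative:
 assumes "a > -1"
 shows "lagint a (pCons 0 (pderiv q) + smult (of_real (a + 1)) q - pCons 0 q) = 0"
proof -
 let ?T = "\<lambda>q. pCons 0 (pderiv q) + smult (cx (a + 1)) q - pCons 0 q"
 have mon: "lagint a (?T (monom c k)) = 0" for c k
 proof -
  have "Gamma (real k + a + 1 + 1) = (real k + a + 1) * Gamma (real k + a + 1)"
   by (rule Gamma_plus1) (use assms in auto)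
  then have g: "cx (Gamma (real (Suc k) + a + 1)) =
    (of_nat k + of_real (a + 1)) * of_real (Gamma (real k + a + 1))"
   by (simp add: algebra_simps)
  have "pCons 0 (pderiv (monom c k)) = monom (of_nat k * c) k"
   by (rule poly_eqI) (auto simp: coeff_pderiv coeff_pCons split: nat.splits)
  moreover have "pCons 0 (monom c k) = monom c (Suc k)"
   by (simp add: monom_Suc)
  ultimately show ?thesis
   by (simp only: smult_monom lagint_add[OF assms] lagint_diff[OF assms] lagint_monom[OF assms] g)
     (simp add: algebra_simps)
 qed
 have add: "?T (p + q) = ?T p + ?T q" for p q
  by (simp add: pderiv_add smult_add_right algebra_simps)
 have "lagint a (?T (\<Sum>i\<in>A. monom (coeff q i) i)) = 0" if "finite A" for A
  using that
 proof (induction A)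
  case (insert i A)
  have "lagint a (?T (\<Sum>i\<in>insert i A. monom (coeff q i) i)) =
    lagint a (?T (monom (coeff q i) i) + ?T (\<Sum>i\<in>A. monom (coeff q i) i))"
   unfolding sum.insert[OF insert.hyps] by (subst add) (rule refl)
  also have "\<dots> = 0"
   using insert.IH mon[of "coeff q i" i] by (subst lagint_add[OF assms]) simp
  finally show ?case .
 qed simp
 from this[of "{..degree q}"] show ?thesis by (simp add: poly_as_sum_of_monoms)
qed

text \<open>Integration by parts with Rodrigues' formula trades one degree of \<open>p\<close> for one unit of the parameter.\<close>

lemma lagint_lagpoly_mult:
 assumes "a > -1" "degree p \<le> n"
 shows "lagint a (lagpoly a n * p) = (-1) ^ n * coeff p n * of_real (Gamma (real n + a + 1))"
 using assms
proof (induction n arbitrary: a p)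
 case 0
 then obtain c where p: "p = [:c:]" by (metis degree_eq_zeroE le_zero_eq)
 have "lagint a [:c:] = c * of_real (Gamma (a + 1))"
  using lagint_monom[OF 0(1), of c 0] by (simp add: monom_0)
 then show ?case by (simp add: p)
next
 case (Suc n)
 have a1: "a + 1 > -1" using Suc.prems by simp
 let ?L = "lagpoly (a + 1) n :: complex poly"
 let ?T = "\<lambda>q. pCons 0 (pderiv q) + smult (cx (a + 1)) q - pCons 0 q"
 have "smult (of_real (real n + 1)) (lagpoly a (Suc n)) * p = ?T ?L * p"
  unfolding lagpoly_rodrigues ..
 also have "\<dots> = ?T (?L * p) - pCons 0 (?L * pderiv p)"
  by (simp add: pderiv_mult algebra_simps smult_add_right)
 finally have "of_real (real n + 1) * lagint a (lagpoly a (Suc n) * p)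
   = lagint a (?T (?L * p) - pCons 0 (?L * pderiv p))"
  by (metis lagint_smult[OF Suc.prems(1)] mult_smult_left)
 also have "\<dots> = - lagint (a + 1) (?L * pderiv p)"
  by (subst lagint_diff[OF Suc.prems(1)], subst lagint_total_derivative[OF Suc.prems(1)],
    subst lagint_pCons_0[OF Suc.prems(1)]) simp
 also have "\<dots> = - ((-1) ^ n * coeff (pderiv p) n * of_real (Gamma (real n + (a + 1) + 1)))"
  using Suc.IH[OF a1, of "pderiv p"] Suc.prems(2) degree_pderiv[of p] by simp
 also have "\<dots> = of_real (real n + 1) * ((-1) ^ Suc n * coeff p (Suc n) * of_real (Gamma (real (Suc n) + a + 1)))"
  by (simp add: coeff_pderiv algebra_simps)
 finally show ?case
  by (subst (asm) mult_left_cancel) (simp_all add: complex_eq_iff)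
qed

text \<open>The squared norm of \<open>L\<^sub>n\<close>.\<close>

definition lag_h :: "real \<Rightarrow> nat \<Rightarrow> real" where
 "lag_h a n = Gamma (real n + a + 1) / fact n"

lemma lag_h_pos: "a > -1 \<Longrightarrow> lag_h a n > 0"
 by (simp add: lag_h_def Gamma_real_pos)

lemma lag_h_Suc: "a > -1 \<Longrightarrow> lag_h a (Suc n) = (real n + a + 1) / (real n + 1) * lag_h a n"
proof -
 assume a: "a > -1"
 have "Gamma (real n + a + 1 + 1) = (real n + a + 1) * Gamma (real n + a + 1)"
  by (rule Gamma_plus1) (use a in auto)
 then have "Gamma (real (Suc n) + a + 1) = (real n + a + 1) * Gamma (real n + a + 1)"
  by (simp add: add_ac)
 then show ?thesis by (simp add: lag_h_def add_ac)
qed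

lemma lagint_orthogonal:
 assumes "a > -1" "degree p < n"
 shows "lagint a (lagpoly a n * p) = 0"
 using lagint_lagpoly_mult[of a p n] assms by (simp add: coeff_eq_0)

lemma lagint_lagpoly_square:
 assumes "a > -1"
 shows "lagint a (lagpoly a n * lagpoly a n) = of_real (lag_h a n)"
 using lagint_lagpoly_mult[OF assms, of "lagpoly a n" n]
 by (simp add: lagcoef_def lag_h_def flip: power_mult_distrib mult.assoc)

subsection \<open>Zeros\<close>

text \<open>The weight charges every interval, whereas a nonzero polynomial has finitely many zeros; hence the weighted
 inner product is definite on polynomials.\<close>

lemma lagM_poly_AE_nonzero:
 fixes q :: "complex poly"
 assumes "q \<noteq> 0" "a > -1"
 shows "\<not> (AE x in lagM a. poly q (of_real x) = 0)"
proof
 assume "AE x in lagM a. poly q (of_real x) = 0"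
 then have "AE x in restrict_space lborel {0..}. 0 < ennreal (weight a x) \<longrightarrow> poly q (of_real x) = 0"
  unfolding lagM_def by (subst (asm) AE_density) (use weight_measurable_restrict in auto)
 then have "AE x in lborel. x \<in> {0..} \<longrightarrow> 0 < ennreal (weight a x) \<longrightarrow> poly q (of_real x) = 0"
  by (subst (asm) AE_restrict_space_iff) auto
 then have "AE x in lborel. x \<notin> {1..2::real} - {x. poly q (of_real x) = 0}"
  by eventually_elim (auto simp: weight_pos)
 moreover have fin: "finite {x :: real. poly q (of_real x) = 0}"
 proof -
  have "finite (cx -` {z. poly q z = 0})"
   by (rule finite_vimageI[OF poly_roots_finite[OF assms(1)]]) (simp add: inj_on_def)
  then show ?thesis by (simp add: vimage_def)
 qed
 moreover have "{1..2::real} - {x. poly q (of_real x) = 0} \<in> sets lborel"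
  using fin by (auto intro!: sets.Diff simp: finite_imp_closed)
 ultimately have "emeasure lborel ({1..2::real} - {x. poly q (of_real x) = 0}) = 0"
  by (subst (asm) AE_iff_measurable) auto
 moreover have "emeasure lborel ({1..2::real} - {x. poly q (of_real x) = 0}) = emeasure lborel {1..2::real}"
  using fin by (intro emeasure_Diff_null_set finite_imp_null_set_lborel) auto
 ultimately show False by simp
qed

definition polycnj :: "complex poly \<Rightarrow> complex poly" where
 "polycnj = map_poly cnj"

lemma poly_polycnj: "poly (polycnj q) (of_real x) = cnj (poly q (of_real x))"
 by (simp add: polycnj_def poly_altdef coeff_map_poly degree_map_poly)

lemma degree_polycnj [simp]: "degree (polycnj q) = degree q"
 by (simp add: polycnj_def degree_map_poly)

lemma lagint_abs_square:
 "lagint a (q * polycnj q) = of_real (LINT x|lagM a. (norm (poly q (of_real x)))\<^sup>2)"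
 unfolding lagint_def poly_mult poly_polycnj complex_norm_square[symmetric]
 by (rule integral_complex_of_real)

lemma lagint_abs_square_pos:
 assumes "a > -1" "q \<noteq> 0"
 obtains c where "c > 0" "lagint a (q * polycnj q) = of_real c"
proof -
 let ?f = "\<lambda>x. (norm (poly q (cx x)))\<^sup>2"
 have "integrable (lagM a) (\<lambda>x. poly (q * polycnj q) (cx x))"
  by (rule integrable_lagM_poly[OF assms(1)])
 then have int: "integrable (lagM a) ?f"
  unfolding poly_mult poly_polycnj complex_norm_square[symmetric] complex_of_real_integrable_eq .
 have "(LINT x|lagM a. ?f x) \<noteq> 0"
  using lagM_poly_AE_nonzero[OF assms(2,1)] integral_nonneg_eq_0_iff_AE[OF int] by simp
 moreover have "(LINT x|lagM a. ?f x) \<ge> 0" by simp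
 ultimately have "(LINT x|lagM a. ?f x) > 0" by linarith
 then show ?thesis using lagint_abs_square by (rule that)
qed

text \<open>If \<open>L = (x - z) q\<close>, orthogonality of \<open>L\<close> to the conjugate of \<open>q\<close> says that \<open>z\<close> is the mean of
 \<open>x\<close> with respect to the positive weight \<open>|q|\<^sup>2\<close>.\<close>

lemma lagpoly_zero_real_positive:
 fixes z :: complex
 assumes "a > -1" "poly (lagpoly a n) z = 0"
 obtains x where "x > 0" "z = of_real x"
proof -
 obtain q where q: "lagpoly a n = [:-z, 1:] * q"
  using assms(2) unfolding poly_eq_0_iff_dvd by (elim dvdE)
 have q0: "q \<noteq> 0" using q lagpoly_nonzero[of a n, where ?'a = complex] by auto
 have a1: "a + 1 > -1" using assms(1) by simp
 have "n = Suc (degree q)"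
  using arg_cong[OF q, of degree] q0 by (simp add: degree_mult_eq del: mult_pCons_left)
 then have "lagint a (lagpoly a n * polycnj q) = 0"
  by (intro lagint_orthogonal assms) simp
 moreover have "lagpoly a n * polycnj q = pCons 0 (q * polycnj q) - smult z (q * polycnj q)"
  unfolding q by (simp add: left_diff_distrib)
 ultimately have eq: "lagint (a + 1) (q * polycnj q) = z * lagint a (q * polycnj q)"
  by (simp add: lagint_diff[OF assms(1)] lagint_smult[OF assms(1)] lagint_pCons_0[OF assms(1)])
 obtain c where c: "c > 0" "lagint a (q * polycnj q) = of_real c"
  by (rule lagint_abs_square_pos[OF assms(1) q0])
 obtain d where d: "d > 0" "lagint (a + 1) (q * polycnj q) = of_real d"
  by (rule lagint_abs_square_pos[OF a1 q0])
 have "z = of_real (d / c)" using eq c d by (simp add: field_simps)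
 with c d show ?thesis by (intro that[of "d / c"]) auto
qed

text \<open>At a double zero, removing both factors leaves a polynomial against which \<open>L\<close> has a positive integral.\<close>

lemma lagpoly_zeros_simple:
 assumes "a > -1"
 shows "rsquarefree (lagpoly a n :: complex poly)"
 unfolding rsquarefree_def
proof (intro conjI allI)
 fix z
 show "order z (lagpoly a n :: complex poly) = 0 \<or> order z (lagpoly a n :: complex poly) = 1"
 proof (rule ccontr)
 assume "\<not> ?thesis"
 then have ord: "2 \<le> order z (lagpoly a n :: complex poly)" by linarith
 then have "poly (lagpoly a n) z = 0" by (auto simp: order_root)
 then obtain x where x: "z = of_real x" by (rule lagpoly_zero_real_positive[OF assms])
 have "[:-z, 1:] ^ 2 dvd (lagpoly a n :: complex poly)"
  using ord by (simp add: order_divides)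
 then obtain q where q: "lagpoly a n = [:-z, 1:] ^ 2 * q" by (elim dvdE)
 have q0: "q \<noteq> 0" using q lagpoly_nonzero[of a n, where ?'a = complex] by auto
 have n: "n = Suc (Suc (degree q))"
  using arg_cong[OF q, of degree] q0 by (simp add: degree_mult_eq degree_power_eq del: mult_pCons_left)
 have "lagint a (lagpoly a n * polycnj q) = 0"
  using n by (intro lagint_orthogonal assms) simp
 moreover have "polycnj ([:-z, 1:] * q) = [:-z, 1:] * polycnj q"
  by (rule poly_eqI) (simp add: polycnj_def coeff_map_poly x coeff_pCons split: nat.splits)
 then have "lagpoly a n * polycnj q = ([:-z, 1:] * q) * polycnj ([:-z, 1:] * q)"
  unfolding q by (simp only: power2_eq_square ac_simps)
 moreover obtain c where "c > 0" "lagint a (([:-z, 1:] * q) * polycnj ([:-z, 1:] * q)) = of_real c"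
  by (rule lagint_abs_square_pos[OF assms, of "[:-z, 1:] * q"])
    (use q0 in \<open>simp_all del: mult_pCons_left\<close>)
 ultimately show False by (simp only:) simp
 qed
qed simp

section \<open>Asymptotics of Laguerre polynomials off the half-line, up to a constant\<close>

definition lagzeros :: "real \<Rightarrow> nat \<Rightarrow> real set" where
 "lagzeros a n = {x. poly (lagpoly a n) x = 0}"

lemma finite_lagzeros [simp]: "finite (lagzeros a n)"
 unfolding lagzeros_def by (rule poly_roots_finite) simp

lemma lagzeros_complex:
 assumes "a > -1"
 shows "{z :: complex. poly (lagpoly a n) z = 0} = of_real ` lagzeros a n"
proof (intro set_eqI iffI)
 fix z :: complex assume "z \<in> {z. poly (lagpoly a n) z = 0}"
 then have z: "poly (lagpoly a n) z = 0" by simp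
 then obtain x where "z = of_real x" by (rule lagpoly_zero_real_positive[OF assms])
 then show "z \<in> of_real ` lagzeros a n"
  using z by (simp add: poly_lagpoly_of_real lagzeros_def)
qed (auto simp: lagzeros_def poly_lagpoly_of_real)

lemma lagzeros_pos:
 assumes "a > -1" "x \<in> lagzeros a n"
 shows "x > 0"
proof -
 have "poly (lagpoly a n) (cx x) = 0"
  using assms(2) by (simp add: poly_lagpoly_of_real lagzeros_def)
 then obtain y where "y > 0" "cx x = of_real y"
  by (rule lagpoly_zero_real_positive[OF assms(1)])
 then show ?thesis by simp
qed

lemma lagpoly_factorization:
 assumes "a > -1"
 shows "smult ((-1) ^ n / fact n) (\<Prod>x\<in>lagzeros a n. [:- cx x, 1:]) = lagpoly a n"
proof -
 have "smult (lead_coeff (lagpoly a n)) (\<Prod>z | poly (lagpoly a n) z = 0. [:- z, 1:]) = (lagpoly a n :: complex poly)"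
  by (rule complex_poly_decompose_rsquarefree[OF lagpoly_zeros_simple[OF assms]])
 moreover have "(\<Prod>z\<in>of_real ` lagzeros a n. [:- z, 1:]) = (\<Prod>x\<in>lagzeros a n. [:- cx x, 1:])"
  by (subst prod.reindex) (auto simp: inj_on_def)
 ultimately show ?thesis
  unfolding lagzeros_complex[OF assms] by (simp add: lagcoef_def)
qed

lemma card_lagzeros:
 assumes "a > -1"
 shows "card (lagzeros a n) = n"
proof -
 have "degree (lagpoly a n :: complex poly) = degree (\<Prod>x\<in>lagzeros a n. [:- cx x, 1:])"
  unfolding lagpoly_factorization[OF assms, symmetric] by (rule degree_smult_eq[THEN trans]) simp
 also have "\<dots> = (\<Sum>x\<in>lagzeros a n. degree [:- cx x, 1:])"
  by (rule degree_prod_eq_sum_degree) simp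
 finally show ?thesis by simp
qed

lemma poly_lagpoly_prod:
 assumes "a > -1"
 shows "poly (lagpoly a n) z = (1 / fact n) * (\<Prod>x\<in>lagzeros a n. cx x - z)"
proof -
 have "poly (lagpoly a n) z = (-1) ^ n / fact n * (\<Prod>x\<in>lagzeros a n. z - cx x)"
  by (subst lagpoly_factorization[OF assms, symmetric]) (simp add: poly_prod)
 also have "(\<Prod>x\<in>lagzeros a n. z - cx x) = (\<Prod>x\<in>lagzeros a n. (-1) * (cx x - z))"
  by simp
 also have "\<dots> = (-1) ^ n * (\<Prod>x\<in>lagzeros a n. cx x - z)"
  unfolding prod.distrib by (simp add: card_lagzeros[OF assms])
 finally show ?thesis by (simp flip: power_mult_distrib)
qed

definition off_ray :: "complex set" where
 "off_ray = - of_real ` {0..}"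

lemma off_ray_iff: "z \<in> off_ray \<longleftrightarrow> Im z \<noteq> 0 \<or> Re z < 0"
 by (auto simp: off_ray_def complex_eq_iff not_le image_iff intro: exI[of _ "Re z"])

lemma open_off_ray: "open off_ray"
proof -
 have eq: "off_ray = {z. Im z < 0} \<union> {z. Im z > 0} \<union> {z. Re z < 0}"
  by (auto simp: off_ray_iff)
 show ?thesis
  unfolding eq by (intro open_Un open_halfspace_Im_lt open_halfspace_Im_gt open_halfspace_Re_lt)
qed

lemma off_ray_diff_nonzero: "z \<in> off_ray \<Longrightarrow> x \<ge> 0 \<Longrightarrow> cx x - z \<noteq> 0"
 by (auto simp: off_ray_def)

lemma neg_square_off_ray: "Re w > 0 \<Longrightarrow> - (w\<^sup>2) \<in> off_ray"
proof (unfold off_ray_iff, cases "Im w = 0")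
 case True
 assume "Re w > 0"
 with True show "Im (- (w\<^sup>2)) \<noteq> 0 \<or> Re (- (w\<^sup>2)) < 0" by (simp add: power2_eq_square)
qed (auto simp: power2_eq_square)

lemma lagpoly_off_ray_nonzero:
 assumes "a > -1" "z \<in> off_ray"
 shows "poly (lagpoly a n) z \<noteq> 0"
 unfolding poly_lagpoly_prod[OF assms(1)]
 using off_ray_diff_nonzero[OF assms(2)] lagzeros_pos[OF assms(1)] by (auto intro: less_imp_le)

text \<open>For \<open>k = 1\<close> this is minus the logarithmic derivative of \<open>L\<^sub>n\<close>; raising \<open>k\<close> corresponds to differentiating.\<close>

definition zero_sum :: "real \<Rightarrow> nat \<Rightarrow> nat \<Rightarrow> complex \<Rightarrow> complex" where
 "zero_sum a n k z = (\<Sum>x\<in>lagzeros a n. 1 / (cx x - z) ^ k)"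

context
 fixes a :: real
 assumes a: "a > -1"
begin

lemma zero_sum_has_derivative:
 assumes "z \<in> off_ray"
 shows "(zero_sum a n k has_field_derivative of_nat k * zero_sum a n (Suc k) z) (at z)"
proof -
 have "((\<lambda>z. 1 / (cx x - z) ^ k) has_field_derivative of_nat k * (1 / (cx x - z) ^ Suc k)) (at z)"
  if "x \<in> lagzeros a n" for x
 proof -
  have nz: "cx x - z \<noteq> 0"
   using off_ray_diff_nonzero[OF assms] lagzeros_pos[OF a that] by simp
  have "((\<lambda>z. inverse ((cx x - z) ^ k)) has_field_derivative
    - (inverse ((cx x - z) ^ k) * (of_nat k * (cx x - z) ^ (k - 1) * (-1)) * inverse ((cx x - z) ^ k))) (at z)"
   using nz by (auto intro!: derivative_eq_intros)
  moreover have "- (inverse ((cx x - z) ^ k) * (of_nat k * (cx x - z) ^ (k - 1) * (-1)) * inverse ((cx x - z) ^ k))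
    = of_nat k * (1 / (cx x - z) ^ Suc k)"
   using nz by (cases k) (simp_all add: divide_simps)
  ultimately show ?thesis by (simp add: inverse_eq_divide)
 qed
 then have "((\<lambda>z. \<Sum>x\<in>lagzeros a n. 1 / (cx x - z) ^ k) has_field_derivative
   (\<Sum>x\<in>lagzeros a n. of_nat k * (1 / (cx x - z) ^ Suc k))) (at z)"
  by (rule DERIV_sum)
 then show ?thesis
  unfolding zero_sum_def[abs_def] sum_distrib_left .
qed

lemma pderiv_lagpoly_eq:
 assumes "z \<in> off_ray"
 shows "poly (pderiv (lagpoly a n)) z = - zero_sum a n 1 z * poly (lagpoly a n) z"
proof -
 have nz: "cx x - z \<noteq> 0" if "x \<in> lagzeros a n" for x
  using off_ray_diff_nonzero[OF assms] lagzeros_pos[OF a that] by simp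
 have "((\<lambda>z. \<Prod>x\<in>lagzeros a n. cx x - z) has_field_derivative
   (\<Prod>x\<in>lagzeros a n. cx x - z) * (\<Sum>x\<in>lagzeros a n. (-1) / (cx x - z))) (at z)"
  by (rule has_field_derivative_prod') (auto intro!: derivative_eq_intros dest: nz)
 then have "((\<lambda>z. (1 / fact n) * (\<Prod>x\<in>lagzeros a n. cx x - z)) has_field_derivative
   (1 / fact n) * ((\<Prod>x\<in>lagzeros a n. cx x - z) * (\<Sum>x\<in>lagzeros a n. (-1) / (cx x - z)))) (at z)"
  by (rule DERIV_cmult)
 then have "(poly (lagpoly a n) has_field_derivative
   poly (lagpoly a n) z * (\<Sum>x\<in>lagzeros a n. (-1) / (cx x - z))) (at z)"
  unfolding mult.assoc[symmetric] poly_lagpoly_prod[OF a, symmetric] by simp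
 then have "poly (pderiv (lagpoly a n)) z = poly (lagpoly a n) z * (\<Sum>x\<in>lagzeros a n. (-1) / (cx x - z))"
  by (rule DERIV_unique[OF poly_DERIV])
 also have "\<dots> = - zero_sum a n 1 z * poly (lagpoly a n) z"
  by (simp add: zero_sum_def sum_negf)
 finally show ?thesis .
qed

lemma poly_eq_derivative:
 assumes "\<And>y. y \<in> off_ray \<Longrightarrow> poly p y = g y" "z \<in> off_ray"
  "(g has_field_derivative d) (at z)"
 shows "poly (pderiv p) z = d"
proof -
 have "(poly p has_field_derivative d) (at z)"
  by (rule has_field_derivative_transform_within_open[OF assms(3) open_off_ray assms(2)])
    (simp add: assms(1))
 then show ?thesis by (rule DERIV_unique[OF poly_DERIV])
qed

lemma pderiv2_lagpoly_eq:
 assumes "z \<in> off_ray"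
 shows "poly (pderiv (pderiv (lagpoly a n))) z =
   ((zero_sum a n 1 z)\<^sup>2 - zero_sum a n 2 z) * poly (lagpoly a n) z"
proof (rule poly_eq_derivative[OF pderiv_lagpoly_eq assms])
 show "((\<lambda>z. - zero_sum a n 1 z * poly (lagpoly a n) z) has_field_derivative
   ((zero_sum a n 1 z)\<^sup>2 - zero_sum a n 2 z) * poly (lagpoly a n) z) (at z)"
  by (rule derivative_eq_intros zero_sum_has_derivative assms poly_DERIV refl)+
    (simp add: pderiv_lagpoly_eq[OF assms] power2_eq_square algebra_simps numeral_2_eq_2)
qed

text \<open>Laguerre's differential equation, divided by \<open>L\<^sub>n\<close>.\<close>

lemma zero_sum_riccati:
 assumes "z \<in> off_ray" "n > 0"
 shows "z * ((zero_sum a n 1 z)\<^sup>2 - zero_sum a n 2 z) - (of_real (a + 1) - z) * zero_sum a n 1 z + of_nat n = 0"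
proof -
 obtain m where n: "n = Suc m" using assms(2) by (cases n) auto
 let ?L = "lagpoly a n :: complex poly"
 have "z * poly (pderiv (pderiv ?L)) z + of_real (a + 1) * poly (pderiv ?L) z - z * poly (pderiv ?L) z
   + of_nat n * poly ?L z = 0"
  using arg_cong[OF lagpoly_ode[of a m, where ?'a = complex], of "\<lambda>p. poly p z"] by (simp add: n add_ac)
 then have "(z * ((zero_sum a n 1 z)\<^sup>2 - zero_sum a n 2 z) - (of_real (a + 1) - z) * zero_sum a n 1 z + of_nat n)
   * poly ?L z = 0"
  unfolding pderiv2_lagpoly_eq[OF assms(1)] pderiv_lagpoly_eq[OF assms(1)] by (simp add: algebra_simps)
 then show ?thesis using lagpoly_off_ray_nonzero[OF a assms(1)] by simp
qed

lemma zero_sum_riccati_derivative: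
 assumes "z \<in> off_ray" "n > 0"
 shows "z * (2 * zero_sum a n 1 z * zero_sum a n 2 z - 2 * zero_sum a n 3 z)
   + ((zero_sum a n 1 z)\<^sup>2 - zero_sum a n 2 z)
   - (of_real (a + 1) - z) * zero_sum a n 2 z + zero_sum a n 1 z = 0"
proof -
 let ?R = "\<lambda>z. z * ((zero_sum a n 1 z)\<^sup>2 - zero_sum a n 2 z) - (of_real (a + 1) - z) * zero_sum a n 1 z + of_nat n"
 have "(?R has_field_derivative (z * (2 * zero_sum a n 1 z * zero_sum a n 2 z - 2 * zero_sum a n 3 z)
   + ((zero_sum a n 1 z)\<^sup>2 - zero_sum a n 2 z)
   - (of_real (a + 1) - z) * zero_sum a n 2 z + zero_sum a n 1 z)) (at z)"
  by (rule derivative_eq_intros zero_sum_has_derivative assms refl)+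
    (simp add: power2_eq_square algebra_simps numeral_2_eq_2 numeral_3_eq_3)
 moreover have "(?R has_field_derivative 0) (at z)"
  by (rule has_field_derivative_transform_within_open[OF DERIV_const[of 0] open_off_ray assms(1)])
    (rule zero_sum_riccati[OF _ assms(2), symmetric])
 ultimately show ?thesis by (rule DERIV_unique)
qed

lemma zero_sum_minus_1:
 "zero_sum a n k (-1) = of_real (\<Sum>x\<in>lagzeros a n. 1 / (x + 1) ^ k)"
 by (simp add: zero_sum_def)

text \<open>At \<open>z = -1\<close> all terms are positive, and the Riccati equation reads \<open>s\<^sup>2 - t + (a + 2) s = n\<close> with \<open>t \<le> s\<close>.
 Bounds at a single point suffice, since for \<open>z = - w\<^sup>2\<close> each term is comparable to its value at \<open>-1\<close>.\<close>

lemma zero_sum_minus_1_le: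
 "(\<Sum>x\<in>lagzeros a n. 1 / (x + 1)) \<le> sqrt n"
proof (cases "n = 0")
 case True
 then show ?thesis using card_lagzeros[OF a, of n] by simp
next
 case False
 define s where "s = (\<Sum>x\<in>lagzeros a n. 1 / (x + 1))"
 define t where "t = (\<Sum>x\<in>lagzeros a n. 1 / (x + 1)\<^sup>2)"
 have s0: "s \<ge> 0" unfolding s_def by (intro sum_nonneg) (use lagzeros_pos[OF a] in force)
 have "t \<le> s" unfolding s_def t_def
 proof (rule sum_mono)
  fix x assume "x \<in> lagzeros a n"
  then have "x > 0" by (rule lagzeros_pos[OF a])
  then show "1 / (x + 1)\<^sup>2 \<le> 1 / (x + 1)"
   by (intro divide_left_mono) (auto simp: power2_eq_square)
 qed
 have "zero_sum a n 1 (-1) = of_real s" "zero_sum a n 2 (-1) = of_real t"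
  unfolding zero_sum_minus_1 s_def t_def by simp_all
 with zero_sum_riccati[of "-1" n] False
 have "cx (- (s\<^sup>2 - t) - (a + 2) * s + real n) = 0"
  by (simp add: off_ray_iff algebra_simps)
 then have "- (s\<^sup>2 - t) - (a + 2) * s + real n = 0"
  by (simp only: of_real_eq_0_iff)
 moreover have "(a + 2) * s \<ge> 1 * s" using a s0 by (intro mult_right_mono) auto
 ultimately have "s\<^sup>2 \<le> real n" using \<open>t \<le> s\<close> by simp
 then show ?thesis unfolding s_def[symmetric] by (rule real_le_rsqrt)
qed

end

text \<open>This positivity selects, among the two approximate roots \<open>\<plusminus> \<surd>n / w\<close> of the Riccati equation, the one with the
 sign plus.\<close>

lemma Re_div_add_square_nonneg:
 assumes "Re w > 0" "x \<ge> 0"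
 shows "Re (w / (of_real x + w\<^sup>2)) \<ge> 0"
proof -
 have "Re (w * cnj (of_real x + w\<^sup>2)) = Re w * (x + (norm w)\<^sup>2)"
  unfolding cmod_power2 by (simp add: power2_eq_square algebra_simps)
 also have "\<dots> \<ge> 0" using assms by (intro mult_nonneg_nonneg) auto
 finally show ?thesis
  by (subst complex_div_cnj) (auto simp: Re_divide_of_real intro!: divide_nonneg_nonneg simp flip: of_real_power)
qed

lemma norm_add_square_ge:
 assumes "0 < a" "a \<le> 1" "a \<le> Re w" "norm w \<le> b" "x \<ge> 0"
 shows "norm (of_real x + w\<^sup>2) \<ge> a ^ 3 / b * (x + 1)"
proof -
 have w0: "norm w > 0" "b > 0" using assms complex_Re_le_cmod[of w] by linarith+
 have aw: "a \<le> norm w" using assms complex_Re_le_cmod[of w] by linarith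
 have "Re (cnj w * (of_real x + w\<^sup>2)) = Re w * (x + (norm w)\<^sup>2)"
  unfolding cmod_power2 by (simp add: power2_eq_square algebra_simps)
 moreover have "Re w * (x + (norm w)\<^sup>2) \<ge> a * (x + a\<^sup>2)"
  using assms aw by (intro mult_mono add_mono power_mono) auto
 moreover have "a\<^sup>2 \<le> 1" using assms by (simp add: power_le_one)
 then have "a * (x + a\<^sup>2) \<ge> a * (a\<^sup>2 * (x + 1))"
  using assms mult_right_mono[of "a\<^sup>2" 1 x] by (intro mult_left_mono) (auto simp: algebra_simps)
 ultimately have "a ^ 3 * (x + 1) \<le> Re (cnj w * (of_real x + w\<^sup>2))"
  by (simp add: power2_eq_square power3_eq_cube mult.assoc)
 also have "\<dots> \<le> norm (cnj w * (of_real x + w\<^sup>2))" by (rule complex_Re_le_cmod)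
 also have "\<dots> \<le> b * norm (of_real x + w\<^sup>2)"
  unfolding norm_mult complex_mod_cnj using assms by (intro mult_right_mono) auto
 finally show ?thesis using w0 by (simp add: field_simps)
qed

text \<open>A compact convex set in the variable \<open>w\<close> on which the estimates are uniform; every point of the right half
 plane lies in one that also contains \<open>1\<close>.\<close>

definition half_disc :: "real \<Rightarrow> real \<Rightarrow> complex set" where
 "half_disc a b = {w. a \<le> Re w \<and> norm w \<le> b}"

lemma half_disc_eq: "half_disc a b = {w. a \<le> Re w} \<inter> cball 0 b"
 by (auto simp: half_disc_def)

lemma compact_half_disc: "compact (half_disc a b)"
proof -
 have "closed {w. a \<le> Re w}" using closed_halfspace_Re_ge[of a] by simp
 then show ?thesis unfolding half_disc_eq by (intro closed_Int_compact compact_cball)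
qed

lemma convex_half_disc: "convex (half_disc a b)"
proof -
 have "convex {w. Re w \<ge> a}" by (rule convex_halfspace_Re_ge)
 then show ?thesis unfolding half_disc_eq by (intro convex_Int convex_cball)
qed

context
 fixes a d b :: real
 assumes a: "a > -1" and d: "0 < d" "d \<le> 1" and b: "1 \<le> b"
begin

lemma half_disc_norm: "w \<in> half_disc d b \<Longrightarrow> d \<le> norm w"
 using complex_Re_le_cmod[of w] by (auto simp: half_disc_def)

lemma half_disc_off_ray: "w \<in> half_disc d b \<Longrightarrow> - (w\<^sup>2) \<in> off_ray"
 using d by (intro neg_square_off_ray) (auto simp: half_disc_def)

lemma norm_zero_sum_le:
 assumes "w \<in> half_disc d b" "k > 0"
 shows "norm (zero_sum a n k (- (w\<^sup>2))) \<le> (b / d ^ 3) ^ k * sqrt n"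
proof -
 have "norm (1 / (cx x - (- (w\<^sup>2))) ^ k) \<le> (b / d ^ 3) ^ k * (1 / (x + 1))"
  if "x \<in> lagzeros a n" for x
 proof -
  have x: "x > 0" by (rule lagzeros_pos[OF a that])
  have ge: "norm (cx x + w\<^sup>2) \<ge> d ^ 3 / b * (x + 1)"
   using assms(1) d x by (intro norm_add_square_ge) (auto simp: half_disc_def)
  have pos: "d ^ 3 / b * (x + 1) > 0" using d b x by simp
  have "norm (1 / (cx x - (- (w\<^sup>2))) ^ k) = 1 / norm (cx x + w\<^sup>2) ^ k"
   by (simp add: norm_divide norm_power)
  also have "\<dots> \<le> 1 / (d ^ 3 / b * (x + 1)) ^ k"
   using order_less_le_trans[OF pos ge] pos ge
   by (intro divide_left_mono power_mono mult_pos_pos[OF zero_less_power zero_less_power] less_imp_le[OF pos]) simp_all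
  also have "\<dots> = (b / d ^ 3) ^ k * (1 / (x + 1) ^ k)"
   using d b by (simp add: power_mult_distrib power_divide)
  also have "\<dots> \<le> (b / d ^ 3) ^ k * (1 / (x + 1))"
   using d b x assms(2) power_increasing[of 1 k "x + 1"]
   by (intro mult_left_mono divide_left_mono) auto
  finally show ?thesis .
 qed
 then have "norm (zero_sum a n k (- (w\<^sup>2))) \<le> (\<Sum>x\<in>lagzeros a n. (b / d ^ 3) ^ k * (1 / (x + 1)))"
  unfolding zero_sum_def by (rule sum_norm_le)
 also have "\<dots> = (b / d ^ 3) ^ k * (\<Sum>x\<in>lagzeros a n. 1 / (x + 1))"
  by (simp add: sum_distrib_left)
 also have "\<dots> \<le> (b / d ^ 3) ^ k * sqrt n"
  using d b by (intro mult_left_mono zero_sum_minus_1_le[OF a]) auto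
 finally show ?thesis .
qed

lemma Re_mult_zero_sum_nonneg:
 assumes "w \<in> half_disc d b"
 shows "Re (w * zero_sum a n 1 (- (w\<^sup>2))) \<ge> 0"
proof -
 have "Re (w * zero_sum a n 1 (- (w\<^sup>2))) = (\<Sum>x\<in>lagzeros a n. Re (w / (of_real x + w\<^sup>2)))"
  by (simp add: zero_sum_def sum_distrib_left)
 also have "\<dots> \<ge> 0"
  using assms d lagzeros_pos[OF a]
  by (intro sum_nonneg Re_div_add_square_nonneg) (auto simp: half_disc_def less_imp_le)
 finally show ?thesis .
qed

lemma norm_zero_sum_add_ge:
 assumes "w \<in> half_disc d b"
 shows "norm (zero_sum a n 1 (- (w\<^sup>2)) + of_real (sqrt n) / w) \<ge> sqrt n / b"
proof -
 let ?S = "zero_sum a n 1 (- (w\<^sup>2))"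
 have w: "norm w > 0" "norm w \<le> b" using half_disc_norm[OF assms] d assms by (auto simp: half_disc_def)
 then have "w \<noteq> 0" by auto
 then have "?S + of_real (sqrt n) / w = (w * ?S + of_real (sqrt n)) / w"
  by (simp add: field_simps)
 then have eq: "norm (?S + of_real (sqrt n) / w) = norm (w * ?S + of_real (sqrt n)) / norm w"
  by (simp only: norm_divide)
 have "sqrt n \<le> Re (w * ?S + of_real (sqrt n))"
  using Re_mult_zero_sum_nonneg[OF assms, of n] by simp
 also have "\<dots> \<le> norm (w * ?S + of_real (sqrt n))" by (rule complex_Re_le_cmod)
 finally have "sqrt n / norm w \<le> norm (?S + of_real (sqrt n) / w)"
  unfolding eq using w by (intro divide_right_mono) auto
 moreover have "sqrt n / b \<le> sqrt n / norm w"
  using w b by (intro divide_left_mono) auto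
 ultimately show ?thesis by linarith
qed

text \<open>Riccati's equation, written so that \<open>\<surd>n / w\<close> is seen to be an approximate solution.\<close>

lemma zero_sum_quadratic:
 assumes "w \<in> half_disc d b" "n > 0"
 shows "(zero_sum a n 1 (- (w\<^sup>2)) - of_real (sqrt n) / w) * (zero_sum a n 1 (- (w\<^sup>2)) + of_real (sqrt n) / w)
  = zero_sum a n 2 (- (w\<^sup>2)) - (of_real (a + 1) / w\<^sup>2 + 1) * zero_sum a n 1 (- (w\<^sup>2))"
proof -
 let ?S = "zero_sum a n 1 (- (w\<^sup>2))" and ?T = "zero_sum a n 2 (- (w\<^sup>2))"
 have w: "w \<noteq> 0" using half_disc_norm[OF assms(1)] d by auto
 have "- (w\<^sup>2) * (?S\<^sup>2 - ?T) - (of_real (a + 1) + w\<^sup>2) * ?S + of_nat n = 0"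
  using zero_sum_riccati[OF a half_disc_off_ray[OF assms(1)] assms(2)] by simp
 moreover have "(cx (sqrt n))\<^sup>2 = of_nat n"
  by (simp flip: of_real_power)
 then have "(?S - of_real (sqrt n) / w) * (?S + of_real (sqrt n) / w) = ?S\<^sup>2 - of_nat n / w\<^sup>2"
  by (simp add: power2_eq_square algebra_simps)
 ultimately show ?thesis
  using w by (simp add: divide_simps) (simp add: algebra_simps)
qed

text \<open>In the factorised Riccati equation the right side is \<open>O(\<surd>n)\<close>, and the factor with the plus sign is at
 least of order \<open>\<surd>n\<close>.\<close>

lemma zero_sum_first_order:
 obtains C where "C \<ge> 0"
  "\<And>n w. n > 0 \<Longrightarrow> w \<in> half_disc d b \<Longrightarrow> norm (zero_sum a n 1 (- (w\<^sup>2)) - of_real (sqrt n) / w) \<le> C"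
proof
 define D where "D = b / d ^ 3"
 define K where "K = D\<^sup>2 + ((a + 1) / d\<^sup>2 + 1) * D"
 have D0: "D > 0" using d b by (simp add: D_def)
 then have K0: "K \<ge> 0" using a d unfolding K_def by (intro add_nonneg_nonneg mult_nonneg_nonneg) auto
 then show "K * b \<ge> 0" using b by simp
 fix n :: nat and w assume n: "n > 0" and w: "w \<in> half_disc d b"
 let ?S = "zero_sum a n 1 (- (w\<^sup>2))" and ?T = "zero_sum a n 2 (- (w\<^sup>2))"
 have aw: "d \<le> norm w" by (rule half_disc_norm[OF w])
 have S: "norm ?S \<le> D * sqrt n" using norm_zero_sum_le[OF w, of 1 n] by (simp add: D_def)
 have T: "norm ?T \<le> D\<^sup>2 * sqrt n" using norm_zero_sum_le[OF w, of 2 n] by (simp add: D_def)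
 have c: "norm (of_real (a + 1) / w\<^sup>2 + 1) \<le> (a + 1) / d\<^sup>2 + 1"
 proof (rule norm_triangle_le, rule add_mono)
  show "norm (of_real (a + 1) / w\<^sup>2) \<le> (a + 1) / d\<^sup>2"
   using a aw d unfolding norm_divide norm_power norm_of_real
   by (intro frac_le power_mono) auto
 qed simp
 have "norm (?S - of_real (sqrt n) / w) * (sqrt n / b)
   \<le> norm (?S - of_real (sqrt n) / w) * norm (?S + of_real (sqrt n) / w)"
  by (intro mult_left_mono norm_zero_sum_add_ge[OF w]) auto
 also have "\<dots> = norm (?T - (of_real (a + 1) / w\<^sup>2 + 1) * ?S)"
  unfolding norm_mult[symmetric] zero_sum_quadratic[OF w n] ..
 also have "\<dots> \<le> norm ?T + norm (of_real (a + 1) / w\<^sup>2 + 1) * norm ?S"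
  unfolding norm_mult[symmetric] by (rule norm_triangle_ineq4)
 also have "\<dots> \<le> D\<^sup>2 * sqrt n + ((a + 1) / d\<^sup>2 + 1) * (D * sqrt n)"
  using a by (intro add_mono T mult_mono c S) auto
 also have "\<dots> = K * sqrt n" by (simp add: K_def algebra_simps)
 finally show "norm (?S - of_real (sqrt n) / w) \<le> K * b"
  using n b by (simp add: field_simps)
qed

text \<open>The derivative of the Riccati equation gives the sum of second powers up to \<open>O(1)\<close>, which is more than its
 trivial bound \<open>O(\<surd>n)\<close>; inserting it into the equation itself improves the error from \<open>O(1)\<close> to \<open>O(1 / \<surd>n)\<close>.\<close>

lemma zero_sum_second_order:
 obtains C N where "C \<ge> 0"
  "\<And>n w. n \<ge> N \<Longrightarrow> n > 0 \<Longrightarrow> w \<in> half_disc d b \<Longrightarrow>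
    norm (2 * w * zero_sum a n 1 (- (w\<^sup>2)) - 2 * of_real (sqrt n) + w + of_real (a + 1 / 2) / w)
     \<le> C / sqrt n"
proof -
 obtain C1 where C1: "C1 \<ge> 0"
  "\<And>n w. n > 0 \<Longrightarrow> w \<in> half_disc d b \<Longrightarrow> norm (zero_sum a n 1 (- (w\<^sup>2)) - of_real (sqrt n) / w) \<le> C1"
  using zero_sum_first_order by metis
 define D where "D = b / d ^ 3"
 have D0: "D > 0" using d b by (simp add: D_def)
 define K2 where "K2 = 2 * b\<^sup>2 * D ^ 3 + (a + 2 + b\<^sup>2) * D\<^sup>2 + D"
 have "0 \<le> (a + 2 + b\<^sup>2) * D\<^sup>2"
  using a zero_le_power2[of b] by (intro mult_nonneg_nonneg) (linarith, simp)
 moreover have "0 \<le> 2 * b\<^sup>2 * D ^ 3" using D0 by simp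
 ultimately have K20: "K2 \<ge> 0" using D0 unfolding K2_def by linarith
 define C2 where "C2 = K2 * b / d\<^sup>2"
 have C20: "C2 \<ge> 0" using K20 b by (simp add: C2_def)
 define E where "E = 1 + (a + 2) / d\<^sup>2"
 have E0: "E \<ge> 0" using a by (simp add: E_def)
 define N where "N = nat \<lceil>(2 * b * C1)\<^sup>2\<rceil>"
 define C where "C = 2 * b * ((E * C1 / 2 + C2) * b)"
 have C0: "C \<ge> 0" unfolding C_def using E0 C1(1) C20 b by (intro mult_nonneg_nonneg add_nonneg_nonneg divide_nonneg_nonneg) auto
 show ?thesis
 proof (rule that[OF C0])
  fix n :: nat and w assume nN: "n \<ge> N" and n: "n > 0" and w: "w \<in> half_disc d b"
  define S where "S = zero_sum a n 1 (- (w\<^sup>2))"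
  define T where "T = zero_sum a n 2 (- (w\<^sup>2))"
  define U where "U = zero_sum a n 3 (- (w\<^sup>2))"
  define r where "r = cx (sqrt n)"
  have nr: "norm r = sqrt n" by (simp add: r_def)
  have aw: "d \<le> norm w" by (rule half_disc_norm[OF w])
  have wb: "norm w \<le> b" using w by (simp add: half_disc_def)
  have w0: "w \<noteq> 0" using aw d by auto
  have S: "norm S \<le> D * sqrt n" using norm_zero_sum_le[OF w, of 1 n] by (simp add: D_def S_def)
  have T: "norm T \<le> D\<^sup>2 * sqrt n" using norm_zero_sum_le[OF w, of 2 n] by (simp add: D_def T_def)
  have U: "norm U \<le> D ^ 3 * sqrt n" using norm_zero_sum_le[OF w, of 3 n] by (simp add: D_def U_def)
  have F: "norm (S - r / w) \<le> C1" unfolding S_def r_def by (rule C1(2)[OF n w])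
  have w2: "norm (w\<^sup>2) \<le> b\<^sup>2" "d\<^sup>2 \<le> norm (w\<^sup>2)"
   unfolding norm_power using wb aw d by (auto intro: power_mono)
  have "(2 * b * C1)\<^sup>2 \<le> real n"
   using nN unfolding N_def by linarith
  then have sq: "2 * b * C1 \<le> sqrt n" by (rule real_le_rsqrt)
  have Slow: "norm S \<ge> sqrt n / (2 * b)"
  proof -
   have "sqrt n / b \<le> norm (r / w)"
    unfolding norm_divide nr using wb aw d by (intro divide_left_mono mult_pos_pos) auto
   also have "\<dots> \<le> norm S + norm (S - r / w)"
    using norm_triangle_ineq4[of S "S - r / w"] by simp
   also have "\<dots> \<le> norm S + C1" using F by simp
   finally show ?thesis using sq b by (simp add: field_simps)
  qed
  have "- (w\<^sup>2) * (2 * S * T - 2 * U) + (S\<^sup>2 - T) - (of_real (a + 1) + w\<^sup>2) * T + S = 0"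
   using zero_sum_riccati_derivative[OF a half_disc_off_ray[OF w] n]
   by (simp add: S_def T_def U_def)
  then have "2 * w\<^sup>2 * S * (T - S / (2 * w\<^sup>2)) = 2 * w\<^sup>2 * U - (of_real (a + 2) + w\<^sup>2) * T + S"
   using w0 by (simp add: algebra_simps power2_eq_square)
  then have eq2: "2 * norm (w\<^sup>2) * norm S * norm (T - S / (2 * w\<^sup>2))
    = norm (2 * w\<^sup>2 * U - (of_real (a + 2) + w\<^sup>2) * T + S)"
   by (metis norm_mult norm_numeral)
  have "2 * d\<^sup>2 * (sqrt n / (2 * b)) * norm (T - S / (2 * w\<^sup>2))
    \<le> 2 * norm (w\<^sup>2) * norm S * norm (T - S / (2 * w\<^sup>2))"
   using w2 Slow b by (intro mult_mono) auto
  also have "\<dots> \<le> norm (2 * w\<^sup>2 * U) + norm ((of_real (a + 2) + w\<^sup>2) * T) + norm S"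
   unfolding eq2 by (rule order_trans[OF norm_triangle_ineq add_mono[OF norm_triangle_ineq4 order_refl]])
  also have "\<dots> \<le> 2 * b\<^sup>2 * (D ^ 3 * sqrt n) + (a + 2 + b\<^sup>2) * (D\<^sup>2 * sqrt n) + D * sqrt n"
  proof (intro add_mono S)
   show "norm (2 * w\<^sup>2 * U) \<le> 2 * b\<^sup>2 * (D ^ 3 * sqrt n)"
    unfolding norm_mult norm_numeral using w2 by (intro mult_mono U) auto
   have "norm (cx (a + 2) + w\<^sup>2) \<le> a + 2 + b\<^sup>2"
    using w2 a by (intro norm_triangle_le add_mono) auto
   then show "norm ((of_real (a + 2) + w\<^sup>2) * T) \<le> (a + 2 + b\<^sup>2) * (D\<^sup>2 * sqrt n)"
    unfolding norm_mult using a by (intro mult_mono T) auto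
  qed
  also have "\<dots> = K2 * sqrt n" by (simp add: K2_def algebra_simps)
  finally have G: "norm (T - S / (2 * w\<^sup>2)) \<le> C2"
   using n d b by (simp add: C2_def field_simps)
  define c where "c = - 1 - of_real (a + 1 / 2) / w\<^sup>2"
  have cE: "norm c \<le> E"
  proof -
   have "norm c \<le> 1 + \<bar>a + 1 / 2\<bar> / norm (w\<^sup>2)"
    using norm_triangle_ineq4[of "- 1" "of_real (a + 1 / 2) / w\<^sup>2"]
    by (simp add: c_def norm_divide del: of_real_add)
   also have "\<dots> \<le> E"
    unfolding E_def using w2 d a by (intro add_mono frac_le) auto
   finally show ?thesis .
  qed
  have "(S - r / w) * (S + r / w) = T - (of_real (a + 1) / w\<^sup>2 + 1) * S"
   unfolding S_def T_def r_def by (rule zero_sum_quadratic[OF w n])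
  also have "\<dots> = c * S + (T - S / (2 * w\<^sup>2))"
   using w0 by (simp add: c_def field_simps)
  finally have "(S - r / w - c / 2) * (S + r / w) = c * (S - r / w) / 2 + (T - S / (2 * w\<^sup>2))"
   by (simp add: algebra_simps add_divide_distrib diff_divide_distrib)
  then have eq3: "norm (S - r / w - c / 2) * norm (S + r / w) = norm (c * (S - r / w) / 2 + (T - S / (2 * w\<^sup>2)))"
   by (metis norm_mult)
  have "norm (S - r / w - c / 2) * (sqrt n / b) \<le> norm (S - r / w - c / 2) * norm (S + r / w)"
   using norm_zero_sum_add_ge[OF w, of n] unfolding S_def r_def by (intro mult_left_mono) auto
  also have "\<dots> \<le> norm (c * (S - r / w) / 2) + norm (T - S / (2 * w\<^sup>2))"
   unfolding eq3 by (rule norm_triangle_ineq)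
  also have "\<dots> \<le> E * C1 / 2 + C2"
  proof (intro add_mono G)
   have "norm c * norm (S - r / w) \<le> E * C1" using E0 by (intro mult_mono cE F) auto
   then show "norm (c * (S - r / w) / 2) \<le> E * C1 / 2" by (simp add: norm_mult norm_divide)
  qed
  finally have H: "norm (S - r / w - c / 2) \<le> (E * C1 / 2 + C2) * b / sqrt n"
   using n b by (simp add: field_simps)
  have "2 * w * S - 2 * r + w + of_real (a + 1 / 2) / w = 2 * w * (S - r / w - c / 2)"
   using w0 by (simp add: c_def field_simps power2_eq_square)
  then have "norm (2 * w * S - 2 * r + w + of_real (a + 1 / 2) / w) = 2 * norm w * norm (S - r / w - c / 2)"
   by (simp add: norm_mult)
  also have "\<dots> \<le> 2 * b * ((E * C1 / 2 + C2) * b / sqrt n)"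
   using b wb by (intro mult_mono H) auto
  finally show "norm (2 * w * zero_sum a n 1 (- (w\<^sup>2)) - 2 * of_real (sqrt n) + w + of_real (a + 1 / 2) / w) \<le> C / sqrt n"
   by (simp add: C_def S_def r_def)
 qed
qed

end

text \<open>The normalised polynomial; its logarithmic derivative is the quantity just bounded.\<close>

definition lag_norm :: "real \<Rightarrow> nat \<Rightarrow> complex \<Rightarrow> complex" where
 "lag_norm a n w = poly (lagpoly a n) (- (w\<^sup>2)) * exp (w\<^sup>2 / 2 - 2 * of_real (sqrt n) * w + of_real (a + 1 / 2) * Ln w)"

lemma lag_norm_has_derivative:
 assumes "a > -1" "Re w > 0"
 shows "(lag_norm a n has_field_derivative
   (2 * w * zero_sum a n 1 (- (w\<^sup>2)) - 2 * of_real (sqrt n) + w + of_real (a + 1 / 2) / w) * lag_norm a n w) (at w)"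
proof -
 have nn: "w \<notin> \<real>\<^sub>\<le>\<^sub>0" using assms(2) by (auto simp: complex_nonpos_Reals_iff)
 have d1: "((\<lambda>w. poly (lagpoly a n) (- (w\<^sup>2))) has_field_derivative
   2 * w * zero_sum a n 1 (- (w\<^sup>2)) * poly (lagpoly a n) (- (w\<^sup>2))) (at w)"
 proof -
  have "((\<lambda>w. poly (lagpoly a n) (- (w\<^sup>2))) has_field_derivative
    poly (pderiv (lagpoly a n)) (- (w\<^sup>2)) * (- (2 * w))) (at w)"
   by (rule DERIV_chain2[OF poly_DERIV]) (auto intro!: derivative_eq_intros)
  then show ?thesis
   unfolding pderiv_lagpoly_eq[OF assms(1) neg_square_off_ray[OF assms(2)]] by (simp add: mult_ac)
 qed
 define E where "E = (\<lambda>w. w\<^sup>2 / 2 - 2 * cx (sqrt n) * w + of_real (a + 1 / 2) * Ln w)"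
 have sq: "((\<lambda>w::complex. w\<^sup>2) has_field_derivative 2 * w) (at w)"
  by (auto intro!: derivative_eq_intros)
 have "(E has_field_derivative
   (2 * w / 2 - 2 * of_real (sqrt n) * 1 + of_real (a + 1 / 2) * inverse w)) (at w)"
  unfolding E_def
  by (intro DERIV_add DERIV_diff DERIV_cmult DERIV_cdivide DERIV_ident has_field_derivative_Ln nn sq)
 from DERIV_fun_exp[OF this] have d2: "((\<lambda>w. exp (E w)) has_field_derivative
   exp (E w) * (w - 2 * of_real (sqrt n) + of_real (a + 1 / 2) / w)) (at w)"
  unfolding divide_inverse[of "of_real (a + 1 / 2)"] by (simp del: of_real_add)
 have G: "lag_norm a n = (\<lambda>w. poly (lagpoly a n) (- (w\<^sup>2)) * exp (E w))"
  unfolding lag_norm_def[abs_def] E_def ..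
 show ?thesis
  unfolding G
  by (rule DERIV_cong[OF DERIV_mult[OF d1 d2]]) (simp add: algebra_simps del: of_real_add)
qed

lemma lag_norm_nonzero:
 assumes "a > -1" "Re w > 0"
 shows "lag_norm a n w \<noteq> 0"
 using lagpoly_off_ray_nonzero[OF assms(1) neg_square_off_ray[OF assms(2)]] by (simp add: lag_norm_def)

text \<open>The logarithmic derivative of the normalised polynomial is \<open>O(1 / \<surd>n)\<close> on a convex compact set containing \<open>w\<close>
 and \<open>1\<close>, so the mean value inequality applies without taking logarithms.\<close>

lemma lag_norm_ratio_tendsto:
 assumes "a > -1" "Re w > 0"
 shows "(\<lambda>n. lag_norm a n w / lag_norm a n 1) \<longlonglongrightarrow> 1"
proof -
 define d where "d = min 1 (Re w)"
 define b where "b = max 1 (norm w)"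
 have ab: "0 < d" "d \<le> 1" "1 \<le> b" using assms by (auto simp: d_def b_def)
 let ?K = "half_disc d b"
 have inK: "1 \<in> ?K" "w \<in> ?K" by (auto simp: half_disc_def d_def b_def)
 let ?e = "\<lambda>n w. 2 * w * zero_sum a n 1 (- (w\<^sup>2)) - 2 * of_real (sqrt n) + w + of_real (a + 1 / 2) / w"
 obtain C N where C: "C \<ge> 0" "\<And>n w. n \<ge> N \<Longrightarrow> n > 0 \<Longrightarrow> w \<in> ?K \<Longrightarrow> norm (?e n w) \<le> C / sqrt n"
  by (rule zero_sum_second_order[OF assms(1) ab]) blast
 have main: "norm (lag_norm a n w / lag_norm a n 1 - 1) \<le> 4 * b * C / sqrt n"
  if n: "n \<ge> N" "n > 0" "sqrt n \<ge> 4 * b * C" for n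
 proof -
  let ?G = "lag_norm a n"
  have der: "(?G has_field_derivative ?e n v * ?G v) (at v within ?K)" if "v \<in> ?K" for v
   by (rule has_field_derivative_at_within[OF lag_norm_has_derivative[OF assms(1)]])
     (use that ab in \<open>auto simp: half_disc_def\<close>)
  then have "continuous_on ?K ?G" by (rule DERIV_continuous_on)
  then have "continuous_on ?K (\<lambda>v. norm (?G v))" by (intro continuous_intros)
  then obtain m where m: "m \<in> ?K" "\<And>v. v \<in> ?K \<Longrightarrow> norm (?G v) \<le> norm (?G m)"
   using continuous_attains_sup[OF compact_half_disc[of d b], of "\<lambda>v. norm (?G v)"] inK by blast
  have diff: "norm (?G v - ?G 1) \<le> (C / sqrt n * norm (?G m)) * (2 * b)" if "v \<in> ?K" for v
  proof -
   have "norm (?G v - ?G 1) \<le> (C / sqrt n * norm (?G m)) * norm (v - 1)"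
   proof (rule field_differentiable_bound[OF convex_half_disc der])
    fix u assume "u \<in> ?K"
    then show "norm (?e n u * ?G u) \<le> C / sqrt n * norm (?G m)"
     unfolding norm_mult by (intro mult_mono C n m) (use C(1) in auto)
   qed (use that inK in auto)
   moreover have "norm (v - 1) \<le> 2 * b"
    using norm_triangle_ineq4[of v 1] that ab by (auto simp: half_disc_def)
   then have "(C / sqrt n * norm (?G m)) * norm (v - 1) \<le> (C / sqrt n * norm (?G m)) * (2 * b)"
    using C(1) by (intro mult_left_mono) auto
   ultimately show ?thesis by (rule order_trans)
  qed
  have s: "sqrt n > 0" using n by simp
  \<comment> \<open>the maximum of the modulus over the half disc is then at most twice the modulus at \<open>1\<close>\<close>
  have half: "C / sqrt n * (2 * b) \<le> 1 / 2" using n(3) s by (simp add: field_simps)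
  have "norm (?G m) \<le> norm (?G 1) + norm (?G m - ?G 1)"
   using norm_triangle_ineq[of "?G 1" "?G m - ?G 1"] by simp
  also have "\<dots> \<le> norm (?G 1) + (C / sqrt n * norm (?G m)) * (2 * b)"
   using diff[OF m(1)] by simp
  also have "\<dots> \<le> norm (?G 1) + 1 / 2 * norm (?G m)"
   using mult_right_mono[OF half, of "norm (?G m)"] by (simp add: mult_ac)
  finally have M: "norm (?G m) \<le> 2 * norm (?G 1)" by simp
  have G1: "?G 1 \<noteq> 0" by (rule lag_norm_nonzero[OF assms(1)]) simp
  have "norm (?G w - ?G 1) \<le> (C / sqrt n * norm (?G m)) * (2 * b)" by (rule diff[OF inK(2)])
  also have "\<dots> \<le> (C / sqrt n * (2 * norm (?G 1))) * (2 * b)"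
   using M C(1) ab by (intro mult_right_mono mult_left_mono) auto
  finally have "norm (?G w - ?G 1) / norm (?G 1) \<le> 4 * b * C / sqrt n"
   using G1 by (simp add: field_simps)
  moreover have "?G w / ?G 1 - 1 = (?G w - ?G 1) / ?G 1" using G1 by (simp add: field_simps)
  ultimately show ?thesis by (simp add: norm_divide)
 qed
 have lim: "filterlim (\<lambda>n. sqrt (real n)) at_top sequentially"
  by (rule filterlim_compose[OF sqrt_at_top filterlim_real_sequentially])
 have "\<forall>\<^sub>F n in sequentially. norm (lag_norm a n w / lag_norm a n 1 - 1) \<le> 4 * b * C / sqrt n"
  using eventually_ge_at_top[of N] eventually_gt_at_top[of 0] filterlim_at_top[THEN iffD1, OF lim, rule_format, of "4 * b * C"]
  by eventually_elim (rule main)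
 moreover have "(\<lambda>n. 4 * b * C / sqrt (real n)) \<longlonglongrightarrow> 0"
  by (rule tendsto_divide_0[OF tendsto_const filterlim_at_top_imp_at_infinity[OF lim]])
 ultimately have "(\<lambda>n. lag_norm a n w / lag_norm a n 1 - 1) \<longlonglongrightarrow> 0"
  by (rule Lim_null_comparison)
 then show ?thesis by (simp add: LIM_zero_iff)
qed

section \<open>The constant at \<open>z = -1\<close>\<close>

lemma lag_h_asymp:
 assumes "a > -1"
 shows "(\<lambda>n. lag_h a n * real n powr (- a)) \<longlonglongrightarrow> 1"
proof -
 have a1: "a + 1 > 0" using assms by simp
 have G: "Gamma (a + 1) \<noteq> 0" using Gamma_real_pos[OF a1] by simp
 have "Gamma_series (a + 1) \<longlonglongrightarrow> Gamma (a + 1)" by (rule Gamma_series_LIMSEQ)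
 then have lim: "(\<lambda>n. Gamma (a + 1) / Gamma_series (a + 1) n) \<longlonglongrightarrow> Gamma (a + 1) / Gamma (a + 1)"
  using G by (intro tendsto_divide tendsto_const) auto
 have lim2: "(\<lambda>n. real n / (real n + a + 1)) \<longlonglongrightarrow> 1" by real_asymp
 have "(\<lambda>n. (Gamma (a + 1) / Gamma_series (a + 1) n) * (real n / (real n + a + 1))) \<longlonglongrightarrow> 1 * 1"
  using tendsto_mult[OF lim lim2] G by simp
 moreover have "\<forall>\<^sub>F n in sequentially. (Gamma (a + 1) / Gamma_series (a + 1) n) * (real n / (real n + a + 1))
   = lag_h a n * real n powr (- a)"
  using eventually_gt_at_top[of 0]
 proof eventually_elim
  case (elim n)
  have n0: "real n > 0" using elim by simp
  have p: "pochhammer (a + 1) (n + 1) = Gamma (a + 1 + real (n + 1)) / Gamma (a + 1)"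
   by (rule pochhammer_Gamma) (use a1 in auto)
  have g: "Gamma (a + 1 + real (n + 1)) = (real n + a + 1) * Gamma (real n + a + 1)"
  proof -
   have "Gamma (real n + a + 1 + 1) = (real n + a + 1) * Gamma (real n + a + 1)"
    by (rule Gamma_plus1) (use a1 in auto)
   then show ?thesis by (simp add: add_ac)
  qed
  have e: "exp ((a + 1) * ln (real n)) = real n powr a * real n"
   using n0 by (simp add: powr_def exp_add distrib_right)
  have "real n + a + 1 > 0" using a1 by simp
  then have Gp: "Gamma (real n + a + 1) > 0" by (rule Gamma_real_pos)
  have nz: "real n + a + 1 \<noteq> 0" "Gamma (real n + a + 1) \<noteq> 0"
   using a1 Gp by linarith+
  have eq: "Gamma_series (a + 1) n = fact n * (real n powr a * real n) * Gamma (a + 1) / ((real n + a + 1) * Gamma (real n + a + 1))"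
   unfolding Gamma_series_def p g using e by simp
  show ?case
   unfolding eq using n0 nz G by (simp add: lag_h_def powr_minus divide_simps)
 qed
 ultimately show ?thesis by (simp add: tendsto_cong)
qed

lemma pochhammer_eq_lag_h:
 assumes "a > -1"
 shows "pochhammer (a + 1) n / fact n = lag_h a n / Gamma (a + 1)"
proof -
 have "pochhammer (a + 1) n = Gamma (a + 1 + real n) / Gamma (a + 1)"
  by (rule pochhammer_Gamma) (use assms in auto)
 then show ?thesis by (simp add: lag_h_def add_ac)
qed

subsection \<open>Laplace's method for the parameter \<open>-1/2\<close>\<close>

text \<open>One half of a Gaussian moment; the two signs of \<open>y\<close> together give the Hermite polynomial of degree \<open>2 n\<close> at an
 imaginary argument, that is \<open>L\<^sub>n\<close> with parameter \<open>-1/2\<close>.\<close>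

definition half_moment :: "nat \<Rightarrow> real \<Rightarrow> real" where
 "half_moment n y = (LINT u|lborel. indicator {0<..} u * (u ^ (2 * n) * exp (- u\<^sup>2 / 2 + sqrt 2 * y * u)))"

lemma integrable_gauss_shift:
 "integrable lborel (\<lambda>u::real. exp (- u\<^sup>2 / 2 + c * u))"
proof -
 have "exp (- u\<^sup>2 / 2 + c * u) = sqrt (2 * pi) * exp (c\<^sup>2 / 2) * normal_density c 1 u" for u
 proof -
  have e: "- u\<^sup>2 / 2 + c * u = c\<^sup>2 / 2 + (- (u - c)\<^sup>2 / 2)"
   by (simp add: power2_eq_square field_simps)
  show ?thesis unfolding e exp_add normal_density_def by simp
 qed
 then show ?thesis by (simp add: integrable_normal_density)
qed

text \<open>The integrand peaks near \<open>u = \<surd>(2 n)\<close>.  After moving the peak to the origin the integrand converges to a Gaussian,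
 and \<open>ln (1 + h) \<le> h\<close> dominates it.\<close>

lemma half_moment_tendsto:
 "(\<lambda>n. half_moment n y / ((sqrt (2 * real n)) ^ (2 * n) * exp (- real n) * exp (2 * y * sqrt n)))
   \<longlonglongrightarrow> sqrt pi * exp (y\<^sup>2 / 2)"
proof -
 define r where "r n = sqrt (2 * real n)" for n
 define j where "j n s = indicator {- r n<..} s * ((1 + s / r n) ^ (2 * n) * exp (- r n * s - s\<^sup>2 / 2 + sqrt 2 * y * s))" for n s
 have eq: "half_moment n y / (r n ^ (2 * n) * exp (- real n) * exp (2 * y * sqrt n)) = (LINT s|lborel. j n s)"
  if n: "n > 0" for n
 proof -
  have r: "r n > 0" "r n ^ 2 = 2 * real n" using n by (auto simp: r_def)
  have "sqrt 2 * r n = 2 * sqrt n"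
   by (simp add: r_def real_sqrt_mult)
  then have ry: "sqrt 2 * y * r n = 2 * y * sqrt n" by (simp add: mult_ac)
  have "half_moment n y = (LINT s|lborel. indicator {0<..} (r n + 1 * s) * ((r n + 1 * s) ^ (2 * n) * exp (- (r n + 1 * s)\<^sup>2 / 2 + sqrt 2 * y * (r n + 1 * s))))"
   unfolding half_moment_def by (subst lborel_integral_real_affine[where c = 1 and t = "r n"]) simp_all
  also have "\<dots> = (LINT s|lborel. (r n ^ (2 * n) * exp (- real n) * exp (2 * y * sqrt n)) * j n s)"
  proof (rule lint_cong)
   fix s :: real
   have p: "(r n + s) ^ (2 * n) = r n ^ (2 * n) * (1 + s / r n) ^ (2 * n)"
    using r by (simp add: field_simps flip: power_mult_distrib)
   have e: "- (r n + s)\<^sup>2 / 2 + sqrt 2 * y * (r n + s)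
     = - real n + 2 * y * sqrt n + (- r n * s - s\<^sup>2 / 2 + sqrt 2 * y * s)"
    using r(2) ry by (simp add: power2_eq_square algebra_simps add_divide_distrib diff_divide_distrib)
   have "indicator {0<..} (r n + s) = (indicator {- r n<..} s :: real)"
    by (simp add: indicator_def)
   then show "indicator {0<..} (r n + 1 * s) * ((r n + 1 * s) ^ (2 * n) * exp (- (r n + 1 * s)\<^sup>2 / 2 + sqrt 2 * y * (r n + 1 * s)))
    = (r n ^ (2 * n) * exp (- real n) * exp (2 * y * sqrt n)) * j n s"
    unfolding j_def mult_1 p e exp_add by (simp add: mult_ac)
  qed
  also have "\<dots> = (r n ^ (2 * n) * exp (- real n) * exp (2 * y * sqrt n)) * (LINT s|lborel. j n s)"
   by simp
  finally show ?thesis using r by simp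
 qed
 have "(\<lambda>n. LINT s|lborel. j n s) \<longlonglongrightarrow> (LINT s|lborel. exp (- s\<^sup>2 + sqrt 2 * y * s))"
 proof (rule integral_dominated_convergence)
  show "(\<lambda>s. exp (- s\<^sup>2 + sqrt 2 * y * s)) \<in> borel_measurable lborel" by measurable
  show "j n \<in> borel_measurable lborel" for n unfolding j_def[abs_def] by measurable
  show "integrable lborel (\<lambda>s. exp (- s\<^sup>2 / 2 + (sqrt 2 * y) * s))" by (rule integrable_gauss_shift)
  show "AE s in lborel. norm (j n s) \<le> exp (- s\<^sup>2 / 2 + (sqrt 2 * y) * s)" for n
  proof (rule AE_I2)
   fix s :: real
   show "norm (j n s) \<le> exp (- s\<^sup>2 / 2 + (sqrt 2 * y) * s)"
   proof (cases "s > - r n")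
    case True
    have "0 \<le> (1 + s / r n) ^ (2 * n) \<and> (1 + s / r n) ^ (2 * n) \<le> exp (r n * s)"
    proof (cases "n = 0")
     case False
     then have r: "r n > 0" "r n * r n = 2 * real n" by (auto simp: r_def)
     have "0 \<le> 1 + s / r n" using True r by (simp add: field_simps)
     moreover have "1 + s / r n \<le> exp (s / r n)" by (rule exp_ge_add_one_self)
     ultimately have "(1 + s / r n) ^ (2 * n) \<le> exp (s / r n) ^ (2 * n)" by (intro power_mono)
     also have "\<dots> = exp (r n * s)"
     proof -
      have "real (2 * n) * (s / r n) = r n * s" using r by (simp add: field_simps)
      then show ?thesis by (simp only: exp_of_nat_mult[symmetric])
     qed
     finally show ?thesis using \<open>0 \<le> 1 + s / r n\<close> by simp
    qed (simp add: r_def)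
    then have "norm (j n s) \<le> exp (r n * s) * exp (- r n * s - s\<^sup>2 / 2 + sqrt 2 * y * s)"
     using True by (simp add: j_def abs_mult mult_right_mono)
    also have "\<dots> = exp (- s\<^sup>2 / 2 + (sqrt 2 * y) * s)"
     by (simp flip: exp_add)
    finally show ?thesis .
   qed (simp add: j_def)
  qed
  show "AE s in lborel. (\<lambda>n. j n s) \<longlonglongrightarrow> exp (- s\<^sup>2 + sqrt 2 * y * s)"
  proof (rule AE_I2)
   fix s :: real
   have rlim: "filterlim r at_top sequentially" unfolding r_def by real_asymp
   have "((\<lambda>h. (ln (1 + h) - h) / h\<^sup>2) \<longlongrightarrow> - (1 / 2)) (at (0::real))" by real_asymp
   have l: "((\<lambda>R. R\<^sup>2 * ln (1 + s / R) - R * s) \<longlongrightarrow> - (s\<^sup>2 / 2)) at_top"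
   proof (cases "s = 0")
    case False
    have A: "((\<lambda>h. (ln (1 + h) - h) / h\<^sup>2) \<longlongrightarrow> - (1 / 2)) (at (0::real))" by real_asymp
    have B: "filterlim (\<lambda>R. s / R) (at 0) at_top"
     unfolding filterlim_at using False eventually_gt_at_top[of "0::real"]
     by (auto intro!: tendsto_divide_0[OF tendsto_const] filterlim_at_top_imp_at_infinity filterlim_ident elim!: eventually_mono)
    have "((\<lambda>R. s\<^sup>2 * ((ln (1 + s / R) - s / R) / (s / R)\<^sup>2)) \<longlongrightarrow> s\<^sup>2 * - (1 / 2)) at_top"
     by (intro tendsto_mult tendsto_const filterlim_compose[OF A B])
    moreover have "\<forall>\<^sub>F R in at_top. s\<^sup>2 * ((ln (1 + s / R) - s / R) / (s / R)\<^sup>2) = R\<^sup>2 * ln (1 + s / R) - R * s"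
     using eventually_gt_at_top[of "0::real"]
     by eventually_elim (use False in \<open>simp add: field_simps power2_eq_square\<close>)
    ultimately show ?thesis by (simp add: tendsto_cong)
   qed simp
   have "(\<lambda>n. exp ((r n)\<^sup>2 * ln (1 + s / r n) - r n * s) * exp (- s\<^sup>2 / 2 + sqrt 2 * y * s))
     \<longlonglongrightarrow> exp (- (s\<^sup>2 / 2)) * exp (- s\<^sup>2 / 2 + sqrt 2 * y * s)"
    by (intro tendsto_mult tendsto_exp tendsto_const filterlim_compose[OF l rlim])
   moreover have "\<forall>\<^sub>F n in sequentially. exp ((r n)\<^sup>2 * ln (1 + s / r n) - r n * s) * exp (- s\<^sup>2 / 2 + sqrt 2 * y * s) = j n s"
    using filterlim_at_top_dense[THEN iffD1, OF rlim, rule_format, of "\<bar>s\<bar>"] eventually_gt_at_top[of 0]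
   proof eventually_elim
    case (elim n)
    then have r: "r n > 0" "(r n)\<^sup>2 = real (2 * n)" by (auto simp: r_def)
    have pos: "1 + s / r n > 0" using elim r by (simp add: field_simps)
    have "(1 + s / r n) ^ (2 * n) = exp ((r n)\<^sup>2 * ln (1 + s / r n))"
     unfolding r(2) exp_of_nat_mult using pos by simp
    then show ?case
     using elim by (simp add: j_def flip: exp_add)
   qed
   ultimately have "(\<lambda>n. j n s) \<longlonglongrightarrow> exp (- (s\<^sup>2 / 2)) * exp (- s\<^sup>2 / 2 + sqrt 2 * y * s)"
    by (rule Lim_transform_eventually)
   then show "(\<lambda>n. j n s) \<longlonglongrightarrow> exp (- s\<^sup>2 + sqrt 2 * y * s)"
    by (simp flip: exp_add)
  qed
 qed
 moreover have "(LINT s|lborel. exp (- s\<^sup>2 + sqrt 2 * y * s)) = sqrt pi * exp (y\<^sup>2 / 2)"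
 proof -
  have "exp (- s\<^sup>2 + sqrt 2 * y * s) = (sqrt pi * exp (y\<^sup>2 / 2)) * normal_density (y / sqrt 2) (1 / sqrt 2) s" for s
  proof -
   have "- s\<^sup>2 + sqrt 2 * y * s = y\<^sup>2 / 2 + (- (s - y / sqrt 2)\<^sup>2 / (2 * (1 / sqrt 2)\<^sup>2))"
   proof -
    define q where "q = y / sqrt 2"
    have "y = sqrt 2 * q" by (simp add: q_def)
    then have y: "sqrt 2 * y = 2 * q" "y\<^sup>2 = 2 * q\<^sup>2"
     by (simp_all add: power_mult_distrib)
    have "(s - q)\<^sup>2 = s\<^sup>2 - sqrt 2 * y * s + y\<^sup>2 / 2"
     unfolding y by (simp add: power2_diff)
    then have "(s - y / sqrt 2)\<^sup>2 = s\<^sup>2 - sqrt 2 * y * s + y\<^sup>2 / 2" by (simp add: q_def)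
    then show ?thesis by (simp add: power_divide)
   qed
   then have "exp (- s\<^sup>2 + sqrt 2 * y * s) =
     exp (y\<^sup>2 / 2) * exp (- (s - y / sqrt 2)\<^sup>2 / (2 * (1 / sqrt 2)\<^sup>2))"
    by (simp only: exp_add)
   then show ?thesis
    by (simp add: normal_density_def power_divide)
  qed
  then show ?thesis by (simp add: integral_normal_density)
 qed
 ultimately have "(\<lambda>n. LINT s|lborel. j n s) \<longlonglongrightarrow> sqrt pi * exp (y\<^sup>2 / 2)" by simp
 moreover have "\<forall>\<^sub>F n in sequentially. (LINT s|lborel. j n s) = half_moment n y / (r n ^ (2 * n) * exp (- real n) * exp (2 * y * sqrt n))"
  using eventually_gt_at_top[of 0] by eventually_elim (use eq in simp)
 ultimately show ?thesis unfolding r_def by (rule Lim_transform_eventually)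
qed

lemma lagcoef_minus_half:
 "lagcoef (-1/2) (j + k) j = (-1) ^ j * fact (2 * (j + k)) / (fact (j + k) * 4 ^ k * fact (2 * j) * fact k)"
proof -
 have "pochhammer (real j + 1 / 2) k / fact j = fact (2 * (j + k)) / (fact (j + k) * 4 ^ k * fact (2 * j))"
 proof (induction k)
  case (Suc k)
  have "pochhammer (real j + 1 / 2) (Suc k) / fact j = (real j + 1 / 2 + real k) * (pochhammer (real j + 1 / 2) k / fact j)"
   by (simp add: pochhammer_Suc)
  also have "\<dots> = (real j + 1 / 2 + real k) * (fact (2 * (j + k)) / (fact (j + k) * 4 ^ k * fact (2 * j)))"
   unfolding Suc.IH ..
  also have "\<dots> = fact (2 * (j + Suc k)) / (fact (j + Suc k) * 4 ^ Suc k * fact (2 * j))"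
  proof -
   have "(fact (2 * (j + Suc k)) :: real) = (2 * (real (j + k) + 1)) * (2 * real (j + k) + 1) * fact (2 * (j + k))"
    by (simp add: algebra_simps)
   moreover have "(fact (j + Suc k) :: real) = (real (j + k) + 1) * fact (j + k)" by (simp add: algebra_simps)
   ultimately show ?thesis
    by (simp only: power_Suc) (simp add: divide_simps, simp add: algebra_simps)
  qed
  finally show ?case .
 qed simp
 then have "pochhammer (real j + 1 / 2) k / (fact k * fact j) = fact (2 * (j + k)) / (fact (j + k) * 4 ^ k * fact (2 * j) * fact k)"
  by (simp add: divide_simps)
 moreover have "lagcoef (-1/2) (j + k) j = (-1) ^ j * (pochhammer (real j + 1 / 2) k / (fact k * fact j))"
  by (simp add: lagcoef_def algebra_simps)
 ultimately show ?thesis by simp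
qed

lemma integrable_half_moment:
 "integrable lborel (\<lambda>u::real. u ^ m * exp (- u\<^sup>2 / 2 + c * u))"
proof -
 have "integrable lborel (\<lambda>u. sqrt (2 * pi) * exp (c\<^sup>2 / 2) * (\<Sum>i\<le>m. of_nat (m choose i) * c ^ (m - i) * (normal_density c 1 u * (u - c) ^ i)))"
  by (intro integrable_mult_right Bochner_Integration.integrable_sum integrable_normal_moment) simp
 moreover have "sqrt (2 * pi) * exp (c\<^sup>2 / 2) * (\<Sum>i\<le>m. of_nat (m choose i) * c ^ (m - i) * (normal_density c 1 u * (u - c) ^ i))
   = u ^ m * exp (- u\<^sup>2 / 2 + c * u)" for u
 proof -
  have "u ^ m = (\<Sum>i\<le>m. of_nat (m choose i) * (u - c) ^ i * c ^ (m - i))"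
   using binomial_ring[of "u - c" c m] by simp
  moreover have e: "- u\<^sup>2 / 2 + c * u = c\<^sup>2 / 2 + (- (u - c)\<^sup>2 / 2)"
   by (simp add: power2_eq_square field_simps)
  have "exp (- u\<^sup>2 / 2 + c * u) = sqrt (2 * pi) * exp (c\<^sup>2 / 2) * normal_density c 1 u"
   unfolding e exp_add normal_density_def by simp
  ultimately show ?thesis by (simp add: sum_distrib_left sum_distrib_right mult_ac)
 qed
 ultimately show ?thesis by simp
qed

lemma lagpoly_minus_half_moment:
 "poly (lagpoly (-1/2) n) (- (y\<^sup>2)) * (2 ^ n * fact n * sqrt (2 * pi) * exp (y\<^sup>2)) = half_moment n y + half_moment n (- y)"
proof -
 let ?c = "sqrt 2 * y"
 have int: "integrable lborel (\<lambda>u. indicator A u * (u ^ (2 * n) * exp (- u\<^sup>2 / 2 + ?c * u)))"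
  if "A \<in> sets borel" for A
  using integrable_mult_indicator[OF _ integrable_half_moment[of "2 * n" ?c], of A] that by simp
 have int: "integrable lborel (\<lambda>u. indicator {0<..} u * (u ^ (2 * n) * exp (- u\<^sup>2 / 2 + ?c * u)))"
   "integrable lborel (\<lambda>u. indicator {..<0} u * (u ^ (2 * n) * exp (- u\<^sup>2 / 2 + ?c * u)))"
  by (rule int; simp)+
 have "half_moment n (- y) = (LINT u|lborel. indicator {..<0} u * (u ^ (2 * n) * exp (- u\<^sup>2 / 2 + ?c * u)))"
  unfolding half_moment_def
  by (subst lborel_integral_real_affine[where c = "-1" and t = 0]) (auto simp: indicator_def intro!: Bochner_Integration.integral_cong)
 then have "half_moment n y + half_moment n (- y) =
   (LINT u|lborel. indicator {0<..} u * (u ^ (2 * n) * exp (- u\<^sup>2 / 2 + ?c * u)) + indicator {..<0} u * (u ^ (2 * n) * exp (- u\<^sup>2 / 2 + ?c * u)))"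
  unfolding half_moment_def
  by (subst Bochner_Integration.integral_add) (use int in simp_all)
 also have "\<dots> = (LINT u|lborel. u ^ (2 * n) * exp (- u\<^sup>2 / 2 + ?c * u))"
  by (rule integral_cong_AE)
    (use AE_lborel_singleton[of 0] in \<open>auto elim!: eventually_mono simp: indicator_def\<close>)
 also have "\<dots> = (LINT u|lborel. (sqrt (2 * pi) * exp (y\<^sup>2)) * (\<Sum>i\<le>2 * n. of_nat (2 * n choose i) * ?c ^ (2 * n - i) * (std_normal_density u * u ^ i)))"
 proof (subst lborel_integral_real_affine[where c = 1 and t = ?c])
  have "(?c + u) ^ (2 * n) * exp (- (?c + u)\<^sup>2 / 2 + ?c * (?c + u))
    = (sqrt (2 * pi) * exp (y\<^sup>2)) * (\<Sum>i\<le>2 * n. of_nat (2 * n choose i) * ?c ^ (2 * n - i) * (std_normal_density u * u ^ i))" for u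
  proof -
   have "(?c + u) ^ (2 * n) = (\<Sum>i\<le>2 * n. of_nat (2 * n choose i) * u ^ i * ?c ^ (2 * n - i))"
    using binomial_ring[of u ?c "2 * n"] by (simp add: add.commute)
   moreover have e: "- (?c + u)\<^sup>2 / 2 + ?c * (?c + u) = y\<^sup>2 + (- u\<^sup>2 / 2)"
    by (simp add: power2_eq_square field_simps)
   have "exp (- (?c + u)\<^sup>2 / 2 + ?c * (?c + u)) = sqrt (2 * pi) * exp (y\<^sup>2) * std_normal_density u"
    unfolding e exp_add std_normal_density_def by simp
   ultimately show ?thesis by (simp add: sum_distrib_left sum_distrib_right mult_ac)
  qed
  then show "\<bar>1\<bar> *\<^sub>R (LINT u|lborel. (?c + 1 * u) ^ (2 * n) * exp (- (?c + 1 * u)\<^sup>2 / 2 + ?c * (?c + 1 * u)))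
   = (LINT u|lborel. (sqrt (2 * pi) * exp (y\<^sup>2)) * (\<Sum>i\<le>2 * n. of_nat (2 * n choose i) * ?c ^ (2 * n - i) * (std_normal_density u * u ^ i)))"
   by simp
 qed simp
 also have "\<dots> = (sqrt (2 * pi) * exp (y\<^sup>2)) * (\<Sum>i\<le>2 * n. of_nat (2 * n choose i) * ?c ^ (2 * n - i) * (LINT u|lborel. std_normal_density u * u ^ i))"
  by (simp add: Bochner_Integration.integral_sum integrable_std_normal_moment)
 also have "(\<Sum>i\<le>2 * n. of_nat (2 * n choose i) * ?c ^ (2 * n - i) * (LINT u|lborel. std_normal_density u * u ^ i))
   = (\<Sum>i\<in>(\<lambda>k. 2 * k) ` {..n}. of_nat (2 * n choose i) * ?c ^ (2 * n - i) * (LINT u|lborel. std_normal_density u * u ^ i))"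
 proof (rule sum.mono_neutral_right)
  show "\<forall>i\<in>{..2 * n} - (*) 2 ` {..n}. of_nat (2 * n choose i) * ?c ^ (2 * n - i) * (LINT u|lborel. std_normal_density u * u ^ i) = 0"
  proof
   fix i assume i: "i \<in> {..2 * n} - (*) 2 ` {..n}"
   have "odd i"
   proof
    assume "even i"
    then obtain k where "i = 2 * k" by (elim evenE)
    with i show False by auto
   qed
   then obtain k where "i = 2 * k + 1" by (elim oddE)
   then show "of_nat (2 * n choose i) * ?c ^ (2 * n - i) * (LINT u|lborel. std_normal_density u * u ^ i) = 0"
    using integral_std_normal_moment_odd[of k] by simp
  qed
 qed auto
 also have "\<dots> = (\<Sum>k\<le>n. of_nat (2 * n choose (2 * k)) * ?c ^ (2 * n - 2 * k) * (LINT u|lborel. std_normal_density u * u ^ (2 * k)))"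
  by (subst sum.reindex) (auto simp: inj_on_def)
 also have "\<dots> = (\<Sum>k\<le>n. 2 ^ n * fact n * (lagcoef (-1/2) n (n - k) * (- (y\<^sup>2)) ^ (n - k)))"
 proof (rule sum.cong[OF refl])
  fix k assume "k \<in> {..n}"
  then obtain j where n: "n = j + k" by (metis atMost_iff le_add_diff_inverse2)
  have c: "?c ^ (2 * n - 2 * k) = 2 ^ j * (y\<^sup>2) ^ j"
  proof -
   have "2 * n - 2 * k = 2 * j" using n by simp
   then have "?c ^ (2 * n - 2 * k) = (?c\<^sup>2) ^ j" by (simp only: power_mult)
   also have "?c\<^sup>2 = 2 * y\<^sup>2" by (simp add: power_mult_distrib)
   finally show ?thesis by (simp only: power_mult_distrib)
  qed
  have b: "real (2 * n choose (2 * k)) = fact (2 * (j + k)) / (fact (2 * k) * fact (2 * j))"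
   using n by (simp add: binomial_fact algebra_simps)
  have m: "(- (y\<^sup>2)) ^ j = (-1) ^ j * (y\<^sup>2) ^ j" by (rule power_minus)
  have p: "(2::real) ^ (j + k) = 2 ^ j * 2 ^ k" by (rule power_add)
  have p4: "(4::real) ^ k = 2 ^ k * 2 ^ k" by (simp flip: power_mult_distrib)
  have s: "(-1::real) ^ j * (-1) ^ j = 1" by (simp flip: power_mult_distrib)
  have "2 ^ n * fact n * (lagcoef (-1/2) n (n - k) * (- (y\<^sup>2)) ^ (n - k)) =
    ((-1) ^ j * (-1) ^ j) * (2 ^ j * 2 ^ k * fact (j + k) * (fact (2 * (j + k)) / (fact (j + k) * (2 ^ k * 2 ^ k) * fact (2 * j) * fact k)) * (y\<^sup>2) ^ j)"
   unfolding n add_diff_cancel_right' lagcoef_minus_half m p p4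
   by (simp only: mult_ac times_divide_eq_right times_divide_eq_left)
  then show "of_nat (2 * n choose (2 * k)) * ?c ^ (2 * n - 2 * k) * (LINT u|lborel. std_normal_density u * u ^ (2 * k))
   = 2 ^ n * fact n * (lagcoef (-1/2) n (n - k) * (- (y\<^sup>2)) ^ (n - k))"
   unfolding integral_std_normal_moment_even c b s by (simp add: field_simps)
 qed
 also have "\<dots> = 2 ^ n * fact n * (\<Sum>k\<le>n. lagcoef (-1/2) n (n - k) * (- (y\<^sup>2)) ^ (n - k))"
  by (simp add: sum_distrib_left)
 also have "(\<Sum>k\<le>n. lagcoef (-1/2) n (n - k) * (- (y\<^sup>2)) ^ (n - k)) = (\<Sum>j\<le>n. lagcoef (-1/2) n j * (- (y\<^sup>2)) ^ j)"
  by (rule sum.reindex_bij_witness[of _ "\<lambda>k. n - k" "\<lambda>k. n - k"]) auto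
 also have "\<dots> = poly (lagpoly (-1/2) n) (- (y\<^sup>2))"
  by (simp add: poly_altdef)
 finally show ?thesis by (simp add: mult_ac)
qed

text \<open>The factor that remains undetermined by the logarithmic derivative.\<close>

definition lag_c :: "real \<Rightarrow> nat \<Rightarrow> real" where
 "lag_c a n = poly (lagpoly a n) (-1) * exp (- 2 * sqrt n) * real n powr (1 / 4 - a / 2)"

lemma lag_c_minus_half: "lag_c (-1/2) \<longlonglongrightarrow> exp (- 1 / 2) / (2 * sqrt pi)"
proof -
 define H where "H y n = half_moment n y / ((sqrt (2 * real n)) ^ (2 * n) * exp (- real n) * exp (2 * y * sqrt n))" for y n
 have H: "H y \<longlonglongrightarrow> sqrt pi * exp (y\<^sup>2 / 2)" for y
  unfolding H_def by (rule half_moment_tendsto)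
 have "(\<lambda>n. exp (- 4 * sqrt (real n))) \<longlonglongrightarrow> 0" by real_asymp
 then have "(\<lambda>n. (lag_h (-1/2) n * real n powr (- (-1/2))) / sqrt pi *
   (exp (-1) * ((H 1 n + exp (- 4 * sqrt n) * H (-1) n) / (2 * H 0 n))))
   \<longlonglongrightarrow> 1 / sqrt pi * (exp (-1) * ((sqrt pi * exp (1\<^sup>2 / 2) + 0 * (sqrt pi * exp ((-1)\<^sup>2 / 2))) / (2 * (sqrt pi * exp (0\<^sup>2 / 2)))))"
  by (intro tendsto_mult tendsto_divide tendsto_add tendsto_const H lag_h_asymp) auto
 also have "1 / sqrt pi * (exp (-1) * ((sqrt pi * exp (1\<^sup>2 / 2) + 0 * (sqrt pi * exp ((-1)\<^sup>2 / 2))) / (2 * (sqrt pi * exp (0\<^sup>2 / 2)))))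
   = (exp (-1) * exp (1 / 2)) / (2 * sqrt pi)"
  by simp
 also have "exp (-1) * exp (1 / 2) = exp (- 1 / 2 :: real)" by (simp flip: exp_add)
 finally have lim: "(\<lambda>n. (lag_h (-1/2) n * real n powr (- (-1/2))) / sqrt pi *
   (exp (-1) * ((H 1 n + exp (- 4 * sqrt n) * H (-1) n) / (2 * H 0 n)))) \<longlonglongrightarrow> exp (- 1 / 2) / (2 * sqrt pi)" .
 have "\<forall>\<^sub>F n in sequentially. H 0 n > 0"
  by (rule order_tendstoD(1)[OF H]) simp
 then have "\<forall>\<^sub>F n in sequentially. (lag_h (-1/2) n * real n powr (- (-1/2))) / sqrt pi *
   (exp (-1) * ((H 1 n + exp (- 4 * sqrt n) * H (-1) n) / (2 * H 0 n))) = lag_c (-1/2) n"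
  using eventually_gt_at_top[of 0]
 proof eventually_elim
  case (elim n)
  define A where "A = (sqrt (2 * real n)) ^ (2 * n) * exp (- real n)"
  define K where "K = 2 ^ n * fact n * sqrt (2 * pi)"
  have A: "A > 0" using elim by (simp add: A_def)
  have K: "K > 0" by (simp add: K_def)
  have hm: "half_moment n y = A * exp (2 * y * sqrt n) * H y n" for y
   using A unfolding H_def A_def by simp
  have L1: "poly (lagpoly (-1/2) n) (-1) * (K * exp 1) = A * (exp (2 * sqrt n) * H 1 n + exp (- 2 * sqrt n) * H (-1) n)"
   using lagpoly_minus_half_moment[of n 1] by (simp add: K_def hm algebra_simps)
  have L0: "poly (lagpoly (-1/2) n) 0 * K = 2 * A * H 0 n"
   using lagpoly_minus_half_moment[of n 0] by (simp add: K_def hm)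
  have L0': "poly (lagpoly (-1/2) n) (0::real) = lag_h (-1/2) n / sqrt pi"
   using pochhammer_eq_lag_h[of "-1/2" n] by (simp add: poly_lagpoly_0 Gamma_one_half_real)
  have h: "lag_h (-1/2) n > 0" by (rule lag_h_pos) simp
  have "poly (lagpoly (-1/2) n) (-1) = A * (exp (2 * sqrt n) * H 1 n + exp (- 2 * sqrt n) * H (-1) n) * exp (-1) / K"
   using L1 K by (simp add: exp_minus field_simps)
  moreover have "A = lag_h (-1/2) n / sqrt pi * K / (2 * H 0 n)"
   using L0 elim unfolding L0' by (simp add: field_simps)
  ultimately have "poly (lagpoly (-1/2) n) (-1) = lag_h (-1/2) n / sqrt pi / (2 * H 0 n) * (exp (2 * sqrt n) * H 1 n + exp (- 2 * sqrt n) * H (-1) n) * exp (-1)"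
   using K by simp
  moreover have "(exp (2 * sqrt n) * H 1 n + exp (- 2 * sqrt n) * H (-1) n) * exp (- 2 * sqrt n) = H 1 n + exp (- 4 * sqrt n) * H (-1) n"
  proof -
   have "exp (2 * sqrt n) * exp (- 2 * sqrt n) = 1" "exp (- 2 * sqrt n) * exp (- 2 * sqrt n) = exp (- 4 * sqrt n)"
    by (simp_all flip: exp_add)
   then show ?thesis by (simp only: distrib_right mult.assoc mult.commute[of "H _ _"]) (simp add: mult.assoc[symmetric])
  qed
  ultimately have "poly (lagpoly (-1/2) n) (-1) * exp (- 2 * sqrt n) =
    lag_h (-1/2) n / sqrt pi / (2 * H 0 n) * exp (-1) * (H 1 n + exp (- 4 * sqrt n) * H (-1) n)"
   by (simp only: mult.assoc mult.commute[of "exp (-1)"]) simp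
  then show ?case
   unfolding lag_c_def by (simp add: mult_ac)
 qed
 from Lim_transform_eventually[OF lim this] show ?thesis .
qed

definition lag_s :: "real \<Rightarrow> nat \<Rightarrow> real" where
 "lag_s a n = (\<Sum>x\<in>lagzeros a n. 1 / (x + 1))"

lemma lag_s_asymp:
 assumes "a > -1"
 shows "(\<lambda>n. lag_s a n / sqrt n) \<longlonglongrightarrow> 1"
proof -
 obtain C where C: "C \<ge> 0"
  "\<And>n w. n > 0 \<Longrightarrow> w \<in> half_disc 1 1 \<Longrightarrow> norm (zero_sum a n 1 (- (w\<^sup>2)) - of_real (sqrt n) / w) \<le> C"
  using zero_sum_first_order[OF assms, of 1 1] by auto
 have "\<forall>\<^sub>F n in sequentially. norm (lag_s a n / sqrt n - 1) \<le> C / sqrt n"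
  using eventually_gt_at_top[of 0]
 proof eventually_elim
  case (elim n)
  have "norm (cx (lag_s a n - sqrt n)) \<le> C"
   using C(2)[of n 1] elim zero_sum_minus_1[OF assms, of n 1] by (simp add: half_disc_def lag_s_def)
  then have "\<bar>lag_s a n - sqrt n\<bar> \<le> C" by (simp only: norm_of_real)
  moreover have "lag_s a n / sqrt n - 1 = (lag_s a n - sqrt n) / sqrt n"
   using elim by (simp add: diff_divide_distrib)
  ultimately show ?case using elim by (simp add: divide_right_mono)
 qed
 moreover have "(\<lambda>n. C / sqrt (real n)) \<longlonglongrightarrow> 0" by real_asymp
 ultimately have "(\<lambda>n. lag_s a n / sqrt n - 1) \<longlonglongrightarrow> 0" by (rule Lim_null_comparison)
 then show ?thesis by (simp add: LIM_zero_iff)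
qed

lemma lagpoly_minus_1_step:
 assumes "a > -1"
 shows "poly (lagpoly (a + 1) n) (-1) = lag_s a (Suc n) * poly (lagpoly a (Suc n)) (-1)"
proof -
 have "cx (poly (lagpoly (a + 1) n) (-1)) = poly (- pderiv (lagpoly a (Suc n))) (-1)"
  using poly_lagpoly_of_real[of "a + 1" n "-1", where ?'a = complex] by (simp add: pderiv_lagpoly)
 also have "\<dots> = zero_sum a (Suc n) 1 (-1) * poly (lagpoly a (Suc n)) (-1)"
  using pderiv_lagpoly_eq[OF assms, of "-1" "Suc n"] by (simp add: off_ray_iff)
 also have "\<dots> = cx (lag_s a (Suc n) * poly (lagpoly a (Suc n)) (-1))"
  using zero_sum_minus_1[OF assms, of "Suc n" 1] poly_lagpoly_of_real[of a "Suc n" "-1", where ?'a = complex]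
  by (simp add: lag_s_def)
 finally show ?thesis by (simp only: of_real_eq_iff)
qed

text \<open>\<open>L\<^sub>n\<close> of parameter \<open>a + 1\<close> is minus the derivative of \<open>L\<^sub>n\<^sub>+\<^sub>1\<close> of parameter \<open>a\<close>, and the logarithmic
 derivative at \<open>-1\<close> is asymptotic to \<open>\<surd>n\<close>.\<close>

lemma lag_c_step:
 assumes "a > -1"
 shows "\<exists>r. r \<longlonglongrightarrow> 1 \<and> (\<forall>\<^sub>F n in sequentially. lag_c (a + 1) n = r n * lag_c a (Suc n))"
proof -
 define r where "r n = lag_s a (Suc n) / sqrt (Suc n) *
   (exp (2 * sqrt (Suc n) - 2 * sqrt n) * ((real n / real (Suc n)) powr (1 / 4 - (a + 1) / 2)))" for n
 have "(\<lambda>n. exp (2 * sqrt (real (Suc n)) - 2 * sqrt (real n))) \<longlonglongrightarrow> exp 0"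
 proof (rule tendsto_exp)
  show "(\<lambda>n. 2 * sqrt (real (Suc n)) - 2 * sqrt (real n)) \<longlonglongrightarrow> 0" by real_asymp
 qed
 moreover have "(\<lambda>n. (real n / real (Suc n)) powr (1 / 4 - (a + 1) / 2)) \<longlonglongrightarrow> 1 powr (1 / 4 - (a + 1) / 2)"
 proof (rule tendsto_powr)
  show "(\<lambda>n. real n / real (Suc n)) \<longlonglongrightarrow> 1" by real_asymp
 qed auto
 ultimately have "r \<longlonglongrightarrow> 1 * (exp 0 * 1 powr (1 / 4 - (a + 1) / 2))"
  unfolding r_def by (intro tendsto_mult LIMSEQ_Suc[OF lag_s_asymp[OF assms]])
 moreover have "\<forall>\<^sub>F n in sequentially. lag_c (a + 1) n = r n * lag_c a (Suc n)"
  using eventually_gt_at_top[of 0]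
 proof eventually_elim
  case (elim n)
  have e: "exp (2 * sqrt (Suc n) - 2 * sqrt n) * exp (- 2 * sqrt (Suc n)) = exp (- 2 * sqrt n)"
   by (simp flip: exp_add)
  define q where "q = real (Suc n)"
  have q: "q > 0" by (simp add: q_def)
  have p: "(real n / q) powr (1 / 4 - (a + 1) / 2) * q powr (1 / 4 - a / 2) / sqrt q = real n powr (1 / 4 - (a + 1) / 2)"
  proof -
   have "q powr (1 / 4 - a / 2) = q powr (1 / 4 - (a + 1) / 2) * sqrt q"
    using q by (simp add: powr_half_sqrt[symmetric] flip: powr_add) (simp add: field_simps)
   then show ?thesis using q by (simp add: powr_divide)
  qed
  have "r n * lag_c a (Suc n) = (lag_s a (Suc n) * poly (lagpoly a (Suc n)) (-1))
    * (exp (2 * sqrt (Suc n) - 2 * sqrt n) * exp (- 2 * sqrt (Suc n)))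
    * ((real n / q) powr (1 / 4 - (a + 1) / 2) * q powr (1 / 4 - a / 2) / sqrt q)"
   unfolding r_def lag_c_def q_def[symmetric] by simp
  also have "\<dots> = lag_c (a + 1) n"
   unfolding e p lag_c_def lagpoly_minus_1_step[OF assms] by simp
  finally show ?case by simp
 qed
 ultimately show ?thesis by auto
qed

lemma lag_c_up:
 assumes "a > -1" "lag_c a \<longlonglongrightarrow> c"
 shows "lag_c (a + 1) \<longlonglongrightarrow> c"
proof -
 obtain r where r: "r \<longlonglongrightarrow> 1" "\<forall>\<^sub>F n in sequentially. lag_c (a + 1) n = r n * lag_c a (Suc n)"
  using lag_c_step[OF assms(1)] by blast
 have "(\<lambda>n. r n * lag_c a (Suc n)) \<longlonglongrightarrow> 1 * c"
  by (intro tendsto_mult r LIMSEQ_Suc assms)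
 moreover have "\<forall>\<^sub>F n in sequentially. r n * lag_c a (Suc n) = lag_c (a + 1) n"
  using r(2) by (simp add: eq_commute)
 ultimately show ?thesis by (simp add: Lim_transform_eventually)
qed

lemma lag_c_down:
 assumes "a > -1" "lag_c (a + 1) \<longlonglongrightarrow> c"
 shows "lag_c a \<longlonglongrightarrow> c"
proof -
 obtain r where r: "r \<longlonglongrightarrow> 1" "\<forall>\<^sub>F n in sequentially. lag_c (a + 1) n = r n * lag_c a (Suc n)"
  using lag_c_step[OF assms(1)] by blast
 have "(\<lambda>n. lag_c (a + 1) n / r n) \<longlonglongrightarrow> c / 1"
  by (intro tendsto_divide r assms) simp
 moreover have "\<forall>\<^sub>F n in sequentially. r n > 1 / 2" by (rule order_tendstoD(1)[OF r(1)]) simp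
 then have "\<forall>\<^sub>F n in sequentially. lag_c (a + 1) n / r n = lag_c a (Suc n)"
  using r(2) by eventually_elim auto
 ultimately have "(\<lambda>n. lag_c a (Suc n)) \<longlonglongrightarrow> c" by (simp add: Lim_transform_eventually)
 then show ?thesis by (rule LIMSEQ_imp_Suc)
qed

lemma dominated_convergence_eventually:
 fixes s :: "nat \<Rightarrow> 'a \<Rightarrow> 'b::{banach, second_countable_topology}"
 assumes "f \<in> borel_measurable M" "\<And>i. s i \<in> borel_measurable M" "integrable M w"
  and "\<forall>\<^sub>F i in sequentially. AE x in M. norm (s i x) \<le> w x"
  and "AE x in M. (\<lambda>i. s i x) \<longlonglongrightarrow> f x"
 shows "(\<lambda>i. integral\<^sup>L M (s i)) \<longlonglongrightarrow> integral\<^sup>L M f"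
proof -
 obtain N where N: "\<And>i. i \<ge> N \<Longrightarrow> AE x in M. norm (s i x) \<le> w x"
  using assms(4) by (auto simp: eventually_at_top_linorder)
 have "(\<lambda>i. integral\<^sup>L M (s (i + N))) \<longlonglongrightarrow> integral\<^sup>L M f"
  by (rule integral_dominated_convergence[where w = w])
    (use assms N in \<open>auto elim!: eventually_mono intro: LIMSEQ_ignore_initial_segment\<close>)
 then show ?thesis by (rule LIMSEQ_offset)
qed

subsection \<open>From \<open>1/2\<close> to all parameters by a fractional integral\<close>

lemma poly_lagpoly_real_prod:
 fixes y :: real
 assumes "a > -1"
 shows "poly (lagpoly a n) y = (1 / fact n) * (\<Prod>x\<in>lagzeros a n. x - y)"
proof -
 have "cx (poly (lagpoly a n) y) = of_real ((1 / fact n) * (\<Prod>x\<in>lagzeros a n. x - y))"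
  unfolding poly_lagpoly_of_real[symmetric] poly_lagpoly_prod[OF assms] by simp
 then show ?thesis by (simp only: of_real_eq_iff)
qed

lemma poly_lagpoly_neg_pos:
 assumes "a > -1" "t \<ge> 0"
 shows "poly (lagpoly a n) (- t) > (0::real)"
 unfolding poly_lagpoly_real_prod[OF assms(1)]
 using lagzeros_pos[OF assms(1)] assms(2) by (intro mult_pos_pos prod_pos) (auto intro: add_pos_nonneg)

lemma lag_ratio_prod:
 assumes "a > -1"
 shows "poly (lagpoly a n) (- t) / poly (lagpoly a n) (-1) = (\<Prod>x\<in>lagzeros a n. (x + t) / (x + 1))"
 unfolding poly_lagpoly_real_prod[OF assms] prod_dividef by simp

lemma lag_ratio_le:
 assumes "a > -1" "0 \<le> t" "t \<le> 1"
 shows "poly (lagpoly a n) (- t) / poly (lagpoly a n) (-1) \<le> exp (- (1 - t) * lag_s a n)"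
proof -
 have "(\<Prod>x\<in>lagzeros a n. (x + t) / (x + 1)) \<le> (\<Prod>x\<in>lagzeros a n. exp (- (1 - t) * (1 / (x + 1))))"
 proof (rule prod_mono)
  fix x assume "x \<in> lagzeros a n"
  then have x: "x > 0" by (rule lagzeros_pos[OF assms(1)])
  have "(x + t) / (x + 1) = 1 + (- (1 - t) * (1 / (x + 1)))"
   using x by (simp add: field_simps)
  also have "\<dots> \<le> exp (- (1 - t) * (1 / (x + 1)))" by (rule exp_ge_add_one_self)
  finally show "0 \<le> (x + t) / (x + 1) \<and> (x + t) / (x + 1) \<le> exp (- (1 - t) * (1 / (x + 1)))"
   using x assms by simp
 qed
 also have "\<dots> = exp (- (1 - t) * lag_s a n)"
  unfolding lag_s_def sum_distrib_left by (simp add: exp_sum)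
 finally show ?thesis unfolding lag_ratio_prod[OF assms(1)] .
qed

lemma lag_ratio_ge:
 assumes "a > -1" "0 < t" "t \<le> 1"
 shows "poly (lagpoly a n) (- t) / poly (lagpoly a n) (-1) \<ge> exp (- (1 - t) / t * lag_s a n)"
proof -
 have "exp (- (1 - t) / t * lag_s a n) = (\<Prod>x\<in>lagzeros a n. exp (- (1 - t) / t * (1 / (x + 1))))"
  unfolding lag_s_def sum_distrib_left by (simp add: exp_sum)
 also have "\<dots> \<le> (\<Prod>x\<in>lagzeros a n. (x + t) / (x + 1))"
 proof (rule prod_mono)
  fix x assume "x \<in> lagzeros a n"
  then have x: "x > 0" by (rule lagzeros_pos[OF assms(1)])
  have "(x + 1) / (x + t) = 1 + (1 - t) / (x + t)"
   using x assms by (simp add: field_simps)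
  also have "\<dots> \<le> exp ((1 - t) / (x + t))" by (rule exp_ge_add_one_self)
  also have "\<dots> \<le> exp ((1 - t) / t * (1 / (x + 1)))"
  proof -
   have "t * (x + 1) \<le> x + t" using x assms mult_right_mono[of t 1 x] by (simp add: algebra_simps)
   then have "(1 - t) / (x + t) \<le> (1 - t) / (t * (x + 1))"
    using x assms by (intro divide_left_mono) auto
   then show ?thesis by simp
  qed
  finally have le: "(x + 1) / (x + t) \<le> exp ((1 - t) / t * (1 / (x + 1)))" .
  have "exp (- (1 - t) / t * (1 / (x + 1))) = inverse (exp ((1 - t) / t * (1 / (x + 1))))"
   unfolding exp_minus[symmetric] by (rule arg_cong[where f = exp]) (simp only: minus_divide_left mult_minus_left)
  also have "\<dots> \<le> inverse ((x + 1) / (x + t))"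
   using x assms by (intro le_imp_inverse_le le) auto
  also have "\<dots> = (x + t) / (x + 1)" by simp
  finally show "0 \<le> exp (- (1 - t) / t * (1 / (x + 1))) \<and> exp (- (1 - t) / t * (1 / (x + 1))) \<le> (x + t) / (x + 1)"
   by simp
 qed
 finally show ?thesis unfolding lag_ratio_prod[OF assms(1)] .
qed

lemma has_bochner_integral_Beta:
 fixes a b :: real
 assumes "a > 0" "b > 0"
 shows "has_bochner_integral lborel (\<lambda>t. indicator {0..1} t * (t powr (a - 1) * (1 - t) powr (b - 1))) (Beta a b)"
proof -
 have int: "set_integrable lborel {0..1} (\<lambda>t. t powr (a - 1) * (1 - t) powr (b - 1))"
  by (rule integrable_Beta[OF assms])
 have "(LINT t:{0..1}|lborel. t powr (a - 1) * (1 - t) powr (b - 1)) = Beta a b"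
  using set_borel_integral_eq_integral(2)[OF int] integral_unique[OF has_integral_Beta_real[OF assms]] by simp
 with int show ?thesis
  unfolding set_integrable_def set_lebesgue_integral_def by (simp add: has_bochner_integral_iff)
qed

text \<open>Koshlyakov's formula: a Beta integral raises the parameter by an arbitrary \<open>\<beta>\<close>, coefficient by coefficient.\<close>

lemma lagpoly_fractional_integral:
 assumes "\<mu> > -1" "\<beta> > 0"
 shows "(LINT t|lborel. indicator {0..1} t * (t powr \<mu> * (1 - t) powr (\<beta> - 1) * poly (lagpoly \<mu> n) (- t)))
  = Gamma \<beta> * Gamma (real n + \<mu> + 1) / Gamma (real n + \<mu> + \<beta> + 1) * poly (lagpoly (\<mu> + \<beta>) n) (-1)"
proof -
 let ?g = "\<lambda>k t. indicator {0..1} t * (t powr (\<mu> + real k + 1 - 1) * (1 - t) powr (\<beta> - 1))"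
 have b: "has_bochner_integral lborel (?g k) (Beta (\<mu> + real k + 1) \<beta>)" for k
  by (rule has_bochner_integral_Beta) (use assms in auto)
 have "(LINT t|lborel. indicator {0..1} t * (t powr \<mu> * (1 - t) powr (\<beta> - 1) * poly (lagpoly \<mu> n) (- t)))
   = (LINT t|lborel. (\<Sum>k\<le>n. lagcoef \<mu> n k * (-1) ^ k * ?g k t))"
 proof (rule integral_cong_AE)
  show "AE t in lborel. indicator {0..1} t * (t powr \<mu> * (1 - t) powr (\<beta> - 1) * poly (lagpoly \<mu> n) (- t))
    = (\<Sum>k\<le>n. lagcoef \<mu> n k * (-1) ^ k * ?g k t)"
   using AE_lborel_singleton[of 0]
  proof eventually_elim
   case (elim t)
   show ?case
   proof (cases "t \<in> {0..1}")
    case True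
    then have t: "t > 0" using elim by auto
    have "poly (lagpoly \<mu> n) (- t) = (\<Sum>k\<le>n. lagcoef \<mu> n k * ((-1) ^ k * t ^ k))"
     by (simp add: poly_altdef flip: power_minus)
    then show ?thesis using True t
     by (simp add: sum_distrib_left powr_add powr_realpow mult_ac)
   qed simp
  qed
 qed (auto simp: poly_altdef)
 also have "\<dots> = (\<Sum>k\<le>n. lagcoef \<mu> n k * (-1) ^ k * Beta (\<mu> + real k + 1) \<beta>)"
  using b by (subst Bochner_Integration.integral_sum) (auto simp: has_bochner_integral_iff)
 also have "\<dots> = (\<Sum>k\<le>n. Gamma \<beta> * Gamma (real n + \<mu> + 1) / Gamma (real n + \<mu> + \<beta> + 1) * (lagcoef (\<mu> + \<beta>) n k * (-1) ^ k))"
 proof (rule sum.cong[OF refl])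
  fix k assume "k \<in> {..n}"
  then have k: "k \<le> n" by simp
  have p1: "pochhammer (\<mu> + real k + 1) (n - k) = Gamma (real n + \<mu> + 1) / Gamma (\<mu> + real k + 1)"
   by (subst pochhammer_Gamma) (use assms k in \<open>auto simp: of_nat_diff algebra_simps\<close>)
  have p2: "pochhammer (\<mu> + \<beta> + real k + 1) (n - k) = Gamma (real n + \<mu> + \<beta> + 1) / Gamma (\<mu> + \<beta> + real k + 1)"
   by (subst pochhammer_Gamma) (use assms k in \<open>auto simp: of_nat_diff algebra_simps\<close>)
  have "0 < \<mu> + real k + 1" "0 < \<mu> + \<beta> + real k + 1" "0 < real n + \<mu> + \<beta> + 1" using assms by auto
  note pos = this[THEN Gamma_real_pos]
  have B: "Beta (\<mu> + real k + 1) \<beta> = Gamma (\<mu> + real k + 1) * Gamma \<beta> / Gamma (\<mu> + \<beta> + real k + 1)"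
   by (simp add: Beta_def add_ac)
  show "lagcoef \<mu> n k * (-1) ^ k * Beta (\<mu> + real k + 1) \<beta> =
    Gamma \<beta> * Gamma (real n + \<mu> + 1) / Gamma (real n + \<mu> + \<beta> + 1) * (lagcoef (\<mu> + \<beta>) n k * (-1) ^ k)"
   unfolding lagcoef_def p1 p2 B using k pos by (cases "even k") (simp_all add: mult_ac)
 qed
 also have "\<dots> = Gamma \<beta> * Gamma (real n + \<mu> + 1) / Gamma (real n + \<mu> + \<beta> + 1) * poly (lagpoly (\<mu> + \<beta>) n) (-1)"
  unfolding poly_altdef sum_distrib_left by simp
 finally show ?thesis .
qed

lemma integrable_Gamma_half:
 fixes \<beta> :: real
 assumes "\<beta> > 0"
 shows "integrable lborel (\<lambda>u. indicator {0..} u * (u powr (\<beta> - 1) * exp (- u / 2)))"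
proof -
 have "(\<lambda>t. cx t powr (of_real \<beta> - 1) / of_real (exp (1 / 2 * t))) absolutely_integrable_on {0<..}"
  by (rule absolutely_integrable_Gamma_integral) (use assms in auto)
 then have A: "integrable lebesgue (\<lambda>t. norm (indicator {0<..} t *\<^sub>R (cx t powr (of_real \<beta> - 1) / of_real (exp (1 / 2 * t)))))"
  unfolding set_integrable_def by (rule integrable_norm)
 have eq: "norm (indicator {0<..} t *\<^sub>R (cx t powr (of_real \<beta> - 1) / of_real (exp (1 / 2 * t))))
   = indicator {0<..} t * (t powr (\<beta> - 1) * exp (- t / 2))" for t :: real
 proof (cases "t > 0")
  case True
  have "norm (cx t powr (of_real \<beta> - 1)) = t powr (\<beta> - 1)"
   using norm_powr_real_powr[of "of_real t" "of_real \<beta> - 1"] True by simp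
  moreover have "norm (cx (exp (1 / 2 * t))) = exp (t / 2)" by simp
  moreover have "exp (- t / 2) = 1 / exp (t / 2)"
   using exp_minus[of "t / 2"] by (simp add: inverse_eq_divide)
  ultimately show ?thesis using True by (simp only: norm_scaleR norm_divide) simp
 qed simp
 have "integrable lebesgue (\<lambda>t. indicator {0<..} t * (t powr (\<beta> - 1) * exp (- t / 2)))"
  using A unfolding eq .
 then have C: "integrable lborel (\<lambda>t::real. indicator {0<..} t * (t powr (\<beta> - 1) * exp (- t / 2)))"
  by (subst (asm) integrable_completion) auto
 have eq2: "indicator {0..} u * (u powr (\<beta> - 1) * exp (- u / 2)) = indicator {0<..} u * (u powr (\<beta> - 1) * exp (- u / 2))" for u :: real
  by (cases "u = 0") (auto simp: indicator_def)
 show ?thesis unfolding eq2 by (rule C)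
qed

text \<open>The integrand concentrates at \<open>t = 1\<close> on the scale \<open>1 / \<surd>n\<close>: with \<open>t = 1 - u / \<surd>n\<close> the quotient of
 polynomials tends to \<open>exp (- u)\<close> by the two bounds above.  The assumption \<open>\<mu> \<ge> 0\<close> keeps \<open>t powr \<mu>\<close> bounded.\<close>

lemma lag_fractional_limit:
 assumes "\<mu> \<ge> 0" "\<beta> > 0"
 shows "(\<lambda>n. real n powr (\<beta> / 2) * (LINT t|lborel. indicator {0..1} t *
   (t powr \<mu> * (1 - t) powr (\<beta> - 1) * (poly (lagpoly \<mu> n) (- t) / poly (lagpoly \<mu> n) (-1))))) \<longlonglongrightarrow> Gamma \<beta>"
proof -
 have \<mu>: "\<mu> > -1" using assms by simp
 define R where "R n t = poly (lagpoly \<mu> n) (- t) / poly (lagpoly \<mu> n) (-1)" for n and t :: real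
 define j where "j n u = indicator {0..sqrt n} u * ((1 - u / sqrt n) powr \<mu> * u powr (\<beta> - 1) * R n (1 - u / sqrt n))" for n u
 have eq: "real n powr (\<beta> / 2) * (LINT t|lborel. indicator {0..1} t * (t powr \<mu> * (1 - t) powr (\<beta> - 1) * R n t))
   = (LINT u|lborel. j n u)" if n: "n > 0" for n
 proof -
  have s: "sqrt n > 0" using n by simp
  have "(LINT t|lborel. indicator {0..1} t * (t powr \<mu> * (1 - t) powr (\<beta> - 1) * R n t))
    = \<bar>- 1 / sqrt n\<bar> *\<^sub>R (LINT u|lborel. indicator {0..1} (1 + (- 1 / sqrt n) * u) *
      ((1 + (- 1 / sqrt n) * u) powr \<mu> * (1 - (1 + (- 1 / sqrt n) * u)) powr (\<beta> - 1) * R n (1 + (- 1 / sqrt n) * u)))"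
   by (rule lborel_integral_real_affine) (use s in auto)
  then have "real n powr (\<beta> / 2) * (LINT t|lborel. indicator {0..1} t * (t powr \<mu> * (1 - t) powr (\<beta> - 1) * R n t))
    = (LINT u|lborel. real n powr (\<beta> / 2) * (1 / sqrt n) * (indicator {0..1} (1 + (- 1 / sqrt n) * u) *
      ((1 + (- 1 / sqrt n) * u) powr \<mu> * (1 - (1 + (- 1 / sqrt n) * u)) powr (\<beta> - 1) * R n (1 + (- 1 / sqrt n) * u))))"
   using s by simp
  also have "\<dots> = (LINT u|lborel. j n u)"
  proof (rule lint_cong)
   fix u :: real
   have ind: "indicator {0..1} (1 + (- 1 / sqrt n) * u) = (indicator {0..sqrt n} u :: real)"
    using s by (auto simp: indicator_def field_simps)
   show "real n powr (\<beta> / 2) * (1 / sqrt n) * (indicator {0..1} (1 + (- 1 / sqrt n) * u) *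
      ((1 + (- 1 / sqrt n) * u) powr \<mu> * (1 - (1 + (- 1 / sqrt n) * u)) powr (\<beta> - 1) * R n (1 + (- 1 / sqrt n) * u))) = j n u"
   proof (cases "u \<in> {0..sqrt n}")
    case True
    have x: "real n powr (\<beta> / 2) * (1 / sqrt n) * (u / sqrt n) powr (\<beta> - 1) = u powr (\<beta> - 1)"
    proof -
     have "real n powr (\<beta> / 2) = sqrt n powr \<beta>"
      using n by (simp add: powr_half_sqrt[symmetric] powr_powr)
     also have "\<dots> = sqrt n powr (\<beta> - 1) * sqrt n"
      using s by (simp add: powr_diff)
     finally show ?thesis using True s by (simp add: powr_divide)
    qed
    show ?thesis unfolding ind j_def x[symmetric] using True by simp
   next
    case False
    then show ?thesis unfolding ind j_def by simp
   qed
  qed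
  finally show ?thesis .
 qed
 have "(\<lambda>n. LINT u|lborel. j n u) \<longlonglongrightarrow> (LINT u|lborel. indicator {0..} u * (u powr (\<beta> - 1) * exp (- u)))"
 proof (rule dominated_convergence_eventually)
  show "(\<lambda>u. indicator {0..} u * (u powr (\<beta> - 1) * exp (- u))) \<in> borel_measurable lborel" by measurable
  show "j n \<in> borel_measurable lborel" for n
   unfolding j_def[abs_def] R_def poly_altdef by measurable
  show "integrable lborel (\<lambda>u. indicator {0..} u * (u powr (\<beta> - 1) * exp (- u / 2)))"
   by (rule integrable_Gamma_half[OF assms(2)])
  show "\<forall>\<^sub>F n in sequentially. AE u in lborel. norm (j n u) \<le> indicator {0..} u * (u powr (\<beta> - 1) * exp (- u / 2))"
  proof -
   have "\<forall>\<^sub>F n in sequentially. lag_s \<mu> n / sqrt n > 1 / 2"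
    by (rule order_tendstoD(1)[OF lag_s_asymp[OF \<mu>]]) simp
   then show ?thesis using eventually_gt_at_top[of 0]
   proof eventually_elim
    case (elim n)
    have s: "sqrt n > 0" using elim by simp
    show ?case
    proof (rule AE_I2)
     fix u :: real
     show "norm (j n u) \<le> indicator {0..} u * (u powr (\<beta> - 1) * exp (- u / 2))"
     proof (cases "u \<in> {0..sqrt n}")
      case True
      define t where "t = 1 - u / sqrt n"
      have t: "0 \<le> t" "t \<le> 1" using True s by (auto simp: t_def field_simps)
      have "R n t \<le> exp (- (1 - t) * lag_s \<mu> n)" unfolding R_def by (rule lag_ratio_le[OF \<mu> t])
      also have "\<dots> \<le> exp (- u / 2)"
      proof -
       have "u * (1 / 2) \<le> u * (lag_s \<mu> n / sqrt n)" using True elim by (intro mult_left_mono) auto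
       then show ?thesis by (simp add: t_def)
      qed
      finally have R1: "R n t \<le> exp (- u / 2)" .
      have R0: "R n t \<ge> 0"
       unfolding R_def using poly_lagpoly_neg_pos[OF \<mu>, of t n] poly_lagpoly_neg_pos[OF \<mu>, of 1 n] t by simp
      have "t powr \<mu> \<le> 1" using t assms by (simp add: powr_le1)
      then have "t powr \<mu> * u powr (\<beta> - 1) * R n t \<le> 1 * u powr (\<beta> - 1) * exp (- u / 2)"
       using R0 R1 by (intro mult_mono) auto
      moreover have "j n u = t powr \<mu> * u powr (\<beta> - 1) * R n t" using True by (simp add: j_def t_def)
      ultimately show ?thesis using True R0 by simp
     qed (simp add: j_def)
    qed
   qed
  qed
  show "AE u in lborel. (\<lambda>n. j n u) \<longlonglongrightarrow> indicator {0..} u * (u powr (\<beta> - 1) * exp (- u))"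
  proof (rule AE_I2)
   fix u :: real
   show "(\<lambda>n. j n u) \<longlonglongrightarrow> indicator {0..} u * (u powr (\<beta> - 1) * exp (- u))"
   proof (cases "u \<ge> 0")
    case True
    have tl: "(\<lambda>n. 1 - u / sqrt (real n)) \<longlonglongrightarrow> 1" by real_asymp
    have up: "(\<lambda>n. exp (- u * (lag_s \<mu> n / sqrt n))) \<longlonglongrightarrow> exp (- u * 1)"
     by (intro tendsto_exp tendsto_mult tendsto_const lag_s_asymp[OF \<mu>])
    have lo: "(\<lambda>n. exp (- u * (lag_s \<mu> n / sqrt n) / (1 - u / sqrt n))) \<longlonglongrightarrow> exp (- u * 1 / 1)"
     by (intro tendsto_exp tendsto_divide tendsto_mult tendsto_const lag_s_asymp[OF \<mu>] tl) simp
    have ev: "\<forall>\<^sub>F n in sequentially. n > 0 \<and> sqrt n > u"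
    proof -
     have "filterlim (\<lambda>n. sqrt (real n)) at_top sequentially" by real_asymp
     from filterlim_at_top_dense[THEN iffD1, OF this, rule_format, of u] eventually_gt_at_top[of "0::nat"]
     show ?thesis by eventually_elim simp
    qed
    have Rlim: "(\<lambda>n. R n (1 - u / sqrt n)) \<longlonglongrightarrow> exp (- u)"
    proof (rule tendsto_sandwich)
     show "\<forall>\<^sub>F n in sequentially. exp (- u * (lag_s \<mu> n / sqrt n) / (1 - u / sqrt n)) \<le> R n (1 - u / sqrt n)"
      using ev
     proof eventually_elim
      case (elim n)
      then have "0 < 1 - u / sqrt n" "1 - u / sqrt n \<le> 1" using True by (auto simp: field_simps)
      from lag_ratio_ge[OF \<mu> this, of n] show ?case by (simp add: R_def)
     qed
     show "\<forall>\<^sub>F n in sequentially. R n (1 - u / sqrt n) \<le> exp (- u * (lag_s \<mu> n / sqrt n))"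
      using ev
     proof eventually_elim
      case (elim n)
      then have "0 \<le> 1 - u / sqrt n" "1 - u / sqrt n \<le> 1" using True by (auto simp: field_simps)
      from lag_ratio_le[OF \<mu> this, of n] show ?case by (simp add: R_def)
     qed
    qed (use up lo in simp_all)
    have "(\<lambda>n. (1 - u / sqrt n) powr \<mu> * u powr (\<beta> - 1) * R n (1 - u / sqrt n)) \<longlonglongrightarrow> 1 powr \<mu> * u powr (\<beta> - 1) * exp (- u)"
     by (intro tendsto_mult tendsto_powr tl Rlim tendsto_const) simp
    moreover have "\<forall>\<^sub>F n in sequentially. (1 - u / sqrt n) powr \<mu> * u powr (\<beta> - 1) * R n (1 - u / sqrt n) = j n u"
     using ev by eventually_elim (use True in \<open>simp add: j_def\<close>)
    ultimately show ?thesis using True by (simp add: Lim_transform_eventually)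
   qed (simp add: j_def)
  qed
 qed
 moreover have "(LINT u|lborel. indicator {0..} u * (u powr (\<beta> - 1) * exp (- u))) = Gamma \<beta>"
 proof -
  have a: "\<beta> - 1 > -1" using assms by simp
  have "(LINT x|lagM (\<beta> - 1). x ^ 0) = Gamma (real 0 + (\<beta> - 1) + 1)"
   by (rule has_bochner_integral_integral_eq[OF has_bochner_integral_moment[OF a]])
  moreover have "(LINT x|lagM (\<beta> - 1). x ^ 0 :: real) = (LINT x:{0..}|lborel. weight (\<beta> - 1) x *\<^sub>R (x ^ 0))"
   by (rule integral_lagM) (intro measurable_lagM_continuous continuous_intros)
  ultimately show ?thesis
   by (simp add: set_lebesgue_integral_def weight_def)
 qed
 ultimately have lim: "(\<lambda>n. LINT u|lborel. j n u) \<longlonglongrightarrow> Gamma \<beta>" by simp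
 have "\<forall>\<^sub>F n in sequentially. (LINT u|lborel. j n u) = real n powr (\<beta> / 2) * (LINT t|lborel. indicator {0..1} t * (t powr \<mu> * (1 - t) powr (\<beta> - 1) * R n t))"
  using eventually_gt_at_top[of 0] by eventually_elim (use eq in simp)
 from Lim_transform_eventually[OF lim this] show ?thesis unfolding R_def .
qed

lemma lag_c_shift:
 assumes "\<mu> \<ge> 0" "\<beta> > 0" "lag_c \<mu> \<longlonglongrightarrow> c"
 shows "lag_c (\<mu> + \<beta>) \<longlonglongrightarrow> c"
proof -
 have \<mu>: "\<mu> > -1" "\<mu> + \<beta> > -1" using assms by auto
 define J where "J n = (LINT t|lborel. indicator {0..1} t *
   (t powr \<mu> * (1 - t) powr (\<beta> - 1) * (poly (lagpoly \<mu> n) (- t) / poly (lagpoly \<mu> n) (-1))))" for n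
 have G: "Gamma \<beta> > 0" by (rule Gamma_real_pos[OF assms(2)])
 have "(\<lambda>n. (lag_h (\<mu> + \<beta>) n * real n powr (- (\<mu> + \<beta>))) / (lag_h \<mu> n * real n powr (- \<mu>)) / Gamma \<beta> * (real n powr (\<beta> / 2) * J n) * lag_c \<mu> n)
   \<longlonglongrightarrow> 1 / 1 / Gamma \<beta> * Gamma \<beta> * c"
  unfolding J_def
  by (intro tendsto_mult tendsto_divide lag_h_asymp \<mu> tendsto_const lag_fractional_limit assms) (use G in auto)
 then have lim: "(\<lambda>n. (lag_h (\<mu> + \<beta>) n * real n powr (- (\<mu> + \<beta>))) / (lag_h \<mu> n * real n powr (- \<mu>)) / Gamma \<beta> * (real n powr (\<beta> / 2) * J n) * lag_c \<mu> n)
   \<longlonglongrightarrow> c" using G by simp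
 have "\<forall>\<^sub>F n in sequentially. (lag_h (\<mu> + \<beta>) n * real n powr (- (\<mu> + \<beta>))) / (lag_h \<mu> n * real n powr (- \<mu>)) / Gamma \<beta> * (real n powr (\<beta> / 2) * J n) * lag_c \<mu> n
   = lag_c (\<mu> + \<beta>) n"
  using eventually_gt_at_top[of 0]
 proof eventually_elim
  case (elim n)
  have n: "real n > 0" using elim by simp
  have h: "lag_h \<mu> n > 0" "lag_h (\<mu> + \<beta>) n > 0" by (rule lag_h_pos[OF \<mu>(1)], rule lag_h_pos[OF \<mu>(2)])
  have L: "poly (lagpoly \<mu> n) (-1) > (0::real)" using poly_lagpoly_neg_pos[OF \<mu>(1), of 1 n] by simp
  have "J n = (LINT t|lborel. (indicator {0..1} t * (t powr \<mu> * (1 - t) powr (\<beta> - 1) * poly (lagpoly \<mu> n) (- t))) / poly (lagpoly \<mu> n) (-1))"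
   unfolding J_def by (simp add: mult_ac)
  also have "\<dots> = (LINT t|lborel. indicator {0..1} t * (t powr \<mu> * (1 - t) powr (\<beta> - 1) * poly (lagpoly \<mu> n) (- t))) / poly (lagpoly \<mu> n) (-1)"
   by (rule integral_divide_zero)
  also have "\<dots> = Gamma \<beta> * (lag_h \<mu> n / lag_h (\<mu> + \<beta>) n) * poly (lagpoly (\<mu> + \<beta>) n) (-1) / poly (lagpoly \<mu> n) (-1)"
   unfolding lagpoly_fractional_integral[OF \<mu>(1) assms(2)] by (simp add: lag_h_def add_ac)
  finally have J: "J n * poly (lagpoly \<mu> n) (-1) = Gamma \<beta> * (lag_h \<mu> n / lag_h (\<mu> + \<beta>) n) * poly (lagpoly (\<mu> + \<beta>) n) (-1)"
   using L by simp
  have pw: "real n powr (- (\<mu> + \<beta>)) / real n powr (- \<mu>) * real n powr (\<beta> / 2) * real n powr (1 / 4 - \<mu> / 2) = real n powr (1 / 4 - (\<mu> + \<beta>) / 2)"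
  proof -
   have e: "- (\<mu> + \<beta>) - (- \<mu>) + \<beta> / 2 + (1 / 4 - \<mu> / 2) = 1 / 4 - (\<mu> + \<beta>) / 2"
    by (simp add: field_simps)
   show ?thesis unfolding powr_diff[symmetric] powr_add[symmetric] e ..
  qed
  have "(lag_h (\<mu> + \<beta>) n * real n powr (- (\<mu> + \<beta>))) / (lag_h \<mu> n * real n powr (- \<mu>)) / Gamma \<beta> * (real n powr (\<beta> / 2) * J n) * lag_c \<mu> n
   = lag_h (\<mu> + \<beta>) n / lag_h \<mu> n / Gamma \<beta> * (J n * poly (lagpoly \<mu> n) (-1)) * exp (- 2 * sqrt n) *
    (real n powr (- (\<mu> + \<beta>)) / real n powr (- \<mu>) * real n powr (\<beta> / 2) * real n powr (1 / 4 - \<mu> / 2))"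
   by (simp add: lag_c_def mult_ac)
  also have "\<dots> = lag_c (\<mu> + \<beta>) n"
   unfolding J pw lag_c_def using h G by simp
  finally show ?case .
 qed
 from Lim_transform_eventually[OF lim this] show ?thesis .
qed

text \<open>From \<open>-1/2\<close> one step up reaches \<open>1/2\<close>, the fractional integral reaches \<open>a + 2\<close>, and two steps down reach \<open>a\<close>.\<close>

theorem lag_c_tendsto:
 assumes "a > -1"
 shows "lag_c a \<longlonglongrightarrow> exp (- 1 / 2) / (2 * sqrt pi)"
proof -
 have "lag_c (-1/2 + 1) \<longlonglongrightarrow> exp (- 1 / 2) / (2 * sqrt pi)"
  by (rule lag_c_up[OF _ lag_c_minus_half]) simp
 then have "lag_c (1/2) \<longlonglongrightarrow> exp (- 1 / 2) / (2 * sqrt pi)" by simp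
 then have "lag_c (1/2 + (a + 3/2)) \<longlonglongrightarrow> exp (- 1 / 2) / (2 * sqrt pi)"
  by (rule lag_c_shift[rotated 2]) (use assms in auto)
 then have "lag_c (a + 1 + 1) \<longlonglongrightarrow> exp (- 1 / 2) / (2 * sqrt pi)" by (simp add: add_ac)
 then have "lag_c (a + 1) \<longlonglongrightarrow> exp (- 1 / 2) / (2 * sqrt pi)"
  by (rule lag_c_down[rotated]) (use assms in simp)
 then show ?thesis by (rule lag_c_down[OF assms])
qed

definition lag_lim :: "real \<Rightarrow> complex \<Rightarrow> complex" where
 "lag_lim a w = exp (- (w\<^sup>2 / 2) - of_real (a + 1 / 2) * Ln w) / of_real (2 * sqrt pi)"

text \<open>Perron's formula: the quotient by the value at \<open>w = 1\<close> and that value itself are known.\<close>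

theorem lagpoly_asymp:
 assumes "a > -1" "Re w > 0"
 shows "(\<lambda>n. poly (lagpoly a n) (- (w\<^sup>2)) * exp (- 2 * of_real (sqrt n) * w) * of_real (real n powr (1 / 4 - a / 2)))
  \<longlonglongrightarrow> lag_lim a w"
proof -
 have "(\<lambda>n. lag_norm a n w / lag_norm a n 1 * (of_real (lag_c a n) * exp (1 / 2)) * exp (- (w\<^sup>2 / 2) - of_real (a + 1 / 2) * Ln w))
  \<longlonglongrightarrow> 1 * (of_real (exp (- 1 / 2) / (2 * sqrt pi)) * exp (1 / 2)) * exp (- (w\<^sup>2 / 2) - of_real (a + 1 / 2) * Ln w)"
  by (intro tendsto_mult tendsto_const tendsto_of_real lag_norm_ratio_tendsto lag_c_tendsto assms)
 also have "1 * (of_real (exp (- 1 / 2) / (2 * sqrt pi)) * exp (1 / 2)) * exp (- (w\<^sup>2 / 2) - of_real (a + 1 / 2) * Ln w) = lag_lim a w"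
 proof -
  have "cx (exp (- 1 / 2)) * exp (1 / 2) = 1"
   by (simp add: exp_of_real[symmetric] flip: exp_add)
  then show ?thesis by (simp add: lag_lim_def field_simps)
 qed
 also have "(\<lambda>n. lag_norm a n w / lag_norm a n 1 * (of_real (lag_c a n) * exp (1 / 2)) * exp (- (w\<^sup>2 / 2) - of_real (a + 1 / 2) * Ln w))
   = (\<lambda>n. poly (lagpoly a n) (- (w\<^sup>2)) * exp (- 2 * of_real (sqrt n) * w) * of_real (real n powr (1 / 4 - a / 2)))"
 proof
  fix n
  have nz: "lag_norm a n 1 \<noteq> 0" by (rule lag_norm_nonzero[OF assms(1)]) simp
  have "lag_norm a n 1 = of_real (poly (lagpoly a n) (-1)) * exp (1 / 2 + of_real (- 2 * sqrt n))"
   using poly_lagpoly_of_real[of a n "-1", where ?'a = complex] by (simp add: lag_norm_def)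
  then have 1: "of_real (lag_c a n) * exp (1 / 2) = lag_norm a n 1 * of_real (real n powr (1 / 4 - a / 2))"
   unfolding lag_c_def exp_add exp_of_real by simp
  have 2: "lag_norm a n w * exp (- (w\<^sup>2 / 2) - of_real (a + 1 / 2) * Ln w) = poly (lagpoly a n) (- (w\<^sup>2)) * exp (- 2 * of_real (sqrt n) * w)"
   unfolding lag_norm_def mult.assoc exp_add[symmetric] by (simp add: algebra_simps)
  have "lag_norm a n w / lag_norm a n 1 * (of_real (lag_c a n) * exp (1 / 2)) * exp (- (w\<^sup>2 / 2) - of_real (a + 1 / 2) * Ln w)
   = (lag_norm a n w * exp (- (w\<^sup>2 / 2) - of_real (a + 1 / 2) * Ln w)) * of_real (real n powr (1 / 4 - a / 2))"
   unfolding 1 using nz by simp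
  then show "lag_norm a n w / lag_norm a n 1 * (of_real (lag_c a n) * exp (1 / 2)) * exp (- (w\<^sup>2 / 2) - of_real (a + 1 / 2) * Ln w)
   = poly (lagpoly a n) (- (w\<^sup>2)) * exp (- 2 * of_real (sqrt n) * w) * of_real (real n powr (1 / 4 - a / 2))"
   unfolding 2 .
 qed
 finally show ?thesis .
qed

section \<open>The weighted Cauchy transform\<close>

text \<open>\<open>lag_psi\<close> is the Cauchy transform without the factor \<open>- 1 / (2 \<pi> i)\<close>.\<close>

definition lag_psi :: "real \<Rightarrow> nat \<Rightarrow> complex \<Rightarrow> complex" where
 "lag_psi a n z = (LINT x|lagM a. poly (lagpoly a n) (cx x) / (cx x - z))"

lemma off_ray_dist:
 assumes "z \<in> off_ray"
 obtains \<delta> where "\<delta> > 0" "\<And>x. x \<ge> 0 \<Longrightarrow> norm (cx x - z) \<ge> \<delta>"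
proof (cases "Im z = 0")
 case True
 then have "Re z < 0" using assms by (simp add: off_ray_iff)
 moreover have "norm (cx x - z) \<ge> - Re z" if "x \<ge> 0" for x
  using complex_Re_le_cmod[of "cx x - z"] that by simp
 ultimately show ?thesis by (intro that[of "- Re z"]) auto
next
 case False
 moreover have "norm (cx x - z) \<ge> \<bar>Im z\<bar>" for x
  using abs_Im_le_cmod[of "cx x - z"] by simp
 ultimately show ?thesis by (intro that[of "\<bar>Im z\<bar>"]) auto
qed

lemma integrable_lagM_poly_divide:
 fixes p :: "complex poly"
 assumes "a > -1" "z \<in> off_ray"
 shows "integrable (lagM a) (\<lambda>x. poly p (cx x) / (cx x - z))"
proof -
 obtain \<delta> where \<delta>: "\<delta> > 0" "\<And>x. x \<ge> 0 \<Longrightarrow> norm (cx x - z) \<ge> \<delta>"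
  by (rule off_ray_dist[OF assms(2)]) blast
 show ?thesis
 proof (rule Bochner_Integration.integrable_bound)
  show "integrable (lagM a) (\<lambda>x. poly p (cx x) / of_real \<delta>)"
   by (intro integrable_divide integrable_lagM_poly assms)
  show "(\<lambda>x. poly p (cx x) / (cx x - z)) \<in> borel_measurable (lagM a)"
   by (intro measurable_lagM_continuous continuous_intros) (use off_ray_diff_nonzero[OF assms(2)] in auto)
  show "AE x in lagM a. norm (poly p (cx x) / (cx x - z)) \<le> norm (poly p (cx x) / of_real \<delta>)"
  proof (rule AE_I2)
   fix x assume "x \<in> space (lagM a)"
   then have "norm (cx x - z) \<ge> \<delta>" using \<delta>(2) by simp
   then show "norm (poly p (cx x) / (cx x - z)) \<le> norm (poly p (cx x) / of_real \<delta>)"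
    using \<delta>(1) unfolding norm_divide by (intro divide_left_mono) (auto intro: mult_pos_pos order_less_le_trans)
  qed
 qed
qed

text \<open>Since \<open>(p(x) - p(z)) / (x - z)\<close> is a polynomial of lower degree, orthogonality lets \<open>p\<close> leave the integral.\<close>

lemma lag_psi_mult:
 fixes p :: "complex poly"
 assumes "a > -1" "z \<in> off_ray" "degree p \<le> n"
 shows "(LINT x|lagM a. poly (lagpoly a n * p) (cx x) / (cx x - z)) = poly p z * lag_psi a n z"
proof -
 have "[:- z, 1:] dvd (p - [:poly p z:])"
  by (simp add: poly_eq_0_iff_dvd[symmetric])
 then obtain q where q: "p - [:poly p z:] = [:- z, 1:] * q" by (elim dvdE)
 have int: "lagint a (lagpoly a n * q) = 0"
 proof (cases "q = 0")
  case False
  have "Suc (degree q) = degree (p - [:poly p z:])"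
   unfolding q using False by (simp add: degree_mult_eq del: mult_pCons_left)
  also have "\<dots> \<le> n" using assms(3) by (intro degree_diff_le) auto
  finally show ?thesis by (intro lagint_orthogonal assms) simp
 qed simp
 have "(LINT x|lagM a. poly (lagpoly a n * p) (cx x) / (cx x - z))
   = (LINT x|lagM a. poly p z * (poly (lagpoly a n) (cx x) / (cx x - z)) + poly (lagpoly a n * q) (cx x))"
 proof (rule lint_cong)
  fix x assume "x \<in> space (lagM a)"
  then have nz: "cx x - z \<noteq> 0" using off_ray_diff_nonzero[OF assms(2)] by simp
  have px: "poly p (of_real x) = poly p z + (of_real x - z) * poly q (of_real x)"
   using arg_cong[OF q, of "\<lambda>r. poly r (of_real x)"] by (simp add: algebra_simps)
  show "poly (lagpoly a n * p) (cx x) / (cx x - z)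
   = poly p z * (poly (lagpoly a n) (cx x) / (cx x - z)) + poly (lagpoly a n * q) (cx x)"
   unfolding poly_mult px using nz by (simp add: field_simps)
 qed
 also have "\<dots> = poly p z * lag_psi a n z + lagint a (lagpoly a n * q)"
  unfolding lag_psi_def lagint_def integral_mult_right_zero[symmetric]
  by (intro Bochner_Integration.integral_add integrable_mult_right integrable_lagM_poly_divide integrable_lagM_poly assms)
 finally show ?thesis unfolding int by simp
qed

lemma lag_psi_times_lagpoly:
 assumes "a > -1" "z \<in> off_ray"
 shows "poly (lagpoly a n) z * lag_psi a n z = (LINT x|lagM a. (of_real ((poly (lagpoly a n) x)\<^sup>2)) / (cx x - z))"
 using lag_psi_mult[OF assms, of "lagpoly a n" n]
 by (simp add: poly_lagpoly_of_real power2_eq_square)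

lemma lag_psi_three_term:
 assumes "a > -1" "z \<in> off_ray"
 shows "z * lag_psi a (Suc n) z = of_real (2 * real n + 3 + a) * lag_psi a (Suc n) z
   - of_real (real n + 2) * lag_psi a (Suc (Suc n)) z - of_real (real n + 1 + a) * lag_psi a n z"
proof -
 have "z * lag_psi a (Suc n) z = (LINT x|lagM a. poly (lagpoly a (Suc n) * [:0, 1:]) (cx x) / (cx x - z))"
  using lag_psi_mult[OF assms, of "[:0, 1:]" "Suc n"] by simp
 also have "lagpoly a (Suc n) * [:0, 1:] = smult (of_real (2 * real n + 3 + a)) (lagpoly a (Suc n))
   - smult (of_real (real n + 2)) (lagpoly a (Suc (Suc n)))
   - smult (of_real (real n + 1 + a)) (lagpoly a n :: complex poly)"
  unfolding lagpoly_three_term[symmetric] by simp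
 also have "(LINT x|lagM a. poly (smult (of_real (2 * real n + 3 + a)) (lagpoly a (Suc n))
   - smult (of_real (real n + 2)) (lagpoly a (Suc (Suc n)))
   - smult (of_real (real n + 1 + a)) (lagpoly a n :: complex poly)) (cx x) / (cx x - z))
  = (LINT x|lagM a. of_real (2 * real n + 3 + a) * (poly (lagpoly a (Suc n)) (cx x) / (cx x - z))
   - of_real (real n + 2) * (poly (lagpoly a (Suc (Suc n))) (cx x) / (cx x - z))
   - of_real (real n + 1 + a) * (poly (lagpoly a n) (cx x) / (cx x - z)))"
  by (simp only: poly_diff poly_smult diff_divide_distrib times_divide_eq_right)
 also have "\<dots> = of_real (2 * real n + 3 + a) * lag_psi a (Suc n) z
   - of_real (real n + 2) * lag_psi a (Suc (Suc n)) z - of_real (real n + 1 + a) * lag_psi a n z"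
  unfolding lag_psi_def
  by (subst Bochner_Integration.integral_diff
     | intro integrable_mult_right Bochner_Integration.integrable_diff integrable_lagM_poly_divide assms
     | simp only: integral_mult_right_zero)+
 finally show ?thesis .
qed

text \<open>The Casoratian of two solutions of one three-term recurrence changes by a known factor in each step.\<close>

lemma lag_casoratian:
 assumes "a > -1" "z \<in> off_ray"
 shows "of_real (real n + 1) * (lag_psi a n z * poly (lagpoly a (Suc n)) z - lag_psi a (Suc n) z * poly (lagpoly a n) z)
   = of_real (lag_h a n)"
proof (induction n)
 case 0
 have "(LINT x|lagM a. poly (lagpoly a (Suc 0)) z * (poly (lagpoly a 0) (cx x) / (cx x - z))
   - poly (lagpoly a (Suc 0)) (cx x) / (cx x - z)) = (LINT x|lagM a. poly 1 (cx x))"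
 proof (rule lint_cong)
  fix x assume "x \<in> space (lagM a)"
  then have nz: "cx x - z \<noteq> 0" using off_ray_diff_nonzero[OF assms(2)] by simp
  then show "poly (lagpoly a (Suc 0)) z * (poly (lagpoly a 0) (cx x) / (cx x - z))
   - poly (lagpoly a (Suc 0)) (cx x) / (cx x - z) = poly 1 (cx x)"
   by (simp add: lagpoly_Suc_0 divide_simps)
 qed
 moreover have "(LINT x|lagM a. poly 1 (cx x)) = of_real (lag_h a 0)"
  using lagint_lagpoly_square[OF assms(1), of 0] by (simp add: lagint_def)
 moreover have "(LINT x|lagM a. poly (lagpoly a (Suc 0)) z * (poly (lagpoly a 0) (cx x) / (cx x - z))
   - poly (lagpoly a (Suc 0)) (cx x) / (cx x - z))
   = poly (lagpoly a (Suc 0)) z * lag_psi a 0 z - lag_psi a (Suc 0) z"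
  unfolding lag_psi_def
  by (subst Bochner_Integration.integral_diff)
    (intro integrable_mult_right integrable_lagM_poly_divide assms | simp only: integral_mult_right_zero)+
 ultimately show ?case by (simp add: mult.commute)
next
 case (Suc n)
 let ?L = "\<lambda>n. poly (lagpoly a n) z" and ?P = "\<lambda>n. lag_psi a n z"
 let ?d = "cx (2 * real n + 3 + a)" and ?b = "cx (real n + 2)" and ?c = "cx (real n + 1 + a)"
 have L: "?b * ?L (Suc (Suc n)) = (?d - z) * ?L (Suc n) - ?c * ?L n"
  using arg_cong[OF lagpoly_three_term[of a n, where ?'a = complex], of "\<lambda>p. poly p z"] by (simp add: algebra_simps)
 have P: "?b * ?P (Suc (Suc n)) = (?d - z) * ?P (Suc n) - ?c * ?P n"
  using lag_psi_three_term[OF assms, of n] by (simp add: algebra_simps)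
 have "?b * (?P (Suc n) * ?L (Suc (Suc n)) - ?P (Suc (Suc n)) * ?L (Suc n))
   = ?P (Suc n) * (?b * ?L (Suc (Suc n))) - (?b * ?P (Suc (Suc n))) * ?L (Suc n)"
  by (simp add: algebra_simps)
 also have "\<dots> = ?c * (?P n * ?L (Suc n) - ?P (Suc n) * ?L n)"
  unfolding L P by (simp add: algebra_simps)
 finally have "of_real (real n + 1) * (?b * (?P (Suc n) * ?L (Suc (Suc n)) - ?P (Suc (Suc n)) * ?L (Suc n)))
   = ?c * of_real (lag_h a n)"
  unfolding Suc.IH[symmetric] by simp
 moreover have "of_real (real n + 1) * of_real (lag_h a (Suc n)) = ?c * cx (lag_h a n)"
  unfolding of_real_mult[symmetric] of_real_eq_iff using lag_h_Suc[OF assms(1), of n] by (simp add: add_ac)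
 ultimately have "of_real (real n + 1) * (?b * (?P (Suc n) * ?L (Suc (Suc n)) - ?P (Suc (Suc n)) * ?L (Suc n)))
   = of_real (real n + 1) * cx (lag_h a (Suc n))" by simp
 moreover have "cx (real n + 1) \<noteq> 0" unfolding of_real_eq_0_iff by simp
 ultimately have "?b * (?P (Suc n) * ?L (Suc (Suc n)) - ?P (Suc (Suc n)) * ?L (Suc n)) = of_real (lag_h a (Suc n))"
  by (metis mult_left_cancel)
 then show ?case by (simp add: add_ac)
qed

lemma cauchy_transform_eq:
 assumes "a > -1" "z \<in> off_ray"
 shows "cauchy_transform a n z = - lag_psi a n z / (2 * of_real pi * \<i>)"
proof -
 let ?g = "\<lambda>x. poly (lagpoly a n) (cx x) / (cx x - z)"
 have meas: "?g \<in> borel_measurable (lagM a)"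
  using integrable_lagM_poly_divide[OF assms] by (rule borel_measurable_integrable)
 have "(LINT x:{0..}|lborel. cx (weight a x) * laguerre a n (cx x) / (z - cx x))
   = (LINT x:{0..}|lborel. cx (weight a x) * (- ?g x))"
  by (rule set_lebesgue_integral_cong)
    (auto simp: laguerre_eq_poly[OF assms(1)] minus_divide_right[symmetric] minus_divide_right)
 also have "\<dots> = (LINT x|lagM a. - ?g x)"
  by (rule integral_lagM_complex) (use meas in simp)
 also have "\<dots> = - lag_psi a n z" by (simp add: lag_psi_def)
 finally show ?thesis unfolding cauchy_transform_def by simp
qed

subsection \<open>Asymptotics\<close>

text \<open>Summing the Casoratian identity divided by \<open>L\<^sub>n L\<^sub>n\<^sub>+\<^sub>1\<close> expresses \<open>\<psi>\<^sub>n / L\<^sub>n\<close> as the tail of a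
 series whose terms are known asymptotically.  The following lemma compares two such tails.\<close>

lemma telescoping_comparison:
 fixes e d :: "nat \<Rightarrow> complex"
 assumes K: "K > 0" and e0: "e \<longlonglongrightarrow> 0" and d0: "d \<longlonglongrightarrow> 0"
  and ratio: "(\<lambda>n. (e n - e (Suc n)) / (d n - d (Suc n))) \<longlonglongrightarrow> 1"
  and nz: "\<And>n. d n \<noteq> 0"
  and steps: "\<forall>\<^sub>F n in sequentially. d n \<noteq> d (Suc n) \<and> norm (d n - d (Suc n)) \<le> K * (norm (d n) - norm (d (Suc n)))"
 shows "(\<lambda>n. e n / d n) \<longlonglongrightarrow> 1"
proof -
 have "\<forall>\<^sub>F n in sequentially. norm (e n / d n - 1) < \<epsilon>" if \<epsilon>: "\<epsilon> > 0" for \<epsilon>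
 proof -
  define \<eta> where "\<eta> = \<epsilon> / (2 * K)"
  have \<eta>: "\<eta> > 0" "\<eta> * K < \<epsilon>" using \<epsilon> K by (auto simp: \<eta>_def)
  have "\<forall>\<^sub>F n in sequentially. norm ((e n - e (Suc n)) / (d n - d (Suc n)) - 1) < \<eta>"
   using ratio \<eta>(1) by (auto simp: tendsto_iff dist_norm)
  then have "\<forall>\<^sub>F n in sequentially. norm ((e n - d n) - (e (Suc n) - d (Suc n))) \<le> \<eta> * K * (norm (d n) - norm (d (Suc n)))"
   using steps
  proof eventually_elim
   case (elim n)
   have dd: "d n - d (Suc n) \<noteq> 0" using elim by simp
   have "(e n - d n) - (e (Suc n) - d (Suc n)) = ((e n - e (Suc n)) / (d n - d (Suc n)) - 1) * (d n - d (Suc n))"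
    using dd by (simp add: field_simps)
   then have "norm ((e n - d n) - (e (Suc n) - d (Suc n))) \<le> \<eta> * norm (d n - d (Suc n))"
    using elim by (simp add: norm_mult mult_right_mono less_imp_le)
   also have "\<dots> \<le> \<eta> * (K * (norm (d n) - norm (d (Suc n))))"
    using elim \<eta> by (intro mult_left_mono) auto
   finally show ?case by (simp add: mult.assoc)
  qed
  then obtain N where N: "\<And>n. n \<ge> N \<Longrightarrow> norm ((e n - d n) - (e (Suc n) - d (Suc n))) \<le> \<eta> * K * (norm (d n) - norm (d (Suc n)))"
   by (auto simp: eventually_at_top_linorder)
  \<comment> \<open>the increments of \<open>e - d\<close> are dominated by those of \<open>|d|\<close>, and both sequences tend to zero\<close>
  have tail: "norm (e n - d n) \<le> \<eta> * K * norm (d n)" if n: "n \<ge> N" for n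
  proof -
   have "norm (e n - d n) \<le> norm (e (m + n) - d (m + n)) + \<eta> * K * (norm (d n) - norm (d (m + n)))" for m
   proof (induction m)
    case (Suc m)
    have "norm (e (m + n) - d (m + n)) \<le> norm (e (Suc (m + n)) - d (Suc (m + n))) + norm ((e (m + n) - d (m + n)) - (e (Suc (m + n)) - d (Suc (m + n))))"
     using norm_triangle_ineq[of "e (Suc (m + n)) - d (Suc (m + n))" "(e (m + n) - d (m + n)) - (e (Suc (m + n)) - d (Suc (m + n)))"] by simp
    with Suc.IH N[of "m + n"] n show ?case by (simp add: algebra_simps)
   qed simp
   moreover have "(\<lambda>m. norm (e (m + n) - d (m + n)) + \<eta> * K * (norm (d n) - norm (d (m + n)))) \<longlonglongrightarrow> norm (0 - 0 :: complex) + \<eta> * K * (norm (d n) - norm (0 :: complex))"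
    by (intro tendsto_intros LIMSEQ_ignore_initial_segment e0 d0)
   ultimately have "norm (e n - d n) \<le> norm (0 - 0 :: complex) + \<eta> * K * (norm (d n) - norm (0 :: complex))"
    by (intro tendsto_lowerbound[where F = sequentially]) auto
   then show ?thesis by simp
  qed
  have "norm (e n / d n - 1) < \<epsilon>" if n: "n \<ge> N" for n
  proof -
   have "e n / d n - 1 = (e n - d n) / d n" using nz[of n] by (simp add: field_simps)
   then have "norm (e n / d n - 1) \<le> \<eta> * K"
    using tail[OF n] nz[of n] by (simp add: norm_divide field_simps)
   with \<eta> show ?thesis by simp
  qed
  then show ?thesis by (auto simp: eventually_at_top_linorder)
 qed
 then show ?thesis by (simp add: tendsto_iff dist_norm)
qed

lemma lag_lim_nonzero: "lag_lim a w \<noteq> 0"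
 by (simp add: lag_lim_def)

lemma lag_psi_times_lagpoly_le:
 assumes "a > -1" "z \<in> off_ray" "\<delta> > 0" "\<And>x. x \<ge> 0 \<Longrightarrow> norm (cx x - z) \<ge> \<delta>"
 shows "norm (poly (lagpoly a n) z * lag_psi a n z) \<le> lag_h a n / \<delta>"
proof -
 have "integrable (lagM a) (\<lambda>x. cx ((poly (lagpoly a n) x)\<^sup>2))"
  using integrable_lagM_poly[OF assms(1), of "lagpoly a n * lagpoly a n"]
  by (simp add: poly_lagpoly_of_real power2_eq_square)
 then have int: "integrable (lagM a) (\<lambda>x. (poly (lagpoly a n) x)\<^sup>2)"
  unfolding complex_of_real_integrable_eq .
 have "cx (LINT x|lagM a. (poly (lagpoly a n) x)\<^sup>2) = of_real (lag_h a n)"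
  unfolding lagint_lagpoly_square[OF assms(1), symmetric] lagint_def integral_complex_of_real[symmetric]
  by (simp add: poly_lagpoly_of_real power2_eq_square)
 then have val: "(LINT x|lagM a. (poly (lagpoly a n) x)\<^sup>2) = lag_h a n" by (simp only: of_real_eq_iff)
 have "norm (poly (lagpoly a n) z * lag_psi a n z) \<le> (LINT x|lagM a. (poly (lagpoly a n) x)\<^sup>2 / \<delta>)"
  unfolding lag_psi_times_lagpoly[OF assms(1,2)]
 proof (rule Bochner_Integration.integral_norm_bound_integral)
  show "integrable (lagM a) (\<lambda>x. (poly (lagpoly a n) x)\<^sup>2 / \<delta>)" using int by simp
  show "integrable (lagM a) (\<lambda>x. of_real ((poly (lagpoly a n) x)\<^sup>2) / (cx x - z))"
   using integrable_lagM_poly_divide[OF assms(1,2), of "lagpoly a n * lagpoly a n"]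
   by (simp add: poly_lagpoly_of_real power2_eq_square)
  fix x assume "x \<in> space (lagM a)"
  then have "norm (cx x - z) \<ge> \<delta>" using assms(4) by simp
  then show "norm (of_real ((poly (lagpoly a n) x)\<^sup>2) / (cx x - z)) \<le> (poly (lagpoly a n) x)\<^sup>2 / \<delta>"
   using assms(3) unfolding norm_divide norm_of_real
   by (intro frac_le) auto
 qed
 then show ?thesis using val by simp
qed

text \<open>By the Casoratian identity the increments of \<open>\<psi>\<^sub>n / L\<^sub>n\<close> are \<open>h\<^sub>n / ((n + 1) L\<^sub>n L\<^sub>n\<^sub>+\<^sub>1)\<close>, which Perron's formula
 shows to be asymptotic to those of the claimed limit.\<close>

lemma lag_ratio_psi_asymp:
 assumes "a > -1" "Re w > 0"
 shows "(\<lambda>n. (lag_psi a n (- (w\<^sup>2)) / poly (lagpoly a n) (- (w\<^sup>2)))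
   / (exp (- 4 * of_real (sqrt n) * w) / (2 * w * (lag_lim a w)\<^sup>2))) \<longlonglongrightarrow> 1"
proof -
 define z where "z = - (w\<^sup>2)"
 define \<kappa> where "\<kappa> = lag_lim a w"
 have z: "z \<in> off_ray" unfolding z_def by (rule neg_square_off_ray[OF assms(2)])
 have w0: "w \<noteq> 0" using assms(2) by auto
 have \<kappa>0: "\<kappa> \<noteq> 0" by (simp add: \<kappa>_def lag_lim_nonzero)
 define L where "L n = poly (lagpoly a n) z" for n
 have L0: "L n \<noteq> 0" for n unfolding L_def by (rule lagpoly_off_ray_nonzero[OF assms(1) z])
 define l where "l n = L n * exp (- 2 * of_real (sqrt n) * w) * of_real (real n powr (1 / 4 - a / 2))" for n
 have l: "l \<longlonglongrightarrow> \<kappa>" unfolding l_def L_def z_def \<kappa>_def by (rule lagpoly_asymp[OF assms])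
 define e where "e n = lag_psi a n z / L n" for n
 define d where "d n = exp (- 4 * of_real (sqrt n) * w) / (2 * w * \<kappa>\<^sup>2)" for n
 \<comment> \<open>\<open>d\<close> is the claimed asymptotic form; passing from \<open>n\<close> to \<open>n + 1\<close> multiplies it by \<open>exp (- 4 w \<delta>\<^sub>n)\<close>\<close>
 define \<delta> where "\<delta> n = sqrt (Suc n) - sqrt n" for n
 have \<delta>pos: "\<delta> n > 0" for n by (simp add: \<delta>_def)
 have \<delta>0: "\<delta> \<longlonglongrightarrow> 0" unfolding \<delta>_def by real_asymp
 have \<delta>h: "(\<lambda>n. sqrt n * \<delta> n) \<longlonglongrightarrow> 1 / 2" unfolding \<delta>_def by real_asymp
 have expo: "(\<lambda>n. (1 - exp (- 4 * v * of_real (\<delta> n))) / of_real (\<delta> n)) \<longlonglongrightarrow> 4 * v" if "v \<noteq> 0" for v :: complex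
 proof -
  have "filterlim (\<lambda>n. - 4 * v * of_real (\<delta> n)) (at 0) sequentially"
   unfolding filterlim_at using that \<delta>pos \<delta>0 by (auto intro!: tendsto_eq_intros always_eventually simp: less_imp_neq[THEN not_sym])
  then have "(\<lambda>n. (exp (- 4 * v * of_real (\<delta> n)) - 1) / (- 4 * v * of_real (\<delta> n))) \<longlonglongrightarrow> 1"
   by (rule filterlim_compose[OF lim_exp_minus_1])
  then have "(\<lambda>n. 4 * v * ((exp (- 4 * v * of_real (\<delta> n)) - 1) / (- 4 * v * of_real (\<delta> n)))) \<longlonglongrightarrow> 4 * v * 1"
   by (intro tendsto_mult tendsto_const)
  moreover have "4 * v * ((exp (- 4 * v * of_real (\<delta> n)) - 1) / (- 4 * v * of_real (\<delta> n))) = (1 - exp (- 4 * v * of_real (\<delta> n))) / of_real (\<delta> n)" for n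
   using that \<delta>pos[of n] by (simp add: divide_simps)
  ultimately show ?thesis by simp
 qed
 have dd: "d n - d (Suc n) = d n * (1 - exp (- 4 * w * of_real (\<delta> n)))" for n
 proof -
  have "exp (- 4 * of_real (sqrt (Suc n)) * w) = exp (- 4 * of_real (sqrt n) * w) * exp (- 4 * w * of_real (\<delta> n))"
   unfolding \<delta>_def exp_add[symmetric] by (simp add: algebra_simps)
  then show ?thesis by (simp add: d_def algebra_simps diff_divide_distrib)
 qed
 have nd: "norm (d n) - norm (d (Suc n)) = norm (d n) * (1 - exp (- 4 * Re w * \<delta> n))" for n
 proof -
  have "norm (d (Suc n)) = norm (d n) * norm (exp (- 4 * w * of_real (\<delta> n)))"
  proof -
   have "d (Suc n) = d n * exp (- 4 * w * of_real (\<delta> n))" using dd[of n] by (simp add: algebra_simps)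
   then show ?thesis by (simp only: norm_mult)
  qed
  then show ?thesis by (simp add: algebra_simps)
 qed
 have "(\<lambda>n. e n / d n) \<longlonglongrightarrow> 1"
 proof (rule telescoping_comparison)
  \<comment> \<open>\<open>|1 - exp (- 4 w \<delta>)| \<approx> 4 |w| \<delta>\<close> and \<open>1 - exp (- 4 \<delta> Re w) \<approx> 4 \<delta> Re w\<close>; the numbers \<open>5\<close> and \<open>3\<close> leave room\<close>
  show "5 * norm w / (3 * Re w) > 0" using assms(2) w0 by simp
  show "d n \<noteq> 0" for n using w0 \<kappa>0 by (simp add: d_def)
  show "d \<longlonglongrightarrow> 0"
  proof (rule tendsto_norm_zero_cancel)
   have "(\<lambda>n. exp (- 4 * sqrt n * Re w)) \<longlonglongrightarrow> 0" using assms(2) by real_asymp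
   then have "(\<lambda>n. exp (- 4 * sqrt n * Re w) / norm (2 * w * \<kappa>\<^sup>2)) \<longlonglongrightarrow> 0 / norm (2 * w * \<kappa>\<^sup>2)"
    by (intro tendsto_divide tendsto_const) (use w0 \<kappa>0 in auto)
   then show "(\<lambda>n. norm (d n)) \<longlonglongrightarrow> 0"
    unfolding d_def norm_divide norm_exp_eq_Re by simp
  qed
  show "e \<longlonglongrightarrow> 0"
  proof -
   obtain r where r: "r > 0" "\<And>x. x \<ge> 0 \<Longrightarrow> norm (cx x - z) \<ge> r"
    by (rule off_ray_dist[OF z]) blast
   have lim: "(\<lambda>n. (lag_h a n * real n powr (- a)) * (sqrt n * exp (- 4 * sqrt n * Re w)) / (r * norm (l n) ^ 2)) \<longlonglongrightarrow> 1 * 0 / (r * norm \<kappa> ^ 2)"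
   proof (intro tendsto_divide tendsto_mult lag_h_asymp assms tendsto_const tendsto_power tendsto_norm l)
    show "(\<lambda>n. sqrt n * exp (- 4 * sqrt n * Re w)) \<longlonglongrightarrow> 0" using assms(2) by real_asymp
   qed (use r \<kappa>0 in auto)
   have ev: "\<forall>\<^sub>F n in sequentially. norm (e n) \<le> (lag_h a n * real n powr (- a)) * (sqrt n * exp (- 4 * sqrt n * Re w)) / (r * norm (l n) ^ 2)"
    using eventually_gt_at_top[of 0]
   proof eventually_elim
    case (elim n)
    have n: "real n > 0" using elim by simp
    have ln: "norm (l n) ^ 2 = norm (L n) ^ 2 * exp (- 4 * sqrt n * Re w) * (real n powr (- a) * sqrt n)"
    proof -
     have "norm (l n) = norm (L n) * exp (- 2 * sqrt n * Re w) * real n powr (1 / 4 - a / 2)"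
      by (simp add: l_def norm_mult)
     moreover have "(exp (- 2 * sqrt n * Re w))\<^sup>2 = exp (- 4 * sqrt n * Re w)"
      by (simp add: power2_eq_square flip: exp_add)
     moreover have "(real n powr (1 / 4 - a / 2))\<^sup>2 = real n powr (- a) * sqrt n"
      using n by (simp add: power2_eq_square powr_half_sqrt[symmetric] flip: powr_add)
     ultimately show ?thesis by (simp add: power_mult_distrib)
    qed
    have "e n = (L n * lag_psi a n z) / (L n)\<^sup>2" using L0[of n] by (simp add: e_def power2_eq_square)
    then have "norm (e n) = norm (L n * lag_psi a n z) / norm (L n) ^ 2" by (simp add: norm_divide norm_power)
    also have "\<dots> \<le> (lag_h a n / r) / norm (L n) ^ 2"
     unfolding L_def by (intro divide_right_mono lag_psi_times_lagpoly_le assms z r) auto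
    also have "\<dots> = (lag_h a n * real n powr (- a)) * (sqrt n * exp (- 4 * sqrt n * Re w)) / (r * norm (l n) ^ 2)"
     unfolding ln using n by simp
    finally show ?case .
   qed
   show ?thesis by (rule Lim_null_comparison[OF ev]) (use lim in simp)
  qed
  show "\<forall>\<^sub>F n in sequentially. d n \<noteq> d (Suc n) \<and> norm (d n - d (Suc n)) \<le> 5 * norm w / (3 * Re w) * (norm (d n) - norm (d (Suc n)))"
  proof -
   have "(\<lambda>n. norm ((1 - exp (- 4 * w * of_real (\<delta> n))) / of_real (\<delta> n))) \<longlonglongrightarrow> norm (4 * w)"
    by (intro tendsto_norm expo w0)
   then have l1: "(\<lambda>n. norm (1 - exp (- 4 * w * of_real (\<delta> n))) / \<delta> n) \<longlonglongrightarrow> 4 * norm w"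
    using \<delta>pos by (simp add: norm_divide norm_mult abs_of_pos)
   have A: "(\<lambda>n. Re ((1 - exp (- 4 * of_real (Re w) * of_real (\<delta> n))) / of_real (\<delta> n))) \<longlonglongrightarrow> Re (4 * of_real (Re w))"
    by (intro tendsto_Re expo) (use assms in auto)
   have B: "Re ((1 - exp (- 4 * of_real (Re w) * of_real (\<delta> n))) / of_real (\<delta> n)) = (1 - exp (- 4 * Re w * \<delta> n)) / \<delta> n" for n
   proof -
    have "(1 - exp (- 4 * of_real (Re w) * of_real (\<delta> n))) / of_real (\<delta> n) = cx ((1 - exp (- 4 * Re w * \<delta> n)) / \<delta> n)"
     by (simp add: exp_of_real[symmetric])
    then show ?thesis by (simp only: Re_complex_of_real)
   qed
   have l2: "(\<lambda>n. (1 - exp (- 4 * Re w * \<delta> n)) / \<delta> n) \<longlonglongrightarrow> 4 * Re w"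
    using A unfolding B by simp
   have "\<forall>\<^sub>F n in sequentially. norm (1 - exp (- 4 * w * of_real (\<delta> n))) / \<delta> n < 5 * norm w"
    "\<forall>\<^sub>F n in sequentially. norm (1 - exp (- 4 * w * of_real (\<delta> n))) / \<delta> n > 0"
    "\<forall>\<^sub>F n in sequentially. (1 - exp (- 4 * Re w * \<delta> n)) / \<delta> n > 3 * Re w"
    using w0 assms(2) by (intro order_tendstoD[OF l1] order_tendstoD[OF l2]; simp)+
   then show ?thesis
   proof eventually_elim
    case (elim n)
    have dn: "d n \<noteq> 0" using w0 \<kappa>0 by (simp add: d_def)
    have g: "norm (1 - exp (- 4 * w * of_real (\<delta> n))) \<le> 5 * norm w * \<delta> n"
     using elim(1) \<delta>pos[of n] by (simp add: field_simps)
    have b: "3 * Re w * \<delta> n \<le> 1 - exp (- 4 * Re w * \<delta> n)"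
     using elim(3) \<delta>pos[of n] by (simp add: field_simps)
    have "5 * norm w * \<delta> n = 5 * norm w / (3 * Re w) * (3 * Re w * \<delta> n)" using assms(2) by simp
    also have "\<dots> \<le> 5 * norm w / (3 * Re w) * (1 - exp (- 4 * Re w * \<delta> n))"
     using assms(2) by (intro mult_left_mono b) auto
    finally have "norm (1 - exp (- 4 * w * of_real (\<delta> n))) \<le> 5 * norm w / (3 * Re w) * (1 - exp (- 4 * Re w * \<delta> n))"
     using g by linarith
    then have "norm (d n) * norm (1 - exp (- 4 * w * of_real (\<delta> n))) \<le> norm (d n) * (5 * norm w / (3 * Re w) * (1 - exp (- 4 * Re w * \<delta> n)))"
     by (rule mult_left_mono) simp
    then have "norm (d n - d (Suc n)) \<le> 5 * norm w / (3 * Re w) * (norm (d n) - norm (d (Suc n)))"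
     unfolding dd nd norm_mult by (simp add: mult_ac)
    moreover have "norm (1 - exp (- 4 * w * of_real (\<delta> n))) > 0"
     using elim(2) \<delta>pos[of n] by (simp only: zero_less_divide_iff) auto
    then have "d n - d (Suc n) \<noteq> 0" unfolding dd using dn by simp
    ultimately show ?case by simp
   qed
  qed
  show "(\<lambda>n. (e n - e (Suc n)) / (d n - d (Suc n))) \<longlonglongrightarrow> 1"
  proof -
   have x1: "(\<lambda>n. of_real (sqrt n * \<delta> n) * ((1 - exp (- 4 * w * of_real (\<delta> n))) / of_real (\<delta> n))) \<longlonglongrightarrow> of_real (1 / 2) * (4 * w)"
    by (intro tendsto_mult tendsto_of_real \<delta>h expo w0)
   have x2: "(\<lambda>n. exp (- 2 * w * of_real (\<delta> n))) \<longlonglongrightarrow> exp (- 2 * w * of_real 0)"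
    by (intro tendsto_intros \<delta>0)
   have "(\<lambda>n. (real n / real (Suc n)) powr (a / 2 + 3 / 4)) \<longlonglongrightarrow> 1 powr (a / 2 + 3 / 4)"
   proof (rule tendsto_powr)
    show "(\<lambda>n. real n / real (Suc n)) \<longlonglongrightarrow> 1" by real_asymp
   qed auto
   then have "(\<lambda>n. of_real (lag_h a n * real n powr (- a)) * (\<kappa>\<^sup>2 / (l n * l (Suc n))) * of_real ((real n / real (Suc n)) powr (a / 2 + 3 / 4))
     * (exp (- 2 * w * of_real (\<delta> n)) * (2 * w) / (of_real (sqrt n * \<delta> n) * ((1 - exp (- 4 * w * of_real (\<delta> n))) / of_real (\<delta> n)))))
    \<longlonglongrightarrow> of_real 1 * (\<kappa>\<^sup>2 / (\<kappa> * \<kappa>)) * of_real (1 powr (a / 2 + 3 / 4)) * (exp (- 2 * w * of_real 0) * (2 * w) / (of_real (1 / 2) * (4 * w)))"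
    by (intro tendsto_mult tendsto_divide tendsto_of_real lag_h_asymp assms tendsto_const l LIMSEQ_Suc[OF l] x1 x2) (use \<kappa>0 w0 in auto)
   also have "of_real 1 * (\<kappa>\<^sup>2 / (\<kappa> * \<kappa>)) * of_real (1 powr (a / 2 + 3 / 4)) * (exp (- 2 * w * of_real 0) * (2 * w) / (of_real (1 / 2) * (4 * w))) = (1 :: complex)"
    using \<kappa>0 w0 by (simp add: power2_eq_square)
   finally have lim: "(\<lambda>n. of_real (lag_h a n * real n powr (- a)) * (\<kappa>\<^sup>2 / (l n * l (Suc n))) * of_real ((real n / real (Suc n)) powr (a / 2 + 3 / 4))
     * (exp (- 2 * w * of_real (\<delta> n)) * (2 * w) / (of_real (sqrt n * \<delta> n) * ((1 - exp (- 4 * w * of_real (\<delta> n))) / of_real (\<delta> n))))) \<longlonglongrightarrow> 1" .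
   have "\<forall>\<^sub>F n in sequentially. of_real (lag_h a n * real n powr (- a)) * (\<kappa>\<^sup>2 / (l n * l (Suc n))) * of_real ((real n / real (Suc n)) powr (a / 2 + 3 / 4))
     * (exp (- 2 * w * of_real (\<delta> n)) * (2 * w) / (of_real (sqrt n * \<delta> n) * ((1 - exp (- 4 * w * of_real (\<delta> n))) / of_real (\<delta> n))))
    = (e n - e (Suc n)) / (d n - d (Suc n))"
    using eventually_gt_at_top[of 0]
   proof eventually_elim
    case (elim n)
    define q where "q = real (Suc n)"
    have n: "real n > 0" and q: "q > 0" using elim by (auto simp: q_def)
    define E where "E = exp (- 2 * w * of_real (\<delta> n))"
    define X where "X = exp (- 2 * of_real (sqrt n) * w)"
    have X2: "exp (- 2 * of_real (sqrt (Suc n)) * w) = X * E"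
     unfolding X_def E_def \<delta>_def exp_add[symmetric] by (simp add: algebra_simps)
    have X4: "exp (- 4 * of_real (sqrt n) * w) = X * X"
     unfolding X_def exp_add[symmetric] by (simp add: algebra_simps)
    have nz: "X \<noteq> 0" "E \<noteq> 0" by (simp_all add: X_def E_def)
    have cas: "e n - e (Suc n) = of_real (lag_h a n) / (of_real q * (L n * L (Suc n)))"
    proof -
     have "of_real q * (lag_psi a n z * L (Suc n) - lag_psi a (Suc n) z * L n) = of_real (lag_h a n)"
      using lag_casoratian[OF assms(1) z, of n] by (simp add: q_def L_def add_ac)
     then show ?thesis
      using L0[of n] L0[of "Suc n"] q unfolding e_def
      by (simp add: divide_simps mult_ac)
    qed
    have ll: "l n * l (Suc n) = L n * L (Suc n) * (X * (X * E)) * of_real (real n powr (1 / 4 - a / 2) * q powr (1 / 4 - a / 2))"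
     unfolding l_def X2 X_def[symmetric] unfolding q_def[symmetric] by simp
    have pw: "real n powr (- a) * (real n / q) powr (a / 2 + 3 / 4) / (real n powr (1 / 4 - a / 2) * q powr (1 / 4 - a / 2)) / sqrt n = 1 / q"
    proof -
     have "real n powr (- a) * (real n / q) powr (a / 2 + 3 / 4) / (real n powr (1 / 4 - a / 2) * q powr (1 / 4 - a / 2)) / sqrt n
       = exp (- a * ln n + (a / 2 + 3 / 4) * (ln n - ln q) - ((1 / 4 - a / 2) * ln n + (1 / 4 - a / 2) * ln q) - 1 / 2 * ln n)"
      using n q by (simp add: powr_def powr_half_sqrt[symmetric] ln_div exp_add exp_diff)
       (simp add: exp_minus inverse_eq_divide)
     also have "\<dots> = exp (- ln q)" by (rule arg_cong[where f = exp]) (simp add: field_simps)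
     also have "\<dots> = 1 / q" using q by (simp add: exp_minus inverse_eq_divide)
     finally show ?thesis .
    qed
    define Y where "Y = 1 - exp (- 4 * w * of_real (\<delta> n))"
    have "of_real (lag_h a n * real n powr (- a)) * (\<kappa>\<^sup>2 / (l n * l (Suc n))) * of_real ((real n / real (Suc n)) powr (a / 2 + 3 / 4))
     * (exp (- 2 * w * of_real (\<delta> n)) * (2 * w) / (of_real (sqrt n * \<delta> n) * ((1 - exp (- 4 * w * of_real (\<delta> n))) / of_real (\<delta> n))))
     = of_real (lag_h a n) * of_real (real n powr (- a) * (real n / q) powr (a / 2 + 3 / 4) / (real n powr (1 / 4 - a / 2) * q powr (1 / 4 - a / 2)) / sqrt n)
      * (\<kappa>\<^sup>2 * (2 * w)) / (L n * L (Suc n) * (X * X) * Y)"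
     unfolding ll q_def[symmetric] E_def[symmetric] Y_def[symmetric]
     using nz \<delta>pos[of n] by (simp add: mult_ac)
    also have "\<dots> = (e n - e (Suc n)) / (d n - d (Suc n))"
     unfolding pw cas dd Y_def[symmetric] unfolding d_def X4
     using q w0 \<kappa>0 by (simp add: field_simps)
    finally show ?case .
   qed
   from Lim_transform_eventually[OF lim this] show ?thesis .
  qed
 qed
 then show ?thesis unfolding e_def d_def L_def z_def \<kappa>_def .
qed

theorem lag_psi_asymp:
 assumes "a > -1" "Re w > 0"
 shows "(\<lambda>n. lag_psi a n (- (w\<^sup>2)) * exp (2 * of_real (sqrt n) * w) * of_real (real n powr (1 / 4 - a / 2)))
  \<longlonglongrightarrow> 1 / (2 * w * lag_lim a w)"
proof -
 define z where "z = - (w\<^sup>2)"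
 define \<kappa> where "\<kappa> = lag_lim a w"
 have z: "z \<in> off_ray" unfolding z_def by (rule neg_square_off_ray[OF assms(2)])
 have w0: "w \<noteq> 0" using assms(2) by auto
 have \<kappa>0: "\<kappa> \<noteq> 0" by (simp add: \<kappa>_def lag_lim_nonzero)
 define D where "D n = exp (- 4 * of_real (sqrt n) * w) / (2 * w * \<kappa>\<^sup>2)" for n :: nat
 have "(\<lambda>n. (lag_psi a n z / poly (lagpoly a n) z / D n) *
    (poly (lagpoly a n) z * exp (- 2 * of_real (sqrt n) * w) * of_real (real n powr (1 / 4 - a / 2))) / (2 * w * \<kappa>\<^sup>2))
   \<longlonglongrightarrow> 1 * \<kappa> / (2 * w * \<kappa>\<^sup>2)"
  unfolding z_def \<kappa>_def D_def
  by (intro tendsto_mult tendsto_divide tendsto_const lag_ratio_psi_asymp lagpoly_asymp assms)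
    (use w0 in \<open>auto simp: lag_lim_nonzero\<close>)
 also have "1 * \<kappa> / (2 * w * \<kappa>\<^sup>2) = 1 / (2 * w * \<kappa>)" using \<kappa>0 by (simp add: power2_eq_square)
 also have "(\<lambda>n. (lag_psi a n z / poly (lagpoly a n) z / D n) *
    (poly (lagpoly a n) z * exp (- 2 * of_real (sqrt n) * w) * of_real (real n powr (1 / 4 - a / 2))) / (2 * w * \<kappa>\<^sup>2))
   = (\<lambda>n. lag_psi a n z * exp (2 * of_real (sqrt n) * w) * of_real (real n powr (1 / 4 - a / 2)))"
 proof
  fix n :: nat
  have X: "exp (- 2 * of_real (sqrt n) * w) = exp (2 * of_real (sqrt n) * w) * exp (- 4 * of_real (sqrt n) * w)"
   unfolding exp_add[symmetric] by (simp add: algebra_simps)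
  show "(lag_psi a n z / poly (lagpoly a n) z / D n) *
    (poly (lagpoly a n) z * exp (- 2 * of_real (sqrt n) * w) * of_real (real n powr (1 / 4 - a / 2))) / (2 * w * \<kappa>\<^sup>2)
    = lag_psi a n z * exp (2 * of_real (sqrt n) * w) * of_real (real n powr (1 / 4 - a / 2))"
   unfolding X D_def using w0 \<kappa>0 lagpoly_off_ray_nonzero[OF assms(1) z, of n] by simp
 qed
 finally show ?thesis unfolding z_def \<kappa>_def .
qed

section \<open>A uniform bound on the half-line\<close>

context
 fixes r :: real
begin

text \<open>The coefficients of \<open>exp (r X) (X - r)\<^sup>n\<close>.  In the Fock norm, which weights the coefficient of \<open>X\<^sup>m\<close> by \<open>m!\<close>, these
 series are displaced number states: orthogonal, of squared norm \<open>n! exp (r\<^sup>2)\<close>.\<close>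

definition fock :: "nat \<Rightarrow> real fps" where
 "fock n = fps_exp r * (fps_X - fps_const r) ^ n"

lemma fock_Suc_nth: "fock (Suc n) $ m = (if m = 0 then 0 else fock n $ (m - 1)) - r * fock n $ m"
proof -
 have "fock (Suc n) = fps_X * fock n - fps_const r * fock n"
  by (simp add: fock_def algebra_simps)
 then show ?thesis by simp
qed

lemma fock_deriv_nth: "(real m + 1) * fock n $ (Suc m) = r * fock n $ m + real n * fock (n - 1) $ m"
proof -
 have "fps_deriv ((fps_X - fps_const r) ^ n) = fps_const (real n) * (fps_X - fps_const r) ^ (n - 1)"
  using fps_deriv_power[of "fps_X - fps_const r" n] by simp
 then have "fps_deriv (fock n) = fps_const r * fock n + fps_const (real n) * fock (n - 1)"
  unfolding fock_def fps_deriv_mult by (simp add: mult_ac)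
 then have "fps_deriv (fock n) $ m = (fps_const r * fock n + fps_const (real n) * fock (n - 1)) $ m"
  by (rule arg_cong)
 then show ?thesis by (simp add: algebra_simps)
qed

lemma fock_bound:
 obtains A B where "A \<ge> 0" "B \<ge> 1" "\<And>m. \<bar>fock n $ m\<bar> \<le> A * B ^ m / fact m"
proof (induction n arbitrary: thesis)
 case 0
 show ?case
 proof (rule 0[of 1 "max 1 \<bar>r\<bar>"])
  fix m
  have "\<bar>r\<bar> ^ m \<le> max 1 \<bar>r\<bar> ^ m" by (intro power_mono) auto
  then show "\<bar>fock 0 $ m\<bar> \<le> 1 * max 1 \<bar>r\<bar> ^ m / fact m"
   by (simp add: fock_def power_abs divide_right_mono)
 qed auto
next
 case (Suc n)
 obtain A B where AB: "A \<ge> 0" "B \<ge> 1" "\<And>m. \<bar>fock n $ m\<bar> \<le> A * B ^ m / fact m"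
  using Suc.IH by blast
 show ?case
 proof (rule Suc.prems[of "A * (1 + \<bar>r\<bar>)" "2 * B"])
  fix m
  have 1: "\<bar>if m = 0 then 0 else fock n $ (m - 1)\<bar> \<le> A * (2 * B) ^ m / fact m"
  proof (cases m)
   case (Suc k)
   have "real (Suc k) \<le> 2 ^ Suc k" by (rule less_imp_le[OF of_nat_less_two_power])
   then have "real (Suc k) * B ^ k \<le> 2 ^ Suc k * B ^ Suc k"
    using AB by (intro mult_mono power_increasing) auto
   then have "A * (real (Suc k) * B ^ k) / fact (Suc k) \<le> A * (2 ^ Suc k * B ^ Suc k) / fact (Suc k)"
    using AB by (intro divide_right_mono mult_left_mono) auto
   moreover have "A * (real (Suc k) * B ^ k) / fact (Suc k) = A * B ^ k / fact k"
    unfolding fact_Suc by (simp del: of_nat_Suc)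
   ultimately show ?thesis using Suc AB(3)[of k] by (simp add: power_mult_distrib mult_ac)
  qed (use AB in simp)
  have "A * B ^ m / fact m \<le> A * (2 * B) ^ m / fact m"
   using AB by (intro divide_right_mono mult_left_mono power_mono) auto
  then have 2: "\<bar>r\<bar> * \<bar>fock n $ m\<bar> \<le> \<bar>r\<bar> * (A * (2 * B) ^ m / fact m)"
   using AB(3)[of m] by (intro mult_left_mono) auto
  have "\<bar>fock (Suc n) $ m\<bar> \<le> \<bar>if m = 0 then 0 else fock n $ (m - 1)\<bar> + \<bar>r\<bar> * \<bar>fock n $ m\<bar>"
   unfolding fock_Suc_nth abs_mult[symmetric] by (rule abs_triangle_ineq4)
  also have "\<dots> \<le> A * (2 * B) ^ m / fact m + \<bar>r\<bar> * (A * (2 * B) ^ m / fact m)"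
   by (intro add_mono 1 2)
  also have "\<dots> = A * (1 + \<bar>r\<bar>) * (2 * B) ^ m / fact m" by (simp add: field_simps)
  finally show "\<bar>fock (Suc n) $ m\<bar> \<le> A * (1 + \<bar>r\<bar>) * (2 * B) ^ m / fact m" .
 qed (use AB in auto)
qed

lemma summable_fock: "summable (\<lambda>m. fact m * (fock n $ m * fock k $ m))"
proof -
 obtain A B where AB: "A \<ge> 0" "B \<ge> 1" "\<And>m. \<bar>fock n $ m\<bar> \<le> A * B ^ m / fact m" using fock_bound[of n] by blast
 obtain C D where CD: "C \<ge> 0" "D \<ge> 1" "\<And>m. \<bar>fock k $ m\<bar> \<le> C * D ^ m / fact m" using fock_bound[of k] by blast
 have "summable (\<lambda>m. A * C * ((B * D) ^ m / fact m))"
  by (intro summable_mult) (use summable_exp[of "B * D"] in \<open>simp add: field_simps\<close>)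
 then show ?thesis
 proof (rule summable_comparison_test')
  fix m :: nat assume "m \<ge> 0"
  have "\<bar>fock n $ m\<bar> * \<bar>fock k $ m\<bar> \<le> (A * B ^ m / fact m) * (C * D ^ m / fact m)"
   using AB CD by (intro mult_mono) auto
  then have "fact m * (\<bar>fock n $ m\<bar> * \<bar>fock k $ m\<bar>) \<le> fact m * ((A * B ^ m / fact m) * (C * D ^ m / fact m))"
   by (rule mult_left_mono) simp
  then show "norm (fact m * (fock n $ m * fock k $ m)) \<le> A * C * ((B * D) ^ m / fact m)"
   by (simp add: abs_mult power_mult_distrib mult_ac)
 qed
qed

text \<open>Multiplication by \<open>X\<close> and differentiation are adjoint for the Fock norm.\<close>

lemma fock_norm: "(\<Sum>m. fact m * (fock n $ m * fock n $ m)) = fact n * exp (r\<^sup>2)"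
proof (induction n)
 case 0
 have "(\<lambda>m. fact m * (fock 0 $ m * fock 0 $ m)) = (\<lambda>m. (r\<^sup>2) ^ m /\<^sub>R fact m)"
  by (simp add: fock_def fun_eq_iff power2_eq_square power_mult_distrib field_simps)
 then show ?case by (simp add: exp_def)
next
 case (Suc n)
 let ?g = "fock n" and ?h = "fock (Suc n)"
 let ?s = "\<lambda>m. fact m * ((if m = 0 then 0 else ?g $ (m - 1)) * ?h $ m)"
 have eq: "fact m * (?h $ m * ?h $ m) = ?s m - r * (fact m * (?g $ m * ?h $ m))" for m
  by (subst (1) fock_Suc_nth) (simp add: algebra_simps)
 have "summable (\<lambda>m. fact m * (?h $ m * ?h $ m) + r * (fact m * (?g $ m * ?h $ m)))"
  by (intro summable_add summable_mult summable_fock)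
 then have sums: "summable ?s" by (simp add: eq)
 have shift: "?s (Suc m) = r * (fact m * (?g $ m * ?h $ m)) + real (Suc n) * (fact m * (?g $ m * ?g $ m))" for m
 proof -
  have "?s (Suc m) = fact m * (?g $ m * ((real m + 1) * ?h $ (Suc m)))" by (simp add: algebra_simps)
  also have "\<dots> = fact m * (?g $ m * (r * ?h $ m + real (Suc n) * ?g $ m))"
   unfolding fock_deriv_nth by simp
  finally show ?thesis by (simp add: algebra_simps)
 qed
 have "(\<Sum>m. ?s m) = (\<Sum>m. ?s (Suc m))"
  by (subst suminf_split_head[OF sums]) simp
 also have "\<dots> = r * (\<Sum>m. fact m * (?g $ m * ?h $ m)) + real (Suc n) * (\<Sum>m. fact m * (?g $ m * ?g $ m))"
  unfolding shift by (subst suminf_add[symmetric]) (intro summable_mult summable_fock | simp add: suminf_mult summable_fock)+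
 finally have "(\<Sum>m. ?s m) = r * (\<Sum>m. fact m * (?g $ m * ?h $ m)) + real (Suc n) * (\<Sum>m. fact m * (?g $ m * ?g $ m))" .
 moreover have "(\<Sum>m. fact m * (?h $ m * ?h $ m)) = (\<Sum>m. ?s m) - r * (\<Sum>m. fact m * (?g $ m * ?h $ m))"
  unfolding eq by (subst suminf_diff[symmetric]) (use sums in \<open>auto intro!: summable_mult summable_fock simp: suminf_mult summable_fock\<close>)
 ultimately show ?case using Suc.IH by simp
qed

lemma fock_diagonal: "fock n $ n = poly (lagpoly 0 n) (r\<^sup>2)"
proof -
 have "(fps_X - fps_const r) ^ n = (\<Sum>k\<le>n. of_nat (n choose k) * fps_X ^ k * (- fps_const r) ^ (n - k))"
  using binomial_ring[of fps_X "- fps_const r" n] by (simp only: diff_conv_add_uminus)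
 also have "\<dots> = (\<Sum>k\<le>n. fps_const (real (n choose k) * (- r) ^ (n - k)) * fps_X ^ k)"
  by (simp add: fps_of_nat[symmetric] fps_const_power fps_const_mult[symmetric] mult_ac fps_const_neg del: fps_const_mult)
 finally have "fock n $ n = (\<Sum>k\<le>n. real (n choose k) * (- r) ^ (n - k) * (fps_X ^ k * fps_exp r) $ n)"
  unfolding fock_def by (simp add: sum_distrib_left fps_sum_nth mult.left_commute[of "fps_exp r"] mult.commute[of "fps_exp r"] mult.assoc)
 also have "\<dots> = (\<Sum>k\<le>n. real (n choose k) * (- r) ^ (n - k) * (r ^ (n - k) / fact (n - k)))"
  by (intro sum.cong refl) (simp add: fps_X_power_mult_nth)
 also have "\<dots> = (\<Sum>j\<le>n. real (n choose j) * (- r) ^ j * (r ^ j / fact j))"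
  by (rule sum.reindex_bij_witness[of _ "\<lambda>k. n - k" "\<lambda>k. n - k"]) (auto simp: binomial_symmetric[symmetric])
 also have "\<dots> = (\<Sum>j\<le>n. lagcoef 0 n j * (r\<^sup>2) ^ j)"
 proof (rule sum.cong[OF refl])
  fix j assume "j \<in> {..n}"
  then have j: "j \<le> n" by simp
  have "pochhammer 1 n = pochhammer 1 j * pochhammer (1 + real j) (n - j)"
   using j by (rule pochhammer_product)
  then have p: "pochhammer (real j + 1) (n - j) = fact n / fact j"
   by (simp add: pochhammer_fact[symmetric] add.commute)
  have "(- r) ^ j * r ^ j = (-1) ^ j * (r\<^sup>2) ^ j"
   by (simp add: power_mult_distrib[symmetric] power2_eq_square)
  then have s: "real (n choose j) * (- r) ^ j * (r ^ j / fact j) = real (n choose j) / fact j * ((-1) ^ j * (r\<^sup>2) ^ j)"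
   by simp
  show "real (n choose j) * (- r) ^ j * (r ^ j / fact j) = lagcoef 0 n j * (r\<^sup>2) ^ j"
   unfolding s lagcoef_def using j by (simp add: p binomial_fact mult_ac)
 qed
 also have "\<dots> = poly (lagpoly 0 n) (r\<^sup>2)" by (simp add: poly_altdef)
 finally show ?thesis .
qed

end

text \<open>A single coefficient is bounded by the Fock norm, and the \<open>n\<close>-th coefficient of the \<open>n\<close>-th series is
 \<open>L\<^sub>n(r\<^sup>2)\<close>.\<close>

lemma lagpoly_0_bound:
 fixes x :: real
 assumes "x \<ge> 0"
 shows "\<bar>poly (lagpoly 0 n) x\<bar> \<le> exp (x / 2)"
proof -
 define r where "r = sqrt x"
 have r: "r\<^sup>2 = x" using assms by (simp add: r_def)
 let ?f = "\<lambda>m. fact m * (fock r n $ m * fock r n $ m)"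
 have "sum ?f {n} \<le> suminf ?f"
  by (rule sum_le_suminf[OF summable_fock]) auto
 then have "fact n * (poly (lagpoly 0 n) x)\<^sup>2 \<le> fact n * exp x"
  unfolding fock_norm by (simp add: fock_diagonal r flip: power2_eq_square)
 then have "(poly (lagpoly 0 n) x)\<^sup>2 \<le> exp x" by simp
 also have "exp x = (exp (x / 2))\<^sup>2" by (simp add: power2_eq_square flip: exp_add)
 finally show ?thesis using abs_le_square_iff[of "poly (lagpoly 0 n) x" "exp (x / 2)"] by simp
qed

definition lag_sup :: "real \<Rightarrow> nat \<Rightarrow> real" where
 "lag_sup a n = (if a \<ge> 0 then pochhammer (a + 1) n / fact n else 2)"

text \<open>The connection formula from parameter \<open>0\<close> has coefficients of one sign for \<open>a \<ge> 0\<close>; for \<open>a < 0\<close> only the leading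
 one is positive, and it equals \<open>1\<close>.\<close>

theorem lagpoly_bound:
 fixes x :: real
 assumes "a > -1" "x \<ge> 0"
 shows "exp (- x / 2) * \<bar>poly (lagpoly a n) x\<bar> \<le> lag_sup a n"
proof -
 define c where "c j = pochhammer a j / fact j" for j
 have conn: "poly (lagpoly a n) y = (\<Sum>j\<le>n. c j * poly (lagpoly 0 (n - j)) y)" for y :: real
  by (subst lagpoly_connection[of a n 0]) (simp add: poly_sum c_def)
 have c_sum: "(\<Sum>j\<le>n. c j) = pochhammer (a + 1) n / fact n"
  using conn[of 0] by (simp add: poly_lagpoly_0 pochhammer_fact[symmetric])
 have abs_sum: "(\<Sum>j\<le>n. \<bar>c j\<bar>) \<le> lag_sup a n"
 proof (cases "a \<ge> 0")
  case True
  have "\<bar>c j\<bar> = c j" for j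
   using True unfolding c_def pochhammer_prod by (simp add: prod_nonneg)
  then show ?thesis using True c_sum by (simp add: lag_sup_def)
 next
  case False
  have neg: "\<bar>c j\<bar> = (if j = 0 then 2 else 0) - c j" for j
  proof (cases j)
   case (Suc k)
   have "pochhammer (a + 1) k > 0" using assms(1) by (intro pochhammer_pos) simp
   then have "c j \<le> 0" using False Suc
    unfolding c_def by (simp add: pochhammer_rec mult_nonpos_nonneg divide_nonpos_pos)
   then show ?thesis using Suc by simp
  qed (simp add: c_def)
  have "(\<Sum>j\<le>n. \<bar>c j\<bar>) = 2 - pochhammer (a + 1) n / fact n"
   unfolding neg sum_subtractf c_sum by simp
  moreover have "pochhammer (a + 1) n > 0" using assms(1) by (intro pochhammer_pos) simp
  ultimately show ?thesis using False by (simp add: lag_sup_def)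
 qed
 have "\<bar>poly (lagpoly a n) x\<bar> \<le> (\<Sum>j\<le>n. \<bar>c j * poly (lagpoly 0 (n - j)) x\<bar>)"
  unfolding conn by (rule sum_abs)
 also have "\<dots> \<le> (\<Sum>j\<le>n. \<bar>c j\<bar> * exp (x / 2))"
  unfolding abs_mult by (intro sum_mono mult_left_mono lagpoly_0_bound assms) auto
 also have "\<dots> \<le> lag_sup a n * exp (x / 2)"
  unfolding sum_distrib_right[symmetric] by (intro mult_right_mono abs_sum) auto
 finally have "exp (- x / 2) * \<bar>poly (lagpoly a n) x\<bar> \<le> exp (- x / 2) * (lag_sup a n * exp (x / 2))"
  by (rule mult_left_mono) simp
 also have "\<dots> = lag_sup a n" by (simp add: exp_minus)
 finally show ?thesis .
qed

section \<open>Cauchy's formula on the parabola\<close>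

definition dparabola :: "real \<Rightarrow> real \<Rightarrow> complex" where
 "dparabola \<rho> t = - 2 * \<i> * Complex \<rho> t"

lemma parabola_param_eq: "zpar \<rho> t = - ((Complex \<rho> t)\<^sup>2)"
 by (simp add: parabola_param_def complex_eq_iff power2_eq_square)

lemma parabola_param_has_derivative:
 "(zpar \<rho> has_vector_derivative dparabola \<rho> t) (at t)"
proof -
 have c: "Complex \<rho> t = of_real \<rho> + of_real t * \<i>" for t by (simp add: complex_eq_iff)
 have "((\<lambda>t. - ((of_real \<rho> + of_real t * \<i>)\<^sup>2)) has_vector_derivative - (2 * (of_real \<rho> + of_real t * \<i>) * \<i>)) (at t)"
  by (auto intro!: derivative_eq_intros simp: has_vector_derivative_def scaleR_conv_of_real algebra_simps)
 then show ?thesis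
  unfolding parabola_param_eq[abs_def] dparabola_def c by (simp add: mult_ac)
qed

lemma norm_parabola_param: "norm (zpar \<rho> t) = \<rho>\<^sup>2 + t\<^sup>2"
 by (simp add: parabola_param_eq norm_power cmod_power2)

lemma norm_dparabola: "norm (dparabola \<rho> t) = 2 * sqrt (\<rho>\<^sup>2 + t\<^sup>2)"
 by (simp add: dparabola_def norm_mult) (simp add: cmod_def)

lemma continuous_parabola_param: "continuous_on A (zpar \<rho>)"
 unfolding parabola_param_def[abs_def] Complex_eq by (intro continuous_intros)

lemma continuous_dparabola: "continuous_on A (dparabola \<rho>)"
 unfolding dparabola_def[abs_def] Complex_eq by (intro continuous_intros)

lemma borel_measurable_parabola_param [measurable]: "zpar \<rho> \<in> borel_measurable borel"
 by (rule borel_measurable_continuous_onI[OF continuous_parabola_param])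

lemma borel_measurable_dparabola [measurable]: "dparabola \<rho> \<in> borel_measurable borel"
 by (rule borel_measurable_continuous_onI[OF continuous_dparabola])

lemma parabola_integral_eq:
 "parabola_integral \<rho> g = (LINT t|lborel. g (zpar \<rho> t) * norm (dparabola \<rho> t))"
 unfolding parabola_integral_def vector_derivative_at[OF parabola_param_has_derivative] ..

text \<open>With \<open>z = - w\<^sup>2\<close> and \<open>Re w = \<rho>\<close>, project \<open>x + w\<^sup>2\<close> on the direction of \<open>w\<close>: the component is
 \<open>\<rho> (x + |w|\<^sup>2) / |w|\<close>, which is at least \<open>\<rho> |w| \<ge> \<rho>\<^sup>2\<close>.\<close>

lemma parabola_dist:
 assumes "\<rho> > 0" "x \<ge> 0"
 shows "norm (zpar \<rho> t - of_real x) \<ge> \<rho>\<^sup>2"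
proof -
 let ?w = "Complex \<rho> t"
 have w: "norm ?w \<ge> \<rho>" using complex_Re_le_cmod[of ?w] by simp
 have "\<rho> * (norm ?w)\<^sup>2 \<le> \<rho> * (x + (norm ?w)\<^sup>2)" using assms by simp
 also have "\<dots> = Re (cnj ?w * (of_real x + ?w\<^sup>2))"
  unfolding cmod_power2 by (simp add: power2_eq_square algebra_simps)
 also have "\<dots> \<le> norm (cnj ?w * (of_real x + ?w\<^sup>2))" by (rule complex_Re_le_cmod)
 also have "\<dots> = norm ?w * norm (of_real x + ?w\<^sup>2)" by (simp add: norm_mult)
 finally have "norm ?w * (\<rho> * norm ?w) \<le> norm ?w * norm (of_real x + ?w\<^sup>2)"
  by (simp add: power2_eq_square mult_ac)
 then have "\<rho> * norm ?w \<le> norm (of_real x + ?w\<^sup>2)"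
  using w assms by (subst (asm) mult_le_cancel_left_pos) auto
 moreover have "\<rho>\<^sup>2 \<le> \<rho> * norm ?w" using w assms by (simp add: power2_eq_square)
 moreover have "norm (zpar \<rho> t - of_real x) = norm (of_real x + ?w\<^sup>2)"
  unfolding parabola_param_eq by (metis add.commute minus_add_distrib norm_minus_cancel uminus_add_conv_diff)
 ultimately show ?thesis by linarith
qed

abbreviation parabola_closure :: "real \<Rightarrow> complex set" where
 "parabola_closure \<rho> \<equiv> closure (parabola_interior \<rho>)"

lemma neg_square_in_interior:
 assumes "\<bar>Re w\<bar> < \<rho>"
 shows "- (w\<^sup>2) \<in> parabola_interior \<rho>"
proof -
 have "csqrt (w\<^sup>2) = w \<or> csqrt (w\<^sup>2) = - w"
  by (rule power2_eq_iff[THEN iffD1, OF power2_csqrt])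
 then show ?thesis using assms by (auto simp: parabola_interior_def simp del: csqrt.simps)
qed

lemma neg_square_in_closure:
 assumes "\<bar>Re w\<bar> \<le> \<rho>" "\<rho> > 0"
 shows "- (w\<^sup>2) \<in> parabola_closure \<rho>"
 unfolding closure_sequential
proof (intro exI conjI allI)
 fix n
 let ?r = "\<lambda>n. 1 - 1 / (real n + 2)"
 have "\<bar>Re (of_real (?r n) * w)\<bar> = ?r n * \<bar>Re w\<bar>" by (simp add: abs_mult)
 also have "\<dots> \<le> ?r n * \<rho>" using assms by (intro mult_left_mono) auto
 also have "\<dots> < 1 * \<rho>" using assms by (intro mult_strict_right_mono) auto
 finally show "- ((of_real (?r n) * w)\<^sup>2) \<in> parabola_interior \<rho>" by (intro neg_square_in_interior) simp
 have "?r \<longlonglongrightarrow> 1" by real_asymp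
 then have "(\<lambda>n. - ((of_real (?r n) * w)\<^sup>2)) \<longlonglongrightarrow> - ((of_real 1 * w)\<^sup>2)" by (intro tendsto_intros)
 then show "(\<lambda>n. - ((of_real (?r n) * w)\<^sup>2)) \<longlonglongrightarrow> - (w\<^sup>2)" by simp
qed

lemma parabola_param_in_closure: "\<rho> > 0 \<Longrightarrow> zpar \<rho> t \<in> parabola_closure \<rho>"
 unfolding parabola_param_eq by (rule neg_square_in_closure) auto

lemma nonneg_real_in_closure:
 assumes "\<rho> > 0" "x \<ge> 0"
 shows "cx x \<in> parabola_closure \<rho>"
proof -
 have "- ((\<i> * of_real (sqrt x))\<^sup>2) \<in> parabola_closure \<rho>"
  by (rule neg_square_in_closure) (use assms in auto)
 then show ?thesis using assms by (simp add: power_mult_distrib flip: of_real_power)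
qed

lemma Re_parabola_closure:
 assumes "z \<in> parabola_closure \<rho>"
 shows "Re z \<ge> - (\<rho>\<^sup>2)"
proof -
 have "closed {z. Re z \<ge> - (\<rho>\<^sup>2)}" by (rule closed_halfspace_Re_ge)
 moreover have "parabola_interior \<rho> \<subseteq> {z. Re z \<ge> - (\<rho>\<^sup>2)}"
 proof
  fix z assume "z \<in> parabola_interior \<rho>"
  define v where "v = csqrt (- z)"
  have v: "0 \<le> Re v" "Re v < \<rho>" "v\<^sup>2 = - z"
   using \<open>z \<in> _\<close> csqrt_principal[of "- z"] by (auto simp: v_def parabola_interior_def)
  have "Re z = - Re (v\<^sup>2)" using v by simp
  also have "\<dots> = (Im v)\<^sup>2 - (Re v)\<^sup>2" by (simp add: power2_eq_square)
  also have "\<dots> \<ge> - (\<rho>\<^sup>2)" using power_mono[of "Re v" \<rho> 2] v zero_le_power2[of "Im v"] by linarith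
  finally show "z \<in> {z. Re z \<ge> - (\<rho>\<^sup>2)}" by simp
 qed
 ultimately show ?thesis using closure_minimal assms by blast
qed

lemma integrable_inverse_square: "integrable lborel (\<lambda>t::real. 1 / (1 + t\<^sup>2))"
proof -
 have "set_integrable lborel (einterval (- \<infinity>) \<infinity>) (\<lambda>t::real. inverse (1 + t\<^sup>2))"
  by (rule integrable_inverse_1_plus_square)
 then show ?thesis by (simp add: set_integrable_def inverse_eq_divide)
qed

text \<open>Functions for which the integral over the parabola converges absolutely.\<close>

definition decaying :: "real \<Rightarrow> (complex \<Rightarrow> complex) \<Rightarrow> real \<Rightarrow> bool" where
 "decaying \<rho> F C \<longleftrightarrow> F analytic_on parabola_closure \<rho> \<and> (\<forall>z\<in>parabola_closure \<rho>. norm (F z) * (1 + norm z)\<^sup>2 \<le> C)"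

lemma analytic_parabola_continuous:
 assumes "F analytic_on parabola_closure \<rho>" "\<rho> > 0"
 shows "continuous_on UNIV (\<lambda>t. F (zpar \<rho> t))"
 by (rule continuous_on_compose2[OF holomorphic_on_imp_continuous_on[OF analytic_imp_holomorphic[OF assms(1)]] continuous_parabola_param])
   (use parabola_param_in_closure[OF assms(2)] in auto)

lemma decaying_bound:
 assumes "decaying \<rho> F C" "\<rho> > 0"
 shows "norm (F (zpar \<rho> t) * dparabola \<rho> t) \<le> 2 * C * (1 / (1 + t\<^sup>2))"
proof -
 define q where "q = 1 + \<rho>\<^sup>2 + t\<^sup>2"
 have q: "q \<ge> 1" "q \<ge> 1 + t\<^sup>2" "q > 0" by (auto simp: q_def add_nonneg_nonneg add_pos_nonneg)
 have "norm (F (zpar \<rho> t)) * (1 + norm (zpar \<rho> t))\<^sup>2 \<le> C"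
  using assms parabola_param_in_closure[OF assms(2)] by (simp add: decaying_def)
 then have F: "norm (F (zpar \<rho> t)) * q\<^sup>2 \<le> C" by (simp add: norm_parabola_param q_def add_ac)
 have C0: "C \<ge> 0" by (rule order_trans[OF _ F]) simp
 have "sqrt (\<rho>\<^sup>2 + t\<^sup>2) \<le> sqrt q" by (simp add: q_def)
 also have "\<dots> \<le> q" using q real_sqrt_le_mono[of q "q\<^sup>2"] by (simp add: power2_eq_square)
 finally have "norm (F (zpar \<rho> t) * dparabola \<rho> t) \<le> norm (F (zpar \<rho> t)) * (2 * q)"
  unfolding norm_mult norm_dparabola by (intro mult_left_mono) auto
 also have "\<dots> = 2 * (norm (F (zpar \<rho> t)) * q\<^sup>2) / q" using q by (simp add: power2_eq_square)
 also have "\<dots> \<le> 2 * C / q" using F q by (intro divide_right_mono) auto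
 also have "\<dots> \<le> 2 * C / (1 + t\<^sup>2)" using C0 q by (intro divide_left_mono mult_pos_pos) (auto intro: add_pos_nonneg)
 finally show ?thesis by simp
qed

lemma decaying_integrable:
 assumes "decaying \<rho> F C" "\<rho> > 0"
 shows "integrable lborel (\<lambda>t. F (zpar \<rho> t) * dparabola \<rho> t)"
proof (rule Bochner_Integration.integrable_bound)
 show "integrable lborel (\<lambda>t. 2 * C * (1 / (1 + t\<^sup>2)))"
  by (intro integrable_mult_right integrable_inverse_square)
 show "(\<lambda>t. F (zpar \<rho> t) * dparabola \<rho> t) \<in> borel_measurable lborel"
  using analytic_parabola_continuous[of F \<rho>] assms continuous_dparabola[of UNIV \<rho>]
  by (auto simp: decaying_def intro!: borel_measurable_continuous_onI continuous_on_mult)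
 show "AE t in lborel. norm (F (zpar \<rho> t) * dparabola \<rho> t) \<le> norm (2 * C * (1 / (1 + t\<^sup>2)))"
  using decaying_bound[OF assms] by (intro AE_I2) (simp only: real_norm_def, rule order_trans[OF _ abs_ge_self])
qed

lemma integrable_over_parabola_divide:
 assumes "\<rho> > 0" "x \<ge> 0" "integrable lborel (\<lambda>t. g t :: complex)"
 shows "integrable lborel (\<lambda>t. g t / (zpar \<rho> t - of_real x))"
proof (rule Bochner_Integration.integrable_bound)
 show "integrable lborel (\<lambda>t. g t / of_real (\<rho>\<^sup>2))" using assms by simp
 have [measurable]: "g \<in> borel_measurable lborel" using assms(3) by (rule borel_measurable_integrable)
 show "(\<lambda>t. g t / (zpar \<rho> t - of_real x)) \<in> borel_measurable lborel" by measurable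
 show "AE t in lborel. norm (g t / (zpar \<rho> t - of_real x)) \<le> norm (g t / of_real (\<rho>\<^sup>2))"
 proof (rule AE_I2)
  fix t
  have "norm (g t) / norm (zpar \<rho> t - of_real x) \<le> norm (g t) / \<rho>\<^sup>2"
   using parabola_dist[OF assms(1,2), of t] assms(1)
   by (intro divide_left_mono mult_pos_pos) (auto intro: order_less_le_trans[OF zero_less_power])
  then show "norm (g t / (zpar \<rho> t - of_real x)) \<le> norm (g t / of_real (\<rho>\<^sup>2))"
   by (simp add: norm_divide norm_power)
 qed
qed

text \<open>Substituting \<open>z = - w\<^sup>2\<close> turns the region into the strip \<open>|Re w| \<le> \<rho>\<close>, traversed twice, and
 \<open>dz / (z - x)\<close> into \<open>dw / (w - i \<surd>x) + dw / (w + i \<surd>x)\<close>.\<close>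

theorem parabola_cauchy_formula:
 assumes dec: "decaying \<rho> F C" and \<rho>: "\<rho> > 0" and x: "x \<ge> 0"
 shows "(LINT t|lborel. F (zpar \<rho> t) * dparabola \<rho> t / (zpar \<rho> t - of_real x)) = 2 * of_real pi * \<i> * F (of_real x)"
proof -
 define s where "s = sqrt x"
 have s: "s \<ge> 0" "s\<^sup>2 = x" using x by (auto simp: s_def)
 define S where "S = {w. \<bar>Re w\<bar> \<le> \<rho>}"
 define H where "H w = F (- (w\<^sup>2))" for w
 define G where "G w = H w / (w - \<i> * of_real s) + H w / (w - (- (\<i> * of_real s)))" for w
 have S_eq: "S = {w. Re w \<le> \<rho>} \<inter> {w. Re w \<ge> - \<rho>}" by (auto simp: S_def)
 have convS: "convex S" unfolding S_eq by (intro convex_Int convex_halfspace_Re_le convex_halfspace_Re_ge)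
 have intS: "w \<in> interior S" if "\<bar>Re w\<bar> < \<rho>" for w
 proof (rule interiorI)
  show "open ({w. Re w < \<rho>} \<inter> {w. Re w > - \<rho>})" by (intro open_Int open_halfspace_Re_lt open_halfspace_Re_gt)
 qed (use that in \<open>auto simp: S_def\<close>)
 have "(F \<circ> (\<lambda>w. - (w\<^sup>2))) analytic_on S"
  by (rule analytic_on_compose_gen[where T = "parabola_closure \<rho>"])
    (use dec neg_square_in_closure[OF _ \<rho>] in \<open>auto intro!: analytic_intros simp: decaying_def S_def\<close>)
 then have holH: "H holomorphic_on S"
  unfolding H_def[abs_def] by (auto dest!: analytic_imp_holomorphic simp: o_def)
 have C0: "C \<ge> 0"
  using dec nonneg_real_in_closure[OF \<rho> order_refl] by (force simp: decaying_def intro: order_trans[OF norm_ge_zero])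
 have Hb: "norm (H w) \<le> C" if "w \<in> S" for w
 proof -
  have "norm (H w) * 1 \<le> norm (H w) * (1 + norm (- (w\<^sup>2)))\<^sup>2" by (intro mult_left_mono) auto
  also have "\<dots> \<le> C"
   using dec neg_square_in_closure[OF _ \<rho>, of w] that unfolding decaying_def S_def H_def by blast
  finally show ?thesis by simp
 qed
 have Geq: "G w = 2 * w * H w / (w\<^sup>2 + of_real x)" if "w\<^sup>2 + of_real x \<noteq> 0" for w
 proof -
  have f: "w\<^sup>2 + of_real x = (w - \<i> * of_real s) * (w - (- (\<i> * of_real s)))"
   using s by (simp add: algebra_simps power2_eq_square flip: of_real_mult)
  then have "w - \<i> * of_real s \<noteq> 0" "w - (- (\<i> * of_real s)) \<noteq> 0" using that by auto
  then show ?thesis unfolding f G_def by (simp add: divide_simps) (simp add: algebra_simps)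
 qed
 \<comment> \<open>by oddness both vertical sides of the rectangle contribute the integral over the parabola\<close>
 have Godd: "G (- w) = - G w" for w
 proof -
  have "H (- w) = H w" by (simp add: H_def)
  moreover have "- w - \<i> * of_real s = - (w - (- (\<i> * of_real s)))" "- w - (- (\<i> * of_real s)) = - (w - \<i> * of_real s)" by auto
  ultimately show ?thesis unfolding G_def by (simp only: divide_minus_right minus_add_distrib) (rule add.commute)
 qed
 define g where "g t = F (zpar \<rho> t) * dparabola \<rho> t / (zpar \<rho> t - of_real x)" for t
 have gG: "g t = \<i> * G (Complex \<rho> t)" for t
 proof -
  have "norm (zpar \<rho> t - of_real x) > 0"
   using parabola_dist[OF \<rho> x, of t] \<rho> by (auto intro: order_less_le_trans[OF zero_less_power])
  then have nz: "(Complex \<rho> t)\<^sup>2 + of_real x \<noteq> 0" by (auto simp: parabola_param_eq add_eq_0_iff)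
  have "zpar \<rho> t - of_real x = - ((Complex \<rho> t)\<^sup>2 + of_real x)" by (simp add: parabola_param_eq)
  then have "g t = F (zpar \<rho> t) * dparabola \<rho> t / - ((Complex \<rho> t)\<^sup>2 + of_real x)" by (simp only: g_def)
  also have "\<dots> = \<i> * (2 * Complex \<rho> t * H (Complex \<rho> t) / ((Complex \<rho> t)\<^sup>2 + of_real x))"
   unfolding divide_minus_right by (simp add: dparabola_def H_def parabola_param_eq mult_ac)
  finally show ?thesis unfolding Geq[OF nz] .
 qed
 have intg: "integrable lborel g"
  unfolding g_def by (rule integrable_over_parabola_divide[OF \<rho> x decaying_integrable[OF dec \<rho>]])
 have rect: "norm (2 * integral {-T..T} g - 4 * of_real pi * \<i> * F (of_real x)) \<le> 16 * C * \<rho> / T"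
  if T: "T > s" "T > 0" "T\<^sup>2 \<ge> 2 * x" for T
 proof -
  define a1 where "a1 = Complex (- \<rho>) (- T)"
  define a2 where "a2 = Complex \<rho> (- T)"
  define a3 where "a3 = Complex \<rho> T"
  define a4 where "a4 = Complex (- \<rho>) T"
  note as = a1_def a2_def a3_def a4_def
  have rp: "rectpath a1 a3 = linepath a1 a2 +++ linepath a2 a3 +++ linepath a3 a4 +++ linepath a4 a1"
   by (simp add: rectpath_def Let_def as)
  have pim: "path_image (rectpath a1 a3) \<subseteq> S - {\<i> * of_real s, - (\<i> * of_real s)}"
   using T s \<rho> by (subst path_image_rectpath_cbox_minus_box) (auto simp: as in_cbox_complex_iff in_box_complex_iff S_def)
  have box: "\<i> * of_real s \<in> box a1 a3" "- (\<i> * of_real s) \<in> box a1 a3"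
   using T s \<rho> by (auto simp: in_box_complex_iff as)
  have I: "((\<lambda>w. H w / (w - p)) has_contour_integral (2 * of_real pi * \<i> * H p)) (rectpath a1 a3)"
   if "p \<in> {\<i> * of_real s, - (\<i> * of_real s)}" for p
  proof -
   have "((\<lambda>w. H w / (w - p)) has_contour_integral (2 * pi * \<i> * winding_number (rectpath a1 a3) p * H p)) (rectpath a1 a3)"
    by (rule Cauchy_integral_formula_convex_simple[OF convS holH])
      (use that \<rho> pim in \<open>auto intro!: intS simp: rp\<close>)
   moreover have "winding_number (rectpath a1 a3) p = 1" by (rule winding_number_rectpath) (use that box in auto)
   ultimately show ?thesis by simp
  qed
  have Hp: "H (\<i> * of_real s) = F (of_real x)" "H (- (\<i> * of_real s)) = F (of_real x)"
   using s by (simp_all add: H_def power_mult_distrib flip: of_real_power)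
  have "(G has_contour_integral (2 * of_real pi * \<i> * H (\<i> * of_real s) + 2 * of_real pi * \<i> * H (- (\<i> * of_real s)))) (rectpath a1 a3)"
   unfolding G_def[abs_def] by (intro has_contour_integral_add I) auto
  then have J: "(G has_contour_integral (4 * of_real pi * \<i> * F (of_real x))) (rectpath a1 a3)"
   unfolding Hp by (simp add: mult_ac)
  then have ci: "G contour_integrable_on (rectpath a1 a3)" by (rule has_contour_integral_integrable)
  then have cis: "G contour_integrable_on linepath a1 a2" "G contour_integrable_on linepath a2 a3"
    "G contour_integrable_on linepath a3 a4" "G contour_integrable_on linepath a4 a1"
   unfolding rp by (auto simp: contour_integrable_joinI valid_path_join)
  have sum: "contour_integral (linepath a1 a2) G + (contour_integral (linepath a2 a3) G + (contour_integral (linepath a3 a4) G + contour_integral (linepath a4 a1) G))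
    = 4 * of_real pi * \<i> * F (of_real x)"
   using contour_integral_unique[OF J] cis unfolding rp by (simp add: valid_path_join contour_integrable_joinI)
  have v1: "contour_integral (linepath a2 a3) G = integral {-T..T} g"
  proof -
   have "contour_integral (linepath a2 a3) G = \<i> * integral {-T..T} (\<lambda>t. G (Complex \<rho> t))"
    by (rule contour_integral_linepath_same_Re) (use T in \<open>auto simp: as\<close>)
   then show ?thesis unfolding gG[abs_def] by simp
  qed
  have v2: "contour_integral (linepath a4 a1) G = integral {-T..T} g"
  proof -
   have "contour_integral (linepath a4 a1) G = - contour_integral (linepath a1 a4) G"
    using contour_integral_reversepath[OF valid_path_linepath, of a1 a4 G] by simp
   also have "contour_integral (linepath a1 a4) G = \<i> * integral {-T..T} (\<lambda>t. G (Complex (- \<rho>) t))"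
    by (rule contour_integral_linepath_same_Re) (use T in \<open>auto simp: as\<close>)
   also have "(\<lambda>t. G (Complex (- \<rho>) t)) = (\<lambda>t. - G (Complex \<rho> (- t)))"
   proof
    fix t
    have "Complex (- \<rho>) t = - Complex \<rho> (- t)" by (simp add: complex_eq_iff)
    then show "G (Complex (- \<rho>) t) = - G (Complex \<rho> (- t))" by (simp only: Godd)
   qed
   also have "integral {-T..T} (\<lambda>t. - G (Complex \<rho> (- t))) = - integral {-T..T} (\<lambda>t. G (Complex \<rho> t))"
    using Henstock_Kurzweil_Integration.integral_reflect_real[of T "-T" "\<lambda>t. G (Complex \<rho> t)"] by simp
   finally show ?thesis unfolding gG[abs_def] by simp
  qed
  have Gb: "norm (G w) \<le> 4 * C / T" if w: "\<bar>Im w\<bar> = T" "\<bar>Re w\<bar> \<le> \<rho>" for w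
  proof -
   have nT: "norm w \<ge> T" using abs_Im_le_cmod[of w] w by simp
   then have n2: "(norm w)\<^sup>2 \<ge> 2 * x" using power_mono[of T "norm w" 2] T by linarith
   have den: "norm (w\<^sup>2 + of_real x) \<ge> (norm w)\<^sup>2 / 2"
    using norm_diff_ineq[of "w\<^sup>2" "of_real x"] n2 x by (simp add: norm_power)
   have nw: "norm w > 0" using nT T(2) by linarith
   then have pos: "(norm w)\<^sup>2 / 2 > 0" by simp
   then have "w\<^sup>2 + of_real x \<noteq> 0" using den by auto
   then have "norm (G w) = 2 * norm w * norm (H w) / norm (w\<^sup>2 + of_real x)"
    by (simp add: Geq norm_mult norm_divide)
   also have "\<dots> \<le> 2 * norm w * C / ((norm w)\<^sup>2 / 2)"
    using den pos Hb[of w] w C0 by (intro frac_le mult_left_mono) (auto simp: S_def)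
   also have "\<dots> = 4 * C / norm w" using nw by (simp add: power2_eq_square field_simps)
   also have "\<dots> \<le> 4 * C / T" using nT T C0 by (intro divide_left_mono mult_pos_pos) auto
   finally show ?thesis .
  qed
  have h1: "norm (contour_integral (linepath a1 a2) G) \<le> 4 * C / T * norm (a2 - a1)"
   by (rule contour_integral_bound_linepath[OF cis(1)])
     (use C0 T \<rho> in \<open>auto intro!: Gb simp: as closed_segment_same_Im closed_segment_eq_real_ivl\<close>)
  have seg: "\<bar>Im w\<bar> = T \<and> \<bar>Re w\<bar> \<le> \<rho>" if "w \<in> closed_segment a3 a4" for w
   using that T(2) \<rho> by (auto simp: as closed_segment_same_Im closed_segment_eq_real_ivl)
  have h2: "norm (contour_integral (linepath a3 a4) G) \<le> 4 * C / T * norm (a4 - a3)"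
   by (rule contour_integral_bound_linepath[OF cis(3)]) (use C0 T(2) seg Gb in auto)
  have "a2 - a1 = of_real (2 * \<rho>)" "a4 - a3 = of_real (- 2 * \<rho>)"
   by (simp_all add: as complex_eq_iff)
  then have nn: "norm (a2 - a1) = 2 * \<rho>" "norm (a4 - a3) = 2 * \<rho>"
   using \<rho> by (simp_all only: norm_of_real)
  have "2 * integral {-T..T} g - 4 * of_real pi * \<i> * F (of_real x) = - (contour_integral (linepath a1 a2) G + contour_integral (linepath a3 a4) G)"
   using sum v1 v2 by (simp add: algebra_simps)
  then have "norm (2 * integral {-T..T} g - 4 * of_real pi * \<i> * F (of_real x)) \<le> norm (contour_integral (linepath a1 a2) G) + norm (contour_integral (linepath a3 a4) G)"
   by (simp only: norm_minus_cancel norm_triangle_ineq)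
  also have "\<dots> \<le> 4 * C / T * (2 * \<rho>) + 4 * C / T * (2 * \<rho>)"
   using h1 h2 unfolding nn by (rule add_mono)
  finally show ?thesis by (simp add: field_simps)
 qed
 have lim1: "(\<lambda>n. integral {- real n..real n} g) \<longlonglongrightarrow> (LINT t|lborel. g t)"
 proof -
  have "(\<lambda>n. LINT t|lborel. indicator {- real n..real n} t *\<^sub>R g t) \<longlonglongrightarrow> (LINT t|lborel. g t)"
  proof (rule integral_dominated_convergence)
   show "integrable lborel (\<lambda>t. norm (g t))" using intg by (rule integrable_norm)
   have [measurable]: "g \<in> borel_measurable lborel" using intg by (rule borel_measurable_integrable)
   show "g \<in> borel_measurable lborel" by measurable
   show "(\<lambda>t. indicator {- real n..real n} t *\<^sub>R g t) \<in> borel_measurable lborel" for n by measurable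
   show "AE t in lborel. (\<lambda>n. indicator {- real n..real n} t *\<^sub>R g t) \<longlonglongrightarrow> g t"
   proof (rule AE_I2)
    fix t
    obtain N :: nat where N: "\<bar>t\<bar> \<le> real N" using real_arch_simple by blast
    have "\<forall>\<^sub>F n in sequentially. indicator {- real n..real n} t *\<^sub>R g t = g t"
     using eventually_ge_at_top[of N]
    proof eventually_elim
     case (elim n)
     then have "real N \<le> real n" by simp
     then have "t \<in> {- real n..real n}" using N by auto
     then show ?case by simp
    qed
    then show "(\<lambda>n. indicator {- real n..real n} t *\<^sub>R g t) \<longlonglongrightarrow> g t" by (rule tendsto_eventually)
   qed
   show "AE t in lborel. norm (indicator {- real n..real n} t *\<^sub>R g t) \<le> norm (g t)" for n
    by (intro AE_I2) (simp add: indicator_def)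
  qed
  moreover have "(LINT t|lborel. indicator {- real n..real n} t *\<^sub>R g t) = integral {- real n..real n} g" for n
  proof -
   have "set_integrable lborel {- real n..real n} g"
    unfolding set_integrable_def by (rule integrable_mult_indicator[OF _ intg]) simp
   from set_borel_integral_eq_integral(2)[OF this] show ?thesis by (simp add: set_lebesgue_integral_def)
  qed
  ultimately show ?thesis by simp
 qed
 have "(\<lambda>n. 2 * integral {- real n..real n} g - 4 * of_real pi * \<i> * F (of_real x)) \<longlonglongrightarrow> 0"
 proof (rule Lim_null_comparison)
  show "(\<lambda>n. 16 * C * \<rho> / real n) \<longlonglongrightarrow> 0" by real_asymp
  show "\<forall>\<^sub>F n in sequentially. norm (2 * integral {- real n..real n} g - 4 * of_real pi * \<i> * F (of_real x)) \<le> 16 * C * \<rho> / real n"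
  proof -
   have "\<forall>\<^sub>F n in sequentially. real n > s" "\<forall>\<^sub>F n in sequentially. real n > 0" "\<forall>\<^sub>F n in sequentially. (real n)\<^sup>2 \<ge> 2 * x"
    by real_asymp+
   then show ?thesis by eventually_elim (rule rect)
  qed
 qed
 moreover have "(\<lambda>n. 2 * integral {- real n..real n} g - 4 * of_real pi * \<i> * F (of_real x)) \<longlonglongrightarrow> 2 * (LINT t|lborel. g t) - 4 * of_real pi * \<i> * F (of_real x)"
  by (intro tendsto_intros lim1)
 ultimately have "2 * (LINT t|lborel. g t) - 4 * of_real pi * \<i> * F (of_real x) = 0"
  using LIMSEQ_unique by blast
 then show ?thesis by (simp add: g_def algebra_simps)
qed

section \<open>Functions of polynomial growth, and contour representations\<close>

lemma growth_cond_continuous: "growth_cond \<rho> f \<Longrightarrow> continuous_on (parabola_closure \<rho>) f"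
 unfolding growth_cond_def using analytic_imp_holomorphic holomorphic_on_imp_continuous_on by blast

lemma poly_analytic_on: "poly q analytic_on S" for q :: "complex poly"
proof -
 have "poly q field_differentiable at x within UNIV" for x
  unfolding field_differentiable_def
  by (rule exI, rule has_field_derivative_at_within, rule poly_DERIV)
 then have "poly q holomorphic_on UNIV" by (simp add: holomorphic_on_def)
 then have "poly q analytic_on UNIV" by (simp add: analytic_on_open)
 then show ?thesis by (rule analytic_on_subset) simp
qed

lemma growth_cond_bound:
 assumes "growth_cond \<rho> f"
 obtains C m where "C \<ge> 0" "\<And>z. z \<in> parabola_closure \<rho> \<Longrightarrow> norm (f z) \<le> C * (1 + norm z) ^ m"
proof -
 obtain \<beta> where \<beta>: "(\<lambda>z. norm (f z)) \<in> O[inf at_infinity (principal (parabola_closure \<rho>))](\<lambda>z. norm z powr \<beta>)"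
  using assms by (auto simp: growth_cond_def)
 obtain c where c: "c > 0" "\<forall>\<^sub>F z in inf at_infinity (principal (parabola_closure \<rho>)). norm (norm (f z)) \<le> c * norm (norm z powr \<beta>)"
  using \<beta> by (rule landau_o.bigE)
 then obtain b where b: "\<And>z. z \<in> parabola_closure \<rho> \<Longrightarrow> b \<le> norm z \<Longrightarrow> norm (f z) \<le> c * norm z powr \<beta>"
  by (auto simp: eventually_inf_principal eventually_at_infinity)
 define m where "m = nat \<lceil>\<bar>\<beta>\<bar>\<rceil>"
 have m: "\<beta> \<le> real m" unfolding m_def by linarith
 let ?K = "parabola_closure \<rho> \<inter> cball 0 (max b 1)"
 have "compact ?K" by (intro closed_Int_compact closed_closure compact_cball)
 moreover have "continuous_on ?K f"
  by (rule continuous_on_subset[OF growth_cond_continuous[OF assms]]) simp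
 ultimately have "bounded (f ` ?K)" using compact_continuous_image compact_imp_bounded by blast
 then obtain D where D: "D > 0" "\<And>z. z \<in> ?K \<Longrightarrow> norm (f z) \<le> D"
  unfolding bounded_pos by auto
 show ?thesis
 proof (rule that[of "c + D" m])
  fix z assume z: "z \<in> parabola_closure \<rho>"
  have ge1: "1 \<le> (1 + norm z) ^ m" by simp
  show "norm (f z) \<le> (c + D) * (1 + norm z) ^ m"
  proof (cases "norm z \<le> max b 1")
   case True
   then have "norm (f z) \<le> D * 1" using D z by auto
   also have "\<dots> \<le> D * (1 + norm z) ^ m" using D ge1 by (intro mult_left_mono) auto
   also have "\<dots> \<le> (c + D) * (1 + norm z) ^ m" using c by (intro mult_right_mono) auto
   finally show ?thesis .
  next
   case False
   then have n1: "norm z \<ge> 1" "norm z \<ge> b" by auto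
   have "norm (f z) \<le> c * norm z powr \<beta>" by (rule b[OF z n1(2)])
   also have "norm z powr \<beta> \<le> norm z powr (real m)" using n1 m by (intro powr_mono) auto
   also have "norm z powr (real m) = norm z ^ m" using n1 by (subst powr_realpow) auto
   also have "norm z ^ m \<le> (1 + norm z) ^ m" by (intro power_mono) auto
   finally have "norm (f z) \<le> c * (1 + norm z) ^ m" using c by (simp add: mult_left_mono)
   also have "\<dots> \<le> (c + D) * (1 + norm z) ^ m" using D by (intro mult_right_mono) auto
   finally show ?thesis .
  qed
 qed (use c D in auto)
qed

lemma growth_cond_real:
 assumes "growth_cond \<rho> f" "\<rho> > 0"
 obtains C m where "C \<ge> 0" "continuous_on {0..} (\<lambda>x. f (cx x))"
  "\<And>x. x \<ge> 0 \<Longrightarrow> norm (f (cx x)) \<le> C * (1 + x) ^ m"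
proof -
 obtain C m where C: "C \<ge> 0" "\<And>z. z \<in> parabola_closure \<rho> \<Longrightarrow> norm (f z) \<le> C * (1 + norm z) ^ m"
  using growth_cond_bound[OF assms(1)] by blast
 have "continuous_on (parabola_closure \<rho>) f"
  by (rule growth_cond_continuous[OF assms(1)])
 then have "continuous_on {0..} (\<lambda>x. f (cx x))"
  by (rule continuous_on_compose2) (use nonneg_real_in_closure[OF assms(2)] in \<open>auto intro!: continuous_intros\<close>)
 moreover have "norm (f (cx x)) \<le> C * (1 + x) ^ m" if "x \<ge> 0" for x
  using C(2)[OF nonneg_real_in_closure[OF assms(2) that]] that by simp
 ultimately show ?thesis using C(1) that by blast
qed

lemma growth_cond_parabola:
 assumes "growth_cond \<rho> f" "\<rho> > 0"
 obtains C m where "C \<ge> 0" "continuous_on UNIV (\<lambda>t. f (zpar \<rho> t))"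
  "\<And>t. norm (f (zpar \<rho> t)) \<le> C * (1 + norm (zpar \<rho> t)) ^ m"
proof -
 obtain C m where C: "C \<ge> 0" "\<And>z. z \<in> parabola_closure \<rho> \<Longrightarrow> norm (f z) \<le> C * (1 + norm z) ^ m"
  using growth_cond_bound[OF assms(1)] by blast
 have "continuous_on UNIV (\<lambda>t. f (zpar \<rho> t))"
  using assms by (intro analytic_parabola_continuous) (auto simp: growth_cond_def)
 with C parabola_param_in_closure[OF assms(2)] that show ?thesis by blast
qed

definition shift_poly :: "real \<Rightarrow> nat \<Rightarrow> complex poly" where
 "shift_poly \<rho> M = [:of_real (\<rho>\<^sup>2 + 1), 1:] ^ M"

lemma degree_shift_poly [simp]: "degree (shift_poly \<rho> M) = M"
 by (simp add: shift_poly_def degree_power_eq)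

lemma shift_poly_nonzero:
 assumes "z \<in> parabola_closure \<rho>"
 shows "poly (shift_poly \<rho> M) z \<noteq> 0"
proof -
 have "Re (of_real (\<rho>\<^sup>2 + 1) + z) \<ge> 1" using Re_parabola_closure[OF assms] by simp
 then have "of_real (\<rho>\<^sup>2 + 1) + z \<noteq> 0" by (metis not_one_le_zero zero_complex.sel(1))
 then show ?thesis by (simp add: shift_poly_def)
qed

text \<open>Dividing by a power of \<open>z + c\<close> with \<open>- c\<close> outside the region makes every admissible function decay.\<close>

lemma growth_cond_decaying:
 assumes "growth_cond \<rho> f"
 obtains M C where "decaying \<rho> (\<lambda>z. f z / poly (shift_poly \<rho> M) z) C"
proof -
 obtain C m where C: "C \<ge> 0" "\<And>z. z \<in> parabola_closure \<rho> \<Longrightarrow> norm (f z) \<le> C * (1 + norm z) ^ m"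
  using growth_cond_bound[OF assms(1)] by blast
 define c0 where "c0 = \<rho>\<^sup>2 + 1"
 have c0: "c0 \<ge> 1" by (simp add: c0_def)
 have "decaying \<rho> (\<lambda>z. f z / poly (shift_poly \<rho> (m + 2)) z) (C * (2 + c0) ^ (m + 2))"
  unfolding decaying_def
 proof (intro conjI ballI)
  show "(\<lambda>z. f z / poly (shift_poly \<rho> (m + 2)) z) analytic_on parabola_closure \<rho>"
   by (rule analytic_on_divide[OF _ poly_analytic_on]) (use assms shift_poly_nonzero in \<open>auto simp: growth_cond_def\<close>)
 next
  fix z assume z: "z \<in> parabola_closure \<rho>"
  define d where "d = norm (of_real c0 + z)"
  have "1 \<le> Re (of_real c0 + z)" using Re_parabola_closure[OF z] by (simp add: c0_def)
  also have "\<dots> \<le> d" unfolding d_def by (rule complex_Re_le_cmod)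
  finally have d1: "d \<ge> 1" .
  have "norm z \<le> d + c0" using norm_triangle_ineq4[of "of_real c0 + z" "of_real c0"] c0 by (simp add: d_def)
  then have "1 + norm z \<le> d + (1 + c0) * 1" by simp
  also have "\<dots> \<le> d + (1 + c0) * d" using d1 c0 by (intro add_left_mono mult_left_mono) auto
  finally have le: "1 + norm z \<le> (2 + c0) * d" by (simp add: algebra_simps)
  have P: "norm (poly (shift_poly \<rho> (m + 2)) z) = d ^ (m + 2)"
   by (simp only: shift_poly_def poly_power norm_power d_def c0_def) simp
  have "norm (f z) * (1 + norm z)\<^sup>2 \<le> C * (1 + norm z) ^ m * (1 + norm z)\<^sup>2"
   by (intro mult_right_mono C(2)[OF z]) auto
  also have "\<dots> = C * (1 + norm z) ^ (m + 2)" by (simp add: power_add power2_eq_square)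
  also have "\<dots> \<le> C * ((2 + c0) * d) ^ (m + 2)"
   using C(1) by (intro mult_left_mono power_mono le) auto
  finally have "norm (f z) * (1 + norm z)\<^sup>2 \<le> C * (2 + c0) ^ (m + 2) * d ^ (m + 2)"
   by (simp only: power_mult_distrib mult.assoc)
  then show "norm (f z / poly (shift_poly \<rho> (m + 2)) z) * (1 + norm z)\<^sup>2 \<le> C * (2 + c0) ^ (m + 2)"
   using d1 unfolding norm_divide P by (simp add: pos_divide_le_eq)
 qed
 then show ?thesis by (rule that)
qed

subsection \<open>Interchanging the two integrals\<close>

lemma emeasure_lagM_finite:
 assumes "a > -1"
 shows "finite_measure (lagM a)"
proof
 have "integrable (lagM a) (\<lambda>x. 1 :: real)" using integrable_lagM_power[OF assms, of 0] by simp
 then show "emeasure (lagM a) (space (lagM a)) \<noteq> \<infinity>"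
  by (simp add: integrable_iff_bounded ennreal_mult_less_top)
qed

lemma lagM_parabola_Fubini:
 fixes u :: "complex poly" and g :: "real \<Rightarrow> complex"
 assumes a: "a > -1" and \<rho>: "\<rho> > 0" and g: "integrable lborel g"
 shows "(LINT x|lagM a. poly u (of_real x) * (LINT t|lborel. g t / (zpar \<rho> t - of_real x)))
   = (LINT t|lborel. g t * (LINT x|lagM a. poly u (of_real x) / (zpar \<rho> t - of_real x)))"
proof -
 interpret finite_measure "lagM a" by (rule emeasure_lagM_finite[OF a])
 interpret pair_sigma_finite "lagM a" lborel ..
 define f where "f = (\<lambda>(x, t). poly u (cx x) * g t / (zpar \<rho> t - of_real x))"
 have [measurable]: "g \<in> borel_measurable lborel" using g by (rule borel_measurable_integrable)
 have [measurable]: "cx \<in> borel_measurable (lagM a)"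
  by (intro measurable_lagM_continuous continuous_intros)
 have [measurable]: "(\<lambda>x. poly u (cx x)) \<in> borel_measurable (lagM a)"
  by (intro measurable_lagM_continuous continuous_intros)
 have meas: "f \<in> borel_measurable (lagM a \<Otimes>\<^sub>M lborel)" unfolding f_def by measurable
 have bound: "norm (f (x, t)) \<le> norm (poly u (cx x)) * norm (g t) / \<rho>\<^sup>2" if "x \<ge> 0" for x t
 proof -
  have "norm (zpar \<rho> t - of_real x) \<ge> \<rho>\<^sup>2" by (rule parabola_dist[OF \<rho> that])
  then show ?thesis using \<rho> unfolding f_def by (simp add: norm_mult norm_divide frac_le)
 qed
 have int_t: "integrable lborel (\<lambda>t. f (x, t))" if "x \<ge> 0" for x
  unfolding f_def using integrable_over_parabola_divide[OF \<rho> that, of "\<lambda>t. poly u (cx x) * g t"] g by simp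
 have "integrable (lagM a \<Otimes>\<^sub>M lborel) f"
 proof (rule Fubini_integrable[OF meas])
  show "AE x in lagM a. integrable lborel (\<lambda>y. f (x, y))" using int_t by (intro AE_I2) auto
  show "integrable (lagM a) (\<lambda>x. LINT y|lborel. norm (f (x, y)))"
  proof (rule Bochner_Integration.integrable_bound)
   show "integrable (lagM a) (\<lambda>x. norm (poly u (cx x)) * ((LINT t|lborel. norm (g t)) / \<rho>\<^sup>2))"
    by (intro integrable_mult_left integrable_norm integrable_lagM_poly a)
   show "(\<lambda>x. LINT y|lborel. norm (f (x, y))) \<in> borel_measurable (lagM a)"
    using meas by measurable
   show "AE x in lagM a. norm (LINT y|lborel. norm (f (x, y))) \<le> norm (norm (poly u (cx x)) * ((LINT t|lborel. norm (g t)) / \<rho>\<^sup>2))"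
   proof (rule AE_I2)
    fix x assume "x \<in> space (lagM a)"
    then have x: "x \<ge> 0" by simp
    have "(LINT y|lborel. norm (f (x, y))) \<le> (LINT t|lborel. norm (poly u (cx x)) * norm (g t) / \<rho>\<^sup>2)"
     using int_t[OF x] g by (intro integral_mono integrable_norm bound x) auto
    also have "\<dots> = norm (poly u (cx x)) * ((LINT t|lborel. norm (g t)) / \<rho>\<^sup>2)" by simp
    finally show "norm (LINT y|lborel. norm (f (x, y))) \<le> norm (norm (poly u (cx x)) * ((LINT t|lborel. norm (g t)) / \<rho>\<^sup>2))"
     by simp
   qed
  qed
 qed
 from Fubini_integral[OF this[unfolded f_def]]
 have F: "(LINT t|lborel. LINT x|lagM a. poly u (cx x) * g t / (zpar \<rho> t - of_real x))
   = (LINT x|lagM a. LINT t|lborel. poly u (cx x) * g t / (zpar \<rho> t - of_real x))"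
  by simp
 have "(LINT x|lagM a. poly u (of_real x) * (LINT t|lborel. g t / (zpar \<rho> t - of_real x)))
   = (LINT x|lagM a. LINT t|lborel. poly u (cx x) * g t / (zpar \<rho> t - of_real x))"
  unfolding integral_mult_right_zero[symmetric] times_divide_eq_right ..
 also have "\<dots> = (LINT t|lborel. g t * (LINT x|lagM a. poly u (of_real x) / (zpar \<rho> t - of_real x)))"
  unfolding F[symmetric] integral_mult_right_zero[symmetric] times_divide_eq_right by (simp only: mult.commute)
 finally show ?thesis .
qed

lemma parabola_off_ray:
 assumes "\<rho> > 0"
 shows "zpar \<rho> t \<in> off_ray"
 unfolding parabola_param_eq by (rule neg_square_off_ray) (use assms in simp)

lemma lagM_measurable_growth:
 assumes "growth_cond \<rho> f" "\<rho> > 0"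
 shows "(\<lambda>x. f (cx x)) \<in> borel_measurable (lagM a)"
 by (rule growth_cond_real[OF assms]) (rule measurable_lagM_continuous)

text \<open>For large \<open>n\<close> the polynomial by which \<open>f\<close> was divided can be moved through the Cauchy transform by orthogonality.\<close>

theorem laguerre_coeff_contour:
 assumes a: "a > -1" and \<rho>: "\<rho> > 0" and f: "growth_cond \<rho> f"
 obtains N where "\<And>n. n \<ge> N \<Longrightarrow> of_real (lag_h a n) * laguerre_coeff a f n
   = (LINT t|lborel. cauchy_transform a n (zpar \<rho> t) * f (zpar \<rho> t) * dparabola \<rho> t)"
proof -
 obtain M C where dec: "decaying \<rho> (\<lambda>z. f z / poly (shift_poly \<rho> M) z) C"
  by (rule growth_cond_decaying[OF f]) blast
 define P where "P = shift_poly \<rho> M"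
 define F where "F z = f z / poly P z" for z
 have decF: "decaying \<rho> F C" using dec by (simp add: F_def[abs_def] P_def)
 have P0: "poly P z \<noteq> 0" if "z \<in> parabola_closure \<rho>" for z unfolding P_def by (rule shift_poly_nonzero[OF that])
 have "of_real (lag_h a n) * laguerre_coeff a f n
   = (LINT t|lborel. cauchy_transform a n (zpar \<rho> t) * f (zpar \<rho> t) * dparabola \<rho> t)" if n: "n \<ge> M" for n
 proof -
  let ?L = "lagpoly a n :: complex poly"
  have meas: "(\<lambda>x. f (cx x) * laguerre a n (cx x)) \<in> borel_measurable (lagM a)"
   unfolding laguerre_eq_poly[OF a]
   by (intro borel_measurable_times lagM_measurable_growth[OF f \<rho>] measurable_lagM_continuous continuous_intros)
  have hn: "lag_h a n * (fact n / Gamma (real n + a + 1)) = 1"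
  proof -
   have "Gamma (real n + a + 1) > 0" by (rule Gamma_real_pos) (use a in simp)
   then show ?thesis by (simp add: lag_h_def)
  qed
  have "of_real (lag_h a n) * laguerre_coeff a f n
    = cx (lag_h a n * (fact n / Gamma (real n + a + 1))) * (LINT x|lagM a. f (cx x) * laguerre a n (cx x))"
   unfolding laguerre_coeff_def integral_lagM_complex[OF meas, symmetric] by (simp add: mult.assoc)
  also have "\<dots> = (LINT x|lagM a. poly (?L * P) (of_real x) * ((LINT t|lborel. F (zpar \<rho> t) * dparabola \<rho> t / (zpar \<rho> t - of_real x)) / (2 * of_real pi * \<i>)))"
   unfolding hn of_real_1 mult_1
  proof (rule lint_cong)
   fix x assume "x \<in> space (lagM a)"
   then have x: "x \<ge> 0" by simp
   show "f (cx x) * laguerre a n (cx x) = poly (?L * P) (of_real x) * ((LINT t|lborel. F (zpar \<rho> t) * dparabola \<rho> t / (zpar \<rho> t - of_real x)) / (2 * of_real pi * \<i>))"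
    unfolding parabola_cauchy_formula[OF decF \<rho> x] laguerre_eq_poly[OF a]
    using P0[OF nonneg_real_in_closure[OF \<rho> x]] by (simp add: F_def)
  qed
  also have "\<dots> = (LINT x|lagM a. poly (?L * P) (of_real x) * (LINT t|lborel. F (zpar \<rho> t) * dparabola \<rho> t / (zpar \<rho> t - of_real x))) / (2 * of_real pi * \<i>)"
   unfolding times_divide_eq_right by (rule integral_divide_zero)
  also have "\<dots> = (LINT t|lborel. F (zpar \<rho> t) * dparabola \<rho> t * (LINT x|lagM a. poly (?L * P) (of_real x) / (zpar \<rho> t - of_real x))) / (2 * of_real pi * \<i>)"
   by (subst lagM_parabola_Fubini[OF a \<rho> decaying_integrable[OF decF \<rho>]]) (rule refl)
  also have "\<dots> = (LINT t|lborel. F (zpar \<rho> t) * dparabola \<rho> t * (LINT x|lagM a. poly (?L * P) (of_real x) / (zpar \<rho> t - of_real x)) / (2 * of_real pi * \<i>))"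
   by (rule integral_divide_zero[symmetric])
  also have "\<dots> = (LINT t|lborel. cauchy_transform a n (zpar \<rho> t) * f (zpar \<rho> t) * dparabola \<rho> t)"
  proof (rule lint_cong)
   fix t
   let ?z = "zpar \<rho> t"
   have "(LINT x|lagM a. poly (?L * P) (of_real x) / (?z - of_real x)) = (LINT x|lagM a. - (poly (?L * P) (of_real x) / (of_real x - ?z)))"
    by (intro lint_cong) (simp add: minus_divide_right)
   also have "\<dots> = - (poly P ?z * lag_psi a n ?z)"
    using lag_psi_mult[OF a parabola_off_ray[OF \<rho>], of P n] n by (simp add: P_def)
   finally show "F ?z * dparabola \<rho> t * (LINT x|lagM a. poly (?L * P) (of_real x) / (?z - of_real x)) / (2 * of_real pi * \<i>)
     = cauchy_transform a n ?z * f ?z * dparabola \<rho> t"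
    unfolding cauchy_transform_eq[OF a parabola_off_ray[OF \<rho>]]
    using P0[OF parabola_param_in_closure[OF \<rho>]] by (simp add: F_def)
  qed
  finally show ?thesis .
 qed
 then show ?thesis by (rule that)
qed

subsection \<open>Interpolation\<close>

definition lagrange_basis :: "complex set \<Rightarrow> complex \<Rightarrow> complex poly" where
 "lagrange_basis S a = (\<Prod>b\<in>S - {a}. smult (1 / (a - b)) [:- b, 1:])"

lemma degree_lagrange_basis:
 assumes "finite S" "card S = Suc n" "a \<in> S"
 shows "degree (lagrange_basis S a) \<le> n"
proof -
 have "degree (lagrange_basis S a) \<le> sum (degree \<circ> (\<lambda>b. smult (1 / (a - b)) [:- b, 1:])) (S - {a})"
  unfolding lagrange_basis_def by (rule degree_prod_sum_le) (use assms in simp)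
 also have "\<dots> \<le> (\<Sum>b\<in>S - {a}. 1)"
  by (intro sum_mono) (simp only: o_def, rule order_trans[OF degree_smult_le], simp)
 finally have "degree (lagrange_basis S a) \<le> (\<Sum>b\<in>S - {a}. 1)" .
 then show ?thesis using assms by simp
qed

lemma poly_lagrange_basis:
 assumes "finite S" "a \<in> S" "c \<in> S"
 shows "poly (lagrange_basis S a) c = (if c = a then 1 else 0)"
proof (cases "c = a")
 case True
 then show ?thesis unfolding lagrange_basis_def poly_prod by (intro trans[OF prod.neutral]) (auto simp flip: diff_divide_distrib)
next
 case False
 then have "poly (lagrange_basis S a) c = 0"
  unfolding lagrange_basis_def poly_prod using assms by (intro prod_zero) (auto intro!: bexI[of _ c])
 with False show ?thesis by simp
qed

definition lagrange_poly :: "complex set \<Rightarrow> (complex \<Rightarrow> complex) \<Rightarrow> complex poly" where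
 "lagrange_poly S f = (\<Sum>a\<in>S. smult (f a) (lagrange_basis S a))"

lemma degree_lagrange_poly:
 assumes "finite S" "card S = Suc n"
 shows "degree (lagrange_poly S f) \<le> n"
 unfolding lagrange_poly_def
 by (intro degree_sum_le assms) (rule order_trans[OF degree_smult_le degree_lagrange_basis[OF assms]])

lemma poly_lagrange_poly:
 assumes "finite S" "c \<in> S"
 shows "poly (lagrange_poly S f) c = f c"
 unfolding lagrange_poly_def poly_sum poly_smult
 using assms by (simp add: poly_lagrange_basis if_distrib sum.delta' cong: if_cong)

lemma lagrange_poly_unique:
 assumes "finite S" "card S = Suc n" "degree p \<le> n" "\<And>c. c \<in> S \<Longrightarrow> poly p c = f c"
 shows "p = lagrange_poly S f"
 by (rule poly_eqI_degree[of S])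
   (use assms degree_lagrange_poly[OF assms(1,2)] in \<open>auto simp: poly_lagrange_poly le_imp_less_Suc\<close>)

lemma interpolant_poly_space:
 assumes "finite S" "card S = Suc n"
 shows "interpolant (poly_space n) S f = poly (lagrange_poly S f)"
 unfolding interpolant_def
proof (rule the_equality)
 show "poly (lagrange_poly S f) \<in> poly_space n \<and> (\<forall>x\<in>S. poly (lagrange_poly S f) x = f x)"
  using degree_lagrange_poly[OF assms] poly_lagrange_poly[OF assms(1)] by (auto simp: poly_space_def)
next
 fix g assume "g \<in> poly_space n \<and> (\<forall>x\<in>S. g x = f x)"
 then obtain p where p: "g = poly p" "degree p \<le> n" "\<And>c. c \<in> S \<Longrightarrow> poly p c = f c" by (auto simp: poly_space_def)
 then show "g = poly (lagrange_poly S f)" using lagrange_poly_unique[OF assms p(2,3)] by simp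
qed

lemma interpolant_exp_poly_space:
 assumes "finite S" "card S = Suc n"
 shows "interpolant (exp_poly_space n) S f = (\<lambda>z. exp (- z / 2) * poly (lagrange_poly S (\<lambda>z. exp (z / 2) * f z)) z)"
 unfolding interpolant_def
proof (rule the_equality)
 have e: "exp (- z / 2) * exp (z / 2) = 1" for z :: complex by (simp flip: exp_add)
 have e2: "exp (z / 2) * exp (- z / 2) = 1" for z :: complex by (simp flip: exp_add)
 let ?p = "lagrange_poly S (\<lambda>z. exp (z / 2) * f z)"
 show "(\<lambda>z. exp (- z / 2) * poly ?p z) \<in> exp_poly_space n \<and> (\<forall>x\<in>S. exp (- x / 2) * poly ?p x = f x)"
  using degree_lagrange_poly[OF assms] poly_lagrange_poly[OF assms(1)] e
  by (auto simp: exp_poly_space_def mult.assoc[symmetric])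
 fix g assume g: "g \<in> exp_poly_space n \<and> (\<forall>x\<in>S. g x = f x)"
 then obtain p where p: "g = (\<lambda>z. exp (- z / 2) * poly p z)" "degree p \<le> n" by (auto simp: exp_poly_space_def)
 have "poly p c = exp (c / 2) * f c" if "c \<in> S" for c
 proof -
  have "f c = exp (- c / 2) * poly p c" using g p that by auto
  then have "exp (c / 2) * f c = (exp (c / 2) * exp (- c / 2)) * poly p c" by simp
  then show ?thesis unfolding e2 by simp
 qed
 then have "p = ?p" by (rule lagrange_poly_unique[OF assms p(2)])
 with p show "g = (\<lambda>z. exp (- z / 2) * poly ?p z)" by simp
qed

lemma difference_quotient_poly:
 fixes p :: "complex poly"
 obtains q where "\<And>x. poly p z - poly p x = (z - x) * poly q x" "degree q \<le> degree p - 1"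
proof -
 have "[:- z, 1:] dvd (p - [:poly p z:])"
  by (simp add: poly_eq_0_iff_dvd[symmetric])
 then obtain q where q: "p - [:poly p z:] = [:- z, 1:] * q" by (elim dvdE)
 have "degree q \<le> degree p - 1"
 proof (cases "q = 0")
  case False
  have "Suc (degree q) = degree (p - [:poly p z:])"
   unfolding q using False by (simp add: degree_mult_eq del: mult_pCons_left)
  also have "\<dots> \<le> degree p" by (intro degree_diff_le) auto
  finally show ?thesis by simp
 qed simp
 moreover have "poly p z - poly p x = (z - x) * poly q x" for x
  using arg_cong[OF q, of "\<lambda>r. poly r x"] by (simp add: algebra_simps)
 ultimately show ?thesis using that by blast
qed

text \<open>The interpolation error of the kernel \<open>x \<mapsto> P(x) / (z - x)\<close>.\<close>

lemma kernel_interpolation_error: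
 assumes S: "finite S" "card S = Suc n" and W: "degree W = Suc n" "\<And>a. a \<in> S \<Longrightarrow> poly W a = 0" "poly W z \<noteq> 0"
  and P: "degree P \<le> Suc n" and zS: "\<And>a. a \<in> S \<Longrightarrow> z \<noteq> a" and zx: "z \<noteq> x"
 shows "poly P x / (z - x) - (\<Sum>a\<in>S. poly P a / (z - a) * poly (lagrange_basis S a) x) = poly P z * poly W x / (poly W z * (z - x))"
proof -
 obtain k where k: "\<And>x. poly W z - poly W x = (z - x) * poly k x" "degree k \<le> degree W - 1"
  using difference_quotient_poly by blast
 obtain r where r: "\<And>x. poly P z - poly P x = (z - x) * poly r x" "degree r \<le> degree P - 1"
  using difference_quotient_poly by blast
 define q where "q = smult (poly P z / poly W z) k - r"
 have dq: "degree q \<le> n"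
  unfolding q_def using k(2) r(2) W P by (intro degree_diff_le order_trans[OF degree_smult_le]) auto
 have id: "poly P y / (z - y) = poly q y + poly P z * poly W y / (poly W z * (z - y))" if "z \<noteq> y" for y
 proof -
  have 1: "poly P y = poly P z - (z - y) * poly r y" using r(1)[of y] by (simp add: algebra_simps)
  have 2: "poly W y = poly W z - (z - y) * poly k y" using k(1)[of y] by (simp add: algebra_simps)
  show ?thesis unfolding q_def 1 2 using that W(3) by (simp add: divide_simps) (simp add: algebra_simps)
 qed
 have "poly q a = poly P a / (z - a)" if "a \<in> S" for a
  using id[OF zS[OF that]] W(2)[OF that] by simp
 then have "q = lagrange_poly S (\<lambda>a. poly P a / (z - a))"
  by (rule lagrange_poly_unique[OF S dq])
 then have "poly q x = (\<Sum>a\<in>S. poly P a / (z - a) * poly (lagrange_basis S a) x)"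
  by (simp add: lagrange_poly_def poly_sum)
 then show ?thesis using id[OF zx] by simp
qed

text \<open>Superposition of the error for the kernel over the parabola.  The threshold \<open>N\<close> depends on the growth of \<open>f\<close> only, not
 on the nodes.\<close>

theorem interpolation_error_contour:
 assumes \<rho>: "\<rho> > 0" and f: "growth_cond \<rho> f"
 obtains N where "\<And>n X W x. n \<ge> N \<Longrightarrow> finite X \<Longrightarrow> card X = Suc n \<Longrightarrow> (\<And>a. a \<in> X \<Longrightarrow> a \<ge> 0) \<Longrightarrow> degree W = Suc n \<Longrightarrow>
   (\<And>a. a \<in> X \<Longrightarrow> poly W (cx a) = 0) \<Longrightarrow> (\<And>t. poly W (zpar \<rho> t) \<noteq> 0) \<Longrightarrow> x \<ge> 0 \<Longrightarrow>
   f (of_real x) - poly (lagrange_poly (of_real ` X) f) (of_real x) =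
    poly W (of_real x) * (LINT t|lborel. f (zpar \<rho> t) / poly W (zpar \<rho> t) * dparabola \<rho> t / (zpar \<rho> t - of_real x)) / (2 * of_real pi * \<i>)"
proof -
 obtain M C where dec: "decaying \<rho> (\<lambda>z. f z / poly (shift_poly \<rho> M) z) C"
  by (rule growth_cond_decaying[OF f]) blast
 define P where "P = shift_poly \<rho> M"
 define F where "F z = f z / poly P z" for z
 have decF: "decaying \<rho> F C" using dec by (simp add: F_def[abs_def] P_def)
 have P0: "poly P z \<noteq> 0" if "z \<in> parabola_closure \<rho>" for z unfolding P_def by (rule shift_poly_nonzero[OF that])
 let ?z = "zpar \<rho>" and ?d = "dparabola \<rho>"
 have rep: "f (of_real y) = poly P (of_real y) * (LINT t|lborel. F (?z t) * ?d t / (?z t - of_real y)) / (2 * of_real pi * \<i>)" if "y \<ge> 0" for y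
  unfolding parabola_cauchy_formula[OF decF \<rho> that] using P0[OF nonneg_real_in_closure[OF \<rho> that]] by (simp add: F_def)
 have int: "integrable lborel (\<lambda>t. F (?z t) * ?d t / (?z t - of_real y))" if "y \<ge> 0" for y
  by (rule integrable_over_parabola_divide[OF \<rho> that decaying_integrable[OF decF \<rho>]])
 have zn: "?z t \<noteq> of_real y" if "y \<ge> 0" for t y
  using parabola_dist[OF \<rho> that, of t] \<rho> by auto
 show ?thesis
 proof (rule that[of M])
  fix n :: nat and X :: "real set" and W :: "complex poly" and x :: real
  assume n: "n \<ge> M" and X: "finite X" "card X = Suc n" "\<And>a. a \<in> X \<Longrightarrow> a \<ge> 0"
   and W: "degree W = Suc n" "\<And>a. a \<in> X \<Longrightarrow> poly W (cx a) = 0" "\<And>t. poly W (?z t) \<noteq> 0" and x: "x \<ge> 0"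
  let ?S = "cx ` X"
  have S: "finite ?S" "card ?S = Suc n" using X by (auto simp: card_image inj_on_def)
  let ?l = "\<lambda>a. poly (lagrange_basis ?S (of_real a)) (cx x)"
  have "f (of_real x) - poly (lagrange_poly ?S f) (of_real x) = f (of_real x) - (\<Sum>a\<in>X. f (of_real a) * ?l a)"
   by (simp add: lagrange_poly_def poly_sum sum.reindex inj_on_def)
  also have "\<dots> = (poly P (of_real x) * (LINT t|lborel. F (?z t) * ?d t / (?z t - of_real x))
    - (\<Sum>a\<in>X. (poly P (of_real a) * ?l a) * (LINT t|lborel. F (?z t) * ?d t / (?z t - of_real a)))) / (2 * of_real pi * \<i>)"
   unfolding diff_divide_distrib sum_divide_distrib using rep[OF x] rep[OF X(3)]
   by (intro arg_cong2[where f = minus] sum.cong) (simp_all add: mult_ac)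
  also have "(poly P (of_real x) * (LINT t|lborel. F (?z t) * ?d t / (?z t - of_real x))
    - (\<Sum>a\<in>X. (poly P (of_real a) * ?l a) * (LINT t|lborel. F (?z t) * ?d t / (?z t - of_real a))))
    = (LINT t|lborel. poly P (of_real x) * (F (?z t) * ?d t / (?z t - of_real x))
    - (\<Sum>a\<in>X. (poly P (of_real a) * ?l a) * (F (?z t) * ?d t / (?z t - of_real a))))"
   by (subst Bochner_Integration.integral_diff Bochner_Integration.integral_sum
      | intro integrable_mult_right Bochner_Integration.integrable_sum int x X | simp only: integral_mult_right_zero)+
  also have "\<dots> = (LINT t|lborel. poly W (of_real x) * (f (?z t) / poly W (?z t) * ?d t / (?z t - of_real x)))"
  proof (rule lint_cong)
   fix t
   have K: "poly P (of_real x) / (?z t - of_real x) - (\<Sum>a\<in>?S. poly P a / (?z t - a) * poly (lagrange_basis ?S a) (of_real x))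
     = poly P (?z t) * poly W (of_real x) / (poly W (?z t) * (?z t - of_real x))"
    by (rule kernel_interpolation_error[OF S W(1) _ W(3)])
      (use W(2) n zn X(3) x in \<open>auto simp: P_def\<close>)
   have "poly P (of_real x) * (F (?z t) * ?d t / (?z t - of_real x)) - (\<Sum>a\<in>X. (poly P (of_real a) * ?l a) * (F (?z t) * ?d t / (?z t - of_real a)))
     = F (?z t) * ?d t * (poly P (of_real x) / (?z t - of_real x) - (\<Sum>a\<in>?S. poly P a / (?z t - a) * poly (lagrange_basis ?S a) (of_real x)))"
    by (simp add: sum.reindex inj_on_def right_diff_distrib sum_distrib_left mult_ac)
   also have "\<dots> = poly W (of_real x) * (f (?z t) / poly W (?z t) * ?d t / (?z t - of_real x))"
    unfolding K using P0[OF parabola_param_in_closure[OF \<rho>], of t] by (simp add: F_def)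
   finally show "poly P (of_real x) * (F (?z t) * ?d t / (?z t - of_real x)) - (\<Sum>a\<in>X. (poly P (of_real a) * ?l a) * (F (?z t) * ?d t / (?z t - of_real a)))
     = poly W (of_real x) * (f (?z t) / poly W (?z t) * ?d t / (?z t - of_real x))" .
  qed
  also have "\<dots> = poly W (of_real x) * (LINT t|lborel. f (?z t) / poly W (?z t) * ?d t / (?z t - of_real x))"
   by (rule integral_mult_right_zero)
  finally show "f (of_real x) - poly (lagrange_poly ?S f) (of_real x) =
    poly W (of_real x) * (LINT t|lborel. f (?z t) / poly W (?z t) * ?d t / (?z t - of_real x)) / (2 * of_real pi * \<i>)" .
 qed
qed

section \<open>Relations between the decay hypotheses\<close>

abbreviation nodeweight :: "real \<Rightarrow> real \<Rightarrow> real" where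
 "nodeweight \<rho> t \<equiv> 1 + norm (zpar \<rho> t)"

text \<open>Eventually uniform decay along the parabola, faster than every power of \<open>z\<close>.\<close>

definition rapid :: "real \<Rightarrow> (nat \<Rightarrow> real \<Rightarrow> real) \<Rightarrow> bool" where
 "rapid \<rho> A \<longleftrightarrow> (\<forall>m::nat. \<exists>K. \<forall>\<^sub>F n in sequentially. \<forall>t. A n t * nodeweight \<rho> t ^ m \<le> K)"

lemma rapid_dominated:
 assumes "rapid \<rho> A" "\<forall>\<^sub>F n in sequentially. \<forall>t. B n t \<le> C * nodeweight \<rho> t ^ k * A n t" "C \<ge> 0"
 shows "rapid \<rho> B"
 unfolding rapid_def
proof
 fix m
 obtain K where K: "\<forall>\<^sub>F n in sequentially. \<forall>t. A n t * nodeweight \<rho> t ^ (k + m) \<le> K"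
  using assms(1) unfolding rapid_def by blast
 have "\<forall>\<^sub>F n in sequentially. \<forall>t. B n t * nodeweight \<rho> t ^ m \<le> C * K"
  using K assms(2)
 proof eventually_elim
  case (elim n)
  show ?case
  proof
   fix t
   have "B n t * nodeweight \<rho> t ^ m \<le> (C * nodeweight \<rho> t ^ k * A n t) * nodeweight \<rho> t ^ m"
    using elim(2) by (intro mult_right_mono) auto
   also have "\<dots> = C * (A n t * nodeweight \<rho> t ^ (k + m))" by (simp add: power_add mult_ac)
   also have "\<dots> \<le> C * K" using elim(1) assms(3) by (intro mult_left_mono) auto
   finally show "B n t * nodeweight \<rho> t ^ m \<le> C * K" .
  qed
 qed
 then show "\<exists>K. \<forall>\<^sub>F n in sequentially. \<forall>t. B n t * nodeweight \<rho> t ^ m \<le> K" by blast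
qed

lemma rapid_square:
 assumes "rapid \<rho> A" "\<And>n t. A n t \<ge> 0"
 shows "rapid \<rho> (\<lambda>n t. A n t ^ 2)"
 unfolding rapid_def
proof
 fix m
 obtain K where K: "\<forall>\<^sub>F n in sequentially. \<forall>t. A n t * nodeweight \<rho> t ^ m \<le> K"
  using assms(1) unfolding rapid_def by blast
 have "\<forall>\<^sub>F n in sequentially. \<forall>t. A n t ^ 2 * nodeweight \<rho> t ^ m \<le> K\<^sup>2"
  using K
 proof eventually_elim
  case (elim n)
  show ?case
  proof
   fix t
   have "A n t ^ 2 * nodeweight \<rho> t ^ m \<le> A n t ^ 2 * (nodeweight \<rho> t ^ m)\<^sup>2"
    by (intro mult_left_mono self_le_power one_le_power) auto
   also have "\<dots> = (A n t * nodeweight \<rho> t ^ m)\<^sup>2" by (simp add: power_mult_distrib)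
   also have "\<dots> \<le> K\<^sup>2" using elim assms(2) by (intro power_mono) auto
   finally show "A n t ^ 2 * nodeweight \<rho> t ^ m \<le> K\<^sup>2" .
  qed
 qed
 then show "\<exists>K. \<forall>\<^sub>F n in sequentially. \<forall>t. A n t ^ 2 * nodeweight \<rho> t ^ m \<le> K" by blast
qed

lemma rapid_sqrt:
 assumes "rapid \<rho> (\<lambda>n t. A n t ^ 2)" "\<And>n t. A n t \<ge> 0"
 shows "rapid \<rho> A"
 unfolding rapid_def
proof
 fix m
 obtain K where K: "\<forall>\<^sub>F n in sequentially. \<forall>t. A n t ^ 2 * nodeweight \<rho> t ^ (2 * m) \<le> K"
  using assms(1) unfolding rapid_def by blast
 have "\<forall>\<^sub>F n in sequentially. \<forall>t. A n t * nodeweight \<rho> t ^ m \<le> sqrt K"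
  using K
 proof eventually_elim
  case (elim n)
  show ?case
  proof
   fix t
   have "(A n t * nodeweight \<rho> t ^ m)\<^sup>2 \<le> K" using elim by (simp add: power_mult_distrib mult.commute flip: power_mult)
   then show "A n t * nodeweight \<rho> t ^ m \<le> sqrt K" by (rule real_le_rsqrt)
  qed
 qed
 then show "\<exists>K. \<forall>\<^sub>F n in sequentially. \<forall>t. A n t * nodeweight \<rho> t ^ m \<le> K" by blast
qed

text \<open>On each point of the parabola either the real part of \<open>1 / (x - z)\<close> or its imaginary part has the same sign
 for all \<open>x \<ge> 0\<close> and is at least of order \<open>(1 + x)\<^sup>-\<^sup>2\<close>; the unit number \<open>u\<close> selects it.  The difference of two simple
 fractions is used instead of a square, because its integrals are values of Stieltjes transforms at \<open>-1\<close> and \<open>-2\<close>.\<close>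

lemma parabola_Stieltjes_lower:
 assumes "\<rho> > 0"
 obtains u where "norm u = 1"
  "\<And>x. x \<ge> 0 \<Longrightarrow> Re (u / (cx x - zpar \<rho> t)) \<ge> 3 * \<rho>\<^sup>2 / 4 / nodeweight \<rho> t ^ 2 * (1 / (x + 1) - 1 / (x + 2))"
proof -
 let ?z = "zpar \<rho> t"
 have re: "Re ?z = t\<^sup>2 - \<rho>\<^sup>2" "Im ?z = - (2 * t * \<rho>)" by (simp_all add: parabola_param_def)
 have step: "3 * \<rho>\<^sup>2 / 4 / nodeweight \<rho> t ^ 2 * (1 / (x + 1) - 1 / (x + 2)) \<le> (3 * \<rho>\<^sup>2 / 4) / (norm (of_real x - ?z))\<^sup>2" if "x \<ge> 0" for x
 proof -
  have n0: "norm (of_real x - ?z) > 0"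
   using parabola_dist[OF assms that, of t] assms by (metis norm_minus_commute order_less_le_trans zero_less_power)
  have "norm (of_real x - ?z) \<le> x + norm ?z" using norm_triangle_ineq4[of "of_real x" ?z] that by simp
  also have "\<dots> \<le> nodeweight \<rho> t * (x + 1)" using that by (simp add: algebra_simps)
  finally have "(norm (of_real x - ?z))\<^sup>2 \<le> (nodeweight \<rho> t * (x + 1))\<^sup>2" by (intro power_mono) auto
  then have "1 / (nodeweight \<rho> t * (x + 1))\<^sup>2 \<le> 1 / (norm (of_real x - ?z))\<^sup>2"
   using n0 that by (intro divide_left_mono mult_pos_pos zero_less_power) (auto intro: add_pos_nonneg)
  moreover have "1 / (x + 1) - 1 / (x + 2) \<le> 1 / (x + 1)\<^sup>2"
   using that by (simp add: divide_simps power2_eq_square)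
  then have "1 / nodeweight \<rho> t ^ 2 * (1 / (x + 1) - 1 / (x + 2)) \<le> 1 / nodeweight \<rho> t ^ 2 * (1 / (x + 1)\<^sup>2)"
   by (intro mult_left_mono) auto
  ultimately have "1 / nodeweight \<rho> t ^ 2 * (1 / (x + 1) - 1 / (x + 2)) \<le> 1 / (norm (of_real x - ?z))\<^sup>2"
   by (simp add: power_mult_distrib)
  then have "(3 * \<rho>\<^sup>2 / 4) * (1 / nodeweight \<rho> t ^ 2 * (1 / (x + 1) - 1 / (x + 2))) \<le> (3 * \<rho>\<^sup>2 / 4) * (1 / (norm (of_real x - ?z))\<^sup>2)"
   by (rule mult_left_mono) simp
  then show ?thesis by simp
 qed
 have inv: "1 / (of_real x - ?z) = cnj (of_real x - ?z) / of_real ((norm (of_real x - ?z))\<^sup>2)" for x :: real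
  using complex_div_cnj[of 1 "of_real x - ?z"] by simp
 show ?thesis
 proof (cases "- Re ?z \<ge> 3 * \<rho>\<^sup>2 / 4")
  case True
  have "Re (1 / (of_real x - ?z)) = (x - Re ?z) / (norm (of_real x - ?z))\<^sup>2" for x
   unfolding inv by (simp add: Re_divide_of_real del: of_real_power)
  note Re1 = this
  have "3 * \<rho>\<^sup>2 / 4 / nodeweight \<rho> t ^ 2 * (1 / (x + 1) - 1 / (x + 2)) \<le> Re (1 / (of_real x - ?z))" if "x \<ge> 0" for x
   by (rule order_trans[OF step[OF that]], unfold Re1, rule divide_right_mono) (use True that in simp_all)
  then show ?thesis by (intro that[of 1]) simp_all
 next
  case False
  have im: "\<bar>Im ?z\<bar> \<ge> 3 * \<rho>\<^sup>2 / 4"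
  proof -
   have "t\<^sup>2 > \<rho>\<^sup>2 / 4" using False unfolding re by simp
   then have "(\<rho> / 2)\<^sup>2 < \<bar>t\<bar>\<^sup>2" by (simp add: power_divide)
   then have "\<rho> / 2 < \<bar>t\<bar>" by (rule power_less_imp_less_base) simp
   then have "2 * (\<rho> / 2) * \<rho> \<le> 2 * \<bar>t\<bar> * \<rho>" using assms by (intro mult_right_mono mult_left_mono) auto
   then show ?thesis unfolding re using assms by (simp add: abs_mult power2_eq_square)
  qed
  define u where "u = (if Im ?z > 0 then - \<i> else \<i>)"
  have Reu: "Re (u / (of_real x - ?z)) = \<bar>Im ?z\<bar> / (norm (of_real x - ?z))\<^sup>2" for x
  proof -
   have "u / (of_real x - ?z) = u * (1 / (of_real x - ?z))" by simp
   also have "\<dots> = (u * cnj (of_real x - ?z)) / of_real ((norm (of_real x - ?z))\<^sup>2)" unfolding inv by simp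
   also have "Re \<dots> = Re (u * cnj (of_real x - ?z)) / (norm (of_real x - ?z))\<^sup>2" by (rule Re_divide_of_real)
   also have "Re (u * cnj (of_real x - ?z)) = \<bar>Im ?z\<bar>" by (simp add: u_def)
   finally show ?thesis .
  qed
  have "norm u = 1" by (simp add: u_def)
  moreover have "3 * \<rho>\<^sup>2 / 4 / nodeweight \<rho> t ^ 2 * (1 / (x + 1) - 1 / (x + 2)) \<le> Re (u / (of_real x - ?z))" if "x \<ge> 0" for x
   by (rule order_trans[OF step[OF that]], unfold Reu, rule divide_right_mono[OF im]) simp
  ultimately show ?thesis by (rule that)
 qed
qed

lemma parabola_Stieltjes_upper:
 assumes "\<rho> > 0" "x \<ge> 0"
 shows "1 / norm (cx x - zpar \<rho> t) \<le> (1 + 1 / \<rho>\<^sup>2) * nodeweight \<rho> t * (1 / (x + 1))"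
proof -
 let ?z = "zpar \<rho> t"
 define d where "d = norm (of_real x - ?z)"
 have d: "d \<ge> \<rho>\<^sup>2" unfolding d_def using parabola_dist[OF assms, of t] by (simp add: norm_minus_commute)
 have d0: "d > 0" using d assms by (auto intro: order_less_le_trans[OF zero_less_power])
 have "x \<le> d + norm ?z" using norm_triangle_ineq[of "of_real x - ?z" ?z] assms by (simp add: d_def)
 then have "x + 1 \<le> d + nodeweight \<rho> t" by simp
 also have "\<dots> \<le> d * nodeweight \<rho> t + d / \<rho>\<^sup>2 * nodeweight \<rho> t"
 proof (rule add_mono)
  show "d \<le> d * nodeweight \<rho> t" using d0 by simp
  have "1 \<le> d / \<rho>\<^sup>2" using d assms by simp
  then show "nodeweight \<rho> t \<le> d / \<rho>\<^sup>2 * nodeweight \<rho> t" using mult_right_mono[of 1 "d / \<rho>\<^sup>2" "nodeweight \<rho> t"] by simp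
 qed
 also have "\<dots> = (1 + 1 / \<rho>\<^sup>2) * nodeweight \<rho> t * d" by (simp add: algebra_simps)
 finally show ?thesis unfolding d_def[symmetric] using d0 assms(2) by (simp add: divide_simps)
qed

subsection \<open>Bounds for the product \<open>\<psi>\<^sub>n L\<^sub>n\<close> and the logarithmic derivative\<close>

definition lag_tau :: "real \<Rightarrow> nat \<Rightarrow> real \<Rightarrow> real" where
 "lag_tau a n s = (LINT x|lagM a. (poly (lagpoly a n) x)\<^sup>2 / (x + s))"

lemma integrable_lag_square:
 assumes "a > -1"
 shows "integrable (lagM a) (\<lambda>x. (poly (lagpoly a n) x)\<^sup>2)"
  and "(LINT x|lagM a. (poly (lagpoly a n) x)\<^sup>2) = lag_h a n"
proof -
 have "integrable (lagM a) (\<lambda>x. cx ((poly (lagpoly a n) x)\<^sup>2))"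
  using integrable_lagM_poly[OF assms(1), of "lagpoly a n * lagpoly a n"]
  by (simp add: poly_lagpoly_of_real power2_eq_square)
 then show "integrable (lagM a) (\<lambda>x. (poly (lagpoly a n) x)\<^sup>2)"
  unfolding complex_of_real_integrable_eq .
 have "cx (LINT x|lagM a. (poly (lagpoly a n) x)\<^sup>2) = of_real (lag_h a n)"
  unfolding lagint_lagpoly_square[OF assms(1), symmetric] lagint_def integral_complex_of_real[symmetric]
  by (simp add: poly_lagpoly_of_real power2_eq_square)
 then show "(LINT x|lagM a. (poly (lagpoly a n) x)\<^sup>2) = lag_h a n" by (simp only: of_real_eq_iff)
qed

lemma integrable_lag_square_divide:
 assumes "a > -1" "s > 0"
 shows "integrable (lagM a) (\<lambda>x. (poly (lagpoly a n) x)\<^sup>2 / (x + s))"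
proof (rule Bochner_Integration.integrable_bound)
 show "integrable (lagM a) (\<lambda>x. (poly (lagpoly a n) x)\<^sup>2 / s)"
  using integrable_lag_square[OF assms(1)] by simp
 show "(\<lambda>x. (poly (lagpoly a n) x)\<^sup>2 / (x + s)) \<in> borel_measurable (lagM a)"
  using assms by (intro measurable_lagM_continuous continuous_intros) auto
 show "AE x in lagM a. norm ((poly (lagpoly a n) x)\<^sup>2 / (x + s)) \<le> norm ((poly (lagpoly a n) x)\<^sup>2 / s)"
  using assms by (intro AE_I2) (auto intro!: divide_left_mono)
qed

lemma lag_tau_eq:
 assumes "a > -1" "s > 0"
 shows "poly (lagpoly a n) (- of_real s) * lag_psi a n (- of_real s) = of_real (lag_tau a n s)"
proof -
 have "- cx s \<in> off_ray" using assms by (simp add: off_ray_iff)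
 from lag_psi_times_lagpoly[OF assms(1) this, of n]
 have "poly (lagpoly a n) (- of_real s) * lag_psi a n (- of_real s)
   = (LINT x|lagM a. cx ((poly (lagpoly a n) x)\<^sup>2 / (x + s)))" by simp
 then show ?thesis unfolding lag_tau_def by (simp only: integral_complex_of_real)
qed

lemma lag_tau_asymp:
 assumes "a > -1" "s > 0"
 shows "(\<lambda>n. lag_tau a n s * real n powr (1 / 2 - a)) \<longlonglongrightarrow> 1 / (2 * sqrt s)"
proof -
 let ?w = "cx (sqrt s)"
 have w: "Re ?w > 0" "- (?w\<^sup>2) = - of_real s" using assms by (simp_all flip: of_real_power)
 have "(\<lambda>n. (poly (lagpoly a n) (- (?w\<^sup>2)) * exp (- 2 * of_real (sqrt n) * ?w) * of_real (real n powr (1 / 4 - a / 2)))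
   * (lag_psi a n (- (?w\<^sup>2)) * exp (2 * of_real (sqrt n) * ?w) * of_real (real n powr (1 / 4 - a / 2))))
  \<longlonglongrightarrow> lag_lim a ?w * (1 / (2 * ?w * lag_lim a ?w))"
  by (intro tendsto_mult lagpoly_asymp lag_psi_asymp assms w)
 also have "lag_lim a ?w * (1 / (2 * ?w * lag_lim a ?w)) = cx (1 / (2 * sqrt s))"
  using lag_lim_nonzero[of a ?w] by simp
 also have "(\<lambda>n. (poly (lagpoly a n) (- (?w\<^sup>2)) * exp (- 2 * of_real (sqrt n) * ?w) * of_real (real n powr (1 / 4 - a / 2)))
   * (lag_psi a n (- (?w\<^sup>2)) * exp (2 * of_real (sqrt n) * ?w) * of_real (real n powr (1 / 4 - a / 2))))
  = (\<lambda>n. cx (lag_tau a n s * real n powr (1 / 2 - a)))"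
 proof
  fix n :: nat
  have e: "exp (- 2 * of_real (sqrt n) * ?w) * exp (2 * of_real (sqrt n) * ?w) = 1" by (simp flip: exp_add)
  have p: "real n powr (1 / 4 - a / 2) * real n powr (1 / 4 - a / 2) = real n powr (1 / 2 - a)"
   by (simp flip: powr_add)
  have "(poly (lagpoly a n) (- (?w\<^sup>2)) * exp (- 2 * of_real (sqrt n) * ?w) * of_real (real n powr (1 / 4 - a / 2)))
   * (lag_psi a n (- (?w\<^sup>2)) * exp (2 * of_real (sqrt n) * ?w) * of_real (real n powr (1 / 4 - a / 2)))
   = (poly (lagpoly a n) (- (?w\<^sup>2)) * lag_psi a n (- (?w\<^sup>2))) * (exp (- 2 * of_real (sqrt n) * ?w) * exp (2 * of_real (sqrt n) * ?w))
    * of_real (real n powr (1 / 4 - a / 2) * real n powr (1 / 4 - a / 2))"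
   by (simp only: of_real_mult mult_ac)
  also have "\<dots> = cx (lag_tau a n s * real n powr (1 / 2 - a))"
   unfolding e p w(2) lag_tau_eq[OF assms] by simp
  finally show "(poly (lagpoly a n) (- (?w\<^sup>2)) * exp (- 2 * of_real (sqrt n) * ?w) * of_real (real n powr (1 / 4 - a / 2)))
   * (lag_psi a n (- (?w\<^sup>2)) * exp (2 * of_real (sqrt n) * ?w) * of_real (real n powr (1 / 4 - a / 2)))
   = cx (lag_tau a n s * real n powr (1 / 2 - a))" .
 qed
 finally show ?thesis by (simp only: tendsto_of_real_iff)
qed

text \<open>\<open>L\<^sub>n \<psi>\<^sub>n\<close> is the Stieltjes transform of \<open>L\<^sub>n\<^sup>2 \<omega>\<close>.  The positive lower bound for its kernel reduces the claim
 to the known asymptotics at the two points \<open>-1\<close> and \<open>-2\<close>.\<close>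

lemma lag_product_lower:
 assumes "a > -1" "\<rho> > 0"
 obtains c where "c > 0" "\<forall>\<^sub>F n in sequentially. \<forall>t.
   norm (poly (lagpoly a n) (zpar \<rho> t) * lag_psi a n (zpar \<rho> t)) * nodeweight \<rho> t ^ 2 \<ge> c * real n powr (a - 1 / 2)"
proof -
 define l where "l = 1 / (2 * sqrt 1) - 1 / (2 * sqrt (2::real))"
 define c0 where "c0 = l / 2"
 have "l > 0" by (simp add: l_def field_simps)
 then have c0: "c0 > 0" "c0 < l" by (simp_all add: c0_def)
 have "(\<lambda>n. lag_tau a n 1 * real n powr (1 / 2 - a) - lag_tau a n 2 * real n powr (1 / 2 - a)) \<longlonglongrightarrow> l"
  unfolding l_def by (intro tendsto_diff lag_tau_asymp assms) auto
 then have "\<forall>\<^sub>F n in sequentially. lag_tau a n 1 * real n powr (1 / 2 - a) - lag_tau a n 2 * real n powr (1 / 2 - a) > c0"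
  by (rule order_tendstoD) (rule c0)
 then have "\<forall>\<^sub>F n in sequentially. \<forall>t. norm (poly (lagpoly a n) (zpar \<rho> t) * lag_psi a n (zpar \<rho> t)) * nodeweight \<rho> t ^ 2 \<ge> (3 * \<rho>\<^sup>2 / 4 * c0) * real n powr (a - 1 / 2)"
  using eventually_gt_at_top[of 0]
 proof eventually_elim
  case (elim n)
  have pw: "real n powr (1 / 2 - a) * real n powr (a - 1 / 2) = 1"
   using elim(2) by (simp flip: powr_add)
  have "c0 * real n powr (a - 1 / 2) \<le> ((lag_tau a n 1 - lag_tau a n 2) * real n powr (1 / 2 - a)) * real n powr (a - 1 / 2)"
   using elim(1) by (intro mult_right_mono) (auto simp: algebra_simps)
  then have tau: "c0 * real n powr (a - 1 / 2) \<le> lag_tau a n 1 - lag_tau a n 2"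
   using pw by (simp add: mult.assoc)
  show ?case
  proof
   fix t
   let ?z = "zpar \<rho> t"
   let ?k = "3 * \<rho>\<^sup>2 / 4 / nodeweight \<rho> t ^ 2"
   obtain u where u: "norm u = 1" "\<And>x. x \<ge> 0 \<Longrightarrow> Re (u / (cx x - ?z)) \<ge> ?k * (1 / (x + 1) - 1 / (x + 2))"
    using parabola_Stieltjes_lower[OF assms(2), of t] by blast
   let ?f = "\<lambda>x. (of_real ((poly (lagpoly a n) x)\<^sup>2)) / (cx x - ?z)"
   have int: "integrable (lagM a) ?f"
    using integrable_lagM_poly_divide[OF assms(1) parabola_off_ray[OF assms(2)], of "lagpoly a n * lagpoly a n"]
    by (simp add: poly_lagpoly_of_real power2_eq_square)
   have ints: "integrable (lagM a) (\<lambda>x. ?k * ((poly (lagpoly a n) x)\<^sup>2 / (x + 1) - (poly (lagpoly a n) x)\<^sup>2 / (x + 2)))"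
    by (intro integrable_mult_right Bochner_Integration.integrable_diff integrable_lag_square_divide assms) auto
   have "?k * (lag_tau a n 1 - lag_tau a n 2) = (LINT x|lagM a. ?k * ((poly (lagpoly a n) x)\<^sup>2 / (x + 1) - (poly (lagpoly a n) x)\<^sup>2 / (x + 2)))"
    unfolding lag_tau_def integral_mult_right_zero
    by (subst Bochner_Integration.integral_diff) (auto intro!: integrable_lag_square_divide assms)
   also have "\<dots> \<le> (LINT x|lagM a. Re (u * ?f x))"
   proof (rule integral_mono[OF ints])
    show "integrable (lagM a) (\<lambda>x. Re (u * ?f x))" using int by (intro integrable_Re integrable_mult_right)
    fix x assume "x \<in> space (lagM a)"
    then have x: "x \<ge> 0" by simp
    have "(poly (lagpoly a n) x)\<^sup>2 * (?k * (1 / (x + 1) - 1 / (x + 2))) \<le> (poly (lagpoly a n) x)\<^sup>2 * Re (u / (cx x - ?z))"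
     by (intro mult_left_mono u(2)[OF x]) auto
    also have "\<dots> = Re (of_real ((poly (lagpoly a n) x)\<^sup>2) * (u / (cx x - ?z)))"
     by (simp only: Re_complex_of_real Im_complex_of_real times_complex.sel mult_zero_left diff_zero)
    also have "of_real ((poly (lagpoly a n) x)\<^sup>2) * (u / (cx x - ?z)) = u * ?f x" by simp
    finally have le: "(poly (lagpoly a n) x)\<^sup>2 * (?k * (1 / (x + 1) - 1 / (x + 2))) \<le> Re (u * ?f x)" .
    have eqk: "k * (A / p - A / q) = A * (k * (1 / p - 1 / q))" for k A p q :: real
     by (simp add: divide_inverse algebra_simps)
    show "?k * ((poly (lagpoly a n) x)\<^sup>2 / (x + 1) - (poly (lagpoly a n) x)\<^sup>2 / (x + 2)) \<le> Re (u * ?f x)"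
     by (subst eqk) (rule le)
   qed
   also have "\<dots> = Re (u * (poly (lagpoly a n) ?z * lag_psi a n ?z))"
    unfolding lag_psi_times_lagpoly[OF assms(1) parabola_off_ray[OF assms(2)]] integral_mult_right_zero[symmetric]
    by (intro integral_Re integrable_mult_right int)
   also have "\<dots> \<le> norm (u * (poly (lagpoly a n) ?z * lag_psi a n ?z))" by (rule complex_Re_le_cmod)
   also have "\<dots> = norm (poly (lagpoly a n) ?z * lag_psi a n ?z)" by (simp add: norm_mult u(1))
   finally have "?k * (lag_tau a n 1 - lag_tau a n 2) \<le> norm (poly (lagpoly a n) ?z * lag_psi a n ?z)" .
   moreover have "?k * (c0 * real n powr (a - 1 / 2)) \<le> ?k * (lag_tau a n 1 - lag_tau a n 2)"
    by (intro mult_left_mono tau) auto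
   ultimately have "?k * (c0 * real n powr (a - 1 / 2)) * nodeweight \<rho> t ^ 2 \<le> norm (poly (lagpoly a n) ?z * lag_psi a n ?z) * nodeweight \<rho> t ^ 2"
    by (intro mult_right_mono) auto
   moreover have "nodeweight \<rho> t ^ 2 > 0" by (intro zero_less_power add_pos_nonneg) auto
   ultimately show "norm (poly (lagpoly a n) ?z * lag_psi a n ?z) * nodeweight \<rho> t ^ 2 \<ge> (3 * \<rho>\<^sup>2 / 4 * c0) * real n powr (a - 1 / 2)"
    by simp
  qed
 qed
 then show ?thesis using c0 assms(2) by (intro that[of "3 * \<rho>\<^sup>2 / 4 * c0"]) auto
qed

lemma lag_product_upper:
 assumes "a > -1" "\<rho> > 0"
 shows "\<forall>\<^sub>F n in sequentially. \<forall>t.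
   norm (poly (lagpoly a n) (zpar \<rho> t) * lag_psi a n (zpar \<rho> t)) \<le> (1 + 1 / \<rho>\<^sup>2) * nodeweight \<rho> t * real n powr (a - 1 / 2)"
proof -
 have "\<forall>\<^sub>F n in sequentially. lag_tau a n 1 * real n powr (1 / 2 - a) < 1"
  by (rule order_tendstoD(2)[OF lag_tau_asymp[OF assms(1)]]) auto
 then show ?thesis using eventually_gt_at_top[of 0]
 proof eventually_elim
  case (elim n)
  have pw: "real n powr (1 / 2 - a) * real n powr (a - 1 / 2) = 1"
   using elim(2) by (simp flip: powr_add)
  have "(lag_tau a n 1 * real n powr (1 / 2 - a)) * real n powr (a - 1 / 2) \<le> 1 * real n powr (a - 1 / 2)"
   using elim(1) by (intro mult_right_mono) auto
  then have tau: "lag_tau a n 1 \<le> real n powr (a - 1 / 2)"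
   using pw by (simp add: mult.assoc)
  show ?case
  proof
   fix t
   let ?z = "zpar \<rho> t"
   let ?f = "\<lambda>x. (of_real ((poly (lagpoly a n) x)\<^sup>2)) / (cx x - ?z)"
   let ?k = "(1 + 1 / \<rho>\<^sup>2) * nodeweight \<rho> t"
   have int: "integrable (lagM a) ?f"
    using integrable_lagM_poly_divide[OF assms(1) parabola_off_ray[OF assms(2)], of "lagpoly a n * lagpoly a n"]
    by (simp add: poly_lagpoly_of_real power2_eq_square)
   have "norm (poly (lagpoly a n) ?z * lag_psi a n ?z) \<le> (LINT x|lagM a. ?k * ((poly (lagpoly a n) x)\<^sup>2 / (x + 1)))"
    unfolding lag_psi_times_lagpoly[OF assms(1) parabola_off_ray[OF assms(2)]]
   proof (rule Bochner_Integration.integral_norm_bound_integral[OF int])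
    show "integrable (lagM a) (\<lambda>x. ?k * ((poly (lagpoly a n) x)\<^sup>2 / (x + 1)))"
     by (intro integrable_mult_right integrable_lag_square_divide assms) simp
    fix x assume "x \<in> space (lagM a)"
    then have x: "x \<ge> 0" by simp
    have "norm (?f x) = (poly (lagpoly a n) x)\<^sup>2 * (1 / norm (cx x - ?z))"
     by (simp add: norm_divide norm_power)
    also have "\<dots> \<le> (poly (lagpoly a n) x)\<^sup>2 * (?k * (1 / (x + 1)))"
     by (intro mult_left_mono parabola_Stieltjes_upper assms x) auto
    finally show "norm (?f x) \<le> ?k * ((poly (lagpoly a n) x)\<^sup>2 / (x + 1))" by (simp add: mult_ac)
   qed
   also have "\<dots> = ?k * lag_tau a n 1" unfolding lag_tau_def by (rule integral_mult_right_zero)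
   also have "\<dots> \<le> ?k * real n powr (a - 1 / 2)"
    using tau by (intro mult_left_mono) (auto intro!: mult_nonneg_nonneg)
   finally show "norm (poly (lagpoly a n) ?z * lag_psi a n ?z) \<le> ?k * real n powr (a - 1 / 2)" .
  qed
 qed
qed

text \<open>The quotient of the two polynomials is a sum over zeros with positive weights, to which the same lower bound applies.\<close>

lemma lagpoly_raise_lower_bound:
 assumes "a > -1" "\<rho> > 0"
 obtains c where "c > 0" "\<forall>\<^sub>F n in sequentially. \<forall>t.
   norm (poly (lagpoly (a + 1) n) (zpar \<rho> t)) * nodeweight \<rho> t ^ 2 \<ge> c * sqrt n * norm (poly (lagpoly a (Suc n)) (zpar \<rho> t))"
proof -
 define sg where "sg n s = (\<Sum>x\<in>lagzeros a n. 1 / (x + s))" for n and s :: real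
 \<comment> \<open>the sums at \<open>-1\<close> and \<open>-2\<close> are close to \<open>\<surd>n\<close> and \<open>\<surd>(n / 2)\<close>; half of the difference is kept\<close>
 define c0 where "c0 = (1 - 1 / sqrt 2) / (2::real)"
 have c0: "c0 > 0" by (simp add: c0_def field_simps)
 obtain C where C: "C \<ge> 0"
  "\<And>n w. n > 0 \<Longrightarrow> w \<in> half_disc 1 2 \<Longrightarrow> norm (zero_sum a n 1 (- (w\<^sup>2)) - of_real (sqrt n) / w) \<le> C"
  using zero_sum_first_order[OF assms(1), of 1 2] by auto
 have sgb: "\<bar>sg n s - sqrt n / sqrt s\<bar> \<le> C" if "n > 0" "1 \<le> s" "s \<le> 4" for n s
 proof -
  have "sqrt s \<le> sqrt 4" using that by (intro real_sqrt_le_mono) auto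
  then have "cx (sqrt s) \<in> half_disc 1 2" using that by (simp add: half_disc_def)
  from C(2)[OF that(1) this]
  have "norm (zero_sum a n 1 (- of_real s) - of_real (sqrt n) / of_real (sqrt s)) \<le> C"
   using that by (simp flip: of_real_power)
  moreover have "zero_sum a n 1 (- of_real s) - of_real (sqrt n) / of_real (sqrt s) = cx (sg n s - sqrt n / sqrt s)"
   by (simp add: zero_sum_def sg_def)
  ultimately show ?thesis by (simp only: norm_of_real)
 qed
 have "filterlim (\<lambda>n. sqrt (real n)) at_top sequentially" by real_asymp
 then have "\<forall>\<^sub>F n in sequentially. 2 * C / c0 \<le> sqrt (real n)"
  by (simp add: filterlim_at_top)
 then have "\<forall>\<^sub>F n in sequentially. \<forall>t. norm (poly (lagpoly (a + 1) n) (zpar \<rho> t)) * nodeweight \<rho> t ^ 2 \<ge> (3 * \<rho>\<^sup>2 / 4 * c0) * sqrt n * norm (poly (lagpoly a (Suc n)) (zpar \<rho> t))"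
 proof eventually_elim
  case (elim n)
  let ?N = "Suc n"
  have "2 * C \<le> c0 * sqrt n" using elim c0 by (simp add: field_simps)
  also have "\<dots> \<le> c0 * sqrt ?N" using c0 by (intro mult_left_mono) auto
  finally have CN: "2 * C \<le> c0 * sqrt ?N" .
  have "sg ?N 1 \<ge> sqrt ?N - C" using sgb[of ?N 1] by simp
  moreover have "sg ?N 2 \<le> sqrt ?N / sqrt 2 + C" using sgb[of ?N 2] by simp
  ultimately have "sg ?N 1 - sg ?N 2 \<ge> sqrt ?N * (1 - 1 / sqrt 2) - 2 * C" by (simp add: algebra_simps)
  also have "sqrt ?N * (1 - 1 / sqrt 2) = 2 * c0 * sqrt ?N" by (simp add: c0_def)
  finally have sd: "c0 * sqrt ?N \<le> sg ?N 1 - sg ?N 2" using CN by simp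
  then have sd: "c0 * sqrt n \<le> sg ?N 1 - sg ?N 2"
   using c0 by (auto intro: order_trans[rotated])
  show ?case
  proof
   fix t
   let ?z = "zpar \<rho> t"
   let ?k = "3 * \<rho>\<^sup>2 / 4 / nodeweight \<rho> t ^ 2"
   obtain u where u: "norm u = 1" "\<And>x. x \<ge> 0 \<Longrightarrow> Re (u / (cx x - ?z)) \<ge> ?k * (1 / (x + 1) - 1 / (x + 2))"
    using parabola_Stieltjes_lower[OF assms(2), of t] by blast
   have "?k * (sg ?N 1 - sg ?N 2) = (\<Sum>x\<in>lagzeros a ?N. ?k * (1 / (x + 1) - 1 / (x + 2)))"
    unfolding sg_def sum_subtractf[symmetric] sum_distrib_left ..
   also have "\<dots> \<le> (\<Sum>x\<in>lagzeros a ?N. Re (u / (cx x - ?z)))"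
    by (intro sum_mono u(2) less_imp_le lagzeros_pos[OF assms(1)])
   also have "\<dots> = Re (u * zero_sum a ?N 1 ?z)" by (simp add: zero_sum_def sum_distrib_left)
   also have "\<dots> \<le> norm (u * zero_sum a ?N 1 ?z)" by (rule complex_Re_le_cmod)
   also have "\<dots> = norm (zero_sum a ?N 1 ?z)" by (simp add: norm_mult u(1))
   finally have S: "?k * (sg ?N 1 - sg ?N 2) \<le> norm (zero_sum a ?N 1 ?z)" .
   have "?k * (c0 * sqrt n) \<le> ?k * (sg ?N 1 - sg ?N 2)"
    by (intro mult_left_mono sd) auto
   then have S: "?k * (c0 * sqrt n) \<le> norm (zero_sum a ?N 1 ?z)" using S by linarith
   have "poly (lagpoly (a + 1) n) ?z = zero_sum a ?N 1 ?z * poly (lagpoly a ?N) ?z"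
    using pderiv_lagpoly_eq[OF assms(1) parabola_off_ray[OF assms(2)], of ?N t] by (simp add: pderiv_lagpoly)
   then have "norm (poly (lagpoly (a + 1) n) ?z) * nodeweight \<rho> t ^ 2 = norm (zero_sum a ?N 1 ?z) * (nodeweight \<rho> t ^ 2 * norm (poly (lagpoly a ?N) ?z))"
    by (simp add: norm_mult)
   also have "\<dots> \<ge> ?k * (c0 * sqrt n) * (nodeweight \<rho> t ^ 2 * norm (poly (lagpoly a ?N) ?z))"
    by (intro mult_right_mono S) auto
   moreover have "nodeweight \<rho> t ^ 2 > 0" by (intro zero_less_power add_pos_nonneg) auto
   ultimately show "(3 * \<rho>\<^sup>2 / 4 * c0) * sqrt n * norm (poly (lagpoly a (Suc n)) ?z) \<le> norm (poly (lagpoly (a + 1) n) ?z) * nodeweight \<rho> t ^ 2"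
    by (simp add: mult_ac)
  qed
 qed
 then show ?thesis using c0 assms(2) by (intro that[of "3 * \<rho>\<^sup>2 / 4 * c0"]) auto
qed

subsection \<open>Transfer of decay\<close>

abbreviation lag_kern :: "real \<Rightarrow> real \<Rightarrow> nat \<Rightarrow> real \<Rightarrow> real" where
 "lag_kern \<rho> a n t \<equiv> real n powr (a / 2 - 1 / 4) * exp (2 * \<rho> * sqrt n) / norm (poly (lagpoly a n) (zpar \<rho> t))"

abbreviation psi_kern :: "real \<Rightarrow> real \<Rightarrow> nat \<Rightarrow> real \<Rightarrow> real" where
 "psi_kern \<rho> a n t \<equiv> real n powr (1 / 4 - a / 2) * exp (2 * \<rho> * sqrt n) * norm (lag_psi a n (zpar \<rho> t))"

abbreviation ratio_kern :: "real \<Rightarrow> real \<Rightarrow> nat \<Rightarrow> real \<Rightarrow> real" where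
 "ratio_kern \<rho> a n t \<equiv> exp (4 * \<rho> * sqrt n) * norm (lag_psi a n (zpar \<rho> t)) / norm (poly (lagpoly a n) (zpar \<rho> t))"

definition rapid_psi where
 "rapid_psi \<rho> a \<longleftrightarrow> rapid \<rho> (\<lambda>n t. psi_kern \<rho> a n t)"

definition rapid_lag where
 "rapid_lag \<rho> a \<longleftrightarrow> rapid \<rho> (\<lambda>n t. lag_kern \<rho> a n t)"

definition rapid_ratio where
 "rapid_ratio \<rho> a \<longleftrightarrow> rapid \<rho> (\<lambda>n t. ratio_kern \<rho> a n t)"

lemma nodeweight_pos: "nodeweight \<rho> t > 0"
 by (intro add_pos_nonneg) auto

lemma lagpoly_parabola_pos:
 assumes "a > -1" "\<rho> > 0"
 shows "norm (poly (lagpoly a n) (zpar \<rho> t)) > 0"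
 using lagpoly_off_ray_nonzero[OF assms(1) parabola_off_ray[OF assms(2)]] by simp

lemma rapid_psi_imp_lag:
 assumes "a > -1" "\<rho> > 0" "rapid_psi \<rho> a"
 shows "rapid_lag \<rho> a"
proof -
 obtain c where c: "c > 0" "\<forall>\<^sub>F n in sequentially. \<forall>t.
   norm (poly (lagpoly a n) (zpar \<rho> t) * lag_psi a n (zpar \<rho> t)) * nodeweight \<rho> t ^ 2 \<ge> c * real n powr (a - 1 / 2)"
  by (rule lag_product_lower[OF assms(1,2)]) blast
 have ev: "\<forall>\<^sub>F n in sequentially. \<forall>t. lag_kern \<rho> a n t
   \<le> (1 / c) * nodeweight \<rho> t ^ 2 * (psi_kern \<rho> a n t)"
  using c(2) eventually_gt_at_top[of 0]
 proof eventually_elim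
  case (elim n)
  show ?case
  proof
   fix t
   let ?L = "norm (poly (lagpoly a n) (zpar \<rho> t))" and ?P = "norm (lag_psi a n (zpar \<rho> t))"
   have L: "?L > 0" by (rule lagpoly_parabola_pos[OF assms(1,2)])
   have pw: "real n powr (a / 2 - 1 / 4) = real n powr (1 / 4 - a / 2) * real n powr (a - 1 / 2)"
    unfolding powr_add[symmetric] by (rule arg_cong[where f = "\<lambda>e. real n powr e"]) (simp add: field_simps)
   have "c * real n powr (a - 1 / 2) \<le> ?L * ?P * nodeweight \<rho> t ^ 2" using elim(1) by (simp add: norm_mult)
   then have "real n powr (a - 1 / 2) / ?L \<le> (1 / c) * nodeweight \<rho> t ^ 2 * ?P"
    using L c(1) by (simp add: field_simps)
   then have "real n powr (1 / 4 - a / 2) * exp (2 * \<rho> * sqrt n) * (real n powr (a - 1 / 2) / ?L) \<le> real n powr (1 / 4 - a / 2) * exp (2 * \<rho> * sqrt n) * ((1 / c) * nodeweight \<rho> t ^ 2 * ?P)"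
    by (intro mult_left_mono) auto
   then show "real n powr (a / 2 - 1 / 4) * exp (2 * \<rho> * sqrt n) / ?L \<le> (1 / c) * nodeweight \<rho> t ^ 2 * (real n powr (1 / 4 - a / 2) * exp (2 * \<rho> * sqrt n) * ?P)"
    unfolding pw by (simp add: mult_ac)
  qed
 qed
 show ?thesis
  unfolding rapid_lag_def by (rule rapid_dominated[OF assms(3)[unfolded rapid_psi_def] ev]) (use c(1) in simp)
qed

lemma rapid_lag_square_eq:
 assumes "n > (0::nat)"
 shows "(real n powr (a / 2 - 1 / 4) * exp (2 * \<rho> * sqrt n) / l) ^ 2 = real n powr (a - 1 / 2) * exp (4 * \<rho> * sqrt n) / l\<^sup>2"
proof -
 have "(real n powr (a / 2 - 1 / 4))\<^sup>2 = real n powr (a - 1 / 2)"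
  by (simp add: power2_eq_square flip: powr_add)
 moreover have "(exp (2 * \<rho> * sqrt n))\<^sup>2 = exp (4 * \<rho> * sqrt n)"
  by (simp add: power2_eq_square flip: exp_add)
 ultimately show ?thesis by (simp add: power_divide power_mult_distrib)
qed

text \<open>\<open>1 / L\<^sub>n\<^sup>2\<close> is \<open>\<psi>\<^sub>n / L\<^sub>n\<close> divided by \<open>L\<^sub>n \<psi>\<^sub>n\<close>.\<close>

lemma rapid_ratio_imp_lag:
 assumes "a > -1" "\<rho> > 0" "rapid_ratio \<rho> a"
 shows "rapid_lag \<rho> a"
proof -
 obtain c where c: "c > 0" "\<forall>\<^sub>F n in sequentially. \<forall>t.
   norm (poly (lagpoly a n) (zpar \<rho> t) * lag_psi a n (zpar \<rho> t)) * nodeweight \<rho> t ^ 2 \<ge> c * real n powr (a - 1 / 2)"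
  by (rule lag_product_lower[OF assms(1,2)]) blast
 have ev: "\<forall>\<^sub>F n in sequentially. \<forall>t. (lag_kern \<rho> a n t)^2
   \<le> (1 / c) * nodeweight \<rho> t ^ 2 * (ratio_kern \<rho> a n t)"
  using c(2) eventually_gt_at_top[of 0]
 proof eventually_elim
  case (elim n)
  show ?case
  proof
   fix t
   let ?L = "norm (poly (lagpoly a n) (zpar \<rho> t))" and ?P = "norm (lag_psi a n (zpar \<rho> t))"
   have L: "?L > 0" by (rule lagpoly_parabola_pos[OF assms(1,2)])
   have "c * real n powr (a - 1 / 2) \<le> ?L * ?P * nodeweight \<rho> t ^ 2" using elim(1) by (simp add: norm_mult)
   then have "real n powr (a - 1 / 2) \<le> (1 / c) * nodeweight \<rho> t ^ 2 * (?L * ?P)"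
    using c(1) by (simp add: field_simps)
   then have "real n powr (a - 1 / 2) * (exp (4 * \<rho> * sqrt n) / ?L\<^sup>2) \<le> (1 / c) * nodeweight \<rho> t ^ 2 * (?L * ?P) * (exp (4 * \<rho> * sqrt n) / ?L\<^sup>2)"
    by (intro mult_right_mono) auto
   moreover have eq: "?L * ?P * (exp (4 * \<rho> * sqrt n) / ?L\<^sup>2) = exp (4 * \<rho> * sqrt n) * ?P / ?L"
    using L by (simp add: power2_eq_square)
   ultimately show "(real n powr (a / 2 - 1 / 4) * exp (2 * \<rho> * sqrt n) / ?L)^2 \<le> (1 / c) * nodeweight \<rho> t ^ 2 * (exp (4 * \<rho> * sqrt n) * ?P / ?L)"
    unfolding rapid_lag_square_eq[OF elim(2)] eq[symmetric] by (simp only: mult.assoc times_divide_eq_right)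
  qed
 qed
 have "rapid \<rho> (\<lambda>n t. (lag_kern \<rho> a n t)^2)"
  by (rule rapid_dominated[OF assms(3)[unfolded rapid_ratio_def] ev]) (use c(1) in simp)
 then show ?thesis unfolding rapid_lag_def by (rule rapid_sqrt) auto
qed

lemma rapid_lag_imp_ratio:
 assumes "a > -1" "\<rho> > 0" "rapid_lag \<rho> a"
 shows "rapid_ratio \<rho> a"
proof -
 have sq: "rapid \<rho> (\<lambda>n t. (lag_kern \<rho> a n t)^2)"
  using assms(3) unfolding rapid_lag_def by (rule rapid_square) auto
 have ev: "\<forall>\<^sub>F n in sequentially. \<forall>t. ratio_kern \<rho> a n t
   \<le> (1 + 1 / \<rho>\<^sup>2) * nodeweight \<rho> t ^ 1 * (lag_kern \<rho> a n t)^2"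
  using lag_product_upper[OF assms(1,2)] eventually_gt_at_top[of 0]
 proof eventually_elim
  case (elim n)
  show ?case
  proof
   fix t
   let ?L = "norm (poly (lagpoly a n) (zpar \<rho> t))" and ?P = "norm (lag_psi a n (zpar \<rho> t))"
   have L: "?L > 0" by (rule lagpoly_parabola_pos[OF assms(1,2)])
   have "?L * ?P \<le> (1 + 1 / \<rho>\<^sup>2) * nodeweight \<rho> t * real n powr (a - 1 / 2)" using elim by (simp add: norm_mult)
   then have "?L * ?P * (exp (4 * \<rho> * sqrt n) / ?L\<^sup>2) \<le> (1 + 1 / \<rho>\<^sup>2) * nodeweight \<rho> t * real n powr (a - 1 / 2) * (exp (4 * \<rho> * sqrt n) / ?L\<^sup>2)"
    by (intro mult_right_mono) auto
   moreover have eq: "?L * ?P * (exp (4 * \<rho> * sqrt n) / ?L\<^sup>2) = exp (4 * \<rho> * sqrt n) * ?P / ?L"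
    using L by (simp add: power2_eq_square)
   ultimately show "exp (4 * \<rho> * sqrt n) * ?P / ?L \<le> (1 + 1 / \<rho>\<^sup>2) * nodeweight \<rho> t ^ 1 * (real n powr (a / 2 - 1 / 4) * exp (2 * \<rho> * sqrt n) / ?L)^2"
    unfolding rapid_lag_square_eq[OF elim(2)] power_one_right eq[symmetric] by (simp only: mult.assoc times_divide_eq_right)
  qed
 qed
 show ?thesis
  unfolding rapid_ratio_def by (rule rapid_dominated[OF sq ev]) simp
qed

lemma rapid_Suc:
 assumes "rapid \<rho> A"
 shows "rapid \<rho> (\<lambda>n. A (Suc n))"
 unfolding rapid_def
proof
 fix m
 obtain K where K: "\<forall>\<^sub>F n in sequentially. \<forall>t. A n t * nodeweight \<rho> t ^ m \<le> K"
  using assms unfolding rapid_def by blast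
 then have "\<forall>\<^sub>F n in sequentially. \<forall>t. A (Suc n) t * nodeweight \<rho> t ^ m \<le> K"
  by (subst eventually_sequentially_Suc)
 then show "\<exists>K. \<forall>\<^sub>F n in sequentially. \<forall>t. A (Suc n) t * nodeweight \<rho> t ^ m \<le> K" by blast
qed

text \<open>The Radau nodes are zeros of a polynomial of parameter \<open>a + 1\<close>, about which the hypotheses say nothing directly.\<close>

lemma rapid_lag_raise:
 assumes "a > -1" "\<rho> > 0" "rapid_lag \<rho> a"
 shows "rapid_lag \<rho> (a + 1)"
proof -
 obtain c where c: "c > 0" "\<forall>\<^sub>F n in sequentially. \<forall>t.
   norm (poly (lagpoly (a + 1) n) (zpar \<rho> t)) * nodeweight \<rho> t ^ 2 \<ge> c * sqrt n * norm (poly (lagpoly a (Suc n)) (zpar \<rho> t))"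
  by (rule lagpoly_raise_lower_bound[OF assms(1,2)]) blast
 have "(\<lambda>n. (real n / real (Suc n)) powr (a / 2 - 1 / 4)) \<longlonglongrightarrow> 1 powr (a / 2 - 1 / 4)"
 proof (rule tendsto_powr)
  show "(\<lambda>n. real n / real (Suc n)) \<longlonglongrightarrow> 1" by real_asymp
 qed auto
 then have two: "\<forall>\<^sub>F n in sequentially. (real n / real (Suc n)) powr (a / 2 - 1 / 4) < 2"
  by (rule order_tendstoD(2)) simp
 have ev: "\<forall>\<^sub>F n in sequentially. \<forall>t. real n powr ((a + 1) / 2 - 1 / 4) * exp (2 * \<rho> * sqrt n) / norm (poly (lagpoly (a + 1) n) (zpar \<rho> t))
   \<le> (2 / c) * nodeweight \<rho> t ^ 2 * (real (Suc n) powr (a / 2 - 1 / 4) * exp (2 * \<rho> * sqrt (Suc n)) / norm (poly (lagpoly a (Suc n)) (zpar \<rho> t)))"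
  using c(2) two eventually_gt_at_top[of 0]
 proof eventually_elim
  case (elim n)
  have a1: "a + 1 > -1" using assms by simp
  have n: "real n > 0" using elim by simp
  have pw: "real n powr ((a + 1) / 2 - 1 / 4) = real n powr (a / 2 - 1 / 4) * sqrt n"
  proof -
   have "(a + 1) / 2 - 1 / 4 = (a / 2 - 1 / 4) + 1 / 2" by (simp add: field_simps)
   then show ?thesis by (simp only: powr_add) (use n in \<open>simp add: powr_half_sqrt\<close>)
  qed
  have q: "real n powr (a / 2 - 1 / 4) \<le> 2 * real (Suc n) powr (a / 2 - 1 / 4)"
   using elim(2) n by (simp add: powr_divide field_simps)
  show ?case
  proof
   fix t
   let ?L = "norm (poly (lagpoly a (Suc n)) (zpar \<rho> t))" and ?M = "norm (poly (lagpoly (a + 1) n) (zpar \<rho> t))"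
   have L: "?L > 0" "?M > 0" by (rule lagpoly_parabola_pos[OF assms(1,2)], rule lagpoly_parabola_pos[OF a1 assms(2)])
   have "c * sqrt n * ?L \<le> ?M * nodeweight \<rho> t ^ 2" using elim(1) by blast
   then have "sqrt n / ?M \<le> (1 / c) * nodeweight \<rho> t ^ 2 / ?L"
    using L c(1) by (simp add: field_simps)
   then have "(real n powr (a / 2 - 1 / 4) * exp (2 * \<rho> * sqrt n)) * (sqrt n / ?M) \<le> (2 * real (Suc n) powr (a / 2 - 1 / 4) * exp (2 * \<rho> * sqrt (Suc n))) * ((1 / c) * nodeweight \<rho> t ^ 2 / ?L)"
    using L assms(2) q by (intro mult_mono) (auto intro!: mult_left_mono)
   then show "real n powr ((a + 1) / 2 - 1 / 4) * exp (2 * \<rho> * sqrt n) / ?M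
     \<le> (2 / c) * nodeweight \<rho> t ^ 2 * (real (Suc n) powr (a / 2 - 1 / 4) * exp (2 * \<rho> * sqrt (Suc n)) / ?L)"
    unfolding pw by (simp add: mult_ac)
  qed
 qed
 show ?thesis
  unfolding rapid_lag_def by (rule rapid_dominated[OF rapid_Suc[OF assms(3)[unfolded rapid_lag_def]] ev]) (use c(1) in simp)
qed

lemma rapid_from_bdd:
 assumes "\<rho> > 0"
  and "\<forall>\<gamma>::real. \<exists>n\<^sub>0::nat. bdd_above ((\<lambda>(n, z). A n z * norm z powr \<gamma>) ` ({n\<^sub>0..} \<times> parabola \<rho>))"
  and "\<And>n z. A n z \<ge> 0"
 shows "rapid \<rho> (\<lambda>n t. A n (zpar \<rho> t))"
 unfolding rapid_def
proof
 fix m :: nat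
 obtain n0 K where K: "\<And>n z. n \<ge> n0 \<Longrightarrow> z \<in> parabola \<rho> \<Longrightarrow> A n z * norm z powr real m \<le> K"
  using spec[OF assms(2), of "real m"] by (auto simp: bdd_above_def)
 have "A n (zpar \<rho> t) * nodeweight \<rho> t ^ m \<le> (1 + 1 / \<rho>\<^sup>2) ^ m * K" if "n \<ge> n0" for n t
 proof -
  let ?z = "zpar \<rho> t"
  have zp: "?z \<in> parabola \<rho>" using bij_betw_parabola_param[OF assms(1)] by (auto simp: bij_betw_def)
  have nz: "norm ?z \<ge> \<rho>\<^sup>2" by (simp add: norm_parabola_param)
  then have "1 \<le> norm ?z / \<rho>\<^sup>2" using assms(1) by simp
  then have "nodeweight \<rho> t \<le> (1 + 1 / \<rho>\<^sup>2) * norm ?z" by (simp add: algebra_simps)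
  then have "nodeweight \<rho> t ^ m \<le> ((1 + 1 / \<rho>\<^sup>2) * norm ?z) ^ m" by (intro power_mono) auto
  then have "A n ?z * nodeweight \<rho> t ^ m \<le> A n ?z * ((1 + 1 / \<rho>\<^sup>2) * norm ?z) ^ m"
   using assms(3) by (intro mult_left_mono) auto
  also have "\<dots> = (1 + 1 / \<rho>\<^sup>2) ^ m * (A n ?z * norm ?z ^ m)" by (simp add: power_mult_distrib mult_ac)
  also have "norm ?z ^ m = norm ?z powr real m"
   using nz assms(1) by (subst powr_realpow) (auto intro: order_less_le_trans[OF zero_less_power])
  also have "(1 + 1 / \<rho>\<^sup>2) ^ m * (A n ?z * norm ?z powr real m) \<le> (1 + 1 / \<rho>\<^sup>2) ^ m * K"
   by (intro mult_left_mono K that zp) auto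
  finally show ?thesis .
 qed
 then show "\<exists>K. \<forall>\<^sub>F n in sequentially. \<forall>t. A n (zpar \<rho> t) * nodeweight \<rho> t ^ m \<le> K"
  by (auto simp: eventually_at_top_linorder)
qed

section \<open>Limits of the weighted integrals over the parabola\<close>

lemma norm_lag_lim:
 assumes "\<rho> > 0"
 shows "norm (lag_lim a (Complex \<rho> t)) = norm (zpar \<rho> t) powr (- a / 2 - 1 / 4) / (norm (exp (- zpar \<rho> t / 2)) * (2 * sqrt pi))"
proof -
 let ?w = "Complex \<rho> t" and ?z = "zpar \<rho> t"
 have w: "?w \<noteq> 0" "norm ?w > 0" using assms by (auto simp: complex_eq_iff)
 have nz: "norm ?z = (norm ?w)\<^sup>2" by (simp add: parabola_param_eq norm_power)
 have "Re (- (?w\<^sup>2 / 2) - of_real (a + 1 / 2) * Ln ?w) = Re ?z / 2 - (a + 1 / 2) * ln (norm ?w)"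
  using w by (simp add: parabola_param_eq)
 note re = this
 have "norm (exp (- (?w\<^sup>2 / 2) - of_real (a + 1 / 2) * Ln ?w)) = exp (Re ?z / 2) * norm ?w powr (- (a + 1 / 2))"
  unfolding norm_exp_eq_Re
 proof -
  have "exp (Re ?z / 2 - (a + 1 / 2) * ln (norm ?w)) = exp (Re ?z / 2) * norm ?w powr (- (a + 1 / 2))"
   by (simp only: powr_def norm_eq_zero w(1) if_False diff_conv_add_uminus exp_add mult_minus_left)
  then show "exp (Re (- (?w\<^sup>2 / 2) - of_real (a + 1 / 2) * Ln ?w)) = exp (Re ?z / 2) * norm ?w powr (- (a + 1 / 2))"
   using re by (simp only:)
 qed
 also have "norm ?w powr (- (a + 1 / 2)) = norm ?z powr (- a / 2 - 1 / 4)"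
 proof -
  have "norm ?z = norm ?w powr 2" using w unfolding nz by (simp add: powr_numeral)
  then have "norm ?z powr (- a / 2 - 1 / 4) = norm ?w powr (2 * (- a / 2 - 1 / 4))" by (simp only: powr_powr)
  also have "2 * (- a / 2 - 1 / 4) = - (a + 1 / 2)" by simp
  finally show ?thesis by simp
 qed
 finally have F: "norm (exp (- (?w\<^sup>2 / 2) - of_real (a + 1 / 2) * Ln ?w)) = exp (Re ?z / 2) * norm ?z powr (- a / 2 - 1 / 4)" .
 have E: "norm (exp (- ?z / 2)) = 1 / exp (Re ?z / 2)"
  unfolding norm_exp_eq_Re inverse_eq_divide[symmetric] exp_minus[symmetric] by simp
 show ?thesis unfolding lag_lim_def norm_divide F E by simp
qed

lemma lag_kernel_tendsto:
 assumes "a > -1" "\<rho> > 0"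
 shows "(\<lambda>n. 1 / (2 * sqrt pi) * (lag_kern \<rho> a n t))
  \<longlonglongrightarrow> norm (exp (- zpar \<rho> t / 2)) * norm (zpar \<rho> t) powr (a / 2 + 1 / 4)"
proof -
 let ?w = "Complex \<rho> t" and ?z = "zpar \<rho> t"
 let ?A = "\<lambda>n. norm (poly (lagpoly a n) ?z * exp (- 2 * of_real (sqrt n) * ?w) * of_real (real n powr (1 / 4 - a / 2)))"
 have z: "norm ?z > 0" using assms(2) by (simp add: norm_parabola_param add_pos_nonneg)
 have "(\<lambda>n. poly (lagpoly a n) (- (?w\<^sup>2)) * exp (- 2 * of_real (sqrt n) * ?w) * of_real (real n powr (1 / 4 - a / 2))) \<longlonglongrightarrow> lag_lim a ?w"
  using assms by (intro lagpoly_asymp) auto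
 then have "?A \<longlonglongrightarrow> norm (lag_lim a ?w)"
  unfolding parabola_param_eq by (rule tendsto_norm)
 then have "(\<lambda>n. 1 / (2 * sqrt pi) / ?A n) \<longlonglongrightarrow> 1 / (2 * sqrt pi) / norm (lag_lim a ?w)"
  by (intro tendsto_divide tendsto_const) (simp_all add: lag_lim_nonzero)
 moreover have "1 / (2 * sqrt pi) / ?A n = 1 / (2 * sqrt pi) * (real n powr (a / 2 - 1 / 4) * exp (2 * \<rho> * sqrt n) / norm (poly (lagpoly a n) ?z))" for n
 proof -
  have d: "1 / real n powr (1 / 4 - a / 2) = real n powr (a / 2 - 1 / 4)"
   using powr_minus_divide[of "real n" "1 / 4 - a / 2"] by simp
  have b: "norm (exp (- 2 * of_real (sqrt n) * ?w)) = 1 / exp (2 * \<rho> * sqrt n)"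
  proof -
   have "Re (- 2 * of_real (sqrt n) * ?w) = - (2 * \<rho> * sqrt n)" by simp
   then show ?thesis unfolding norm_exp_eq_Re by (simp only: exp_minus inverse_eq_divide)
  qed
  have "?A n = norm (poly (lagpoly a n) ?z) * (1 / exp (2 * \<rho> * sqrt n)) * real n powr (1 / 4 - a / 2)"
   unfolding norm_mult b by simp
  then show ?thesis unfolding d[symmetric] by (simp only:) simp
 qed
 moreover have "1 / (2 * sqrt pi) / norm (lag_lim a ?w) = norm (exp (- ?z / 2)) * norm ?z powr (a / 2 + 1 / 4)"
 proof -
  have "norm ?z powr (- a / 2 - 1 / 4) = 1 / norm ?z powr (a / 2 + 1 / 4)"
   using powr_minus_divide[of "norm ?z" "a / 2 + 1 / 4"] by simp
  then show ?thesis unfolding norm_lag_lim[OF assms(2)] using z by (simp only:) simp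
 qed
 ultimately show ?thesis by simp
qed

lemma psi_kernel_tendsto:
 assumes "a > -1" "\<rho> > 0"
 shows "(\<lambda>n. 1 / sqrt pi * (psi_kern \<rho> a n t))
  \<longlonglongrightarrow> norm (exp (- zpar \<rho> t / 2)) * norm (zpar \<rho> t) powr (a / 2 - 1 / 4)"
proof -
 let ?w = "Complex \<rho> t" and ?z = "zpar \<rho> t"
 let ?A = "\<lambda>n. norm (lag_psi a n ?z * exp (2 * of_real (sqrt n) * ?w) * of_real (real n powr (1 / 4 - a / 2)))"
 have z: "norm ?z > 0" using assms(2) by (simp add: norm_parabola_param add_pos_nonneg)
 have w: "norm ?w = norm ?z powr (1 / 2)" by (simp add: parabola_param_eq norm_power powr_half_sqrt)
 have "(\<lambda>n. lag_psi a n (- (?w\<^sup>2)) * exp (2 * of_real (sqrt n) * ?w) * of_real (real n powr (1 / 4 - a / 2))) \<longlonglongrightarrow> 1 / (2 * ?w * lag_lim a ?w)"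
  using assms by (intro lag_psi_asymp) auto
 then have "?A \<longlonglongrightarrow> norm (1 / (2 * ?w * lag_lim a ?w))"
  unfolding parabola_param_eq by (rule tendsto_norm)
 then have "(\<lambda>n. 1 / sqrt pi * ?A n) \<longlonglongrightarrow> 1 / sqrt pi * norm (1 / (2 * ?w * lag_lim a ?w))"
  by (intro tendsto_mult tendsto_const)
 moreover have "?A n = real n powr (1 / 4 - a / 2) * exp (2 * \<rho> * sqrt n) * norm (lag_psi a n ?z)" for n
  by (simp add: norm_mult mult_ac)
 moreover have "1 / sqrt pi * norm (1 / (2 * ?w * lag_lim a ?w)) = norm (exp (- ?z / 2)) * norm ?z powr (a / 2 - 1 / 4)"
 proof -
  have pi_s: "sqrt pi > 0" by simp
  have alg: "1 / s * (1 / (2 * W * (P / (E * (2 * s))))) = E * (1 / (W * P))" if "s > 0" for s W P E :: real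
   using that by simp
  have "norm ?z powr (a / 2 - 1 / 4) * (norm ?z powr (1 / 2) * norm ?z powr (- a / 2 - 1 / 4)) = norm ?z powr ((a / 2 - 1 / 4) + (1 / 2 + (- a / 2 - 1 / 4)))"
   by (simp only: powr_add)
  also have "(a / 2 - 1 / 4) + (1 / 2 + (- a / 2 - 1 / 4)) = 0" by simp
  finally have "norm ?z powr (1 / 2) * norm ?z powr (- a / 2 - 1 / 4) * norm ?z powr (a / 2 - 1 / 4) = 1"
   using z by (simp add: mult.commute)
  then have "1 / (norm ?z powr (1 / 2) * norm ?z powr (- a / 2 - 1 / 4)) = norm ?z powr (a / 2 - 1 / 4)"
   unfolding inverse_eq_divide[symmetric] by (rule inverse_unique)
  then show ?thesis
   unfolding norm_mult norm_divide norm_lag_lim[OF assms(2)] w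
   by (simp only: norm_one norm_numeral alg[OF pi_s])
 qed
 ultimately show ?thesis by simp
qed

lemma ratio_kernel_tendsto:
 assumes "a > -1" "\<rho> > 0"
 shows "(\<lambda>n. 1 / (2 * pi) * (ratio_kern \<rho> a n t))
  \<longlonglongrightarrow> norm (exp (- zpar \<rho> t)) * norm (zpar \<rho> t) powr a"
proof -
 let ?z = "zpar \<rho> t"
 let ?A = "\<lambda>n. 1 / sqrt pi * (real n powr (1 / 4 - a / 2) * exp (2 * \<rho> * sqrt n) * norm (lag_psi a n ?z))"
 let ?B = "\<lambda>n. 1 / (2 * sqrt pi) * (real n powr (a / 2 - 1 / 4) * exp (2 * \<rho> * sqrt n) / norm (poly (lagpoly a n) ?z))"
 have "(\<lambda>n. ?A n * ?B n) \<longlonglongrightarrow> norm (exp (- ?z / 2)) * norm ?z powr (a / 2 - 1 / 4) * (norm (exp (- ?z / 2)) * norm ?z powr (a / 2 + 1 / 4))"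
  by (intro tendsto_mult[OF psi_kernel_tendsto lag_kernel_tendsto] assms)
 moreover have "norm (exp (- ?z / 2)) * norm ?z powr (a / 2 - 1 / 4) * (norm (exp (- ?z / 2)) * norm ?z powr (a / 2 + 1 / 4)) = norm (exp (- ?z)) * norm ?z powr a"
 proof -
  have "norm (exp (- ?z / 2)) * norm (exp (- ?z / 2)) = norm (exp (- ?z))"
   by (simp flip: norm_mult exp_add)
  moreover have "norm ?z powr (a / 2 - 1 / 4) * norm ?z powr (a / 2 + 1 / 4) = norm ?z powr a"
   by (simp flip: powr_add)
  moreover have "(e * p) * (e * q) = (e * e) * (p * q)" for e p q :: real by simp
  ultimately show ?thesis by (simp only:)
 qed
 moreover have "\<forall>\<^sub>F n in sequentially. ?A n * ?B n = 1 / (2 * pi) * (exp (4 * \<rho> * sqrt n) * norm (lag_psi a n ?z) / norm (poly (lagpoly a n) ?z))"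
  using eventually_gt_at_top[of 0]
 proof eventually_elim
  case (elim n)
  have "real n powr (1 / 4 - a / 2) * real n powr (a / 2 - 1 / 4) = 1" using elim by (simp flip: powr_add)
  moreover have "exp (2 * \<rho> * sqrt n) * exp (2 * \<rho> * sqrt n) = exp (4 * \<rho> * sqrt n)" by (simp flip: exp_add)
  moreover have "sqrt pi * sqrt pi = pi" by simp
  moreover have "1 / s * (d * e * p) * (1 / (2 * s) * (b * e / l)) = 1 / (2 * (s * s)) * ((d * b) * (e * e) * p / l)" for s d e p b l :: real
   by (simp only: divide_inverse inverse_mult_distrib mult_ac)
  ultimately show ?case by (simp only:)
 qed
 ultimately show ?thesis by (simp only: tendsto_cong)
qed

text \<open>What the dominated convergence argument needs of a family of kernels: domination for large \<open>n\<close> and a positive limit.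
 Positivity matters when the limit integral vanishes, for then \<open>f\<close> vanishes on the parabola and all integrals are zero.\<close>

definition parabola_kernel :: "real \<Rightarrow> (nat \<Rightarrow> real \<Rightarrow> real) \<Rightarrow> (real \<Rightarrow> real) \<Rightarrow> bool" where
 "parabola_kernel \<rho> A a \<longleftrightarrow> rapid \<rho> A \<and> (\<forall>n t. A n t \<ge> 0) \<and> (\<forall>n. A n \<in> borel_measurable borel)
   \<and> (\<forall>t. (\<lambda>n. A n t) \<longlonglongrightarrow> a t) \<and> (\<forall>t. a t > 0)"

lemma rapid_scale:
 assumes "rapid \<rho> A" "c \<ge> 0"
 shows "rapid \<rho> (\<lambda>n t. c * A n t)"
 by (rule rapid_dominated[OF assms(1), of _ c 0]) (use assms in auto)

lemma measurable_lag_psi: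
 assumes "a > -1" "\<rho> > 0"
 shows "(\<lambda>t. lag_psi a n (zpar \<rho> t)) \<in> borel_measurable borel"
proof -
 interpret finite_measure "lagM a" by (rule emeasure_lagM_finite[OF assms(1)])
 have [measurable]: "cx \<in> borel_measurable (lagM a)"
  by (intro measurable_lagM_continuous continuous_intros)
 have [measurable]: "(\<lambda>x. poly (lagpoly a n) (cx x)) \<in> borel_measurable (lagM a)"
  by (intro measurable_lagM_continuous continuous_intros)
 show ?thesis unfolding lag_psi_def by measurable
qed

lemma measurable_lagpoly_parabola:
 "(\<lambda>t. poly (lagpoly a n) (zpar \<rho> t)) \<in> borel_measurable borel"
 by (intro borel_measurable_continuous_onI continuous_intros continuous_parabola_param)

lemma parabola_param_nonzero: "\<rho> > 0 \<Longrightarrow> norm (zpar \<rho> t) > 0"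
 by (simp add: norm_parabola_param add_pos_nonneg)

lemma lag_kernel:
 assumes "a > -1" "\<rho> > 0" "rapid_lag \<rho> a"
 shows "parabola_kernel \<rho>
  (\<lambda>n t. 1 / (2 * sqrt pi) * (lag_kern \<rho> a n t))
  (\<lambda>t. norm (exp (- zpar \<rho> t / 2)) * norm (zpar \<rho> t) powr (a / 2 + 1 / 4))"
 unfolding parabola_kernel_def
proof (intro conjI allI lag_kernel_tendsto rapid_scale assms(1,2) assms(3)[unfolded rapid_lag_def])
 note measurable_lagpoly_parabola[measurable]
 show "(\<lambda>t. 1 / (2 * sqrt pi) * (lag_kern \<rho> a n t)) \<in> borel_measurable borel" for n
  by measurable
qed (use parabola_param_nonzero[OF assms(2)] in auto)

lemma psi_kernel:
 assumes "a > -1" "\<rho> > 0" "rapid_psi \<rho> a"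
 shows "parabola_kernel \<rho>
  (\<lambda>n t. 1 / sqrt pi * (psi_kern \<rho> a n t))
  (\<lambda>t. norm (exp (- zpar \<rho> t / 2)) * norm (zpar \<rho> t) powr (a / 2 - 1 / 4))"
 unfolding parabola_kernel_def
proof (intro conjI allI psi_kernel_tendsto rapid_scale assms(1,2) assms(3)[unfolded rapid_psi_def])
 note measurable_lag_psi[OF assms(1,2), measurable]
 show "(\<lambda>t. 1 / sqrt pi * (psi_kern \<rho> a n t)) \<in> borel_measurable borel" for n
  by measurable
qed (use parabola_param_nonzero[OF assms(2)] in auto)

lemma ratio_kernel:
 assumes "a > -1" "\<rho> > 0" "rapid_ratio \<rho> a"
 shows "parabola_kernel \<rho>
  (\<lambda>n t. 1 / (2 * pi) * (ratio_kern \<rho> a n t))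
  (\<lambda>t. norm (exp (- zpar \<rho> t)) * norm (zpar \<rho> t) powr a)"
 unfolding parabola_kernel_def
proof (intro conjI allI ratio_kernel_tendsto rapid_scale assms(1,2) assms(3)[unfolded rapid_ratio_def])
 note measurable_lag_psi[OF assms(1,2), measurable] measurable_lagpoly_parabola[measurable]
 show "(\<lambda>t. 1 / (2 * pi) * (ratio_kern \<rho> a n t)) \<in> borel_measurable borel" for n
  by measurable
qed (use parabola_param_nonzero[OF assms(2)] in auto)

lemma parabola_kernel_Suc:
 assumes "parabola_kernel \<rho> A a"
 shows "parabola_kernel \<rho> (\<lambda>n. A (Suc n)) a"
 using assms unfolding parabola_kernel_def
 by (auto intro: rapid_Suc simp: filterlim_sequentially_Suc[of "\<lambda>n. A n _"])

lemma parabola_kernel_divide: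
 assumes "\<rho> > 0" "parabola_kernel \<rho> A a"
 shows "parabola_kernel \<rho> (\<lambda>n t. A n t / norm (zpar \<rho> t)) (\<lambda>t. a t / norm (zpar \<rho> t))"
proof -
 have "A n t / norm (zpar \<rho> t) \<le> 1 / \<rho>\<^sup>2 * nodeweight \<rho> t ^ 0 * A n t" for n t
 proof -
  have "A n t / norm (zpar \<rho> t) \<le> A n t / \<rho>\<^sup>2"
   using assms parabola_param_nonzero[OF assms(1), of t]
   by (intro divide_left_mono mult_pos_pos) (simp_all add: parabola_kernel_def norm_parabola_param)
  then show ?thesis by simp
 qed
 then have ev: "\<forall>\<^sub>F n in sequentially. \<forall>t. A n t / norm (zpar \<rho> t) \<le> 1 / \<rho>\<^sup>2 * nodeweight \<rho> t ^ 0 * A n t"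
  by (intro always_eventually allI)
 have "rapid \<rho> A" using assms(2) by (simp add: parabola_kernel_def)
 then have "rapid \<rho> (\<lambda>n t. A n t / norm (zpar \<rho> t))"
  by (rule rapid_dominated[OF _ ev]) simp
 moreover have "(\<lambda>t. A n t / norm (zpar \<rho> t)) \<in> borel_measurable borel" for n
 proof -
  have [measurable]: "A n \<in> borel_measurable borel" using assms(2) by (simp add: parabola_kernel_def)
  show ?thesis by measurable
 qed
 moreover have "(\<lambda>n. A n t / norm (zpar \<rho> t)) \<longlonglongrightarrow> a t / norm (zpar \<rho> t)" for t
  using assms(2) parabola_param_nonzero[OF assms(1), of t] unfolding parabola_kernel_def
  by (intro tendsto_divide tendsto_const) auto
 moreover have "a t / norm (zpar \<rho> t) > 0" for t
  using assms(2) parabola_param_nonzero[OF assms(1), of t] unfolding parabola_kernel_def by (intro divide_pos_pos) auto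
 ultimately show ?thesis using assms(2) unfolding parabola_kernel_def by simp
qed

text \<open>Dominated convergence along the parabola.  The conclusion is an inequality with a factor \<open>c > 1\<close> rather than a
 limit, so that a vanishing limit integral needs no separate treatment later.\<close>

lemma parabola_kernel_integral:
 fixes F :: "real \<Rightarrow> complex"
 assumes \<rho>: "\<rho> > 0" and K: "parabola_kernel \<rho> A a"
  and F: "continuous_on UNIV F" "\<And>t. norm (F t) \<le> C * nodeweight \<rho> t ^ m"
 defines "X \<equiv> \<lambda>n. LINT t|lborel. A n t * norm (F t) * norm (dparabola \<rho> t)"
 defines "J \<equiv> LINT t|lborel. a t * norm (F t) * norm (dparabola \<rho> t)"
 shows "\<forall>\<^sub>F n in sequentially. integrable lborel (\<lambda>t. A n t * norm (F t) * norm (dparabola \<rho> t))"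
  and "J \<ge> 0" and "\<And>n. X n \<ge> 0"
  and "c > 1 \<Longrightarrow> \<forall>\<^sub>F n in sequentially. X n \<le> c * J"
proof -
 have A0: "A n t \<ge> 0" and a0: "a t > 0" and lim: "(\<lambda>n. A n t) \<longlonglongrightarrow> a t" for n t
  using K by (auto simp: parabola_kernel_def)
 have [measurable]: "A n \<in> borel_measurable borel" for n using K by (auto simp: parabola_kernel_def)
 have [measurable]: "a \<in> borel_measurable borel"
  by (rule borel_measurable_LIMSEQ_real[where u = A]) (use lim in auto)
 have [measurable]: "F \<in> borel_measurable borel" by (rule borel_measurable_continuous_onI[OF F(1)])
 let ?g = "\<lambda>n t. A n t * norm (F t) * norm (dparabola \<rho> t)"
 let ?h = "\<lambda>t. a t * norm (F t) * norm (dparabola \<rho> t)"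
 obtain K0 where K0: "\<forall>\<^sub>F n in sequentially. \<forall>t. A n t * nodeweight \<rho> t ^ (m + 2) \<le> K0"
  using K unfolding parabola_kernel_def rapid_def by blast
 define M where "M = 2 * \<bar>C\<bar> * \<bar>K0\<bar>"
 have M0: "\<bar>M\<bar> = M" by (simp add: M_def)
 have d: "norm (dparabola \<rho> t) \<le> 2 * nodeweight \<rho> t" for t
 proof -
  have "sqrt s \<le> 1 + s" if "s \<ge> 0" for s :: real
  proof (rule real_le_lsqrt)
   have "0 \<le> s * s" by simp
   then show "s \<le> (1 + s)\<^sup>2" using that by (simp add: power2_eq_square algebra_simps)
  qed (use that in auto)
  from this[of "\<rho>\<^sup>2 + t\<^sup>2"] have "sqrt (\<rho>\<^sup>2 + t\<^sup>2) \<le> 1 + (\<rho>\<^sup>2 + t\<^sup>2)" by simp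
  then show ?thesis by (simp add: norm_dparabola norm_parabola_param)
 qed
 have nw: "nodeweight \<rho> t \<ge> 1 + t\<^sup>2" for t by (simp add: norm_parabola_param)
 have dom: "\<forall>\<^sub>F n in sequentially. \<forall>t. ?g n t \<le> M * (1 / (1 + t\<^sup>2))"
  using K0
 proof eventually_elim
  case (elim n)
  show ?case
  proof
   fix t
   have p: "nodeweight \<rho> t > 0" by (rule nodeweight_pos)
   have t: "1 + t\<^sup>2 > 0" by (auto intro: add_pos_nonneg)
   have "norm (F t) \<le> \<bar>C\<bar> * nodeweight \<rho> t ^ m"
    by (rule order_trans[OF F(2)]) (auto intro!: mult_right_mono)
   then have "?g n t \<le> A n t * (\<bar>C\<bar> * nodeweight \<rho> t ^ m) * (2 * nodeweight \<rho> t)"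
    by (intro mult_mono d mult_left_mono A0 mult_nonneg_nonneg) auto
   also have "\<dots> = 2 * \<bar>C\<bar> * (A n t * nodeweight \<rho> t ^ (m + 2)) / nodeweight \<rho> t"
    using p by (simp add: power_add power2_eq_square)
   also have "\<dots> \<le> 2 * \<bar>C\<bar> * \<bar>K0\<bar> / nodeweight \<rho> t"
    using elim p by (intro divide_right_mono mult_left_mono) (auto intro: order_trans[OF _ abs_ge_self])
   also have "\<dots> \<le> 2 * \<bar>C\<bar> * \<bar>K0\<bar> / (1 + t\<^sup>2)"
    using nw t by (intro divide_left_mono) (auto intro!: mult_pos_pos p)
   finally show "?g n t \<le> M * (1 / (1 + t\<^sup>2))" by (simp add: M_def)
  qed
 qed
 have intw: "integrable lborel (\<lambda>t. M * (1 / (1 + t\<^sup>2)))" by (intro integrable_mult_right integrable_inverse_square)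
 show ev: "\<forall>\<^sub>F n in sequentially. integrable lborel (?g n)"
  using dom
 proof eventually_elim
  case (elim n)
  show ?case
   by (rule Bochner_Integration.integrable_bound[OF intw])
     (use elim A0 in \<open>auto simp: abs_mult M0 intro!: AE_I2\<close>)
 qed
 have "?h t \<le> M * (1 / (1 + t\<^sup>2))" for t
  by (rule tendsto_upperbound[OF tendsto_mult_right[OF tendsto_mult_right[OF lim]]])
    (use dom in \<open>auto elim: eventually_mono\<close>)
 then have inth: "integrable lborel ?h"
  by (intro Bochner_Integration.integrable_bound[OF intw])
    (use a0 in \<open>auto simp: abs_mult less_imp_le M0 intro!: AE_I2\<close>)
 have lm: "X \<longlonglongrightarrow> J"
  unfolding X_def J_def
 proof (rule dominated_convergence_eventually[OF _ _ intw])
  show "\<forall>\<^sub>F n in sequentially. AE t in lborel. norm (?g n t) \<le> M * (1 / (1 + t\<^sup>2))"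
   using dom by eventually_elim (use A0 in \<open>auto simp: abs_mult\<close>)
  show "AE t in lborel. (\<lambda>n. ?g n t) \<longlonglongrightarrow> ?h t"
   by (intro AE_I2 tendsto_mult lim tendsto_const)
 qed auto
 show J0: "J \<ge> 0" unfolding J_def using a0 by (intro Bochner_Integration.integral_nonneg) (auto simp: less_imp_le)
 show "X n \<ge> 0" for n unfolding X_def using A0 by (intro Bochner_Integration.integral_nonneg) auto
 show "\<forall>\<^sub>F n in sequentially. X n \<le> c * J" if "c > 1"
 proof (cases "J = 0")
  case True
  then have "AE t in lborel. ?h t = 0"
   unfolding J_def using a0 inth by (subst (asm) integral_nonneg_eq_0_iff_AE) (auto simp: less_imp_le)
  then have "AE t in lborel. ?g n t = 0" for n
   by eventually_elim (use a0 in \<open>auto simp: less_imp_neq[symmetric]\<close>)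
  then have "X n = 0" for n unfolding X_def by (rule integral_eq_zero_AE)
  then show ?thesis using True by simp
 next
  case False
  then have "J < c * J" using J0 that by simp
  then have "\<forall>\<^sub>F n in sequentially. X n < c * J" by (rule order_tendstoD(2)[OF lm])
  then show ?thesis by eventually_elim simp
 qed
qed

lemma asymp_boundI:
 assumes "\<forall>\<^sub>F n in sequentially. A n \<le> s n * (b n * X n)" "s \<longlonglongrightarrow> S" "S > 0" "\<And>n. b n \<ge> 0" "\<And>n. X n \<ge> 0" "J \<ge> 0"
  and "\<And>c. c > 1 \<Longrightarrow> \<forall>\<^sub>F n in sequentially. X n \<le> c * J"
 shows "asymp_bound A S (\<lambda>n. b n * J)"
 unfolding asymp_bound_def
proof (intro allI impI)
 fix C0 assume C0: "C0 > S"
 define T where "T = (S + C0) / 2"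
 have T: "S < T" "T < C0" "T > 0" using C0 assms(3) by (auto simp: T_def)
 have "\<forall>\<^sub>F n in sequentially. X n \<le> C0 / T * J" using T by (intro assms(7)) simp
 moreover have "\<forall>\<^sub>F n in sequentially. s n < T" by (rule order_tendstoD(2)[OF assms(2) T(1)])
 ultimately have "\<forall>\<^sub>F n in sequentially. A n \<le> C0 * (b n * J)"
  using assms(1)
 proof eventually_elim
  case (elim n)
  have "A n \<le> s n * (b n * X n)" by (rule elim(3))
  also have "\<dots> \<le> T * (b n * X n)" using elim(2) assms(4,5) by (intro mult_right_mono) auto
  also have "\<dots> \<le> T * (b n * (C0 / T * J))" using elim(1) assms(4) T by (intro mult_left_mono) auto
  also have "\<dots> = C0 * (b n * J)" using T by simp
  finally show ?case .
 qed
 then show "\<exists>n0. \<forall>n\<ge>n0. A n \<le> C0 * (b n * J)" by (simp add: eventually_at_top_linorder)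
qed

section \<open>Interpolation errors\<close>

lemma measurable_lagM_poly_complex: "(\<lambda>x. poly p (cx x)) \<in> borel_measurable (lagM a)"
 by (intro measurable_lagM_continuous continuous_intros)

lemma integrable_lagM_norm_poly_square:
 assumes "a > -1"
 shows "integrable (lagM a) (\<lambda>x. (norm (poly p (cx x)))\<^sup>2)"
proof -
 have "integrable (lagM a) (\<lambda>x. cx ((norm (poly p (cx x)))\<^sup>2))"
  using integrable_lagM_poly[OF assms, of "p * polycnj p"] unfolding poly_mult poly_polycnj complex_norm_square[symmetric] .
 then show ?thesis unfolding complex_of_real_integrable_eq .
qed

lemma weight_norm_le:
 assumes "a > -1" "B \<ge> 0" "\<And>x. x \<ge> 0 \<Longrightarrow> norm (g (cx x)) \<le> norm (poly p (cx x)) * B"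
 shows "weight_norm a g \<le> sqrt (LINT x|lagM a. (norm (poly p (cx x)))\<^sup>2) * B"
proof -
 let ?P = "\<lambda>x. (norm (poly p (cx x)))\<^sup>2"
 have int: "integrable (lagM a) (\<lambda>x. ?P x * B\<^sup>2)"
  by (intro integrable_mult_left integrable_lagM_norm_poly_square assms)
 have meas: "(\<lambda>x. ?P x * B\<^sup>2) \<in> borel_measurable (lagM a)" using int by (rule borel_measurable_integrable)
 have "(LINT x:{0..}|lborel. weight a x * (norm (g (cx x)))\<^sup>2) \<le> (LINT x:{0..}|lborel. weight a x *\<^sub>R (?P x * B\<^sup>2))"
  unfolding set_lebesgue_integral_def
 proof (rule integral_mono')
  show "integrable lborel (\<lambda>x. indicat_real {0..} x *\<^sub>R (weight a x *\<^sub>R (?P x * B\<^sup>2)))"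
   using int unfolding integrable_lagM_iff[OF meas] set_integrable_def .
  show "0 \<le> indicat_real {0..} x *\<^sub>R (weight a x *\<^sub>R (?P x * B\<^sup>2))" for x
   by (simp add: weight_nonneg)
  show "indicat_real {0..} x *\<^sub>R (weight a x * (norm (g (cx x)))\<^sup>2) \<le> indicat_real {0..} x *\<^sub>R (weight a x *\<^sub>R (?P x * B\<^sup>2))" for x
  proof (cases "x \<ge> 0")
   case True
   have "(norm (g (cx x)))\<^sup>2 \<le> (norm (poly p (cx x)) * B)\<^sup>2"
    using assms(3)[OF True] by (intro power_mono) auto
   then have "weight a x * (norm (g (cx x)))\<^sup>2 \<le> weight a x * (?P x * B\<^sup>2)"
    by (intro mult_left_mono weight_nonneg) (simp add: power_mult_distrib)
   then show ?thesis using True by simp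
  qed simp
 qed
 also have "\<dots> = (LINT x|lagM a. ?P x * B\<^sup>2)" by (rule integral_lagM[OF meas, symmetric])
 also have "\<dots> = (LINT x|lagM a. ?P x) * B\<^sup>2" by (rule integral_mult_left_zero)
 finally have "weight_norm a g \<le> sqrt ((LINT x|lagM a. ?P x) * B\<^sup>2)"
  unfolding weight_norm_def by (rule real_sqrt_le_mono)
 also have "\<dots> = sqrt (LINT x|lagM a. ?P x) * B" using assms(2) by (simp add: real_sqrt_mult)
 finally show ?thesis .
qed

lemma sup_norm_le:
 assumes "\<And>x. x \<ge> 0 \<Longrightarrow> norm (g (cx x)) \<le> B"
 shows "sup_norm g \<le> B"
 unfolding sup_norm_def by (rule cSUP_least) (use assms in auto)

text \<open>Gauss and Radau nodes are treated at once: \<open>X n\<close> are the nodes, \<open>W n\<close> is their node polynomial, and \<open>\<kappa> n / |W n|\<close>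
 converges to \<open>wt\<close> on the parabola.\<close>

locale interpolation_scheme =
 fixes \<rho> :: real and X :: "nat \<Rightarrow> real set" and W :: "nat \<Rightarrow> complex poly"
  and \<kappa> :: "nat \<Rightarrow> real" and wt :: "complex \<Rightarrow> real"
 assumes \<rho>: "\<rho> > 0"
  and kernel: "parabola_kernel \<rho> (\<lambda>n t. \<kappa> n / norm (poly (W n) (zpar \<rho> t))) (\<lambda>t. wt (zpar \<rho> t))"
  and \<kappa>: "\<forall>\<^sub>F n in sequentially. \<kappa> n > 0"
  and nodes: "finite (X n)" "card (X n) = Suc n" "x \<in> X n \<Longrightarrow> x \<ge> 0" "x \<in> X n \<Longrightarrow> poly (W n) (of_real x) = 0"
  and degree_W: "degree (W n) = Suc n"
  and W_nonzero: "poly (W n) (zpar \<rho> t) \<noteq> 0"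
begin

abbreviation points :: "nat \<Rightarrow> complex set" where
 "points n \<equiv> of_real ` X n"

lemma points: "finite (points n)" "card (points n) = Suc n"
 using nodes(1,2) by (auto simp: card_image inj_on_def)

definition mean :: "(complex \<Rightarrow> complex) \<Rightarrow> nat \<Rightarrow> real" where
 "mean f n = (LINT t|lborel. \<kappa> n / norm (poly (W n) (zpar \<rho> t)) * norm (f (zpar \<rho> t)) * norm (dparabola \<rho> t))"

definition limit_integral :: "(complex \<Rightarrow> complex) \<Rightarrow> real" where
 "limit_integral f = parabola_integral \<rho> (\<lambda>z. wt z * norm (f z))"

lemma mean_bounds:
 assumes "growth_cond \<rho> f"
 shows "\<forall>\<^sub>F n in sequentially. integrable lborel (\<lambda>t. \<kappa> n / norm (poly (W n) (zpar \<rho> t)) * norm (f (zpar \<rho> t)) * norm (dparabola \<rho> t))"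
  and "limit_integral f \<ge> 0" and "\<And>n. mean f n \<ge> 0"
  and "\<And>c. c > 1 \<Longrightarrow> \<forall>\<^sub>F n in sequentially. mean f n \<le> c * limit_integral f"
proof -
 obtain C m where C: "C \<ge> 0" "continuous_on UNIV (\<lambda>t. f (zpar \<rho> t))"
  "\<And>t. norm (f (zpar \<rho> t)) \<le> C * (1 + norm (zpar \<rho> t)) ^ m"
  by (rule growth_cond_parabola[OF assms \<rho>]) blast
 note * = parabola_kernel_integral[OF \<rho> kernel C(2,3)]
 have l: "limit_integral f = (LINT t|lborel. wt (zpar \<rho> t) * norm (f (zpar \<rho> t)) * norm (dparabola \<rho> t))"
  unfolding limit_integral_def parabola_integral_eq ..
 show "\<forall>\<^sub>F n in sequentially. integrable lborel (\<lambda>t. \<kappa> n / norm (poly (W n) (zpar \<rho> t)) * norm (f (zpar \<rho> t)) * norm (dparabola \<rho> t))"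
  by (rule *(1))
 show "limit_integral f \<ge> 0" unfolding l by (rule *(2))
 show "mean f n \<ge> 0" for n unfolding mean_def by (rule *(3))
 show "\<forall>\<^sub>F n in sequentially. mean f n \<le> c * limit_integral f" if "c > 1" for c
  unfolding l mean_def by (rule *(4)[OF that])
qed

text \<open>The distance of \<open>z\<close> to the half-line is at least \<open>\<rho>\<^sup>2\<close>; this is the origin of that factor in the bounds.\<close>

theorem error_le:
 assumes f: "growth_cond \<rho> f"
 shows "\<forall>\<^sub>F n in sequentially. \<forall>x\<ge>0. norm (f (of_real x) - poly (lagrange_poly (points n) f) (of_real x))
  \<le> norm (poly (W n) (of_real x)) * (mean f n / (\<kappa> n * (2 * pi * \<rho>\<^sup>2)))"
proof -
 obtain N where N: "\<And>n X W x. n \<ge> N \<Longrightarrow> finite X \<Longrightarrow> card X = Suc n \<Longrightarrow> (\<And>a. a \<in> X \<Longrightarrow> a \<ge> 0) \<Longrightarrow> degree W = Suc n \<Longrightarrow>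
   (\<And>a. a \<in> X \<Longrightarrow> poly W (cx a) = 0) \<Longrightarrow> (\<And>t. poly W (zpar \<rho> t) \<noteq> 0) \<Longrightarrow> x \<ge> 0 \<Longrightarrow>
   f (of_real x) - poly (lagrange_poly (of_real ` X) f) (of_real x) =
    poly W (of_real x) * (LINT t|lborel. f (zpar \<rho> t) / poly W (zpar \<rho> t) * dparabola \<rho> t / (zpar \<rho> t - of_real x)) / (2 * of_real pi * \<i>)"
  by (rule interpolation_error_contour[OF \<rho> f]) blast
 show ?thesis
  using mean_bounds(1)[OF f] \<kappa> eventually_ge_at_top[of N]
 proof eventually_elim
  case (elim n)
  let ?z = "zpar \<rho>" and ?d = "dparabola \<rho>"
  let ?A = "\<lambda>t. \<kappa> n / norm (poly (W n) (?z t)) * norm (f (?z t)) * norm (?d t)"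
  show ?case
  proof (intro allI impI)
   fix x :: real assume x: "x \<ge> 0"
   let ?I = "LINT t|lborel. f (?z t) / poly (W n) (?z t) * ?d t / (?z t - of_real x)"
   have "norm ?I \<le> (LINT t|lborel. norm (f (?z t) / poly (W n) (?z t) * ?d t / (?z t - of_real x)))"
    by (rule integral_norm_bound)
   also have "\<dots> \<le> (LINT t|lborel. ?A t / (\<kappa> n * \<rho>\<^sup>2))"
   proof (rule integral_mono')
    show "integrable lborel (\<lambda>t. ?A t / (\<kappa> n * \<rho>\<^sup>2))" using elim(1) by (rule integrable_divide)
    show "0 \<le> ?A t / (\<kappa> n * \<rho>\<^sup>2)" for t using elim(2) by simp
    show "norm (f (?z t) / poly (W n) (?z t) * ?d t / (?z t - of_real x)) \<le> ?A t / (\<kappa> n * \<rho>\<^sup>2)" for t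
    proof -
     have d: "norm (?z t - of_real x) \<ge> \<rho>\<^sup>2" by (rule parabola_dist[OF \<rho> x])
     have "norm (f (?z t) / poly (W n) (?z t) * ?d t / (?z t - of_real x)) = norm (f (?z t)) / norm (poly (W n) (?z t)) * norm (?d t) / norm (?z t - of_real x)"
      by (simp add: norm_mult norm_divide)
     also have "\<dots> \<le> norm (f (?z t)) / norm (poly (W n) (?z t)) * norm (?d t) / \<rho>\<^sup>2"
      using d \<rho> by (intro divide_left_mono mult_pos_pos) (auto intro: order_less_le_trans[OF _ d])
     also have "\<dots> = ?A t / (\<kappa> n * \<rho>\<^sup>2)" using elim(2) by simp
     finally show ?thesis .
    qed
   qed
   also have "\<dots> = mean f n / (\<kappa> n * \<rho>\<^sup>2)" unfolding mean_def by (rule integral_divide_zero)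
   finally have I: "norm ?I \<le> mean f n / (\<kappa> n * \<rho>\<^sup>2)" .
   have "f (of_real x) - poly (lagrange_poly (points n) f) (of_real x) = poly (W n) (of_real x) * ?I / (2 * of_real pi * \<i>)"
    by (rule N[OF elim(3) nodes(1,2) nodes(3) degree_W nodes(4) W_nonzero x])
   then have "norm (f (of_real x) - poly (lagrange_poly (points n) f) (of_real x)) = norm (poly (W n) (of_real x)) * (norm ?I / (2 * pi))"
    by (simp add: norm_mult norm_divide)
   also have "\<dots> \<le> norm (poly (W n) (of_real x)) * (mean f n / (\<kappa> n * \<rho>\<^sup>2) / (2 * pi))"
    by (intro mult_left_mono divide_right_mono I) auto
   finally show "norm (f (of_real x) - poly (lagrange_poly (points n) f) (of_real x)) \<le> norm (poly (W n) (of_real x)) * (mean f n / (\<kappa> n * (2 * pi * \<rho>\<^sup>2)))"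
    by (simp add: mult_ac)
  qed
 qed
qed

lemma asymp_bound_mean:
 assumes "growth_cond \<rho> f"
  and A: "\<forall>\<^sub>F n in sequentially. A n \<le> v n * (mean f n / (\<kappa> n * (2 * pi * \<rho>\<^sup>2)))"
  and s: "(\<lambda>n. v n / (\<kappa> n * (2 * pi * \<rho>\<^sup>2) * b n)) \<longlonglongrightarrow> S" "S > 0" and b: "\<And>n. b n \<ge> 0" "\<forall>\<^sub>F n in sequentially. b n > 0"
 shows "asymp_bound A S (\<lambda>n. b n * limit_integral f)"
proof (rule asymp_boundI[OF _ s b(1) mean_bounds(3,2,4)[OF assms(1)]])
 show "\<forall>\<^sub>F n in sequentially. A n \<le> v n / (\<kappa> n * (2 * pi * \<rho>\<^sup>2) * b n) * (b n * mean f n)"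
  using A b(2) by eventually_elim simp
qed

theorem weight_norm_asymp:
 assumes f: "growth_cond \<rho> f" and a: "a > -1"
  and s: "(\<lambda>n. sqrt (LINT x|lagM a. (norm (poly (W n) (cx x)))\<^sup>2) / (\<kappa> n * (2 * pi * \<rho>\<^sup>2) * b n)) \<longlonglongrightarrow> S" "S > 0"
  and b: "\<And>n. b n \<ge> 0" "\<forall>\<^sub>F n in sequentially. b n > 0"
 shows "asymp_bound (\<lambda>n. weight_norm a (\<lambda>z. f z - interpolant (poly_space n) (points n) f z)) S (\<lambda>n. b n * limit_integral f)"
 using f
proof (rule asymp_bound_mean[OF _ _ s b])
 show "\<forall>\<^sub>F n in sequentially. weight_norm a (\<lambda>z. f z - interpolant (poly_space n) (points n) f z)
   \<le> sqrt (LINT x|lagM a. (norm (poly (W n) (cx x)))\<^sup>2) * (mean f n / (\<kappa> n * (2 * pi * \<rho>\<^sup>2)))"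
  using error_le[OF f] \<kappa>
 proof eventually_elim
  case (elim n)
  then show ?case unfolding interpolant_poly_space[OF points]
   by (intro weight_norm_le a) (use mean_bounds(3)[OF f] in auto)
 qed
qed

theorem sup_norm_asymp:
 assumes f: "growth_cond \<rho> (\<lambda>z. exp (z / 2) * f z)"
  and v: "\<And>n x. x \<ge> 0 \<Longrightarrow> exp (- x / 2) * norm (poly (W n) (cx x)) \<le> v n"
  and s: "(\<lambda>n. v n / (\<kappa> n * (2 * pi * \<rho>\<^sup>2) * b n)) \<longlonglongrightarrow> S" "S > 0"
  and b: "\<And>n. b n \<ge> 0" "\<forall>\<^sub>F n in sequentially. b n > 0"
 shows "asymp_bound (\<lambda>n. sup_norm (\<lambda>z. f z - interpolant (exp_poly_space n) (points n) f z)) S (\<lambda>n. b n * limit_integral (\<lambda>z. exp (z / 2) * f z))"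
 using f
proof (rule asymp_bound_mean[OF _ _ s b])
 let ?g = "\<lambda>z. exp (z / 2) * f z"
 show "\<forall>\<^sub>F n in sequentially. sup_norm (\<lambda>z. f z - interpolant (exp_poly_space n) (points n) f z) \<le> v n * (mean ?g n / (\<kappa> n * (2 * pi * \<rho>\<^sup>2)))"
  using error_le[OF f] \<kappa>
 proof eventually_elim
  case (elim n)
  show ?case unfolding interpolant_exp_poly_space[OF points]
  proof (rule sup_norm_le)
   fix x :: real assume x: "x \<ge> 0"
   let ?p = "poly (lagrange_poly (points n) ?g) (of_real x)" and ?B = "mean ?g n / (\<kappa> n * (2 * pi * \<rho>\<^sup>2))"
   have B: "?B \<ge> 0" using elim(2) by (intro divide_nonneg_nonneg mean_bounds(3)[OF f]) auto
   have "exp (- cx x / 2) * ?g (of_real x) = f (of_real x)"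
    by (simp only: mult.assoc[symmetric] exp_add[symmetric]) simp
   then have "f (of_real x) - exp (- of_real x / 2) * ?p = exp (- of_real x / 2) * (?g (of_real x) - ?p)"
    by (simp only: right_diff_distrib)
   then have "norm (f (of_real x) - exp (- of_real x / 2) * ?p) = exp (- x / 2) * norm (?g (of_real x) - ?p)"
    by (simp add: norm_mult)
   also have "\<dots> \<le> exp (- x / 2) * (norm (poly (W n) (of_real x)) * ?B)"
    using elim(1) x by (intro mult_left_mono) auto
   also have "\<dots> = (exp (- x / 2) * norm (poly (W n) (of_real x))) * ?B" by (rule mult.assoc[symmetric])
   also have "\<dots> \<le> v n * ?B" by (intro mult_right_mono v x B)
   finally show "norm (f (of_real x) - exp (- of_real x / 2) * ?p) \<le> v n * ?B" .
  qed
 qed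
qed

end

subsection \<open>Laguerre and Laguerre--Radau points\<close>

lemma laguerre_points_eq:
 assumes "a > -1"
 shows "laguerre_points a n = of_real ` lagzeros a (Suc n)"
 unfolding lagzeros_complex[OF assms, symmetric] laguerre_points_def by (simp add: laguerre_eq_poly[OF assms])

lemma radau_points_eq:
 assumes "a > -1"
 shows "radau_points a n = of_real ` insert 0 (lagzeros (a + 1) n)"
proof -
 have a1: "a + 1 > -1" using assms by simp
 have "radau_points a n = insert 0 {z. poly (lagpoly (a + 1) n) z = 0}"
  unfolding radau_points_def using laguerre_eq_poly[OF a1] by auto
 then show ?thesis unfolding lagzeros_complex[OF a1] by simp
qed

abbreviation gauss_scale :: "real \<Rightarrow> real \<Rightarrow> nat \<Rightarrow> real" where
 "gauss_scale \<rho> a n \<equiv> 1 / (2 * sqrt pi) * (real (Suc n) powr (a / 2 - 1 / 4) * exp (2 * \<rho> * sqrt (real (Suc n))))"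

abbreviation radau_scale :: "real \<Rightarrow> real \<Rightarrow> nat \<Rightarrow> real" where
 "radau_scale \<rho> a n \<equiv> 1 / (2 * sqrt pi) * (real n powr (a / 2 + 1 / 4) * exp (2 * \<rho> * sqrt (real n)))"

lemma gauss_scheme:
 assumes "a > -1" "\<rho> > 0" "rapid_lag \<rho> a"
 shows "interpolation_scheme \<rho> (\<lambda>n. lagzeros a (Suc n)) (\<lambda>n. lagpoly a (Suc n)) (gauss_scale \<rho> a)
  (\<lambda>z. norm (exp (- z / 2)) * norm z powr (a / 2 + 1 / 4))"
proof
 show "parabola_kernel \<rho> (\<lambda>n t. gauss_scale \<rho> a n / norm (poly (lagpoly a (Suc n)) (zpar \<rho> t)))
   (\<lambda>t. norm (exp (- zpar \<rho> t / 2)) * norm (zpar \<rho> t) powr (a / 2 + 1 / 4))"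
  using parabola_kernel_Suc[OF lag_kernel[OF assms]] by (simp only: times_divide_eq_right)
 show "x \<in> lagzeros a (Suc n) \<Longrightarrow> 0 \<le> x" for x n using lagzeros_pos[OF assms(1)] by (auto intro: less_imp_le)
 show "x \<in> lagzeros a (Suc n) \<Longrightarrow> poly (lagpoly a (Suc n)) (cx x) = 0" for x n
  by (auto simp: lagzeros_def poly_lagpoly_of_real)
 show "poly (lagpoly a (Suc n)) (zpar \<rho> t) \<noteq> 0" for n t
  by (rule lagpoly_off_ray_nonzero[OF assms(1) parabola_off_ray[OF assms(2)]])
qed (use assms in \<open>simp_all add: card_lagzeros degree_lagpoly\<close>)

lemma radau_scheme:
 assumes "a > -1" "\<rho> > 0" "rapid_lag \<rho> a"
 shows "interpolation_scheme \<rho> (\<lambda>n. insert 0 (lagzeros (a + 1) n)) (\<lambda>n. pCons 0 (lagpoly (a + 1) n)) (radau_scale \<rho> a)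
  (\<lambda>z. norm (exp (- z / 2)) * norm z powr (a / 2 - 1 / 4))"
proof
 have a1: "a + 1 > -1" using assms by simp
 let ?z = "zpar \<rho>"
 have z: "?z t \<noteq> 0" for t using parabola_param_nonzero[OF assms(2), of t] by auto
 have "norm (exp (- ?z t / 2)) * norm (?z t) powr ((a + 1) / 2 + 1 / 4) / norm (?z t) = norm (exp (- ?z t / 2)) * norm (?z t) powr (a / 2 - 1 / 4)" for t
 proof -
  have "norm (?z t) powr ((a + 1) / 2 + 1 / 4) / norm (?z t) powr 1 = norm (?z t) powr ((a + 1) / 2 + 1 / 4 - 1)"
   by (simp only: powr_diff)
  also have "(a + 1) / 2 + 1 / 4 - 1 = a / 2 - 1 / 4" by (simp add: field_simps)
  finally show ?thesis unfolding times_divide_eq_right[symmetric] by simp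
 qed
 moreover have "1 / (2 * sqrt pi) * (real n powr ((a + 1) / 2 - 1 / 4) * exp (2 * \<rho> * sqrt n) / norm (poly (lagpoly (a + 1) n) (?z t))) / norm (?z t)
   = radau_scale \<rho> a n / norm (poly (pCons 0 (lagpoly (a + 1) n)) (?z t))" for n t
 proof -
  have "(a + 1) / 2 - 1 / 4 = a / 2 + 1 / 4" by (simp add: field_simps)
  then show ?thesis by (simp only:) (simp add: norm_mult mult_ac)
 qed
 ultimately show "parabola_kernel \<rho> (\<lambda>n t. radau_scale \<rho> a n / norm (poly (pCons 0 (lagpoly (a + 1) n)) (?z t)))
   (\<lambda>t. norm (exp (- ?z t / 2)) * norm (?z t) powr (a / 2 - 1 / 4))"
  using parabola_kernel_divide[OF assms(2) lag_kernel[OF a1 assms(2) rapid_lag_raise[OF assms]]] by (simp only:)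
 show "\<forall>\<^sub>F n in sequentially. radau_scale \<rho> a n > 0"
  using eventually_gt_at_top[of 0] by eventually_elim simp
 have 0: "0 \<notin> lagzeros (a + 1) n" for n using lagzeros_pos[OF a1] by blast
 then show "card (insert 0 (lagzeros (a + 1) n)) = Suc n" for n using card_lagzeros[OF a1] by simp
 show "x \<in> insert 0 (lagzeros (a + 1) n) \<Longrightarrow> 0 \<le> x" for x n using lagzeros_pos[OF a1] by (auto intro: less_imp_le)
 show "x \<in> insert 0 (lagzeros (a + 1) n) \<Longrightarrow> poly (pCons 0 (lagpoly (a + 1) n)) (cx x) = 0" for x n
  by (auto simp: lagzeros_def poly_lagpoly_of_real)
 show "poly (pCons 0 (lagpoly (a + 1) n)) (?z t) \<noteq> 0" for n t
  using lagpoly_off_ray_nonzero[OF a1 parabola_off_ray[OF assms(2)]] z by simp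
 show "degree (pCons 0 (lagpoly (a + 1) n) :: complex poly) = Suc n" for n
  using lagpoly_nonzero[of "a + 1" n] by (simp add: degree_lagpoly)
qed (use assms in auto)

lemma lagpoly_real_points: "poly (lagpoly a n) (cx x) = of_real (poly (lagpoly a n) x)"
 by (rule poly_lagpoly_of_real)

lemma gauss_square_norm:
 assumes "a > -1"
 shows "(LINT x|lagM a. (norm (poly (lagpoly a n) (cx x)))\<^sup>2) = lag_h a n"
 using integrable_lag_square(2)[OF assms] by (simp add: lagpoly_real_points)

lemma radau_poly_eq:
 assumes "a > -1"
 shows "pCons 0 (lagpoly (a + 1) n) = smult (of_real (real n + a + 1)) (lagpoly a n) - smult (of_real (real n + 1)) (lagpoly a (Suc n) :: 'a :: real_field poly)"
 using lagpoly_raise[where 'a = 'a, of a n] by (simp add: add_ac)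

text \<open>In the expansion of the node polynomial the two terms are orthogonal and of equal size, whence the factor \<open>\<surd>2\<close>.\<close>

lemma radau_square_norm:
 assumes "a > -1"
 shows "(LINT x|lagM a. (norm (poly (pCons 0 (lagpoly (a + 1) n)) (cx x)))\<^sup>2)
  = (real n + a + 1)\<^sup>2 * lag_h a n + (real n + 1)\<^sup>2 * lag_h a (Suc n)"
proof -
 let ?d = "of_real (real n + a + 1) :: complex" and ?b = "of_real (real n + 1) :: complex"
 let ?L = "lagpoly a n :: complex poly" and ?M = "lagpoly a (Suc n) :: complex poly"
 let ?W = "pCons 0 (lagpoly (a + 1) n) :: complex poly"
 have sq: "cx ((norm (poly ?W (of_real x)))\<^sup>2) = poly (?W * ?W) (of_real x)" for x
  unfolding complex_norm_square by (simp add: lagpoly_real_points)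
 have "cx (LINT x|lagM a. (norm (poly ?W (of_real x)))\<^sup>2) = lagint a (?W * ?W)"
  unfolding lagint_def sq[symmetric] by (rule integral_complex_of_real[symmetric])
 also have "?W * ?W = smult (?d * ?d) (?L * ?L) - smult (?d * ?b) (?M * ?L) - smult (?d * ?b) (?M * ?L) + smult (?b * ?b) (?M * ?M)"
 proof -
  have "(smult d p - smult b q) * (smult d p - smult b q) = smult (d * d) (p * p) - smult (d * b) (q * p) - smult (d * b) (q * p) + smult (b * b) (q * q)"
   for d b :: complex and p q by (simp add: algebra_simps smult_diff_right)
  then show ?thesis unfolding radau_poly_eq[OF assms] .
 qed
 also have "lagint a \<dots> = ?d * ?d * of_real (lag_h a n) - ?d * ?b * lagint a (?M * ?L) - ?d * ?b * lagint a (?M * ?L) + ?b * ?b * of_real (lag_h a (Suc n))"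
  by (simp only: lagint_add[OF assms] lagint_diff[OF assms] lagint_smult[OF assms] lagint_lagpoly_square[OF assms])
 also have "lagint a (?M * ?L) = 0" by (rule lagint_orthogonal) (use assms in \<open>simp_all add: degree_lagpoly\<close>)
 finally have "cx (LINT x|lagM a. (norm (poly ?W (of_real x)))\<^sup>2) = of_real ((real n + a + 1)\<^sup>2 * lag_h a n + (real n + 1)\<^sup>2 * lag_h a (Suc n))"
  by (simp add: power2_eq_square)
 then show ?thesis unfolding of_real_eq_iff .
qed

lemma radau_square_norm_asymp:
 assumes "a > -1"
 shows "(\<lambda>n. ((real n + a + 1)\<^sup>2 * lag_h a n + (real n + 1)\<^sup>2 * lag_h a (Suc n)) * real n powr (- a - 2)) \<longlonglongrightarrow> 2"
proof -
 let ?r = "\<lambda>n. lag_h a n * real n powr (- a)"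
 have r: "?r \<longlonglongrightarrow> 1" by (rule lag_h_asymp[OF assms])
 have r': "(\<lambda>n. ?r (Suc n)) \<longlonglongrightarrow> 1" using LIMSEQ_Suc[OF r] .
 have "(\<lambda>n. ((real n + a + 1) / n)\<^sup>2 * ?r n + ((real n + 1) / n)\<^sup>2 * (real (Suc n) powr a / real n powr a) * ?r (Suc n)) \<longlonglongrightarrow> 1\<^sup>2 * 1 + 1\<^sup>2 * 1 * 1"
 proof (intro tendsto_add tendsto_mult tendsto_power r r')
  show "(\<lambda>n. (real n + a + 1) / n) \<longlonglongrightarrow> 1" by real_asymp
  show "(\<lambda>n. (real n + 1) / n) \<longlonglongrightarrow> 1" by real_asymp
  show "(\<lambda>n. real (Suc n) powr a / real n powr a) \<longlonglongrightarrow> 1" by real_asymp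
 qed
 moreover have "\<forall>\<^sub>F n in sequentially. ((real n + a + 1) / n)\<^sup>2 * ?r n + ((real n + 1) / n)\<^sup>2 * (real (Suc n) powr a / real n powr a) * ?r (Suc n)
   = ((real n + a + 1)\<^sup>2 * lag_h a n + (real n + 1)\<^sup>2 * lag_h a (Suc n)) * real n powr (- a - 2)"
  using eventually_gt_at_top[of 0]
 proof eventually_elim
  case (elim n)
  have p: "real n powr (- a - 2) = real n powr (- a) * (1 / (real n)\<^sup>2)"
   using elim by (simp add: powr_diff powr_numeral)
  have q: "real n powr (- a) = 1 / real n powr a" "real (Suc n) powr a * real (Suc n) powr (- a) = 1"
   by (simp_all add: powr_minus_divide)
  have "(real (Suc n) powr a / real n powr a) * ?r (Suc n) = lag_h a (Suc n) * (1 / real n powr a) * (real (Suc n) powr a * real (Suc n) powr (- a))"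
   by (simp only: divide_inverse mult_ac mult_1_left)
  then have e: "(real (Suc n) powr a / real n powr a) * ?r (Suc n) = lag_h a (Suc n) * real n powr (- a)"
   unfolding q by simp
  show ?case unfolding mult.assoc e p by (simp add: power_divide algebra_simps)
 qed
 ultimately show ?thesis by (simp only: tendsto_cong) simp
qed

lemma lag_sup_asymp:
 assumes "a > -1"
 shows "(\<lambda>n. lag_sup a n * real n powr (- (\<bar>a\<bar> + a) / 2)) \<longlonglongrightarrow> kappa a"
proof (cases "a \<ge> 0")
 case True
 then have "(\<lambda>n. lag_sup a n * real n powr (- (\<bar>a\<bar> + a) / 2)) = (\<lambda>n. lag_h a n * real n powr (- a) / Gamma (a + 1))"
  by (simp add: lag_sup_def pochhammer_eq_lag_h[OF assms])
 moreover have "(\<lambda>n. lag_h a n * real n powr (- a) / Gamma (a + 1)) \<longlonglongrightarrow> 1 / Gamma (a + 1)"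
  by (intro tendsto_divide lag_h_asymp assms tendsto_const) (use Gamma_real_pos[of "a + 1"] assms in linarith)
 ultimately show ?thesis using True by (simp add: kappa_def)
next
 case False
 have "\<forall>\<^sub>F n in sequentially. lag_sup a n * real n powr (- (\<bar>a\<bar> + a) / 2) = 2"
  using eventually_gt_at_top[of 0] by eventually_elim (use False in \<open>simp add: lag_sup_def\<close>)
 then show ?thesis using False by (simp add: kappa_def tendsto_eventually)
qed

lemma kappa_pos: "a > -1 \<Longrightarrow> kappa a > 0"
 by (simp add: kappa_def Gamma_real_pos)

lemma root_2_pi: "root 2 pi / (pi * c) = 1 / (sqrt pi * c)"
proof -
 have "s / (s * s * c) = 1 / (s * c)" if "s > 0" for s :: real using that by simp
 from this[of "sqrt pi"] show ?thesis
  unfolding sqrt_def[symmetric] by (simp only: real_sqrt_mult_self abs_of_nonneg pi_ge_zero real_sqrt_gt_zero pi_gt_zero)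
qed

lemma gauss_weight_norm_asymp:
 assumes "a > -1" "\<rho> > 0" "rapid_lag \<rho> a" "growth_cond \<rho> f"
 shows "asymp_bound (\<lambda>n. weight_norm a (\<lambda>z. f z - interpolant (poly_space n) (laguerre_points a n) f z))
   (1 / (sqrt pi * \<rho>\<^sup>2))
   (\<lambda>n. real n powr (1 / 4) * exp (- 2 * \<rho> * sqrt (real n))
    * parabola_integral \<rho> (\<lambda>z. norm (exp (- z / 2)) * norm z powr (a / 2 + 1 / 4) * norm (f z)))"
proof -
 interpret interpolation_scheme \<rho> "\<lambda>n. lagzeros a (Suc n)" "\<lambda>n. lagpoly a (Suc n)" "gauss_scale \<rho> a"
  "\<lambda>z. norm (exp (- z / 2)) * norm z powr (a / 2 + 1 / 4)"
  by (rule gauss_scheme[OF assms(1-3)])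
 let ?b = "\<lambda>n. real n powr (1 / 4) * exp (- 2 * \<rho> * sqrt (real n))"
 let ?r = "\<lambda>n. lag_h a n * real n powr (- a)"
 have "(\<lambda>n. real (Suc n) powr (a / 2) / (gauss_scale \<rho> a n * (2 * pi * \<rho>\<^sup>2) * ?b n)) \<longlonglongrightarrow> root 2 pi / (pi * \<rho>\<^sup>2)"
  using assms(2) by real_asymp
 moreover have "root 2 pi / (pi * \<rho>\<^sup>2) = 1 / (sqrt pi * \<rho>\<^sup>2)"
  by (rule root_2_pi)
 moreover have "(\<lambda>n. sqrt (?r (Suc n))) \<longlonglongrightarrow> sqrt 1"
  by (intro tendsto_real_sqrt LIMSEQ_Suc lag_h_asymp assms)
 ultimately have "(\<lambda>n. sqrt (?r (Suc n)) * (real (Suc n) powr (a / 2) / (gauss_scale \<rho> a n * (2 * pi * \<rho>\<^sup>2) * ?b n))) \<longlonglongrightarrow> sqrt 1 * (1 / (sqrt pi * \<rho>\<^sup>2))"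
  by (intro tendsto_mult) (simp_all only:)
 moreover have "sqrt (?r (Suc n)) * (real (Suc n) powr (a / 2) / c) = sqrt (LINT x|lagM a. (norm (poly (lagpoly a (Suc n)) (cx x)))\<^sup>2) / c" for n c
 proof -
  have "sqrt (real (Suc n) powr (- a)) = real (Suc n) powr (- a / 2)"
   by (simp only: powr_half_sqrt[symmetric] powr_ge_zero powr_powr) simp
  then have "sqrt (?r (Suc n)) * real (Suc n) powr (a / 2) = sqrt (lag_h a (Suc n)) * (real (Suc n) powr (- a / 2) * real (Suc n) powr (a / 2))"
   by (simp only: real_sqrt_mult mult.assoc)
  also have "real (Suc n) powr (- a / 2) * real (Suc n) powr (a / 2) = 1" by (simp flip: powr_add)
  finally show ?thesis unfolding gauss_square_norm[OF assms(1)] times_divide_eq_right by simp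
 qed
 ultimately have lim: "(\<lambda>n. sqrt (LINT x|lagM a. (norm (poly (lagpoly a (Suc n)) (cx x)))\<^sup>2) / (gauss_scale \<rho> a n * (2 * pi * \<rho>\<^sup>2) * ?b n)) \<longlonglongrightarrow> 1 / (sqrt pi * \<rho>\<^sup>2)"
  by (simp only: real_sqrt_one mult_1_left)
 have b: "\<forall>\<^sub>F n in sequentially. ?b n > 0" using eventually_gt_at_top[of 0] by eventually_elim simp
 show ?thesis
  unfolding laguerre_points_eq[OF assms(1)] limit_integral_def[symmetric]
  by (rule weight_norm_asymp[OF assms(4,1) lim _ _ b]) (use assms(2) in auto)
qed

lemma radau_weight_norm_asymp:
 assumes "a > -1" "\<rho> > 0" "rapid_lag \<rho> a" "growth_cond \<rho> f"
 shows "asymp_bound (\<lambda>n. weight_norm a (\<lambda>z. f z - interpolant (poly_space n) (radau_points a n) f z))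
   (sqrt 2 / (sqrt pi * \<rho>\<^sup>2))
   (\<lambda>n. real n powr (3 / 4) * exp (- 2 * \<rho> * sqrt (real n))
    * parabola_integral \<rho> (\<lambda>z. norm (exp (- z / 2)) * norm z powr (a / 2 - 1 / 4) * norm (f z)))"
proof -
 interpret interpolation_scheme \<rho> "\<lambda>n. insert 0 (lagzeros (a + 1) n)" "\<lambda>n. pCons 0 (lagpoly (a + 1) n)" "radau_scale \<rho> a"
  "\<lambda>z. norm (exp (- z / 2)) * norm z powr (a / 2 - 1 / 4)"
  by (rule radau_scheme[OF assms(1-3)])
 let ?b = "\<lambda>n. real n powr (3 / 4) * exp (- 2 * \<rho> * sqrt (real n))"
 let ?N = "\<lambda>n. (real n + a + 1)\<^sup>2 * lag_h a n + (real n + 1)\<^sup>2 * lag_h a (Suc n)"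
 have "(\<lambda>n. real n * real n powr (a / 2) / (radau_scale \<rho> a n * (2 * pi * \<rho>\<^sup>2) * ?b n)) \<longlonglongrightarrow> root 2 pi / (pi * \<rho>\<^sup>2)"
  using assms(2) by real_asymp
 moreover have "root 2 pi / (pi * \<rho>\<^sup>2) = 1 / (sqrt pi * \<rho>\<^sup>2)"
  by (rule root_2_pi)
 moreover have "(\<lambda>n. sqrt (?N n * real n powr (- a - 2))) \<longlonglongrightarrow> sqrt 2"
  by (intro tendsto_real_sqrt radau_square_norm_asymp assms)
 ultimately have "(\<lambda>n. sqrt (?N n * real n powr (- a - 2)) * (real n * real n powr (a / 2) / (radau_scale \<rho> a n * (2 * pi * \<rho>\<^sup>2) * ?b n))) \<longlonglongrightarrow> sqrt 2 * (1 / (sqrt pi * \<rho>\<^sup>2))"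
  by (intro tendsto_mult) (simp_all only:)
 moreover have "\<forall>\<^sub>F n in sequentially. sqrt (?N n * real n powr (- a - 2)) * (real n * real n powr (a / 2) / (radau_scale \<rho> a n * (2 * pi * \<rho>\<^sup>2) * ?b n))
   = sqrt (LINT x|lagM a. (norm (poly (pCons 0 (lagpoly (a + 1) n)) (cx x)))\<^sup>2) / (radau_scale \<rho> a n * (2 * pi * \<rho>\<^sup>2) * ?b n)"
  using eventually_gt_at_top[of 0]
 proof eventually_elim
  case (elim n)
  have "sqrt (real n powr (- a - 2)) = real n powr ((- a - 2) * (1 / 2))"
   by (simp only: powr_half_sqrt[symmetric] powr_ge_zero powr_powr)
  also have "(- a - 2) * (1 / 2) = - (a / 2 + 1)" by simp
  finally have "sqrt (?N n * real n powr (- a - 2)) * real n powr (a / 2 + 1) = sqrt (?N n) * (real n powr (- (a / 2 + 1)) * real n powr (a / 2 + 1))"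
   by (simp only: real_sqrt_mult mult.assoc)
  also have "real n powr (- (a / 2 + 1)) * real n powr (a / 2 + 1) = 1" using elim by (simp flip: powr_add)
  also have "real n powr (a / 2 + 1) = real n * real n powr (a / 2)" using elim by (simp add: powr_add)
  finally show ?case unfolding radau_square_norm[OF assms(1)] times_divide_eq_right by (simp only: mult_1_right)
 qed
 ultimately have lim: "(\<lambda>n. sqrt (LINT x|lagM a. (norm (poly (pCons 0 (lagpoly (a + 1) n)) (cx x)))\<^sup>2) / (radau_scale \<rho> a n * (2 * pi * \<rho>\<^sup>2) * ?b n)) \<longlonglongrightarrow> sqrt 2 / (sqrt pi * \<rho>\<^sup>2)"
  by (simp only: tendsto_cong) simp
 have b: "\<forall>\<^sub>F n in sequentially. ?b n > 0" using eventually_gt_at_top[of 0] by eventually_elim simp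
 show ?thesis
  unfolding radau_points_eq[OF assms(1)] limit_integral_def[symmetric]
  by (rule weight_norm_asymp[OF assms(4,1) lim _ _ b]) (use assms(2) in auto)
qed

lemma exp_half_integrand:
 "norm (exp (- z / 2)) * p * norm (exp (z / 2) * w) = p * norm w" for z w :: complex
proof -
 have "norm (exp (- z / 2)) * norm (exp (z / 2)) = 1" by (simp flip: norm_mult exp_add)
 then show ?thesis unfolding norm_mult by (metis mult.assoc mult.commute mult_1_left)
qed

lemma gauss_sup_norm_asymp:
 assumes "a > -1" "\<rho> > 0" "rapid_lag \<rho> a" "growth_cond \<rho> (\<lambda>z. exp (z / 2) * f z)"
 shows "asymp_bound (\<lambda>n. sup_norm (\<lambda>z. f z - interpolant (exp_poly_space n) (laguerre_points a n) f z))
   (kappa a / (sqrt pi * \<rho>\<^sup>2))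
   (\<lambda>n. real n powr (\<bar>a\<bar> / 2 + 1 / 4) * exp (- 2 * \<rho> * sqrt (real n))
    * parabola_integral \<rho> (\<lambda>z. norm z powr (a / 2 + 1 / 4) * norm (f z)))"
proof -
 interpret interpolation_scheme \<rho> "\<lambda>n. lagzeros a (Suc n)" "\<lambda>n. lagpoly a (Suc n)" "gauss_scale \<rho> a"
  "\<lambda>z. norm (exp (- z / 2)) * norm z powr (a / 2 + 1 / 4)"
  by (rule gauss_scheme[OF assms(1-3)])
 define \<beta> where "\<beta> = \<bar>a\<bar>"
 let ?b = "\<lambda>n. real n powr (\<beta> / 2 + 1 / 4) * exp (- 2 * \<rho> * sqrt (real n))"
 let ?v = "\<lambda>n. lag_sup a (Suc n)"
 have "(\<lambda>n. real (Suc n) powr (\<beta> / 2) * real (Suc n) powr (a / 2) / (gauss_scale \<rho> a n * (2 * pi * \<rho>\<^sup>2) * ?b n)) \<longlonglongrightarrow> root 2 pi / (pi * \<rho>\<^sup>2)"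
  using assms(2) by real_asymp
 moreover have "real (Suc n) powr (\<beta> / 2) * real (Suc n) powr (a / 2) = real (Suc n) powr ((\<beta> + a) / 2)" for n
  by (simp only: powr_add add_divide_distrib)
 moreover have "root 2 pi / (pi * \<rho>\<^sup>2) = 1 / (sqrt pi * \<rho>\<^sup>2)"
  by (rule root_2_pi)
 moreover have "(\<lambda>n. ?v n * real (Suc n) powr (- (\<beta> + a) / 2)) \<longlonglongrightarrow> kappa a"
  unfolding \<beta>_def by (intro LIMSEQ_Suc[of "\<lambda>n. lag_sup a n * real n powr (- (\<bar>a\<bar> + a) / 2)"] lag_sup_asymp assms)
 ultimately have "(\<lambda>n. (?v n * real (Suc n) powr (- (\<beta> + a) / 2)) * (real (Suc n) powr ((\<beta> + a) / 2) / (gauss_scale \<rho> a n * (2 * pi * \<rho>\<^sup>2) * ?b n))) \<longlonglongrightarrow> kappa a * (1 / (sqrt pi * \<rho>\<^sup>2))"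
  by (intro tendsto_mult) (simp_all only:)
 moreover have "(?v n * real (Suc n) powr (- (\<beta> + a) / 2)) * (real (Suc n) powr ((\<beta> + a) / 2) / c) = ?v n / c" for n c
 proof -
  have "real (Suc n) powr (- (\<beta> + a) / 2) * real (Suc n) powr ((\<beta> + a) / 2) = real (Suc n) powr (- (\<beta> + a) / 2 + (\<beta> + a) / 2)"
   by (simp only: powr_add)
  also have "- (\<beta> + a) / 2 + (\<beta> + a) / 2 = 0" by (simp add: field_simps)
  finally show ?thesis by (simp only: times_divide_eq_right mult.assoc) simp
 qed
 ultimately have lim: "(\<lambda>n. ?v n / (gauss_scale \<rho> a n * (2 * pi * \<rho>\<^sup>2) * ?b n)) \<longlonglongrightarrow> kappa a / (sqrt pi * \<rho>\<^sup>2)"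
  by (simp only: times_divide_eq_right mult_1_right)
 have b: "\<forall>\<^sub>F n in sequentially. ?b n > 0" using eventually_gt_at_top[of 0] by eventually_elim simp
 have v: "exp (- x / 2) * norm (poly (lagpoly a (Suc n)) (cx x)) \<le> ?v n" if "x \<ge> 0" for n x
  using lagpoly_bound[OF assms(1) that, of "Suc n"] by (simp add: lagpoly_real_points)
 have S: "kappa a / (sqrt pi * \<rho>\<^sup>2) > 0" using kappa_pos[OF assms(1)] assms(2) by simp
 have "asymp_bound (\<lambda>n. sup_norm (\<lambda>z. f z - interpolant (exp_poly_space n) (points n) f z)) (kappa a / (sqrt pi * \<rho>\<^sup>2)) (\<lambda>n. ?b n * limit_integral (\<lambda>z. exp (z / 2) * f z))"
  by (rule sup_norm_asymp[OF assms(4) v lim S _ b]) auto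
 then show ?thesis
  unfolding laguerre_points_eq[OF assms(1)] limit_integral_def exp_half_integrand \<beta>_def .
qed

text \<open>In the maximum norm the two terms of the node polynomial are estimated separately, whence the factor \<open>2\<close>.\<close>

lemma radau_sup_norm_asymp:
 assumes "a > -1" "\<rho> > 0" "rapid_lag \<rho> a" "growth_cond \<rho> (\<lambda>z. exp (z / 2) * f z)"
 shows "asymp_bound (\<lambda>n. sup_norm (\<lambda>z. f z - interpolant (exp_poly_space n) (radau_points a n) f z))
   (2 * kappa a / (sqrt pi * \<rho>\<^sup>2))
   (\<lambda>n. real n powr (\<bar>a\<bar> / 2 + 3 / 4) * exp (- 2 * \<rho> * sqrt (real n))
    * parabola_integral \<rho> (\<lambda>z. norm z powr (a / 2 - 1 / 4) * norm (f z)))"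
proof -
 interpret interpolation_scheme \<rho> "\<lambda>n. insert 0 (lagzeros (a + 1) n)" "\<lambda>n. pCons 0 (lagpoly (a + 1) n)" "radau_scale \<rho> a"
  "\<lambda>z. norm (exp (- z / 2)) * norm z powr (a / 2 - 1 / 4)"
  by (rule radau_scheme[OF assms(1-3)])
 define \<beta> where "\<beta> = \<bar>a\<bar>"
 let ?b = "\<lambda>n. real n powr (\<beta> / 2 + 3 / 4) * exp (- 2 * \<rho> * sqrt (real n))"
 let ?v = "\<lambda>n. (real n + a + 1) * lag_sup a n + (real n + 1) * lag_sup a (Suc n)"
 let ?c = "\<lambda>n. radau_scale \<rho> a n * (2 * pi * \<rho>\<^sup>2) * ?b n"
 let ?k = "\<lambda>n. lag_sup a n * real n powr (- (\<beta> + a) / 2)"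
 have pi: "root 2 pi / (pi * \<rho>\<^sup>2) = 1 / (sqrt pi * \<rho>\<^sup>2)"
  by (rule root_2_pi)
 have p: "real m powr ((\<beta> + a) / 2) = real m powr (\<beta> / 2) * real m powr (a / 2)" for m
  by (simp only: powr_add add_divide_distrib)
 have "(\<lambda>n. (real n + a + 1) * real n powr ((\<beta> + a) / 2) / ?c n) \<longlonglongrightarrow> root 2 pi / (pi * \<rho>\<^sup>2)"
  unfolding p using assms(2) by real_asymp
 moreover have "(\<lambda>n. (real n + 1) * real (Suc n) powr ((\<beta> + a) / 2) / ?c n) \<longlonglongrightarrow> root 2 pi / (pi * \<rho>\<^sup>2)"
  unfolding p using assms(2) by real_asymp
 moreover have k: "?k \<longlonglongrightarrow> kappa a" unfolding \<beta>_def by (rule lag_sup_asymp[OF assms(1)])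
 moreover have "(\<lambda>n. ?k (Suc n)) \<longlonglongrightarrow> kappa a" using LIMSEQ_Suc[OF k] .
 ultimately have L: "(\<lambda>n. ?k n * ((real n + a + 1) * real n powr ((\<beta> + a) / 2) / ?c n) + ?k (Suc n) * ((real n + 1) * real (Suc n) powr ((\<beta> + a) / 2) / ?c n))
   \<longlonglongrightarrow> kappa a * (1 / (sqrt pi * \<rho>\<^sup>2)) + kappa a * (1 / (sqrt pi * \<rho>\<^sup>2))"
  unfolding pi by (intro tendsto_add tendsto_mult)
 have one: "?k m * (q * real m powr ((\<beta> + a) / 2) / c) = q * lag_sup a m / c" if "m > 0" for m q c
 proof -
  have "real m powr (- (\<beta> + a) / 2) * real m powr ((\<beta> + a) / 2) = real m powr (- (\<beta> + a) / 2 + (\<beta> + a) / 2)"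
   by (simp only: powr_add)
  also have "- (\<beta> + a) / 2 + (\<beta> + a) / 2 = 0" by (simp add: field_simps)
  finally have "real m powr (- (\<beta> + a) / 2) * real m powr ((\<beta> + a) / 2) = 1" using that by simp
  moreover have "l * p * (q * p' / c) = q * l / c * (p * p')" for l p p' :: real by simp
  ultimately show ?thesis by (simp only: mult_1_right)
 qed
 have "\<forall>\<^sub>F n in sequentially. ?k n * ((real n + a + 1) * real n powr ((\<beta> + a) / 2) / ?c n) + ?k (Suc n) * ((real n + 1) * real (Suc n) powr ((\<beta> + a) / 2) / ?c n) = ?v n / ?c n"
  using eventually_gt_at_top[of 0]
 proof eventually_elim
  case (elim n)
  show ?case unfolding one[OF elim] one[OF zero_less_Suc] by (rule add_divide_distrib[symmetric])
 qed
 from Lim_transform_eventually[OF L this]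
 have lim: "(\<lambda>n. ?v n / ?c n) \<longlonglongrightarrow> 2 * kappa a / (sqrt pi * \<rho>\<^sup>2)" by (simp only: mult_2 add_divide_distrib times_divide_eq_right mult_1_right)
 have b: "\<forall>\<^sub>F n in sequentially. ?b n > 0" using eventually_gt_at_top[of 0] by eventually_elim simp
 have v: "exp (- x / 2) * norm (poly (pCons 0 (lagpoly (a + 1) n)) (cx x)) \<le> ?v n" if "x \<ge> 0" for n x
 proof -
  have "poly (pCons 0 (lagpoly (a + 1) n)) (cx x) = of_real (poly (pCons 0 (lagpoly (a + 1) n)) x)"
   by (simp add: lagpoly_real_points)
  then have "norm (poly (pCons 0 (lagpoly (a + 1) n)) (cx x)) = \<bar>poly (pCons 0 (lagpoly (a + 1) n)) x\<bar>"
   by (simp only: norm_of_real)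
  also have "poly (pCons 0 (lagpoly (a + 1) n)) x = (real n + a + 1) * poly (lagpoly a n) x - (real n + 1) * poly (lagpoly a (Suc n)) x"
   by (subst radau_poly_eq[OF assms(1)]) simp
  also have "\<bar>(real n + a + 1) * poly (lagpoly a n) x - (real n + 1) * poly (lagpoly a (Suc n)) x\<bar> \<le> (real n + a + 1) * \<bar>poly (lagpoly a n) x\<bar> + (real n + 1) * \<bar>poly (lagpoly a (Suc n)) x\<bar>"
   by (rule order_trans[OF abs_triangle_ineq4]) (use assms(1) in \<open>simp add: abs_mult\<close>)
  finally have "exp (- x / 2) * norm (poly (pCons 0 (lagpoly (a + 1) n)) (cx x)) \<le> exp (- x / 2) * ((real n + a + 1) * \<bar>poly (lagpoly a n) x\<bar> + (real n + 1) * \<bar>poly (lagpoly a (Suc n)) x\<bar>)"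
   by (rule mult_left_mono) simp
  also have "\<dots> = (real n + a + 1) * (exp (- x / 2) * \<bar>poly (lagpoly a n) x\<bar>) + (real n + 1) * (exp (- x / 2) * \<bar>poly (lagpoly a (Suc n)) x\<bar>)"
   by (simp add: algebra_simps)
  also have "\<dots> \<le> ?v n"
   using assms(1) by (intro add_mono mult_left_mono lagpoly_bound that) auto
  finally show ?thesis .
 qed
 have S: "2 * kappa a / (sqrt pi * \<rho>\<^sup>2) > 0" using kappa_pos[OF assms(1)] assms(2) by simp
 have "asymp_bound (\<lambda>n. sup_norm (\<lambda>z. f z - interpolant (exp_poly_space n) (points n) f z)) (2 * kappa a / (sqrt pi * \<rho>\<^sup>2)) (\<lambda>n. ?b n * limit_integral (\<lambda>z. exp (z / 2) * f z))"
  by (rule sup_norm_asymp[OF assms(4) v lim S _ b]) auto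
 then show ?thesis
  unfolding radau_points_eq[OF assms(1)] limit_integral_def exp_half_integrand \<beta>_def .
qed

section \<open>Quadrature\<close>

lemma weighted_integral_eq:
 "(\<lambda>x. g (cx x)) \<in> borel_measurable (lagM a) \<Longrightarrow> weighted_integral a g = (LINT x|lagM a. g (cx x))"
 unfolding weighted_integral_def by (rule integral_lagM_complex)

lemma integrable_lagM_growth:
 assumes "a > -1" "growth_cond \<rho> f" "\<rho> > 0"
 shows "integrable (lagM a) (\<lambda>x. f (cx x))"
 by (rule growth_cond_real[OF assms(2,3)]) (rule integrable_lagM_poly_growth[OF assms(1)])

context interpolation_scheme
begin

theorem quadrature_error:
 assumes f: "growth_cond \<rho> f" and a: "a > -1"
 shows "\<forall>\<^sub>F n in sequentially.
  norm (weighted_integral a f - weighted_integral a (interpolant (poly_space n) (points n) f))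
   \<le> (LINT t|lborel. 1 / (2 * pi) * (norm (LINT x|lagM a. poly (W n) (of_real x) / (zpar \<rho> t - of_real x)) / norm (poly (W n) (zpar \<rho> t)))
      * norm (f (zpar \<rho> t)) * norm (dparabola \<rho> t))"
proof -
 let ?z = "zpar \<rho>" and ?d = "dparabola \<rho>"
 obtain N where N: "\<And>n X W x. n \<ge> N \<Longrightarrow> finite X \<Longrightarrow> card X = Suc n \<Longrightarrow> (\<And>b. b \<in> X \<Longrightarrow> b \<ge> 0) \<Longrightarrow> degree W = Suc n \<Longrightarrow>
   (\<And>b. b \<in> X \<Longrightarrow> poly W (cx b) = 0) \<Longrightarrow> (\<And>t. poly W (zpar \<rho> t) \<noteq> 0) \<Longrightarrow> x \<ge> 0 \<Longrightarrow>
   f (of_real x) - poly (lagrange_poly (of_real ` X) f) (of_real x) =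
    poly W (of_real x) * (LINT t|lborel. f (zpar \<rho> t) / poly W (zpar \<rho> t) * dparabola \<rho> t / (zpar \<rho> t - of_real x)) / (2 * of_real pi * \<i>)"
  by (rule interpolation_error_contour[OF \<rho> f]) blast
 obtain C m where cont: "continuous_on UNIV (\<lambda>t. f (?z t))"
  by (rule growth_cond_parabola[OF f \<rho>]) blast
 show ?thesis
  using mean_bounds(1)[OF f] \<kappa> eventually_ge_at_top[of N]
 proof eventually_elim
  case (elim n)
  let ?g = "\<lambda>t. f (?z t) / poly (W n) (?z t) * ?d t"
  let ?V = "\<lambda>t. LINT x|lagM a. poly (W n) (of_real x) / (?z t - of_real x)"
  let ?p = "lagrange_poly (points n) f"
  have "continuous_on UNIV ?g"
   by (intro continuous_intros cont continuous_parabola_param continuous_dparabola) (use W_nonzero in auto)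
  then have meas: "?g \<in> borel_measurable lborel" by (simp add: borel_measurable_continuous_onI)
  have g: "integrable lborel ?g"
  proof (rule Bochner_Integration.integrable_bound)
   show "integrable lborel (\<lambda>t. \<kappa> n / norm (poly (W n) (?z t)) * norm (f (?z t)) * norm (?d t) / \<kappa> n)"
    using elim(1) by (rule integrable_divide)
   show "AE t in lborel. norm (?g t) \<le> norm (\<kappa> n / norm (poly (W n) (?z t)) * norm (f (?z t)) * norm (?d t) / \<kappa> n)"
    using elim(2) by (intro AE_I2) (simp add: norm_mult norm_divide abs_mult)
  qed (rule meas)
  have "weighted_integral a f - weighted_integral a (poly ?p) = (LINT x|lagM a. f (of_real x)) - (LINT x|lagM a. poly ?p (of_real x))"
   using integrable_lagM_growth[OF a f \<rho>] by (simp add: weighted_integral_eq measurable_lagM_poly_complex borel_measurable_integrable)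
  also have "\<dots> = (LINT x|lagM a. f (of_real x) - poly ?p (of_real x))"
   by (intro Bochner_Integration.integral_diff[symmetric] integrable_lagM_growth[OF a f \<rho>] integrable_lagM_poly a)
  also have "\<dots> = (LINT x|lagM a. poly (W n) (of_real x) * (LINT t|lborel. ?g t / (?z t - of_real x)) / (2 * of_real pi * \<i>))"
  proof (rule lint_cong)
   fix x assume "x \<in> space (lagM a)"
   then show "f (of_real x) - poly ?p (of_real x) = poly (W n) (of_real x) * (LINT t|lborel. ?g t / (?z t - of_real x)) / (2 * of_real pi * \<i>)"
    by (intro N[OF elim(3) nodes(1,2) nodes(3) degree_W nodes(4) W_nonzero]) simp_all
  qed
  also have "\<dots> = (LINT t|lborel. ?g t * ?V t) / (2 * of_real pi * \<i>)"
   unfolding integral_divide_zero lagM_parabola_Fubini[OF a \<rho> g] ..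
  finally have "norm (weighted_integral a f - weighted_integral a (poly ?p)) = norm (LINT t|lborel. ?g t * ?V t) / (2 * pi)"
   by (simp add: norm_divide norm_mult)
  also have "\<dots> \<le> (LINT t|lborel. norm (?g t * ?V t)) / (2 * pi)"
   by (intro divide_right_mono integral_norm_bound) simp
  also have "\<dots> = (LINT t|lborel. norm (?g t * ?V t) / (2 * pi))" by (rule integral_divide_zero[symmetric])
  also have "\<dots> = (LINT t|lborel. 1 / (2 * pi) * (norm (?V t) / norm (poly (W n) (?z t))) * norm (f (?z t)) * norm (?d t))"
   by (intro lint_cong) (simp add: norm_mult norm_divide mult_ac)
  finally show ?case unfolding interpolant_poly_space[OF points] .
 qed
qed

end

lemma lagM_shift_integral:
 fixes g :: "real \<Rightarrow> complex"
 assumes "g \<in> borel_measurable (lagM a)"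
 shows "(LINT x|lagM a. of_real x * g x) = (LINT x|lagM (a + 1). g x)"
proof -
 have g': "g \<in> borel_measurable (lagM (a + 1))"
  using assms by (simp only: measurable_lagM_cong)
 have id: "cx \<in> borel_measurable (lagM a)"
  by (intro measurable_lagM_continuous continuous_intros)
 have w: "indicat_real {0..} x *\<^sub>R (weight a x *\<^sub>R (cx x * g x)) = indicat_real {0..} x *\<^sub>R (weight (a + 1) x *\<^sub>R g x)" for x
  by (cases "x > 0") (auto simp: weight_def powr_add scaleR_conv_of_real indicator_def)
 show ?thesis
  unfolding integral_lagM[OF borel_measurable_times[OF id assms]] integral_lagM[OF g'] set_lebesgue_integral_def w ..
qed

lemma quadrature_asympI:
 assumes \<rho>: "\<rho> > 0" and f: "growth_cond \<rho> f"
  and K: "parabola_kernel \<rho> (\<lambda>n t. 1 / (2 * pi) * (exp (4 * \<rho> * sqrt (real (m n))) * q n t)) (\<lambda>t. a (zpar \<rho> t))"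
  and m: "\<And>n. m n \<ge> n"
  and A: "\<forall>\<^sub>F n in sequentially. A n \<le> (LINT t|lborel. 1 / (2 * pi) * q n t * norm (f (zpar \<rho> t)) * norm (dparabola \<rho> t))"
 shows "asymp_bound A 1 (\<lambda>n. exp (- 4 * \<rho> * sqrt (real n)) * parabola_integral \<rho> (\<lambda>z. a z * norm (f z)))"
proof -
 obtain C k where C: "C \<ge> 0" "continuous_on UNIV (\<lambda>t. f (zpar \<rho> t))"
  "\<And>t. norm (f (zpar \<rho> t)) \<le> C * (1 + norm (zpar \<rho> t)) ^ k"
  by (rule growth_cond_parabola[OF f \<rho>]) blast
 note * = parabola_kernel_integral[OF \<rho> K C(2,3)]
 let ?X = "\<lambda>n. LINT t|lborel. 1 / (2 * pi) * (exp (4 * \<rho> * sqrt (real (m n))) * q n t) * norm (f (zpar \<rho> t)) * norm (dparabola \<rho> t)"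
 have X: "(LINT t|lborel. 1 / (2 * pi) * q n t * norm (f (zpar \<rho> t)) * norm (dparabola \<rho> t)) \<le> exp (- 4 * \<rho> * sqrt (real n)) * ?X n" for n
 proof -
  have e: "exp (- 4 * \<rho> * sqrt (real (m n))) * exp (4 * \<rho> * sqrt (real (m n))) = 1" by (simp flip: exp_add)
  have "(LINT t|lborel. 1 / (2 * pi) * q n t * norm (f (zpar \<rho> t)) * norm (dparabola \<rho> t))
   = (LINT t|lborel. exp (- 4 * \<rho> * sqrt (real (m n))) * (1 / (2 * pi) * (exp (4 * \<rho> * sqrt (real (m n))) * q n t) * norm (f (zpar \<rho> t)) * norm (dparabola \<rho> t)))"
  proof (rule lint_cong)
   have "E * (p * (E' * q) * u * v) = (E * E') * (p * q * u * v)" for E p E' q u v :: real by simp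
   then show "1 / (2 * pi) * q n t * norm (f (zpar \<rho> t)) * norm (dparabola \<rho> t)
    = exp (- 4 * \<rho> * sqrt (real (m n))) * (1 / (2 * pi) * (exp (4 * \<rho> * sqrt (real (m n))) * q n t) * norm (f (zpar \<rho> t)) * norm (dparabola \<rho> t))" for t
    by (simp only: e mult_1_left)
  qed
  also have "\<dots> = exp (- 4 * \<rho> * sqrt (real (m n))) * ?X n" by (rule integral_mult_right_zero)
  also have "\<dots> \<le> exp (- 4 * \<rho> * sqrt (real n)) * ?X n"
   using m[of n] \<rho> by (intro mult_right_mono *(3)) simp
  finally show ?thesis .
 qed
 show ?thesis
  unfolding parabola_integral_eq
 proof (rule asymp_boundI[of _ "\<lambda>_. 1", OF _ _ _ _ *(3) *(2) *(4)])
  show "\<forall>\<^sub>F n in sequentially. A n \<le> 1 * (exp (- 4 * \<rho> * sqrt (real n)) * ?X n)"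
   using A by eventually_elim (use X in \<open>auto intro: order_trans\<close>)
 qed auto
qed

lemma gauss_quadrature_asymp:
 assumes "a > -1" "\<rho> > 0" "rapid_lag \<rho> a" "rapid_ratio \<rho> a" "growth_cond \<rho> f"
 shows "asymp_bound (\<lambda>n. norm (weighted_integral a f - gauss_laguerre a n f)) 1
  (\<lambda>n. exp (- 4 * \<rho> * sqrt (real n)) * parabola_integral \<rho> (\<lambda>z. norm (exp (- z)) * norm z powr a * norm (f z)))"
proof -
 interpret interpolation_scheme \<rho> "\<lambda>n. lagzeros a (Suc n)" "\<lambda>n. lagpoly a (Suc n)" "gauss_scale \<rho> a"
  "\<lambda>z. norm (exp (- z / 2)) * norm z powr (a / 2 + 1 / 4)"
  by (rule gauss_scheme[OF assms(1-3)])
 have V: "norm (LINT x|lagM a. poly (lagpoly a n) (of_real x) / (z - of_real x)) = norm (lag_psi a n z)" for n z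
 proof -
  have "(LINT x|lagM a. poly (lagpoly a n) (of_real x) / (z - of_real x)) = (LINT x|lagM a. - (poly (lagpoly a n) (of_real x) / (of_real x - z)))"
   by (intro lint_cong) (metis minus_diff_eq minus_divide_right)
  then show ?thesis by (simp add: lag_psi_def)
 qed
 show ?thesis
  unfolding gauss_laguerre_def laguerre_points_eq[OF assms(1)]
 proof (rule quadrature_asympI[OF assms(2,5), of Suc])
  show "parabola_kernel \<rho> (\<lambda>n t. 1 / (2 * pi) * (exp (4 * \<rho> * sqrt (real (Suc n))) * (norm (lag_psi a (Suc n) (zpar \<rho> t)) / norm (poly (lagpoly a (Suc n)) (zpar \<rho> t)))))
    (\<lambda>t. norm (exp (- zpar \<rho> t)) * norm (zpar \<rho> t) powr a)"
   using parabola_kernel_Suc[OF ratio_kernel[OF assms(1,2,4)]] by (simp only: times_divide_eq_right)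
  show "\<forall>\<^sub>F n in sequentially. norm (weighted_integral a f - weighted_integral a (interpolant (poly_space n) (points n) f))
    \<le> (LINT t|lborel. 1 / (2 * pi) * (norm (lag_psi a (Suc n) (zpar \<rho> t)) / norm (poly (lagpoly a (Suc n)) (zpar \<rho> t)))
      * norm (f (zpar \<rho> t)) * norm (dparabola \<rho> t))"
   using quadrature_error[OF assms(5,1)] unfolding V .
 qed simp
qed

lemma radau_quadrature_asymp:
 assumes "a > -1" "\<rho> > 0" "rapid_lag \<rho> a" "growth_cond \<rho> f"
 shows "asymp_bound (\<lambda>n. norm (weighted_integral a f - gauss_laguerre_radau a n f)) 1
  (\<lambda>n. exp (- 4 * \<rho> * sqrt (real n)) * parabola_integral \<rho> (\<lambda>z. norm (exp (- z)) * norm z powr a * norm (f z)))"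
proof -
 have a1: "a + 1 > -1" using assms by simp
 interpret interpolation_scheme \<rho> "\<lambda>n. insert 0 (lagzeros (a + 1) n)" "\<lambda>n. pCons 0 (lagpoly (a + 1) n)" "radau_scale \<rho> a"
  "\<lambda>z. norm (exp (- z / 2)) * norm z powr (a / 2 - 1 / 4)"
  by (rule radau_scheme[OF assms(1-3)])
 let ?z = "zpar \<rho>"
 have z: "norm (?z t) > 0" for t by (rule parabola_param_nonzero[OF assms(2)])
 have V: "norm (LINT x|lagM a. poly (pCons 0 (lagpoly (a + 1) n)) (of_real x) / (?z t - of_real x)) = norm (lag_psi (a + 1) n (?z t))" for n t
 proof -
  have "integrable (lagM a) (\<lambda>x. poly (- lagpoly (a + 1) n) (of_real x) / (of_real x - ?z t))"
   by (rule integrable_lagM_poly_divide[OF assms(1) parabola_off_ray[OF assms(2)]])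
  then have meas: "(\<lambda>x. poly (- lagpoly (a + 1) n) (of_real x) / (of_real x - ?z t)) \<in> borel_measurable (lagM a)"
   by (rule borel_measurable_integrable)
  have "(LINT x|lagM a. poly (pCons 0 (lagpoly (a + 1) n)) (of_real x) / (?z t - of_real x)) = (LINT x|lagM a. of_real x * (poly (- lagpoly (a + 1) n) (of_real x) / (of_real x - ?z t)))"
  proof (rule lint_cong)
   have "x * l / (z - x) = x * (- l / (x - z))" for x l z :: complex
    by (metis minus_diff_eq minus_divide_divide times_divide_eq_right)
   then show "poly (pCons 0 (lagpoly (a + 1) n)) (of_real x) / (?z t - of_real x) = of_real x * (poly (- lagpoly (a + 1) n) (of_real x) / (of_real x - ?z t))" for x
    by (simp only: poly_pCons poly_minus add_0_left)
  qed
  also have "\<dots> = (LINT x|lagM (a + 1). poly (- lagpoly (a + 1) n) (of_real x) / (of_real x - ?z t))"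
   by (rule lagM_shift_integral[OF meas])
  also have "\<dots> = - lag_psi (a + 1) n (?z t)" by (simp add: lag_psi_def)
  finally show ?thesis by simp
 qed
 show ?thesis
  unfolding gauss_laguerre_radau_def radau_points_eq[OF assms(1)]
 proof (rule quadrature_asympI[OF assms(2,4), of "\<lambda>n. n"])
  have lim: "norm (exp (- ?z t)) * norm (?z t) powr (a + 1) / norm (?z t) = norm (exp (- ?z t)) * norm (?z t) powr a" for t
   using z[of t] by (simp add: powr_add)
  have q: "1 / (2 * pi) * (exp (4 * \<rho> * sqrt (real n)) * norm (lag_psi (a + 1) n (?z t)) / norm (poly (lagpoly (a + 1) n) (?z t))) / norm (?z t)
   = 1 / (2 * pi) * (exp (4 * \<rho> * sqrt (real n)) * (norm (lag_psi (a + 1) n (?z t)) / norm (poly (pCons 0 (lagpoly (a + 1) n)) (?z t))))" for n t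
   by (simp add: norm_mult mult_ac)
  show "parabola_kernel \<rho> (\<lambda>n t. 1 / (2 * pi) * (exp (4 * \<rho> * sqrt (real n)) * (norm (lag_psi (a + 1) n (?z t)) / norm (poly (pCons 0 (lagpoly (a + 1) n)) (?z t)))))
    (\<lambda>t. norm (exp (- ?z t)) * norm (?z t) powr a)"
   using parabola_kernel_divide[OF assms(2) ratio_kernel[OF a1 assms(2) rapid_lag_imp_ratio[OF a1 assms(2) rapid_lag_raise[OF assms(1-3)]]]]
   unfolding lim q .
  show "\<forall>\<^sub>F n in sequentially. norm (weighted_integral a f - weighted_integral a (interpolant (poly_space n) (points n) f))
    \<le> (LINT t|lborel. 1 / (2 * pi) * (norm (lag_psi (a + 1) n (?z t)) / norm (poly (pCons 0 (lagpoly (a + 1) n)) (?z t)))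
      * norm (f (?z t)) * norm (dparabola \<rho> t))"
   using quadrature_error[OF assms(4,1)] unfolding V .
 qed simp
qed

section \<open>Laguerre coefficients\<close>

lemma laguerre_coeff_norm_le:
 assumes "a > -1" "\<rho> > 0" "growth_cond \<rho> f"
 defines "X \<equiv> \<lambda>n. LINT t|lborel. 1 / sqrt pi * (psi_kern \<rho> a n t) * norm (f (zpar \<rho> t)) * norm (dparabola \<rho> t)"
 shows "\<forall>\<^sub>F n in sequentially. lag_h a n * norm (laguerre_coeff a f n) \<le> 1 / (2 * sqrt pi) * (real n powr (a / 2 - 1 / 4) * exp (- 2 * \<rho> * sqrt n)) * X n"
proof -
 let ?z = "zpar \<rho>" and ?d = "dparabola \<rho>"
 obtain N where N: "\<And>n. n \<ge> N \<Longrightarrow> of_real (lag_h a n) * laguerre_coeff a f n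
   = (LINT t|lborel. cauchy_transform a n (?z t) * f (?z t) * ?d t)"
  by (rule laguerre_coeff_contour[OF assms(1-3)]) blast
 show ?thesis
  using eventually_ge_at_top[of N] eventually_gt_at_top[of 0]
 proof eventually_elim
  case (elim n)
  let ?c = "1 / (2 * sqrt pi) * (real n powr (a / 2 - 1 / 4) * exp (- 2 * \<rho> * sqrt n))"
  have pw: "real n powr (a / 2 - 1 / 4) * real n powr (1 / 4 - a / 2) = 1" using elim by (simp flip: powr_add)
  have ex: "exp (- 2 * \<rho> * sqrt n) * exp (2 * \<rho> * sqrt n) = 1" by (simp flip: exp_add)
  have pp: "1 / (2 * sqrt pi) * (1 / sqrt pi) = 1 / (2 * pi)" by simp
  have "lag_h a n * norm (laguerre_coeff a f n) = norm (of_real (lag_h a n) * laguerre_coeff a f n)"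
   using lag_h_pos[OF assms(1), of n] by (simp add: norm_mult)
  also have "\<dots> \<le> (LINT t|lborel. norm (cauchy_transform a n (?z t) * f (?z t) * ?d t))"
   unfolding N[OF elim(1)] by (rule integral_norm_bound)
  also have "\<dots> = (LINT t|lborel. ?c * (1 / sqrt pi * (real n powr (1 / 4 - a / 2) * exp (2 * \<rho> * sqrt n) * norm (lag_psi a n (?z t))) * norm (f (?z t)) * norm (?d t)))"
  proof (rule lint_cong)
   fix t
   have assoc: "s * (p * e) * (s' * (p' * e' * l) * u * v) = (s * s') * (p * p') * (e * e') * l * u * v" for s p e s' p' e' l u v :: real
    by simp
   have "?c * (1 / sqrt pi * (real n powr (1 / 4 - a / 2) * exp (2 * \<rho> * sqrt n) * norm (lag_psi a n (?z t))) * norm (f (?z t)) * norm (?d t))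
    = 1 / (2 * pi) * 1 * 1 * norm (lag_psi a n (?z t)) * norm (f (?z t)) * norm (?d t)"
    unfolding assoc pw ex pp ..
   moreover have "norm (cauchy_transform a n (?z t)) = norm (lag_psi a n (?z t)) / (2 * pi)"
    unfolding cauchy_transform_eq[OF assms(1) parabola_off_ray[OF assms(2)]] by (simp add: norm_divide norm_mult)
   ultimately show "norm (cauchy_transform a n (?z t) * f (?z t) * ?d t)
     = ?c * (1 / sqrt pi * (real n powr (1 / 4 - a / 2) * exp (2 * \<rho> * sqrt n) * norm (lag_psi a n (?z t))) * norm (f (?z t)) * norm (?d t))"
    unfolding norm_mult by simp
  qed
  also have "\<dots> = ?c * X n" unfolding X_def by (rule integral_mult_right_zero)
  finally show ?case .
 qed
qed

text \<open>The second form is normalised by the norm of \<open>L\<^sub>n\<close>, as Parseval's identity requires.\<close>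

lemma laguerre_coeff_asymp:
 assumes "a > -1" "\<rho> > 0" "rapid_psi \<rho> a" "growth_cond \<rho> f"
 shows "asymp_bound (\<lambda>n. norm (laguerre_coeff a f n)) (1 / (2 * sqrt pi))
   (\<lambda>n. real n powr (- a / 2 - 1 / 4) * exp (- 2 * \<rho> * sqrt (real n))
    * parabola_integral \<rho> (\<lambda>z. norm (exp (- z / 2)) * norm z powr (a / 2 - 1 / 4) * norm (f z)))" (is ?coeff)
  and "asymp_bound (\<lambda>n. norm (laguerre_coeff a f n) * sqrt (lag_h a n)) (1 / (2 * sqrt pi))
   (\<lambda>n. real n powr (- 1 / 4) * exp (- 2 * \<rho> * sqrt (real n))
    * parabola_integral \<rho> (\<lambda>z. norm (exp (- z / 2)) * norm z powr (a / 2 - 1 / 4) * norm (f z)))" (is ?normalized)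
proof -
 obtain C k where C: "C \<ge> 0" "continuous_on UNIV (\<lambda>t. f (zpar \<rho> t))"
  "\<And>t. norm (f (zpar \<rho> t)) \<le> C * (1 + norm (zpar \<rho> t)) ^ k"
  by (rule growth_cond_parabola[OF assms(4,2)]) blast
 note * = parabola_kernel_integral[OF assms(2) psi_kernel[OF assms(1-3)] C(2,3)]
 define X where "X n = (LINT t|lborel. 1 / sqrt pi * (psi_kern \<rho> a n t) * norm (f (zpar \<rho> t)) * norm (dparabola \<rho> t))" for n
 define J where "J = parabola_integral \<rho> (\<lambda>z. norm (exp (- z / 2)) * norm z powr (a / 2 - 1 / 4) * norm (f z))"
 have X0: "X n \<ge> 0" for n unfolding X_def by (rule *(3))
 have J0: "J \<ge> 0" unfolding J_def parabola_integral_eq by (rule *(2))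
 have XJ: "\<forall>\<^sub>F n in sequentially. X n \<le> c * J" if "c > 1" for c
  unfolding X_def J_def parabola_integral_eq by (rule *(4)[OF that])
 let ?r = "\<lambda>n. lag_h a n * real n powr (- a)"
 have h: "lag_h a n > 0" for n by (rule lag_h_pos[OF assms(1)])
 have bound: "\<forall>\<^sub>F n in sequentially. lag_h a n * norm (laguerre_coeff a f n) \<le> 1 / (2 * sqrt pi) * (real n powr (a / 2 - 1 / 4) * exp (- 2 * \<rho> * sqrt n)) * X n"
  unfolding X_def by (rule laguerre_coeff_norm_le[OF assms(1,2,4)])
 have "(\<lambda>n. 1 / (2 * sqrt pi) / ?r n) \<longlonglongrightarrow> 1 / (2 * sqrt pi) / 1"
  by (intro tendsto_divide tendsto_const lag_h_asymp assms) simp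
 then have l1: "(\<lambda>n. 1 / (2 * sqrt pi) / ?r n) \<longlonglongrightarrow> 1 / (2 * sqrt pi)" by simp
 have "(\<lambda>n. 1 / (2 * sqrt pi) / sqrt (?r n)) \<longlonglongrightarrow> 1 / (2 * sqrt pi) / sqrt 1"
  by (intro tendsto_divide tendsto_const tendsto_real_sqrt lag_h_asymp assms) simp
 then have l2: "(\<lambda>n. 1 / (2 * sqrt pi) / sqrt (?r n)) \<longlonglongrightarrow> 1 / (2 * sqrt pi)" by simp
 show ?coeff
  unfolding J_def[symmetric]
 proof (rule asymp_boundI[OF _ l1 _ _ X0 J0 XJ])
  show "\<forall>\<^sub>F n in sequentially. norm (laguerre_coeff a f n) \<le> 1 / (2 * sqrt pi) / ?r n * (real n powr (- a / 2 - 1 / 4) * exp (- 2 * \<rho> * sqrt (real n)) * X n)"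
   using bound eventually_gt_at_top[of 0]
  proof eventually_elim
   case (elim n)
   have pw: "real n powr (a / 2 - 1 / 4) = real n powr (- a / 2 - 1 / 4) / real n powr (- a)"
    unfolding powr_diff[symmetric] by (rule arg_cong[where f = "\<lambda>e. real n powr e"]) (simp add: field_simps)
   have "norm (laguerre_coeff a f n) \<le> 1 / (2 * sqrt pi) * (real n powr (a / 2 - 1 / 4) * exp (- 2 * \<rho> * sqrt n)) * X n / lag_h a n"
    using elim(1) h[of n] by (simp only: pos_le_divide_eq mult.commute)
   also have "\<dots> = 1 / (2 * sqrt pi) / ?r n * (real n powr (- a / 2 - 1 / 4) * exp (- 2 * \<rho> * sqrt (real n)) * X n)"
    unfolding pw by simp
   finally show ?case .
  qed
 qed auto
 show ?normalized
  unfolding J_def[symmetric]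
 proof (rule asymp_boundI[OF _ l2 _ _ X0 J0 XJ])
  show "\<forall>\<^sub>F n in sequentially. norm (laguerre_coeff a f n) * sqrt (lag_h a n) \<le> 1 / (2 * sqrt pi) / sqrt (?r n) * (real n powr (- 1 / 4) * exp (- 2 * \<rho> * sqrt (real n)) * X n)"
   using bound eventually_gt_at_top[of 0]
  proof eventually_elim
   case (elim n)
   have s: "sqrt (lag_h a n) > 0" using h[of n] by simp
   have "sqrt (real n powr (- a)) = real n powr (- a * (1 / 2))"
    by (simp only: powr_half_sqrt[symmetric] powr_ge_zero powr_powr)
   moreover have "real n powr (a / 2 - 1 / 4) = real n powr (- 1 / 4) / real n powr (- a * (1 / 2))"
    unfolding powr_diff[symmetric] by (rule arg_cong[where f = "\<lambda>e. real n powr e"]) (simp add: field_simps)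
   ultimately have pw: "real n powr (a / 2 - 1 / 4) = real n powr (- 1 / 4) / sqrt (real n powr (- a))" by simp
   have "norm (laguerre_coeff a f n) * sqrt (lag_h a n) = lag_h a n * norm (laguerre_coeff a f n) / sqrt (lag_h a n)"
    using s h[of n] real_sqrt_mult_self[of "lag_h a n"] by (simp add: field_simps)
   also have "\<dots> \<le> 1 / (2 * sqrt pi) * (real n powr (a / 2 - 1 / 4) * exp (- 2 * \<rho> * sqrt n)) * X n / sqrt (lag_h a n)"
    using elim(1) s by (intro divide_right_mono) auto
   also have "\<dots> = 1 / (2 * sqrt pi) / sqrt (?r n) * (real n powr (- 1 / 4) * exp (- 2 * \<rho> * sqrt (real n)) * X n)"
    unfolding pw real_sqrt_mult by simp
   finally show ?case .
  qed
 qed auto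
qed

section \<open>Orthogonal projection\<close>

text \<open>An algebra of functions, containing \<open>f\<close> and all polynomials, that are integrable against the weight.\<close>

definition tempered :: "(real \<Rightarrow> complex) \<Rightarrow> bool" where
 "tempered g \<longleftrightarrow> continuous_on {0..} g \<and> (\<exists>C m. \<forall>x\<ge>0. norm (g x) \<le> C * (1 + x) ^ m)"

lemma temperedE:
 assumes "tempered g"
 obtains C m where "C \<ge> 0" "\<And>x. x \<ge> 0 \<Longrightarrow> norm (g x) \<le> C * (1 + x) ^ m"
proof -
 obtain C m where C: "\<forall>x\<ge>0. norm (g x) \<le> C * (1 + x) ^ m" using assms by (auto simp: tempered_def)
 have "norm (g x) \<le> \<bar>C\<bar> * (1 + x) ^ m" if "x \<ge> 0" for x
  by (rule order_trans[OF C[rule_format, OF that]]) (use that in \<open>auto intro: mult_right_mono\<close>)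
 then show ?thesis using that[of "\<bar>C\<bar>" m] by auto
qed

lemma integrable_tempered: "a > -1 \<Longrightarrow> tempered g \<Longrightarrow> integrable (lagM a) g"
 unfolding tempered_def using integrable_lagM_poly_growth[of a g] by blast

lemma tempered_growth: "growth_cond \<rho> f \<Longrightarrow> \<rho> > 0 \<Longrightarrow> tempered (\<lambda>x. f (cx x))"
 unfolding tempered_def using growth_cond_real[of \<rho> f] by metis

lemma tempered_mult:
 assumes "tempered f" "tempered g"
 shows "tempered (\<lambda>x. f x * g x)"
proof -
 obtain C m where C: "C \<ge> 0" "\<And>x. x \<ge> 0 \<Longrightarrow> norm (f x) \<le> C * (1 + x) ^ m" by (rule temperedE[OF assms(1)]) blast
 obtain D k where D: "D \<ge> 0" "\<And>x. x \<ge> 0 \<Longrightarrow> norm (g x) \<le> D * (1 + x) ^ k" by (rule temperedE[OF assms(2)]) blast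
 have "norm (f x * g x) \<le> (C * D) * (1 + x) ^ (m + k)" if "x \<ge> 0" for x
 proof -
  have "norm (f x * g x) \<le> (C * (1 + x) ^ m) * (D * (1 + x) ^ k)"
   unfolding norm_mult using that C(1) by (intro mult_mono C(2) D(2)) auto
  then show ?thesis by (simp add: power_add mult_ac)
 qed
 then show ?thesis using assms unfolding tempered_def by (auto intro: continuous_on_mult)
qed

lemma tempered_add:
 assumes "tempered f" "tempered g"
 shows "tempered (\<lambda>x. f x + g x)"
proof -
 obtain C m where C: "C \<ge> 0" "\<And>x. x \<ge> 0 \<Longrightarrow> norm (f x) \<le> C * (1 + x) ^ m" by (rule temperedE[OF assms(1)]) blast
 obtain D k where D: "D \<ge> 0" "\<And>x. x \<ge> 0 \<Longrightarrow> norm (g x) \<le> D * (1 + x) ^ k" by (rule temperedE[OF assms(2)]) blast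
 have "norm (f x + g x) \<le> (C + D) * (1 + x) ^ (m + k)" if "x \<ge> 0" for x
 proof -
  have "norm (f x + g x) \<le> C * (1 + x) ^ m + D * (1 + x) ^ k"
   by (rule order_trans[OF norm_triangle_ineq add_mono[OF C(2) D(2)]]) (use that in auto)
  also have "\<dots> \<le> C * (1 + x) ^ (m + k) + D * (1 + x) ^ (m + k)"
   using that C(1) D(1) by (intro add_mono mult_left_mono power_increasing) auto
  finally show ?thesis by (simp add: distrib_right)
 qed
 then show ?thesis using assms unfolding tempered_def by (auto intro: continuous_on_add)
qed

lemma tempered_const: "tempered (\<lambda>_. c)"
 unfolding tempered_def by (intro conjI continuous_on_const exI[of _ "norm c"] exI[of _ "0::nat"]) simp

lemma tempered_poly: "tempered (\<lambda>x. poly q (cx x))"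
proof (induction q)
 case (pCons a q)
 have "tempered cx"
  unfolding tempered_def by (auto intro!: exI[of _ "1::real"] exI[of _ "1::nat"] continuous_intros)
 then have "tempered (\<lambda>x. a + cx x * poly q (cx x))"
  by (intro tempered_add tempered_mult tempered_const pCons)
 then show ?case by simp
qed (simp add: tempered_const)

lemma tempered_diff_poly:
 assumes "tempered f"
 shows "tempered (\<lambda>x. f x - poly q (cx x))"
 using tempered_add[OF assms tempered_poly[of "- q"]] by simp

lemma tempered_cnj: "tempered f \<Longrightarrow> tempered (\<lambda>x. cnj (f x))"
 unfolding tempered_def by (auto intro: continuous_on_cnj)

lemma weight_norm_tempered:
 assumes "tempered (\<lambda>x. g (cx x))"
 shows "weight_norm a g = sqrt (LINT x|lagM a. (norm (g (cx x)))\<^sup>2)"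
proof -
 have "(\<lambda>x. (norm (g (cx x)))\<^sup>2) \<in> borel_measurable (lagM a)"
  using assms unfolding tempered_def by (intro measurable_lagM_continuous continuous_intros) auto
 from integral_lagM[OF this] show ?thesis unfolding weight_norm_def by simp
qed

lemma lagM_pythagoras:
 assumes a: "a > -1" and D: "tempered D" and orth: "\<And>q. degree q \<le> n \<Longrightarrow> (LINT x|lagM a. D x * poly q (of_real x)) = 0"
  and q: "degree q \<le> n"
 shows "(LINT x|lagM a. (norm (D x + poly q (of_real x)))\<^sup>2) = (LINT x|lagM a. (norm (D x))\<^sup>2) + (LINT x|lagM a. (norm (poly q (of_real x)))\<^sup>2)"
proof -
 let ?q = "\<lambda>x. poly q (cx x)"
 have int: "integrable (lagM a) (\<lambda>x. D x * cnj (D x))" "integrable (lagM a) (\<lambda>x. ?q x * cnj (?q x))" "integrable (lagM a) (\<lambda>x. D x * cnj (?q x))" "integrable (lagM a) (\<lambda>x. cnj (D x * cnj (?q x)))"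
  by (intro integrable_tempered[OF a] tempered_mult tempered_cnj D tempered_poly)+
 have 0: "(LINT x|lagM a. D x * cnj (?q x)) = 0"
  unfolding poly_polycnj[symmetric] by (rule orth) (use q in simp)
 have "cx (LINT x|lagM a. (norm (D x + ?q x))\<^sup>2) = (LINT x|lagM a. cx ((norm (D x + ?q x))\<^sup>2))"
  by (rule integral_complex_of_real[symmetric])
 also have "\<dots> = (LINT x|lagM a. (D x * cnj (D x) + ?q x * cnj (?q x)) + (D x * cnj (?q x) + cnj (D x * cnj (?q x))))"
  unfolding complex_norm_square by (simp add: algebra_simps)
 also have "\<dots> = ((LINT x|lagM a. D x * cnj (D x)) + (LINT x|lagM a. ?q x * cnj (?q x))) + ((LINT x|lagM a. D x * cnj (?q x)) + (LINT x|lagM a. cnj (D x * cnj (?q x))))"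
  by (simp only: Bochner_Integration.integral_add Bochner_Integration.integrable_add int)
 also have "(LINT x|lagM a. cnj (D x * cnj (?q x))) = 0"
  unfolding integral_bounded_linear[OF bounded_linear_cnj int(3)] 0 by simp
 finally show ?thesis
  unfolding 0 complex_norm_square[symmetric] integral_complex_of_real by (simp only: add_0_right of_real_add[symmetric] of_real_eq_iff)
qed

lemma laguerre_coeff_eq:
 assumes "a > -1" "tempered (\<lambda>x. f (cx x))"
 shows "(LINT x|lagM a. f (of_real x) * poly (lagpoly a k) (of_real x)) = of_real (lag_h a k) * laguerre_coeff a f k"
proof -
 have meas: "(\<lambda>x. f (of_real x) * poly (lagpoly a k) (of_real x)) \<in> borel_measurable (lagM a)"
  by (intro borel_measurable_integrable integrable_tempered[OF assms(1)] tempered_mult assms tempered_poly)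
 have "laguerre_coeff a f k = of_real (1 / lag_h a k) * (LINT x|lagM a. f (of_real x) * poly (lagpoly a k) (of_real x))"
  unfolding laguerre_coeff_def laguerre_eq_poly[OF assms(1)] mult.assoc integral_lagM_complex[OF meas]
  by (simp add: lag_h_def add_ac)
 then show ?thesis using lag_h_pos[OF assms(1), of k] by simp
qed

definition proj_poly :: "real \<Rightarrow> (complex \<Rightarrow> complex) \<Rightarrow> nat \<Rightarrow> complex poly" where
 "proj_poly a f n = (\<Sum>k\<le>n. smult (laguerre_coeff a f k) (lagpoly a k))"

lemma laguerre_proj_eq: "a > -1 \<Longrightarrow> laguerre_proj a n f = poly (proj_poly a f n)"
 unfolding laguerre_proj_def[abs_def] proj_poly_def by (simp add: fun_eq_iff poly_sum laguerre_eq_poly)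

lemma degree_proj_poly: "degree (proj_poly a f n) \<le> n"
 unfolding proj_poly_def by (intro degree_sum_le) (auto intro: order_trans[OF degree_smult_le] simp: degree_lagpoly)

lemma lagpoly_span:
 fixes q :: "complex poly"
 assumes "degree q \<le> n"
 obtains c where "q = (\<Sum>k\<le>n. smult (c k) (lagpoly a k))"
 using assms
proof (induction n arbitrary: q thesis)
 case 0
 then obtain d where "q = [:d:]" by (metis degree_0_id le_zero_eq)
 then show ?case using 0(1)[of "\<lambda>_. d"] by (simp add: lagpoly_0)
next
 case (Suc n)
 let ?L = "lagpoly a (Suc n) :: complex poly"
 define b where "b = coeff q (Suc n) / coeff ?L (Suc n)"
 have "lead_coeff ?L \<noteq> 0" by (simp only: leading_coeff_0_iff lagpoly_nonzero not_False_eq_True)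
 then have L: "coeff ?L (Suc n) \<noteq> 0" by (simp add: degree_lagpoly del: coeff_lagpoly leading_coeff_0_iff)
 then have "coeff (q - smult b ?L) (Suc n) = 0" by (simp add: b_def del: coeff_lagpoly)
 moreover have "degree (q - smult b ?L) \<le> Suc n"
  by (intro degree_diff_le Suc.prems(2) order_trans[OF degree_smult_le]) (simp add: degree_lagpoly)
 ultimately have "degree (q - smult b ?L) \<le> n"
  by (metis eq_zero_or_degree_less degree_0 le_0_eq le_less_Suc_eq less_Suc_eq_le linorder_not_less nat_less_le zero_le)
 then obtain c where c: "q - smult b ?L = (\<Sum>k\<le>n. smult (c k) (lagpoly a k))" using Suc.IH by blast
 have "(\<Sum>k\<le>n. smult ((c(Suc n := b)) k) (lagpoly a k)) = (\<Sum>k\<le>n. smult (c k) (lagpoly a k))"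
  by (intro sum.cong refl) simp
 then have "q = (\<Sum>k\<le>Suc n. smult ((c(Suc n := b)) k) (lagpoly a k))"
  using c by (simp add: algebra_simps)
 then show ?case by (rule Suc.prems(1))
qed

lemma proj_orthogonal:
 assumes a: "a > -1" and f: "tempered (\<lambda>x. f (cx x))" and q: "degree q \<le> n"
 shows "(LINT x|lagM a. (f (of_real x) - poly (proj_poly a f n) (of_real x)) * poly q (of_real x)) = 0"
proof -
 let ?D = "\<lambda>x. f (cx x) - poly (proj_poly a f n) (cx x)"
 have one: "(LINT x|lagM a. ?D x * poly (lagpoly a k) (of_real x)) = 0" if "k \<le> n" for k
 proof -
  have orth: "lagint a (lagpoly a j * lagpoly a k) = (if j = k then of_real (lag_h a k) else 0)" for j
  proof -
   consider "j = k" | "j < k" | "k < j" by linarith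
   then show ?thesis
   proof cases
    case 2
    then show ?thesis using lagint_orthogonal[OF a, of "lagpoly a j" k] by (simp add: degree_lagpoly mult.commute)
   next
    case 3
    then show ?thesis using lagint_orthogonal[OF a, of "lagpoly a k" j] by (simp add: degree_lagpoly)
   qed (simp add: lagint_lagpoly_square[OF a])
  qed
  have "lagint a (proj_poly a f n * lagpoly a k) = laguerre_coeff a f k * of_real (lag_h a k)"
   unfolding proj_poly_def sum_distrib_right mult_smult_left lagint_sum[OF a] lagint_smult[OF a] orth
   using that by (simp add: if_distrib sum.delta cong: if_cong)
  moreover have "(LINT x|lagM a. ?D x * poly (lagpoly a k) (of_real x)) = (LINT x|lagM a. f (of_real x) * poly (lagpoly a k) (of_real x)) - lagint a (proj_poly a f n * lagpoly a k)"
   unfolding lagint_def poly_mult left_diff_distrib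
   by (intro Bochner_Integration.integral_diff integrable_tempered[OF a] tempered_mult f tempered_poly)
  ultimately show ?thesis unfolding laguerre_coeff_eq[OF a f] by simp
 qed
 obtain c where c: "q = (\<Sum>k\<le>n. smult (c k) (lagpoly a k))" using lagpoly_span[OF q] by blast
 have "(LINT x|lagM a. ?D x * poly q (of_real x)) = (LINT x|lagM a. (\<Sum>k\<le>n. c k * (?D x * poly (lagpoly a k) (of_real x))))"
  unfolding c poly_sum poly_smult sum_distrib_left by (simp only: mult.left_commute)
 also have "\<dots> = (\<Sum>k\<le>n. LINT x|lagM a. c k * (?D x * poly (lagpoly a k) (of_real x)))"
  by (intro Bochner_Integration.integral_sum integrable_mult_right integrable_tempered[OF a] tempered_mult tempered_diff_poly f tempered_poly)
 also have "\<dots> = 0" using one by (simp add: integral_mult_right_zero)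
 finally show ?thesis .
qed

definition proj_error :: "real \<Rightarrow> (complex \<Rightarrow> complex) \<Rightarrow> nat \<Rightarrow> real" where
 "proj_error a f n = (LINT x|lagM a. (norm (f (of_real x) - poly (proj_poly a f n) (of_real x)))\<^sup>2)"

lemma proj_error_nonneg: "proj_error a f n \<ge> 0"
 unfolding proj_error_def by (intro Bochner_Integration.integral_nonneg) auto

lemma proj_error_Suc:
 assumes a: "a > -1" and f: "tempered (\<lambda>x. f (cx x))"
 shows "proj_error a f n = proj_error a f (Suc n) + (norm (laguerre_coeff a f (Suc n)))\<^sup>2 * lag_h a (Suc n)"
proof -
 let ?d = "laguerre_coeff a f (Suc n)" and ?L = "lagpoly a (Suc n) :: complex poly"
 have P: "proj_poly a f (Suc n) = proj_poly a f n + smult ?d ?L" by (simp add: proj_poly_def)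
 have "proj_error a f n = (LINT x|lagM a. (norm ((f (of_real x) - poly (proj_poly a f (Suc n)) (of_real x)) + poly (smult ?d ?L) (of_real x)))\<^sup>2)"
  unfolding proj_error_def P by simp
 also have "\<dots> = proj_error a f (Suc n) + (LINT x|lagM a. (norm (poly (smult ?d ?L) (of_real x)))\<^sup>2)"
  unfolding proj_error_def
  by (rule lagM_pythagoras[OF a tempered_diff_poly[OF f] proj_orthogonal[OF a f]])
    (auto intro: order_trans[OF degree_smult_le] simp: degree_lagpoly)
 also have "(LINT x|lagM a. (norm (poly (smult ?d ?L) (of_real x)))\<^sup>2) = (LINT x|lagM a. (norm ?d)\<^sup>2 * (norm (poly ?L (of_real x)))\<^sup>2)"
  by (simp add: norm_mult power_mult_distrib)
 also have "\<dots> = (norm ?d)\<^sup>2 * lag_h a (Suc n)"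
  unfolding integral_mult_right_zero gauss_square_norm[OF a] ..
 finally show ?thesis .
qed

lemma proj_error_le:
 assumes a: "a > -1" and f: "tempered (\<lambda>x. f (cx x))" and p: "degree p \<le> n"
 shows "proj_error a f n \<le> (LINT x|lagM a. (norm (f (of_real x) - poly p (of_real x)))\<^sup>2)"
proof -
 have "(LINT x|lagM a. (norm (f (of_real x) - poly p (of_real x)))\<^sup>2)
  = (LINT x|lagM a. (norm ((f (of_real x) - poly (proj_poly a f n) (of_real x)) + poly (proj_poly a f n - p) (of_real x)))\<^sup>2)"
  by simp
 also have "\<dots> = proj_error a f n + (LINT x|lagM a. (norm (poly (proj_poly a f n - p) (of_real x)))\<^sup>2)"
  unfolding proj_error_def
  by (rule lagM_pythagoras[OF a tempered_diff_poly[OF f] proj_orthogonal[OF a f]])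
    (auto intro: degree_diff_le degree_proj_poly p)
 also have "\<dots> \<ge> proj_error a f n" by (simp add: Bochner_Integration.integral_nonneg)
 finally show ?thesis .
qed

lemma proj_error_tendsto:
 assumes "a > -1" "\<rho> > 0" "rapid_lag \<rho> a" "growth_cond \<rho> f"
 shows "proj_error a f \<longlonglongrightarrow> 0"
proof -
 have f: "tempered (\<lambda>x. f (cx x))" by (rule tempered_growth[OF assms(4,2)])
 define J where "J = parabola_integral \<rho> (\<lambda>z. norm (exp (- z / 2)) * norm z powr (a / 2 + 1 / 4) * norm (f z))"
 define c where "c = 1 / (sqrt pi * \<rho>\<^sup>2) + 1"
 obtain n0 where n0: "\<And>n. n \<ge> n0 \<Longrightarrow> weight_norm a (\<lambda>z. f z - interpolant (poly_space n) (laguerre_points a n) f z)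
   \<le> c * (real n powr (1 / 4) * exp (- 2 * \<rho> * sqrt (real n)) * J)"
  using gauss_weight_norm_asymp[OF assms] unfolding asymp_bound_def J_def c_def by (meson less_add_one)
 have pts: "finite (laguerre_points a n)" "card (laguerre_points a n) = Suc n" for n
  unfolding laguerre_points_eq[OF assms(1)] using card_lagzeros[OF assms(1)] by (auto simp: card_image inj_on_def)
 have le: "sqrt (proj_error a f n) \<le> c * (real n powr (1 / 4) * exp (- 2 * \<rho> * sqrt (real n)) * J)" if "n \<ge> n0" for n
 proof -
  let ?p = "lagrange_poly (laguerre_points a n) f"
  have "sqrt (proj_error a f n) \<le> sqrt (LINT x|lagM a. (norm (f (of_real x) - poly ?p (of_real x)))\<^sup>2)"
   by (intro real_sqrt_le_mono proj_error_le assms f degree_lagrange_poly pts)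
  also have "\<dots> = weight_norm a (\<lambda>z. f z - interpolant (poly_space n) (laguerre_points a n) f z)"
   unfolding interpolant_poly_space[OF pts] by (rule weight_norm_tempered[symmetric]) (rule tempered_diff_poly[OF f])
  also note n0[OF that]
  finally show ?thesis .
 qed
 have "(\<lambda>n. real n powr (1 / 4) * exp (- 2 * \<rho> * sqrt (real n))) \<longlonglongrightarrow> 0" using assms(2) by real_asymp
 then have "(\<lambda>n. c * (real n powr (1 / 4) * exp (- 2 * \<rho> * sqrt (real n)) * J)) \<longlonglongrightarrow> c * (0 * J)"
  by (intro tendsto_mult tendsto_const)
 then have lim: "(\<lambda>n. c * (real n powr (1 / 4) * exp (- 2 * \<rho> * sqrt (real n)) * J)) \<longlonglongrightarrow> 0" by simp
 have "\<forall>\<^sub>F n in sequentially. 0 \<le> sqrt (proj_error a f n)"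
  by (simp add: proj_error_nonneg)
 moreover have "\<forall>\<^sub>F n in sequentially. sqrt (proj_error a f n) \<le> c * (real n powr (1 / 4) * exp (- 2 * \<rho> * sqrt (real n)) * J)"
  unfolding eventually_at_top_linorder using le by blast
 ultimately have "(\<lambda>n. sqrt (proj_error a f n)) \<longlonglongrightarrow> 0"
  by (rule tendsto_sandwich[OF _ _ tendsto_const lim])
 then have "(\<lambda>n. (sqrt (proj_error a f n))\<^sup>2) \<longlonglongrightarrow> 0\<^sup>2" by (rule tendsto_power)
 then show ?thesis using proj_error_nonneg by simp
qed

text \<open>The increments of \<open>exp (- 4 \<rho> \<surd>n)\<close> dominate the terms of the Parseval tail; this produces the factor
 \<open>1 / (2 \<rho>)\<close>.\<close>

lemma exp_sqrt_decrement:
 assumes "\<rho> > 0"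
 shows "2 * \<rho> * real (Suc n) powr (- 1 / 2) * exp (- 4 * \<rho> * sqrt (Suc n)) \<le> exp (- 4 * \<rho> * sqrt n) - exp (- 4 * \<rho> * sqrt (Suc n))"
proof -
 let ?s = "sqrt (Suc n)" and ?r = "sqrt n"
 have s: "?s > 0" "?r \<ge> 0" "?r \<le> ?s" by auto
 have "(?s - ?r) * (?s + ?r) = 1" by (simp add: algebra_simps flip: real_sqrt_mult)
 moreover have "(?s - ?r) * (?s + ?r) \<le> (?s - ?r) * (2 * ?s)" using s by (intro mult_left_mono) auto
 moreover have e: "(?s - ?r) * (2 * ?s) = 2 * (?s - ?r) * ?s" by simp
 ultimately have "1 \<le> 2 * (?s - ?r) * ?s" by linarith
 then have "1 / ?s \<le> 2 * (?s - ?r)" using s(1) by (simp only: pos_divide_le_eq)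
 then have "2 * \<rho> * (1 / ?s) \<le> 2 * \<rho> * (2 * (?s - ?r))" using assms by (intro mult_left_mono) auto
 also have "\<dots> = 4 * \<rho> * (?s - ?r)" by simp
 also have "\<dots> \<le> exp (4 * \<rho> * (?s - ?r)) - 1" using exp_ge_add_one_self[of "4 * \<rho> * (?s - ?r)"] by linarith
 finally have "2 * \<rho> * (1 / ?s) * exp (- 4 * \<rho> * ?s) \<le> (exp (4 * \<rho> * (?s - ?r)) - 1) * exp (- 4 * \<rho> * ?s)"
  by (rule mult_right_mono) simp
 also have "\<dots> = exp (- 4 * \<rho> * ?r) - exp (- 4 * \<rho> * ?s)"
  by (simp add: left_diff_distrib algebra_simps flip: exp_add)
 finally show ?thesis by (simp add: powr_minus_divide powr_half_sqrt)
qed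

text \<open>From some \<open>n\<close> on, the squared error minus the claimed squared bound increases; as it tends to zero, it is never
 positive there.\<close>

lemma proj_weight_norm_asymp:
 assumes "a > -1" "\<rho> > 0" "rapid_psi \<rho> a" "growth_cond \<rho> f"
 shows "asymp_bound (\<lambda>n. weight_norm a (\<lambda>z. f z - laguerre_proj a n f z)) (1 / (2 * sqrt (2 * pi * \<rho>)))
   (\<lambda>n. exp (- 2 * \<rho> * sqrt (real n)) * parabola_integral \<rho> (\<lambda>z. norm (exp (- z / 2)) * norm z powr (a / 2 - 1 / 4) * norm (f z)))"
 unfolding asymp_bound_def
proof (intro allI impI)
 fix C assume C: "C > 1 / (2 * sqrt (2 * pi * \<rho>))"
 define J where "J = parabola_integral \<rho> (\<lambda>z. norm (exp (- z / 2)) * norm z powr (a / 2 - 1 / 4) * norm (f z))"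
 have f: "tempered (\<lambda>x. f (cx x))" by (rule tempered_growth[OF assms(4,2)])
 have lag: "rapid_lag \<rho> a" by (rule rapid_psi_imp_lag[OF assms(1-3)])
 have C0: "C > 0" using C assms(2) by (auto intro: order_less_trans[rotated])
 have J0: "J \<ge> 0" unfolding J_def parabola_integral_eq by (intro Bochner_Integration.integral_nonneg) auto
 have "1 / (2 * sqrt pi) = 1 / (2 * sqrt (2 * pi * \<rho>)) * sqrt (2 * \<rho>)"
  using assms(2) by (simp add: real_sqrt_mult)
 also have "\<dots> < C * sqrt (2 * \<rho>)" using C assms(2) by (intro mult_strict_right_mono) auto
 finally obtain n0 where n0: "\<And>n. n \<ge> n0 \<Longrightarrow> norm (laguerre_coeff a f n) * sqrt (lag_h a n) \<le> C * sqrt (2 * \<rho>) * (real n powr (- 1 / 4) * exp (- 2 * \<rho> * sqrt (real n)) * J)"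
  using laguerre_coeff_asymp(2)[OF assms] unfolding asymp_bound_def J_def by blast
 let ?E = "\<lambda>n. C\<^sup>2 * J\<^sup>2 * exp (- 4 * \<rho> * sqrt (real n))"
 have step: "proj_error a f n - ?E n \<le> proj_error a f (Suc n) - ?E (Suc n)" if "n \<ge> n0" for n
 proof -
  let ?d = "norm (laguerre_coeff a f (Suc n))" and ?m = "real (Suc n)"
  have h: "lag_h a (Suc n) > 0" by (rule lag_h_pos[OF assms(1)])
  have "?d\<^sup>2 * lag_h a (Suc n) = (?d * sqrt (lag_h a (Suc n)))\<^sup>2" using h by (simp add: power_mult_distrib)
  also have "\<dots> \<le> (C * sqrt (2 * \<rho>) * (?m powr (- 1 / 4) * exp (- 2 * \<rho> * sqrt ?m) * J))\<^sup>2"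
   using n0[of "Suc n"] that h by (intro power_mono) auto
  also have "\<dots> = C\<^sup>2 * (2 * \<rho>) * ((?m powr (- 1 / 4))\<^sup>2 * (exp (- 2 * \<rho> * sqrt ?m))\<^sup>2 * J\<^sup>2)"
   using assms(2) by (simp add: power_mult_distrib)
  also have "(?m powr (- 1 / 4))\<^sup>2 = ?m powr (- 1 / 2)" by (simp add: power2_eq_square flip: powr_add)
  also have "(exp (- 2 * \<rho> * sqrt ?m))\<^sup>2 = exp (- 4 * \<rho> * sqrt ?m)" by (simp add: power2_eq_square flip: exp_add)
  also have "C\<^sup>2 * (2 * \<rho>) * (?m powr (- 1 / 2) * exp (- 4 * \<rho> * sqrt ?m) * J\<^sup>2) = C\<^sup>2 * J\<^sup>2 * (2 * \<rho> * ?m powr (- 1 / 2) * exp (- 4 * \<rho> * sqrt ?m))"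
   by (simp only: mult_ac)
  also have "\<dots> \<le> C\<^sup>2 * J\<^sup>2 * (exp (- 4 * \<rho> * sqrt n) - exp (- 4 * \<rho> * sqrt (Suc n)))"
   by (intro mult_left_mono exp_sqrt_decrement assms(2)) auto
  also have "\<dots> = ?E n - ?E (Suc n)" by (rule right_diff_distrib)
  finally show ?thesis using proj_error_Suc[OF assms(1) f, of n] by linarith
 qed
 have "(\<lambda>n. exp (- 4 * \<rho> * sqrt (real n))) \<longlonglongrightarrow> 0" using assms(2) by real_asymp
 then have "(\<lambda>n. proj_error a f n - ?E n) \<longlonglongrightarrow> 0 - C\<^sup>2 * J\<^sup>2 * 0"
  by (intro tendsto_diff tendsto_mult tendsto_const proj_error_tendsto[OF assms(1,2) lag assms(4)])
 then have lim: "(\<lambda>n. proj_error a f n - ?E n) \<longlonglongrightarrow> 0" by simp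
 have "weight_norm a (\<lambda>z. f z - laguerre_proj a n f z) \<le> C * (exp (- 2 * \<rho> * sqrt (real n)) * J)" if n: "n \<ge> n0" for n
 proof -
  have mono: "proj_error a f n - ?E n \<le> proj_error a f (n + k) - ?E (n + k)" for k
  proof (induction k)
   case (Suc k)
   then show ?case using step[of "n + k"] n by simp
  qed simp
  have "\<exists>N. \<forall>m\<ge>N. proj_error a f n - ?E n \<le> proj_error a f m - ?E m"
   using mono[of "_ - n"] by (intro exI[of _ n]) (metis le_add_diff_inverse)
  from LIMSEQ_le_const[OF lim this] have "proj_error a f n \<le> ?E n" by simp
  also have "exp (- 4 * \<rho> * sqrt (real n)) = (exp (- 2 * \<rho> * sqrt (real n)))\<^sup>2" by (simp add: power2_eq_square flip: exp_add)
  also have "C\<^sup>2 * J\<^sup>2 * (exp (- 2 * \<rho> * sqrt (real n)))\<^sup>2 = (C * (exp (- 2 * \<rho> * sqrt (real n)) * J))\<^sup>2"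
   by (simp only: power_mult_distrib mult_ac)
  finally have "sqrt (proj_error a f n) \<le> C * (exp (- 2 * \<rho> * sqrt (real n)) * J)"
   using C0 J0 by (intro real_le_lsqrt proj_error_nonneg) auto
  moreover have "weight_norm a (\<lambda>z. f z - laguerre_proj a n f z) = sqrt (proj_error a f n)"
   unfolding laguerre_proj_eq[OF assms(1)] proj_error_def by (rule weight_norm_tempered) (rule tempered_diff_poly[OF f])
  ultimately show ?thesis by simp
 qed
 then show "\<exists>n0. \<forall>n\<ge>n0. weight_norm a (\<lambda>z. f z - laguerre_proj a n f z) \<le> C * (exp (- 2 * \<rho> * sqrt (real n)) *
   parabola_integral \<rho> (\<lambda>z. norm (exp (- z / 2)) * norm z powr (a / 2 - 1 / 4) * norm (f z)))"
  unfolding J_def by blast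
qed

section \<open>Convergence rates of Laguerre approximations\<close>

lemma rapid_psi_of_bdd:
 assumes "a > -1" "\<rho> > 0"
  and "\<forall>\<gamma>::real. \<exists>n\<^sub>0::nat. bdd_above ((\<lambda>(n, z). real n powr (- a / 2 + 1 / 4) * exp (2 * \<rho> * sqrt (real n))
           * norm (cauchy_transform a n z) * norm z powr \<gamma>) ` ({n\<^sub>0..} \<times> parabola \<rho>))"
 shows "rapid_psi \<rho> a"
proof -
 let ?A = "\<lambda>n z. real n powr (- a / 2 + 1 / 4) * exp (2 * \<rho> * sqrt (real n)) * norm (cauchy_transform a n z)"
 have r: "rapid \<rho> (\<lambda>n t. ?A n (zpar \<rho> t))"
  by (rule rapid_from_bdd[OF assms(2,3)]) simp
 have "norm (cauchy_transform a n (zpar \<rho> t)) = norm (lag_psi a n (zpar \<rho> t)) / (2 * pi)" for n t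
  unfolding cauchy_transform_eq[OF assms(1) parabola_off_ray[OF assms(2)]] by (simp add: norm_divide norm_mult)
 moreover have "- a / 2 + 1 / 4 = 1 / 4 - a / 2" by simp
 ultimately have eq: "2 * pi * ?A n (zpar \<rho> t) = psi_kern \<rho> a n t" for n t
  by (simp only:) simp
 show ?thesis unfolding rapid_psi_def by (rule rapid_scale[OF r, of "2 * pi", unfolded eq]) simp
qed

lemma rapid_lag_of_bdd:
 assumes "a > -1" "\<rho> > 0"
  and "\<forall>\<gamma>::real. \<exists>n\<^sub>0::nat. bdd_above ((\<lambda>(n, z). real n powr (a / 2 - 1 / 4) * exp (2 * \<rho> * sqrt (real n))
           * norm z powr \<gamma> / norm (laguerre a n z)) ` ({n\<^sub>0..} \<times> parabola \<rho>))"
 shows "rapid_lag \<rho> a"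
proof -
 let ?A = "\<lambda>n z. real n powr (a / 2 - 1 / 4) * exp (2 * \<rho> * sqrt (real n)) / norm (poly (lagpoly a n) z)"
 have "(\<lambda>(n, z). real n powr (a / 2 - 1 / 4) * exp (2 * \<rho> * sqrt (real n)) * norm z powr \<gamma> / norm (laguerre a n z)) = (\<lambda>(n, z). ?A n z * norm z powr \<gamma>)" for \<gamma>
  by (simp add: fun_eq_iff laguerre_eq_poly[OF assms(1)])
 then have "rapid \<rho> (\<lambda>n t. ?A n (zpar \<rho> t))"
  by (intro rapid_from_bdd[OF assms(2)]) (use assms(3) in simp_all)
 then show ?thesis unfolding rapid_lag_def .
qed

lemma rapid_ratio_of_bdd:
 assumes "a > -1" "\<rho> > 0"
  and "\<forall>\<gamma>::real. \<exists>n\<^sub>0::nat. bdd_above ((\<lambda>(n, z). exp (4 * \<rho> * sqrt (real n)) * norm (cauchy_transform a n z)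
           * norm z powr \<gamma> / norm (laguerre a n z)) ` ({n\<^sub>0..} \<times> parabola \<rho>))"
 shows "rapid_ratio \<rho> a"
proof -
 let ?A = "\<lambda>n z. exp (4 * \<rho> * sqrt (real n)) * norm (cauchy_transform a n z) / norm (poly (lagpoly a n) z)"
 have "(\<lambda>(n, z). exp (4 * \<rho> * sqrt (real n)) * norm (cauchy_transform a n z) * norm z powr \<gamma> / norm (laguerre a n z)) = (\<lambda>(n, z). ?A n z * norm z powr \<gamma>)" for \<gamma>
  by (simp add: fun_eq_iff laguerre_eq_poly[OF assms(1)])
 then have r: "rapid \<rho> (\<lambda>n t. ?A n (zpar \<rho> t))"
  by (intro rapid_from_bdd[OF assms(2)]) (use assms(3) in simp_all)
 have "norm (cauchy_transform a n (zpar \<rho> t)) = norm (lag_psi a n (zpar \<rho> t)) / (2 * pi)" for n t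
  unfolding cauchy_transform_eq[OF assms(1) parabola_off_ray[OF assms(2)]] by (simp add: norm_divide norm_mult)
 then have eq: "2 * pi * ?A n (zpar \<rho> t) = ratio_kern \<rho> a n t" for n t
  by (simp only:) simp
 show ?thesis unfolding rapid_ratio_def by (rule rapid_scale[OF r, of "2 * pi", unfolded eq]) simp
qed

theorem theorem5p1:
 fixes \<rho> \<alpha> :: real
 assumes "\<rho> > 0" and "\<alpha> > -1"
 shows
  "((\<forall>\<gamma>::real. \<exists>n\<^sub>0::nat. bdd_above
     ((\<lambda>(n, z). real n powr (- \<alpha> / 2 + 1 / 4) * exp (2 * \<rho> * sqrt (real n))
           * norm (cauchy_transform \<alpha> n z) * norm z powr \<gamma>)
      ` ({n\<^sub>0..} \<times> parabola \<rho>)))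
   \<longrightarrow> (\<forall>f. growth_cond \<rho> f \<longrightarrow>
      asymp_bound (\<lambda>n. norm (laguerre_coeff \<alpha> f n))
       (1 / (2 * sqrt pi))
       (\<lambda>n. real n powr (- \<alpha> / 2 - 1 / 4) * exp (- 2 * \<rho> * sqrt (real n))
        * parabola_integral \<rho>
          (\<lambda>z. norm (exp (- z / 2)) * norm z powr (\<alpha> / 2 - 1 / 4) * norm (f z)))
     \<and> asymp_bound (\<lambda>n. weight_norm \<alpha> (\<lambda>z. f z - laguerre_proj \<alpha> n f z))
       (1 / (2 * sqrt (2 * pi * \<rho>)))
       (\<lambda>n. exp (- 2 * \<rho> * sqrt (real n))
        * parabola_integral \<rho>
          (\<lambda>z. norm (exp (- z / 2)) * norm z powr (\<alpha> / 2 - 1 / 4) * norm (f z)))))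
  \<and> ((\<forall>\<gamma>::real. \<exists>n\<^sub>0::nat. bdd_above
     ((\<lambda>(n, z). real n powr (\<alpha> / 2 - 1 / 4) * exp (2 * \<rho> * sqrt (real n))
           * norm z powr \<gamma> / norm (laguerre \<alpha> n z))
      ` ({n\<^sub>0..} \<times> parabola \<rho>)))
   \<longrightarrow> (\<forall>f. growth_cond \<rho> f \<longrightarrow>
      asymp_bound
       (\<lambda>n. weight_norm \<alpha>
         (\<lambda>z. f z - interpolant (poly_space n) (laguerre_points \<alpha> n) f z))
       (1 / (sqrt pi * \<rho>\<^sup>2))
       (\<lambda>n. real n powr (1 / 4) * exp (- 2 * \<rho> * sqrt (real n))
        * parabola_integral \<rho>
          (\<lambda>z. norm (exp (- z / 2)) * norm z powr (\<alpha> / 2 + 1 / 4) * norm (f z)))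
     \<and> asymp_bound
       (\<lambda>n. weight_norm \<alpha>
         (\<lambda>z. f z - interpolant (poly_space n) (radau_points \<alpha> n) f z))
       (sqrt 2 / (sqrt pi * \<rho>\<^sup>2))
       (\<lambda>n. real n powr (3 / 4) * exp (- 2 * \<rho> * sqrt (real n))
        * parabola_integral \<rho>
          (\<lambda>z. norm (exp (- z / 2)) * norm z powr (\<alpha> / 2 - 1 / 4) * norm (f z))))
    \<and> (\<forall>f. growth_cond \<rho> (\<lambda>z. exp (z / 2) * f z) \<longrightarrow>
      asymp_bound
       (\<lambda>n. sup_norm
         (\<lambda>z. f z - interpolant (exp_poly_space n) (laguerre_points \<alpha> n) f z))
       (kappa \<alpha> / (sqrt pi * \<rho>\<^sup>2))
       (\<lambda>n. real n powr (\<bar>\<alpha>\<bar> / 2 + 1 / 4) * exp (- 2 * \<rho> * sqrt (real n))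
        * parabola_integral \<rho>
          (\<lambda>z. norm z powr (\<alpha> / 2 + 1 / 4) * norm (f z)))
     \<and> asymp_bound
       (\<lambda>n. sup_norm
         (\<lambda>z. f z - interpolant (exp_poly_space n) (radau_points \<alpha> n) f z))
       (2 * kappa \<alpha> / (sqrt pi * \<rho>\<^sup>2))
       (\<lambda>n. real n powr (\<bar>\<alpha>\<bar> / 2 + 3 / 4) * exp (- 2 * \<rho> * sqrt (real n))
        * parabola_integral \<rho>
          (\<lambda>z. norm z powr (\<alpha> / 2 - 1 / 4) * norm (f z)))))
  \<and> ((\<forall>\<gamma>::real. \<exists>n\<^sub>0::nat. bdd_above
     ((\<lambda>(n, z). exp (4 * \<rho> * sqrt (real n)) * norm (cauchy_transform \<alpha> n z)
           * norm z powr \<gamma> / norm (laguerre \<alpha> n z))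
      ` ({n\<^sub>0..} \<times> parabola \<rho>)))
   \<longrightarrow> (\<forall>f. growth_cond \<rho> f \<longrightarrow>
      asymp_bound (\<lambda>n. norm (weighted_integral \<alpha> f - gauss_laguerre \<alpha> n f))
       1
       (\<lambda>n. exp (- 4 * \<rho> * sqrt (real n))
        * parabola_integral \<rho>
          (\<lambda>z. norm (exp (- z)) * norm z powr \<alpha> * norm (f z)))
     \<and> asymp_bound (\<lambda>n. norm (weighted_integral \<alpha> f - gauss_laguerre_radau \<alpha> n f))
       1
       (\<lambda>n. exp (- 4 * \<rho> * sqrt (real n))
        * parabola_integral \<rho>
          (\<lambda>z. norm (exp (- z)) * norm z powr \<alpha> * norm (f z)))))"
proof (intro conjI impI allI, goal_cases)
 case (1 f)
 then show ?case by (intro laguerre_coeff_asymp(1) rapid_psi_of_bdd assms)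
next
 case (2 f)
 then show ?case by (intro proj_weight_norm_asymp rapid_psi_of_bdd assms)
next
 case (3 f)
 then show ?case by (intro gauss_weight_norm_asymp rapid_lag_of_bdd assms)
next
 case (4 f)
 then show ?case by (intro radau_weight_norm_asymp rapid_lag_of_bdd assms)
next
 case (5 f)
 then show ?case by (intro gauss_sup_norm_asymp rapid_lag_of_bdd assms)
next
 case (6 f)
 then show ?case by (intro radau_sup_norm_asymp rapid_lag_of_bdd assms)
next
 case (7 f)
 then show ?case by (intro gauss_quadrature_asymp rapid_ratio_imp_lag rapid_ratio_of_bdd assms)
next
 case (8 f)
 then show ?case by (intro radau_quadrature_asymp rapid_ratio_imp_lag rapid_ratio_of_bdd assms)
qed

end
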